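(* (Homogeneous Poincaré Lemma) Let $(M,\nabla_M)$ be a homogeneity supermanifold of total dimension $k$, let $m\in|M|$, and let $\nabla_M=\sum_{i=1}^k w_i\, x^i\,\partial_{x^i}$ in homogeneous local coordinates $(x^i)$ in a neighbourhood of $m$. In this neighbourhood, take a closed homogeneous $n$-form $\omega$, $n>0$, of degree $\lambda=(\sigma,w)\in\mathbb{Z}_2\times\mathbb{R}$. Then the following hold locally near $m$. 1. If $\nabla_M(m)=0$, then we can find a homogeneous $(n-1)$-form $\alpha$ of degree $\lambda$ such that $\omega=\mathrm{d}\alpha$. Moreover, we can choose $\alpha$ such that $\alpha(m)=0$. 2. If $\nabla_M(m)\neq 0$, then there is such a form $\alpha$ (homogeneous of degree $\lambda$, with $\omega=\mathrm{d}\alpha$ and $\alpha(m)=0$) for $n>1$. For $n=1$, we can find a homogeneous function $f$ such that $\omega=\mathrm{d}f$, except for the case $w=0$. However, the function $f$ does not vanish at $m$ (except when $\omega=0$, of course). 3. If $\nabla_M(m)\neq 0$ and the homogeneous form $\omega$ is a 1-form of weight $w=0$, then in local coordinates $(x,y^i)$ around $m$ such that $x$ is even, $x(m)=1$, $y^i(m)=0$ and $\nabla_M=x\,\partial_x$, we have $$\omega(x,y)=c\,\frac{\mathrm{d}x}{x}+\mathrm{d}g(y)$$ for a constant $c\in\mathbb{R}$ and a function $g=g(y)$ depending on the coordinates $(y^i)$ only. In other words, $\omega=\mathrm{d}f$ with $f(x,y)=c\,\ln(x)+g(y)+c_1$, $c_1$ a constant. The function $f$ is not homogeneous if $c\neq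 0$.
   Context: Supermanifolds are standard smooth real $\mathbb{Z}_2$-graded supermanifolds; $|M|$ is the body of $M$; the total dimension of a supermanifold of dimension $(p|q)$ is $p+q$. For a function, form or vector field, the value at $m\in|M|$ (e.g. $f(m)$, $\alpha(m)$, $\nabla_M(m)$) is obtained by reducing coefficient functions to $|M|$ and evaluating at $m$. A weight vector field on $M$ is an even vector field $\nabla_M$ such that near every point of $|M|$ there are local coordinates $(x^i)$ (even and odd) with $\nabla_M(x^i)=w_i x^i$, $w_i\in\mathbb{R}$ (homogeneous coordinates); then $\nabla_M=\sum_i w_i x^i\partial_{x^i}$. A homogeneity supermanifold is a supermanifold $M$ equipped with a weight vector field $\nabla_M$. A (local) tensor field $K$ (in particular a differential form or a function) has weight $w\in\mathbb{R}$ if $\mathcal{L}_{\nabla_M}K=w K$ (for functions: $\nabla_M(f)=wf$), and it is homogeneous of degree $\lambda=(\sigma,w)\in\mathbb{Z}_2\times\mathbb{R}$ if in addition it has parity $\sigma$. If $\nabla_M(m)\ne 0$, there always exist local coordinates $(x,y^i)$ around $m$ with $x$ even, $x(m)=1$, $y^i(m)=0$ and $\nabla_M=x\,\partial_x$. Differential forms on $M$ follow Deligne's sign convention: with $\sigma_a$ the parity of $x^a$, $x^a\,\mathrm{d}x^b=(-1)^{\sigma_a\sigma_b}\mathrm{d}x^b\,x^a$ and $\mathrm{d}x^a\wedge \mathrm{d}x^b=-(-1)^{\sigma_a\sigma_b}\mathrm{d}x^b\wedge \mathrm{d}x^a$; the de Rham derivative satisfies $\mathrm{d}f=\sum_i\mathrm{d}x^i\,\partial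 f/\partial x^i$ and $\mathrm{d}(\alpha\wedge\beta)=\mathrm{d}\alpha\wedge\beta+(-1)^k\alpha\wedge\mathrm{d}\beta$ for a $k$-form $\alpha$.
   Formalization: "f does not vanish at m (except when ω=0)" is false (ω=d(xy), ∇=x∂_x, m=(1,0)); it is replaced by: f(m)=0 iff ω(∇)(m)=0; f=0 iff ω=0; and for each such m and w≠0 some closed 1-form of weight w has only homogeneous potentials non-zero at m. *)

theory Defs
  imports "HOL-Analysis.Analysis" "HOL-Algebra.Module" "HOL-Library.Multiset" "HOL-Library.Z2"
begin

section \<open>Superdomains\<close>

text \<open>
  The superdomain of dimension \<open>(p|q)\<close> over an open set \<open>V\<close> of \<^term>\<open>Euclidean_space p\<close> has the
  coordinates \<open>x\<^sup>i\<close>, \<open>i < p + q\<close>; those with \<open>i < p\<close> are even, those with \<open>p \<le> i\<close> are odd.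
  A superfunction is the family of its coefficients: \<open>f\<close> stands for the sum over
  \<open>J = {j\<^sub>1 < \<dots> < j\<^sub>r} \<subseteq> {p..<p+q}\<close> of \<open>f J\<close> times \<open>x\<^sup>j\<^sup>1 \<cdots> x\<^sup>j\<^sup>r\<close>.  All coefficients are extended by
  \<open>0\<close> outside \<open>V\<close>.
\<close>

type_synonym sfun = "nat set \<Rightarrow> (nat \<Rightarrow> real) \<Rightarrow> real"

definition pderiv_at :: "nat \<Rightarrow> ((nat \<Rightarrow> real) \<Rightarrow> real) \<Rightarrow> (nat \<Rightarrow> real) \<Rightarrow> real" where
  "pderiv_at i u x = deriv (\<lambda>t. u (x(i := t))) (x i)"

definition smooth_fun :: "nat \<Rightarrow> (nat \<Rightarrow> real) set \<Rightarrow> ((nat \<Rightarrow> real) \<Rightarrow> real) \<Rightarrow> bool" where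
  "smooth_fun p V u \<longleftrightarrow>
     (\<forall>is. set is \<subseteq> {..<p} \<longrightarrow>
        continuous_map (subtopology (Euclidean_space p) V) euclideanreal (foldr pderiv_at is u) \<and>
        (\<forall>i<p. \<forall>x\<in>V. (\<lambda>t. foldr pderiv_at is u (x(i := t))) differentiable (at (x i))))"

definition sfuns :: "nat \<Rightarrow> nat \<Rightarrow> (nat \<Rightarrow> real) set \<Rightarrow> sfun set" where
  "sfuns p q V =
     {f. \<forall>J. smooth_fun p V (f J) \<and> (\<forall>x. x \<notin> V \<longrightarrow> f J x = 0) \<and>
             (\<not> J \<subseteq> {p..<p + q} \<longrightarrow> f J = (\<lambda>_. 0))}"

text \<open>The real function \<open>u\<close> as a superfunction not involving the odd coordinates.\<close>

definition sf_of_fun :: "(nat \<Rightarrow> real) set \<Rightarrow> ((nat \<Rightarrow> real) \<Rightarrow> real) \<Rightarrow> sfun" where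
  "sf_of_fun V u = (\<lambda>J x. if J = {} \<and> x \<in> V then u x else 0)"

definition sf_coord :: "nat \<Rightarrow> (nat \<Rightarrow> real) set \<Rightarrow> nat \<Rightarrow> sfun" where
  "sf_coord p V i =
     (if i < p then sf_of_fun V (\<lambda>x. x i) else (\<lambda>J x. if J = {i} \<and> x \<in> V then 1 else 0))"

text \<open>\<open>grass_sign J K\<close> is the sign that sorts the product of the odd monomials of \<open>J\<close> and \<open>K\<close>.\<close>

definition grass_sign :: "nat set \<Rightarrow> nat set \<Rightarrow> real" where
  "grass_sign J K = (- 1) ^ card {(j, k). j \<in> J \<and> k \<in> K \<and> k < j}"

definition sf_mult :: "sfun \<Rightarrow> sfun \<Rightarrow> sfun" where
  "sf_mult f g = (\<lambda>L x. \<Sum>J\<in>Pow L. grass_sign J (L - J) * f J x * g (L - J) x)"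

definition sf_restrict :: "(nat \<Rightarrow> real) set \<Rightarrow> sfun \<Rightarrow> sfun" where
  "sf_restrict V f = (\<lambda>J x. if x \<in> V then f J x else 0)"

text \<open>The partial derivative; with respect to an odd coordinate this is the left derivative.\<close>

definition sf_pderiv :: "nat \<Rightarrow> (nat \<Rightarrow> real) set \<Rightarrow> nat \<Rightarrow> sfun \<Rightarrow> sfun" where
  "sf_pderiv p V i f =
     (\<lambda>J x. if x \<notin> V then 0
            else if i < p then pderiv_at i (f J) x
            else if i \<in> J then 0
            else (- 1) ^ card {j \<in> J. j < i} * f (insert i J) x)"

subsection \<open>Real superalgebras\<close>

record 's superalg = "(real, 's) module" +
  hpart :: "bit \<Rightarrow> 's set"

definition real_ring :: "real ring" where
  "real_ring = \<lparr>carrier = UNIV, mult = (*), one = 1, zero = 0, add = (+)\<rparr>"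

definition superalgebra :: "'s superalg \<Rightarrow> bool" where
  "superalgebra A \<longleftrightarrow>
     Ring.ring A \<and> Module.module real_ring A \<and>
     (\<forall>a. \<forall>x\<in>carrier A. \<forall>y\<in>carrier A.
        (a \<odot>\<^bsub>A\<^esub> x) \<otimes>\<^bsub>A\<^esub> y = a \<odot>\<^bsub>A\<^esub> (x \<otimes>\<^bsub>A\<^esub> y) \<and> x \<otimes>\<^bsub>A\<^esub> (a \<odot>\<^bsub>A\<^esub> y) = a \<odot>\<^bsub>A\<^esub> (x \<otimes>\<^bsub>A\<^esub> y)) \<and>
     (\<forall>\<sigma>. submodule (hpart A \<sigma>) real_ring A) \<and>
     (\<forall>x\<in>carrier A. \<exists>!y. fst y \<in> hpart A 0 \<and> snd y \<in> hpart A 1 \<and> x = fst y \<oplus>\<^bsub>A\<^esub> snd y) \<and>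
     \<one>\<^bsub>A\<^esub> \<in> hpart A 0 \<and>
     (\<forall>\<sigma> \<tau>. \<forall>x\<in>hpart A \<sigma>. \<forall>y\<in>hpart A \<tau>.
        x \<otimes>\<^bsub>A\<^esub> y \<in> hpart A (\<sigma> + \<tau>) \<and>
        x \<otimes>\<^bsub>A\<^esub> y = (if \<sigma> = 1 \<and> \<tau> = 1 then \<ominus>\<^bsub>A\<^esub> (y \<otimes>\<^bsub>A\<^esub> x) else y \<otimes>\<^bsub>A\<^esub> x))"

definition superalg_hom :: "'s superalg \<Rightarrow> 't superalg \<Rightarrow> ('s \<Rightarrow> 't) set" where
  "superalg_hom A B =
     {h \<in> ring_hom A B.
        (\<forall>a. \<forall>x\<in>carrier A. h (a \<odot>\<^bsub>A\<^esub> x) = a \<odot>\<^bsub>B\<^esub> h x) \<and>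
        (\<forall>\<sigma>. h ` hpart A \<sigma> \<subseteq> hpart B \<sigma>)}"

definition superalg_iso :: "'s superalg \<Rightarrow> 't superalg \<Rightarrow> ('s \<Rightarrow> 't) set" where
  "superalg_iso A B = {h \<in> superalg_hom A B. bij_betw h (carrier A) (carrier B)}"

definition sf_alg :: "nat \<Rightarrow> nat \<Rightarrow> (nat \<Rightarrow> real) set \<Rightarrow> sfun superalg" where
  "sf_alg p q V =
     \<lparr>carrier = sfuns p q V, mult = sf_mult, one = sf_of_fun V (\<lambda>_. 1), zero = (\<lambda>_ _. 0),
      add = (\<lambda>f g J x. f J x + g J x), smult = (\<lambda>a f J x. a * f J x),
      hpart = (\<lambda>\<sigma>. {f \<in> sfuns p q V. \<forall>J x. f J x \<noteq> 0 \<longrightarrow> of_nat (card J) = \<sigma>})\<rparr>"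

subsection \<open>Differential forms on superdomains\<close>

text \<open>
  A monomial in the differentials is a multiset of indices; it stands for the wedge product of the
  \<open>dx\<^sup>i\<close> in increasing order of \<open>i\<close>.  By \<open>dx\<^sup>a \<and> dx\<^sup>b = -(-1)\<^bsup>\<sigma>\<^sub>a\<sigma>\<^sub>b\<^esup> dx\<^sup>b \<and> dx\<^sup>a\<close> the differentials of odd
  coordinates commute and may be repeated.  A form \<open>\<omega>\<close> is the sum of the \<open>dx\<^sup>I\<close> times \<open>\<omega> I\<close>,
  coefficients standing on the right.
\<close>

type_synonym dform = "nat multiset \<Rightarrow> sfun"

definition dmonoms :: "nat \<Rightarrow> nat \<Rightarrow> nat \<Rightarrow> nat multiset set" where
  "dmonoms p q n = {I. size I = n \<and> set_mset I \<subseteq> {..<p + q} \<and> (\<forall>i<p. count I i \<le> 1)}"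

definition dforms :: "nat \<Rightarrow> nat \<Rightarrow> (nat \<Rightarrow> real) set \<Rightarrow> nat \<Rightarrow> dform set" where
  "dforms p q V n =
     {\<omega>. \<forall>I. (I \<in> dmonoms p q n \<longrightarrow> \<omega> I \<in> sfuns p q V) \<and> (I \<notin> dmonoms p q n \<longrightarrow> \<omega> I = (\<lambda>_ _. 0))}"

definition dmonom_form :: "nat multiset \<Rightarrow> sfun \<Rightarrow> dform" where
  "dmonom_form I f = (\<lambda>K. if K = I then f else (\<lambda>_ _. 0))"

definition odd_size :: "nat \<Rightarrow> nat multiset \<Rightarrow> nat" where
  "odd_size p I = size (filter_mset (\<lambda>i. p \<le> i) I)"

text \<open>
  The sign that sorts \<open>dx\<^sup>I \<and> dx\<^sup>K\<close>: moving \<open>dx\<^sup>k\<close> to the left of \<open>dx\<^sup>i\<close>, where \<open>k < i\<close>, costs \<open>-1\<close>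
  unless both are odd, i.e. unless \<open>p \<le> k\<close>.
\<close>

definition dmonom_sign :: "nat \<Rightarrow> nat multiset \<Rightarrow> nat multiset \<Rightarrow> real" where
  "dmonom_sign p I K =
     (- 1) ^ (\<Sum>i\<in>#I. size (filter_mset (\<lambda>k. k < i \<and> k < p) K))"

text \<open>
  \<open>dx\<^sup>I f \<and> dx\<^sup>K g = dx\<^sup>I \<and> dx\<^sup>K f' g\<close>, where \<open>f'\<close> arises from \<open>f\<close> by the sign rule
  \<open>x\<^sup>a dx\<^sup>b = (-1)\<^bsup>\<sigma>\<^sub>a\<sigma>\<^sub>b\<^esup> dx\<^sup>b x\<^sup>a\<close>.
\<close>

definition wedge :: "nat \<Rightarrow> dform \<Rightarrow> dform \<Rightarrow> dform" where
  "wedge p \<alpha> \<beta> =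
     (\<lambda>L J x. if \<exists>i<p. 1 < count L i then 0
              else \<Sum>I\<in>{I. I \<subseteq># L}.
                     dmonom_sign p I (L - I) *
                     sf_mult (\<lambda>K y. (- 1) ^ (odd_size p (L - I) * card K) * \<alpha> I K y)
                       (\<beta> (L - I)) J x)"

definition wedge_list :: "nat \<Rightarrow> (nat \<Rightarrow> real) set \<Rightarrow> dform list \<Rightarrow> dform" where
  "wedge_list p V \<alpha>s = foldr (wedge p) \<alpha>s (dmonom_form {#} (sf_of_fun V (\<lambda>_. 1)))"

text \<open>
  \<open>d(dx\<^sup>I f) = (-1)\<^sup>n dx\<^sup>I \<and> df\<close> for \<open>I\<close> of size \<open>n\<close>, and \<open>df\<close> is the sum of the \<open>dx\<^sup>j \<partial>f/\<partial>x\<^sup>j\<close>.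
\<close>

definition ext_d :: "nat \<Rightarrow> nat \<Rightarrow> (nat \<Rightarrow> real) set \<Rightarrow> dform \<Rightarrow> dform" where
  "ext_d p q V \<omega> =
     (\<lambda>L J x. if L \<in> dmonoms p q (size L)
              then \<Sum>j\<in>set_mset L.
                     (- 1) ^ size (L - {#j#}) * dmonom_sign p (L - {#j#}) {#j#} *
                     sf_pderiv p V j (\<omega> (L - {#j#})) J x
              else 0)"

definition sf_d :: "nat \<Rightarrow> nat \<Rightarrow> (nat \<Rightarrow> real) set \<Rightarrow> sfun \<Rightarrow> dform" where
  "sf_d p q V f = ext_d p q V (dmonom_form {#} f)"

text \<open>
  The Lie derivative along an even vector field, given as a derivation \<open>D\<close> of the superfunctions:
  the derivation of degree \<open>0\<close> of the algebra of forms that extends \<open>D\<close> and commutes with \<open>d\<close>, so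
  that \<open>dx\<^sup>i\<close> goes to \<open>d(D(x\<^sup>i))\<close>.
\<close>

definition lie_deriv ::
    "nat \<Rightarrow> nat \<Rightarrow> (nat \<Rightarrow> real) set \<Rightarrow> (sfun \<Rightarrow> sfun) \<Rightarrow> dform \<Rightarrow> dform" where
  "lie_deriv p q V D \<omega> =
     (\<lambda>L J x.
        (\<Sum>I\<in>dmonoms p q (size L). \<Sum>r<size I.
           wedge p
             (wedge_list p V
               ((map (\<lambda>i. sf_d p q V (sf_coord p V i)) (sorted_list_of_multiset I))
                  [r := sf_d p q V (D (sf_coord p V (sorted_list_of_multiset I ! r)))]))
             (dmonom_form {#} (\<omega> I)) L J x)
        + D (\<omega> L) J x)"

text \<open>
  The pullback of forms from the superdomain over \<open>V\<close> to the one over \<open>V'\<close> along the morphism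
  given by the homomorphism \<open>\<theta>\<close> of superfunctions: \<open>dx\<^sup>i\<close> goes to \<open>d(\<theta>(x\<^sup>i))\<close>.
\<close>

definition pullback ::
    "nat \<Rightarrow> nat \<Rightarrow> (nat \<Rightarrow> real) set \<Rightarrow> (nat \<Rightarrow> real) set \<Rightarrow> (sfun \<Rightarrow> sfun) \<Rightarrow> dform \<Rightarrow> dform" where
  "pullback p q V V' \<theta> \<omega> =
     (\<lambda>L J x. \<Sum>I\<in>dmonoms p q (size L).
        wedge p
          (wedge_list p V'
            (map (\<lambda>i. sf_d p q V' (\<theta> (sf_coord p V i))) (sorted_list_of_multiset I)))
          (dmonom_form {#} (\<theta> (\<omega> I))) L J x)"


section \<open>Supermanifolds\<close>

text \<open>A topological space with a sheaf of real superalgebras; \<open>restr M U W\<close> restricts from \<open>U\<close> to \<open>W\<close>.\<close>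

record ('a, 's) superspace =
  body :: "'a topology"
  sections :: "'a set \<Rightarrow> 's superalg"
  restr :: "'a set \<Rightarrow> 'a set \<Rightarrow> 's \<Rightarrow> 's"

definition sheaf_of_superalgebras :: "('a, 's) superspace \<Rightarrow> bool" where
  "sheaf_of_superalgebras M \<longleftrightarrow>
     (\<forall>U. openin (body M) U \<longrightarrow> superalgebra (sections M U)) \<and>
     (\<forall>U W. openin (body M) U \<and> openin (body M) W \<and> W \<subseteq> U \<longrightarrow>
        restr M U W \<in> superalg_hom (sections M U) (sections M W)) \<and>
     (\<forall>U. openin (body M) U \<longrightarrow> (\<forall>s\<in>carrier (sections M U). restr M U U s = s)) \<and>
     (\<forall>U W T. openin (body M) U \<and> openin (body M) W \<and> openin (body M) T \<and> T \<subseteq> W \<and> W \<subseteq> U \<longrightarrow>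
        (\<forall>s\<in>carrier (sections M U). restr M W T (restr M U W s) = restr M U T s)) \<and>
     (\<forall>\<U> s. (\<forall>U\<in>\<U>. openin (body M) U \<and> s U \<in> carrier (sections M U)) \<and>
        (\<forall>U\<in>\<U>. \<forall>W\<in>\<U>. restr M U (U \<inter> W) (s U) = restr M W (U \<inter> W) (s W)) \<longrightarrow>
        (\<exists>!t. t \<in> carrier (sections M (\<Union>\<U>)) \<and> (\<forall>U\<in>\<U>. restr M (\<Union>\<U>) U t = s U)))"

text \<open>
  A system of local coordinates on \<open>cdom c\<close>: an isomorphism, of spaces with sheaves of
  superalgebras, onto the superdomain over \<open>cimg c\<close>; \<open>ciso c W\<close> sends the superfunctions over
  \<open>cmap c ` W\<close> to the sections over \<open>W\<close>.  The coordinate \<open>x\<^sup>i\<close> is the image of \<open>sf_coord p (cimg c) i\<close>.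
\<close>

record ('a, 's) chart =
  cdom :: "'a set"
  cmap :: "'a \<Rightarrow> nat \<Rightarrow> real"
  ciso :: "'a set \<Rightarrow> sfun \<Rightarrow> 's"

definition cimg :: "('a, 's) chart \<Rightarrow> (nat \<Rightarrow> real) set" where
  "cimg c = cmap c ` cdom c"

definition charts :: "nat \<Rightarrow> nat \<Rightarrow> ('a, 's) superspace \<Rightarrow> ('a, 's) chart set" where
  "charts p q M =
     {c. openin (body M) (cdom c) \<and>
         openin (Euclidean_space p) (cimg c) \<and>
         homeomorphic_map (subtopology (body M) (cdom c))
           (subtopology (Euclidean_space p) (cimg c)) (cmap c) \<and>
         (\<forall>W. openin (body M) W \<and> W \<subseteq> cdom c \<longrightarrow>
            ciso c W \<in> superalg_iso (sf_alg p q (cmap c ` W)) (sections M W)) \<and>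
         (\<forall>U W. openin (body M) U \<and> openin (body M) W \<and> W \<subseteq> U \<and> U \<subseteq> cdom c \<longrightarrow>
            (\<forall>f\<in>sfuns p q (cmap c ` U).
               restr M U W (ciso c U f) = ciso c W (sf_restrict (cmap c ` W) f)))}"

definition chart_restrict :: "('a, 's) chart \<Rightarrow> 'a set \<Rightarrow> ('a, 's) chart" where
  "chart_restrict c U = c\<lparr>cdom := U\<rparr>"

definition supermanifold :: "nat \<Rightarrow> nat \<Rightarrow> ('a, 's) superspace \<Rightarrow> bool" where
  "supermanifold p q M \<longleftrightarrow>
     Hausdorff_space (body M) \<and> second_countable (body M) \<and> sheaf_of_superalgebras M \<and>
     (\<forall>m\<in>topspace (body M). \<exists>c\<in>charts p q M. m \<in> cdom c)"

text \<open>The expression in the coordinates \<open>c\<close> of a section \<open>s\<close> over an open set \<open>U \<supseteq> cdom c\<close>.\<close>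

definition local_expr ::
    "nat \<Rightarrow> nat \<Rightarrow> ('a, 's) superspace \<Rightarrow> 'a set \<Rightarrow> ('a, 's) chart \<Rightarrow> 's \<Rightarrow> sfun" where
  "local_expr p q M U c s =
     the_inv_into (sfuns p q (cimg c)) (ciso c (cdom c)) (restr M U (cdom c) s)"

text \<open>
  For \<open>cdom c' \<subseteq> cdom c\<close>: the change of coordinates from \<open>c\<close> to \<open>c'\<close>, as a homomorphism from the
  superfunctions over \<open>cimg c\<close> to those over \<open>cimg c'\<close>.
\<close>

definition transition ::
    "nat \<Rightarrow> nat \<Rightarrow> ('a, 's) superspace \<Rightarrow> ('a, 's) chart \<Rightarrow> ('a, 's) chart \<Rightarrow> sfun \<Rightarrow> sfun" where
  "transition p q M c c' f = local_expr p q M (cdom c) c' (ciso c (cdom c) f)"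

definition fun_vanishes_at ::
    "nat \<Rightarrow> nat \<Rightarrow> ('a, 's) superspace \<Rightarrow> 'a set \<Rightarrow> 's \<Rightarrow> 'a \<Rightarrow> bool" where
  "fun_vanishes_at p q M U s m \<longleftrightarrow>
     (\<forall>c\<in>charts p q M. m \<in> cdom c \<and> cdom c \<subseteq> U \<longrightarrow> local_expr p q M U c s {} (cmap c m) = 0)"

subsection \<open>Weight vector fields\<close>

definition even_vector_field :: "('a, 's) superspace \<Rightarrow> ('a set \<Rightarrow> 's \<Rightarrow> 's) \<Rightarrow> bool" where
  "even_vector_field M D \<longleftrightarrow>
     (\<forall>U. openin (body M) U \<longrightarrow>
        (\<forall>\<sigma>. D U ` hpart (sections M U) \<sigma> \<subseteq> hpart (sections M U) \<sigma>) \<and>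
        (\<forall>f\<in>carrier (sections M U). D U f \<in> carrier (sections M U) \<and>
           (\<forall>a. D U (a \<odot>\<^bsub>sections M U\<^esub> f) = a \<odot>\<^bsub>sections M U\<^esub> D U f) \<and>
           (\<forall>g\<in>carrier (sections M U).
              D U (f \<oplus>\<^bsub>sections M U\<^esub> g) = D U f \<oplus>\<^bsub>sections M U\<^esub> D U g \<and>
              D U (f \<otimes>\<^bsub>sections M U\<^esub> g) =
                (D U f \<otimes>\<^bsub>sections M U\<^esub> g) \<oplus>\<^bsub>sections M U\<^esub> (f \<otimes>\<^bsub>sections M U\<^esub> D U g)))) \<and>
     (\<forall>U W. openin (body M) U \<and> openin (body M) W \<and> W \<subseteq> U \<longrightarrow>
        (\<forall>f\<in>carrier (sections M U). restr M U W (D U f) = D W (restr M U W f)))"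

definition vf_local ::
    "nat \<Rightarrow> nat \<Rightarrow> ('a, 's) superspace \<Rightarrow> ('a set \<Rightarrow> 's \<Rightarrow> 's) \<Rightarrow> ('a, 's) chart \<Rightarrow> sfun \<Rightarrow> sfun" where
  "vf_local p q M D c f = local_expr p q M (cdom c) c (D (cdom c) (ciso c (cdom c) f))"

text \<open>The coefficients of the vector field are its values on the coordinate functions.\<close>

definition vf_vanishes_at ::
    "nat \<Rightarrow> nat \<Rightarrow> ('a, 's) superspace \<Rightarrow> ('a set \<Rightarrow> 's \<Rightarrow> 's) \<Rightarrow> 'a \<Rightarrow> bool" where
  "vf_vanishes_at p q M D m \<longleftrightarrow>
     (\<forall>c\<in>charts p q M. m \<in> cdom c \<longrightarrow>
        (\<forall>i<p + q. vf_local p q M D c (sf_coord p (cimg c) i) {} (cmap c m) = 0))"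

definition homogeneous_coords ::
    "nat \<Rightarrow> nat \<Rightarrow> ('a, 's) superspace \<Rightarrow> ('a set \<Rightarrow> 's \<Rightarrow> 's) \<Rightarrow> ('a, 's) chart \<Rightarrow> (nat \<Rightarrow> real) \<Rightarrow> bool" where
  "homogeneous_coords p q M D c w \<longleftrightarrow>
     c \<in> charts p q M \<and>
     (\<forall>i<p + q. D (cdom c) (ciso c (cdom c) (sf_coord p (cimg c) i)) =
        w i \<odot>\<^bsub>sections M (cdom c)\<^esub> ciso c (cdom c) (sf_coord p (cimg c) i))"

definition homogeneity_supermanifold ::
    "nat \<Rightarrow> nat \<Rightarrow> ('a, 's) superspace \<Rightarrow> ('a set \<Rightarrow> 's \<Rightarrow> 's) \<Rightarrow> bool" where
  "homogeneity_supermanifold p q M D \<longleftrightarrow>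
     supermanifold p q M \<and> even_vector_field M D \<and>
     (\<forall>m\<in>topspace (body M). \<exists>c w. homogeneous_coords p q M D c w \<and> m \<in> cdom c)"

definition homogeneous_fun ::
    "('a, 's) superspace \<Rightarrow> ('a set \<Rightarrow> 's \<Rightarrow> 's) \<Rightarrow> 'a set \<Rightarrow> bit \<times> real \<Rightarrow> 's \<Rightarrow> bool" where
  "homogeneous_fun M D U \<delta> f \<longleftrightarrow>
     f \<in> hpart (sections M U) (fst \<delta>) \<and> D U f = snd \<delta> \<odot>\<^bsub>sections M U\<^esub> f"

subsection \<open>Differential forms on supermanifolds\<close>

text \<open>
  A form on an open set \<open>U\<close> assigns to every system of local coordinates inside \<open>U\<close> a coordinate
  expression, compatibly with restrictions and changes of coordinates.  Its values on charts that
  are not inside \<open>U\<close> are irrelevant, and equality on \<open>U\<close> is \<open>mform_eq\<close>.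
\<close>

type_synonym ('a, 's) mform = "('a, 's) chart \<Rightarrow> dform"

definition mforms ::
    "nat \<Rightarrow> nat \<Rightarrow> ('a, 's) superspace \<Rightarrow> 'a set \<Rightarrow> nat \<Rightarrow> ('a, 's) mform set" where
  "mforms p q M U n =
     {\<omega>. (\<forall>c\<in>charts p q M. cdom c \<subseteq> U \<longrightarrow> \<omega> c \<in> dforms p q (cimg c) n) \<and>
         (\<forall>c\<in>charts p q M. \<forall>c'\<in>charts p q M. cdom c' \<subseteq> cdom c \<and> cdom c \<subseteq> U \<longrightarrow>
            \<omega> c' = pullback p q (cimg c) (cimg c') (transition p q M c c') (\<omega> c))}"

definition mform_eq ::
    "nat \<Rightarrow> nat \<Rightarrow> ('a, 's) superspace \<Rightarrow> 'a set \<Rightarrow> ('a, 's) mform \<Rightarrow> ('a, 's) mform \<Rightarrow> bool" where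
  "mform_eq p q M U \<omega> \<eta> \<longleftrightarrow> (\<forall>c\<in>charts p q M. cdom c \<subseteq> U \<longrightarrow> \<omega> c = \<eta> c)"

definition mform_zero :: "('a, 's) mform" where
  "mform_zero = (\<lambda>_ _ _ _. 0)"

definition mform_d :: "nat \<Rightarrow> nat \<Rightarrow> ('a, 's) mform \<Rightarrow> ('a, 's) mform" where
  "mform_d p q \<omega> = (\<lambda>c. ext_d p q (cimg c) (\<omega> c))"

definition fun_d ::
    "nat \<Rightarrow> nat \<Rightarrow> ('a, 's) superspace \<Rightarrow> 'a set \<Rightarrow> 's \<Rightarrow> ('a, 's) mform" where
  "fun_d p q M U f = (\<lambda>c. sf_d p q (cimg c) (local_expr p q M U c f))"

definition closed_mform ::
    "nat \<Rightarrow> nat \<Rightarrow> ('a, 's) superspace \<Rightarrow> 'a set \<Rightarrow> ('a, 's) mform \<Rightarrow> bool" where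
  "closed_mform p q M U \<omega> \<longleftrightarrow> mform_eq p q M U (mform_d p q \<omega>) mform_zero"

text \<open>The parity of \<open>dx\<^sup>i\<close> is that of \<open>x\<^sup>i\<close>; the form degree does not enter.\<close>

definition homogeneous_mform ::
    "nat \<Rightarrow> nat \<Rightarrow> ('a, 's) superspace \<Rightarrow> ('a set \<Rightarrow> 's \<Rightarrow> 's) \<Rightarrow> 'a set \<Rightarrow> bit \<times> real \<Rightarrow>
     ('a, 's) mform \<Rightarrow> bool" where
  "homogeneous_mform p q M D U \<delta> \<omega> \<longleftrightarrow>
     (\<forall>c\<in>charts p q M. cdom c \<subseteq> U \<longrightarrow>
        (\<forall>I J x. \<omega> c I J x \<noteq> 0 \<longrightarrow> of_nat (odd_size p I + card J) = fst \<delta>) \<and>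
        lie_deriv p q (cimg c) (vf_local p q M D c) (\<omega> c) = (\<lambda>I J x. snd \<delta> * \<omega> c I J x))"

definition mform_vanishes_at ::
    "nat \<Rightarrow> nat \<Rightarrow> ('a, 's) superspace \<Rightarrow> 'a set \<Rightarrow> ('a, 's) mform \<Rightarrow> 'a \<Rightarrow> bool" where
  "mform_vanishes_at p q M U \<omega> m \<longleftrightarrow>
     (\<forall>c\<in>charts p q M. m \<in> cdom c \<and> cdom c \<subseteq> U \<longrightarrow> (\<forall>I. \<omega> c I {} (cmap c m) = 0))"

text \<open>
  The value at \<open>m\<close> of the 1-form \<open>\<omega>\<close> on the vector field, computed in the coordinates \<open>c\<close>; the
  coefficients of an even vector field at odd coordinates have value \<open>0\<close>.
\<close>

definition pairing_at ::
    "nat \<Rightarrow> nat \<Rightarrow> ('a, 's) superspace \<Rightarrow> ('a set \<Rightarrow> 's \<Rightarrow> 's) \<Rightarrow> ('a, 's) chart \<Rightarrow>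
     ('a, 's) mform \<Rightarrow> 'a \<Rightarrow> real" where
  "pairing_at p q M D c \<omega> m =
     (\<Sum>i<p. vf_local p q M D c (sf_coord p (cimg c) i) {} (cmap c m) * \<omega> c {#i#} {} (cmap c m))"

definition is_nbhd :: "('a, 's) superspace \<Rightarrow> 'a \<Rightarrow> 'a set \<Rightarrow> bool" where
  "is_nbhd M m U \<longleftrightarrow> openin (body M) U \<and> m \<in> U"

text \<open>\<open>f\<close> is a homogeneous function of degree \<open>\<delta>\<close> on \<open>U\<close> with \<open>\<omega> = df\<close> there.\<close>

definition homogeneous_potential ::
    "nat \<Rightarrow> nat \<Rightarrow> ('a, 's) superspace \<Rightarrow> ('a set \<Rightarrow> 's \<Rightarrow> 's) \<Rightarrow> 'a set \<Rightarrow> bit \<times> real \<Rightarrow>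
     ('a, 's) mform \<Rightarrow> 's \<Rightarrow> bool" where
  "homogeneous_potential p q M D U \<delta> \<omega> f \<longleftrightarrow>
     homogeneous_fun M D U \<delta> f \<and> mform_eq p q M U \<omega> (fun_d p q M U f)"

end

theory Submission
  imports Defs "HOL-Library.Function_Algebras"
begin

text \<open>
  In homogeneous coordinates the Lie derivative along \<open>\<nabla>\<close> sends \<open>dx\<^sup>I f\<close> to \<open>dx\<^sup>I (\<nabla>f + w\<^sub>I f)\<close>, where \<open>w\<^sub>I\<close> is the
  sum of the weights of the coordinates in \<open>I\<close>, so homogeneity can be tested on coefficients.  On a box
  around \<open>m\<close>, subtracting a suitable \<open>d\<alpha>\<close> from a closed form removes \<open>dx\<^sup>i\<close> and all dependence on \<open>x\<^sup>i\<close>: the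
  coefficients of \<open>\<alpha>\<close> are those at \<open>dx\<^sup>i\<close>, integrated along \<open>x\<^sup>i\<close> from the slice \<open>x\<^sup>i = x\<^sup>i(m)\<close>, or multiplied
  by \<open>x\<^sup>i\<close> if that coordinate is odd.  If \<open>w\<^sub>i x\<^sup>i(m) = 0\<close> then the slice is invariant under \<open>\<nabla>\<close> and \<open>\<alpha>\<close>
  inherits the weight.  For \<open>\<nabla>(m) = 0\<close> all coordinates can be removed.  Otherwise \<open>w\<^sub>j x\<^sup>j(m) \<noteq> 0\<close> for some \<open>j\<close>;
  replacing \<open>x\<^sup>i\<close> by \<open>x\<^sup>i - x\<^sup>i(m) t\<^sup>e\<close>, where \<open>t = x\<^sup>j / x\<^sup>j(m)\<close> and \<open>e = w\<^sub>i / w\<^sub>j\<close>, gives homogeneous coordinates in which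
  all coordinates but \<open>x\<^sup>j\<close> vanish at \<open>m\<close> and can be removed.  What remains is a multiple of \<open>dx\<^sup>j\<close> not
  involving the other coordinates: zero for \<open>n > 1\<close>, and \<open>c dx/x\<close> for \<open>n = 1\<close> and weight \<open>0\<close>.  For \<open>n = 1\<close>
  and weight \<open>w \<noteq> 0\<close>, the contraction of \<open>\<omega>\<close> with \<open>\<nabla>\<close>, divided by \<open>w\<close>, is a potential by Cartan's formula.
\<close>

section \<open>Smooth functions on open subsets of Euclidean space\<close>

text \<open>A chart comes with a homeomorphism and isomorphisms of sheaves of superalgebras, but
  with no formula for a change of coordinates: that is an abstract homomorphism
  \<open>\<theta>\<close>. A form in turn has to be given in every chart. So a form found in one
  chart is carried to the others by pullback, and everything rests on the fact that an abstract
  \<open>\<theta>\<close> respects values at points and obeys the chain rule. Locality fixes the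
  values of the pulled back coordinates, and Hadamard's lemma does the rest. Its quotient is an
  average along a segment; the same average gives the primitives in one coordinate, the symmetry of
  second derivatives and the derivatives of the adapted coordinates.

  A potential of nonzero weight may vanish at a point with \<open>\<nabla>(m) \<noteq> 0\<close>:
  for \<open>\<nabla> = x \<partial>_x\<close> take \<open>d(x y)\<close> at \<open>(1, 0)\<close>.
  By Euler's formula \<open>w f(m)\<close> is the value at \<open>m\<close> of
  \<open>\<omega>\<close> on \<open>\<nabla>\<close>. This decides when \<open>f\<close> vanishes,
  and \<open>d(x^w)\<close> is an example in which it does not.\<close>

lemma Euclidean_space_open_subset: "openin (Euclidean_space p) V \<Longrightarrow> V \<subseteq> {x. \<forall>i\<ge>p. x i = 0}"
  using openin_subset[of "Euclidean_space p" V] by (simp add: topspace_Euclidean_space)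

lemma openin_Euclidean_space_iff:
  "openin (Euclidean_space p) V \<longleftrightarrow> (\<exists>T. open T \<and> V = T \<inter> {x. \<forall>i\<ge>p. x i = 0})"
  by (simp add: Euclidean_space_def openin_subtopology euclidean_product_topology)

lemma continuous_map_Euclidean_space_iff:
  assumes "openin (Euclidean_space p) V"
  shows "continuous_map (subtopology (Euclidean_space p) V) euclideanreal u \<longleftrightarrow> continuous_on V u"
proof -
  have "subtopology (Euclidean_space p) V = subtopology euclidean V"
    using Euclidean_space_open_subset[OF assms]
    by (simp add: Euclidean_space_def subtopology_subtopology euclidean_product_topology Int_absorb1)
  then show ?thesis by simp
qed

lemma continuous_on_fun_upd:
  assumes "continuous_on S f" "continuous_on S (g :: 'a::topological_space \<Rightarrow> real)"
  shows "continuous_on S (\<lambda>y. (f y :: nat \<Rightarrow> real)(i := g y))"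
proof (rule continuous_on_coordinatewise_then_product)
  fix j
  show "continuous_on S (\<lambda>y. ((f y)(i := g y)) j)"
    using assms continuous_on_product_then_coordinatewise[OF assms(1), of j]
    by (cases "i = j") auto
qed

lemma eventually_fun_upd_in:
  assumes "openin (Euclidean_space p) V" "x \<in> V" "i < p"
  shows "\<forall>\<^sub>F t in nhds (x i). x(i := t) \<in> V"
proof -
  obtain T where T: "open T" "V = T \<inter> {x. \<forall>i\<ge>p. x i = 0}"
    using assms(1) by (auto simp: openin_Euclidean_space_iff)
  have "continuous_on UNIV (\<lambda>t::real. x(i := t))"
    by (intro continuous_on_fun_upd continuous_intros)
  then have "open ((\<lambda>t. x(i := t)) -` T)"
    using T(1) open_vimage by blast
  moreover have "x i \<in> (\<lambda>t. x(i := t)) -` T"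
    using assms T by auto
  ultimately have "\<forall>\<^sub>F t in nhds (x i). t \<in> (\<lambda>t. x(i := t)) -` T"
    by (rule eventually_nhds_in_open)
  then show ?thesis
    by eventually_elim (use assms T in auto)
qed

abbreviation has_pderiv :: "nat \<Rightarrow> ((nat \<Rightarrow> real) \<Rightarrow> real) \<Rightarrow> real \<Rightarrow> (nat \<Rightarrow> real) \<Rightarrow> bool" where
  "has_pderiv i u d x \<equiv> ((\<lambda>t. u (x(i := t))) has_real_derivative d) (at (x i))"

lemma pderiv_at_eqI: "has_pderiv i u d x \<Longrightarrow> pderiv_at i u x = d"
  by (simp add: pderiv_at_def DERIV_imp_deriv)

text \<open>Coefficients of superfunctions are cut off to \<open>0\<close> outside \<open>V\<close>,
  so derivatives on \<open>V\<close> must not see values outside. Openness of \<open>V\<close>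
  provides this along every coordinate line with \<open>i < p\<close>.\<close>

lemma has_pderiv_cong:
  assumes "openin (Euclidean_space p) V" "x \<in> V" "i < p" "\<And>y. y \<in> V \<Longrightarrow> u y = v y"
  shows "has_pderiv i u d x \<longleftrightarrow> has_pderiv i v d x"
proof (rule DERIV_cong_ev[OF refl _ refl])
  show "\<forall>\<^sub>F t in nhds (x i). u (x(i := t)) = v (x(i := t))"
    using eventually_fun_upd_in[OF assms(1-3)] by eventually_elim (use assms(4) in auto)
qed

lemma pderiv_at_cong:
  assumes "openin (Euclidean_space p) V" "x \<in> V" "i < p" "\<And>y. y \<in> V \<Longrightarrow> u y = v y"
  shows "pderiv_at i u x = pderiv_at i v x"
  unfolding pderiv_at_def deriv_def using has_pderiv_cong[OF assms(1-3), of u v] assms(4) by simp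

lemma differentiable_iff_has_pderiv:
  "(\<lambda>t. u (x(i := t))) differentiable (at (x i)) \<longleftrightarrow> has_pderiv i u (pderiv_at i u x) x"
  unfolding pderiv_at_def
  using DERIV_deriv_iff_real_differentiable by blast

text \<open>Smoothness quantifies over all lists of directions at once and has no base case.
  Counting the order gives an induction in which the function is generalised, because the
  derivatives of a product or a composite are again built from functions of that kind.\<close>

primrec Ck :: "nat \<Rightarrow> nat \<Rightarrow> (nat \<Rightarrow> real) set \<Rightarrow> ((nat \<Rightarrow> real) \<Rightarrow> real) \<Rightarrow> bool" where
  "Ck 0 p V u = continuous_on V u"
| "Ck (Suc k) p V u =
     (continuous_on V u \<and> (\<forall>i<p. (\<forall>x\<in>V. has_pderiv i u (pderiv_at i u x) x) \<and> Ck k p V (pderiv_at i u)))"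

lemma Ck_cong:
  assumes "openin (Euclidean_space p) V" "\<And>y. y \<in> V \<Longrightarrow> u y = v y"
  shows "Ck k p V u \<longleftrightarrow> Ck k p V v"
  using assms(2)
proof (induction k arbitrary: u v)
  case 0
  then show ?case by (auto cong: continuous_on_cong)
next
  case (Suc k)
  have "continuous_on V u \<longleftrightarrow> continuous_on V v"
    using Suc.prems by (auto cong: continuous_on_cong)
  moreover have "Ck k p V (pderiv_at i u) \<longleftrightarrow> Ck k p V (pderiv_at i v)" if "i < p" for i
    using pderiv_at_cong[OF assms(1) _ that Suc.prems] by (intro Suc.IH)
  moreover have "has_pderiv i u (pderiv_at i u x) x \<longleftrightarrow> has_pderiv i v (pderiv_at i v x) x"
    if "i < p" "x \<in> V" for i x
    using pderiv_at_cong[OF assms(1) that(2,1) Suc.prems] has_pderiv_cong[OF assms(1) that(2,1) Suc.prems]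
    by simp
  ultimately show ?case by simp
qed

text \<open>Any candidate \<open>u'\<close> will do: it has to agree with
  \<open>pderiv_at i u\<close> only on \<open>V\<close>, while a formula such as the product rule
  says nothing about \<open>pderiv_at\<close> elsewhere.\<close>

lemma Ck_SucI:
  assumes "openin (Euclidean_space p) V" "continuous_on V u"
    and "\<And>i. i < p \<Longrightarrow> \<exists>u'. Ck k p V u' \<and> (\<forall>x\<in>V. has_pderiv i u (u' x) x)"
  shows "Ck (Suc k) p V u"
proof -
  have "(\<forall>x\<in>V. has_pderiv i u (pderiv_at i u x) x) \<and> Ck k p V (pderiv_at i u)" if i: "i < p" for i
  proof -
    obtain u' where u': "Ck k p V u'" "\<forall>x\<in>V. has_pderiv i u (u' x) x"
      using assms(3)[OF i] by blast
    have "\<And>x. x \<in> V \<Longrightarrow> pderiv_at i u x = u' x"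
      using u'(2) pderiv_at_eqI by blast
    then show ?thesis
      using u' Ck_cong[OF assms(1), of "pderiv_at i u" u'] by simp
  qed
  then show ?thesis using assms(2) by simp
qed

lemma Ck_Suc_D: "Ck (Suc k) p V u \<Longrightarrow> Ck k p V u"
  by (induction k arbitrary: u) auto

text \<open>\<open>foldr\<close> applies the last entry of the list first. One derivative of
  \<open>u\<close> itself is therefore split off at the end of the list, by appending
  \<open>[i]\<close> in one direction and by \<open>rev_cases\<close> in the other.\<close>

lemma smooth_fun_rec:
  assumes "openin (Euclidean_space p) V"
  shows "smooth_fun p V u \<longleftrightarrow>
    continuous_on V u \<and> (\<forall>i<p. (\<forall>x\<in>V. has_pderiv i u (pderiv_at i u x) x) \<and> smooth_fun p V (pderiv_at i u))"
    (is "_ \<longleftrightarrow> ?R")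
proof
  assume L: "smooth_fun p V u"
  note D = L[unfolded smooth_fun_def continuous_map_Euclidean_space_iff[OF assms] differentiable_iff_has_pderiv, rule_format]
  have "smooth_fun p V (pderiv_at i u)" if "i < p" for i
    unfolding smooth_fun_def continuous_map_Euclidean_space_iff[OF assms] differentiable_iff_has_pderiv
  proof (intro allI impI)
    fix "is" :: "nat list" assume "set is \<subseteq> {..<p}"
    then have "set (is @ [i]) \<subseteq> {..<p}" using that by auto
    from D[OF this] show "continuous_on V (foldr pderiv_at is (pderiv_at i u)) \<and>
         (\<forall>ia<p. \<forall>x\<in>V. has_pderiv ia (foldr pderiv_at is (pderiv_at i u))
            (pderiv_at ia (foldr pderiv_at is (pderiv_at i u)) x) x)"
      by simp
  qed
  then show ?R using D[of "[]"] by simp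
next
  assume R: ?R
  show "smooth_fun p V u"
    unfolding smooth_fun_def continuous_map_Euclidean_space_iff[OF assms] differentiable_iff_has_pderiv
  proof (intro allI impI)
    fix "is" :: "nat list" assume *: "set is \<subseteq> {..<p}"
    show "continuous_on V (foldr pderiv_at is u) \<and>
         (\<forall>ia<p. \<forall>x\<in>V. has_pderiv ia (foldr pderiv_at is u) (pderiv_at ia (foldr pderiv_at is u) x) x)"
    proof (cases "is" rule: rev_cases)
      case Nil
      then show ?thesis using R by simp
    next
      case (snoc js i)
      then have "smooth_fun p V (pderiv_at i u)" "set js \<subseteq> {..<p}" using R * by auto
      then show ?thesis
        using snoc unfolding smooth_fun_def continuous_map_Euclidean_space_iff[OF assms] differentiable_iff_has_pderiv
        by simp
    qed
  qed
qed

lemma smooth_fun_iff_Ck: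
  assumes "openin (Euclidean_space p) V"
  shows "smooth_fun p V u \<longleftrightarrow> (\<forall>k. Ck k p V u)"
proof
  assume "smooth_fun p V u"
  then have "Ck k p V u" for k
  proof (induction k arbitrary: u)
    case 0
    then show ?case using smooth_fun_rec[OF assms, of u] by simp
  next
    case (Suc k)
    then show ?case using smooth_fun_rec[OF assms, of u] by simp
  qed
  then show "\<forall>k. Ck k p V u" by blast
next
  assume R: "\<forall>k. Ck k p V u"
  have "continuous_on V (foldr pderiv_at is u) \<and>
         (\<forall>ia<p. \<forall>x\<in>V. has_pderiv ia (foldr pderiv_at is u) (pderiv_at ia (foldr pderiv_at is u) x) x)"
    if "set is \<subseteq> {..<p}" for "is"
    using that R
  proof (induction "is" arbitrary: u rule: rev_induct)
    case Nil
    then have "Ck (Suc 0) p V u" by blast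
    then show ?case unfolding foldr.simps id_apply Ck.simps by blast
  next
    case (snoc i js)
    have "Ck k p V (pderiv_at i u)" for k
    proof -
      have "Ck (Suc k) p V u" using snoc.prems(2) by blast
      then show ?thesis using snoc.prems(1) by simp
    qed
    then show ?case using snoc.IH[of "pderiv_at i u"] snoc.prems(1) by simp
  qed
  then show "smooth_fun p V u"
    unfolding smooth_fun_def continuous_map_Euclidean_space_iff[OF assms] differentiable_iff_has_pderiv by blast
qed

lemma smooth_fun_cong:
  assumes "openin (Euclidean_space p) V" "\<And>y. y \<in> V \<Longrightarrow> u y = v y"
  shows "smooth_fun p V u \<longleftrightarrow> smooth_fun p V v"
  using Ck_cong[OF assms] by (simp add: smooth_fun_iff_Ck[OF assms(1)])

lemma smooth_fun_has_pderiv: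
  "openin (Euclidean_space p) V \<Longrightarrow> smooth_fun p V u \<Longrightarrow> i < p \<Longrightarrow> x \<in> V \<Longrightarrow> has_pderiv i u (pderiv_at i u x) x"
  using smooth_fun_rec by blast

lemma smooth_fun_pderiv:
  "openin (Euclidean_space p) V \<Longrightarrow> smooth_fun p V u \<Longrightarrow> i < p \<Longrightarrow> smooth_fun p V (pderiv_at i u)"
  using smooth_fun_rec by blast

lemma smooth_fun_continuous_on:
  "openin (Euclidean_space p) V \<Longrightarrow> smooth_fun p V u \<Longrightarrow> continuous_on V u"
  using smooth_fun_rec by blast

text \<open>Each order of \<open>u\<close> comes from the order below of its derivatives, which are
  already known to be smooth.\<close>

lemma smooth_fun_derivI:
  assumes "openin (Euclidean_space p) V" "continuous_on V u"
    and "\<And>i. i < p \<Longrightarrow> \<exists>u'. smooth_fun p V u' \<and> (\<forall>x\<in>V. has_pderiv i u (u' x) x)"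
  shows "smooth_fun p V u"
  unfolding smooth_fun_iff_Ck[OF assms(1)]
proof
  fix k
  show "Ck k p V u"
  proof (cases k)
    case 0
    then show ?thesis using assms(2) by simp
  next
    case (Suc l)
    then show ?thesis
      using Ck_SucI[OF assms(1,2), of l] assms(3) smooth_fun_iff_Ck[OF assms(1)] by meson
  qed
qed

section \<open>Closure properties of smooth functions\<close>

lemma smooth_fun_subset:
  assumes "openin (Euclidean_space p) V" "openin (Euclidean_space p) W" "W \<subseteq> V" "smooth_fun p V u"
  shows "smooth_fun p W u"
proof -
  have "Ck k p W u" if "Ck k p V u" for k
    using that
    by (induction k arbitrary: u) (use assms(3) continuous_on_subset in \<open>auto 4 3\<close>)
  then show ?thesis using assms smooth_fun_iff_Ck by meson
qed

lemma smooth_fun_const: "openin (Euclidean_space p) V \<Longrightarrow> smooth_fun p V (\<lambda>_. a)"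
proof -
  assume V: "openin (Euclidean_space p) V"
  have "Ck k p V (\<lambda>_. a)" for k
  proof (induction k arbitrary: a)
    case (Suc k)
    then show ?case by (intro Ck_SucI[OF V]) (auto intro!: exI[of _ "\<lambda>_. 0"])
  qed simp
  then show ?thesis using V smooth_fun_iff_Ck by blast
qed

lemma Ck_add:
  assumes V: "openin (Euclidean_space p) V"
  shows "Ck k p V u \<Longrightarrow> Ck k p V v \<Longrightarrow> Ck k p V (\<lambda>x. u x + v x)"
proof (induction k arbitrary: u v)
  case (Suc k)
  show ?case
  proof (rule Ck_SucI[OF V])
    show "continuous_on V (\<lambda>x. u x + v x)" using Suc.prems by (auto intro: continuous_intros)
    fix i assume "i < p"
    then show "\<exists>u'. Ck k p V u' \<and> (\<forall>x\<in>V. has_pderiv i (\<lambda>x. u x + v x) (u' x) x)"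
      using Suc by (intro exI[of _ "\<lambda>x. pderiv_at i u x + pderiv_at i v x"]) (auto intro: DERIV_add)
  qed
qed (auto intro: continuous_intros)

lemma Ck_mult:
  assumes V: "openin (Euclidean_space p) V"
  shows "Ck k p V u \<Longrightarrow> Ck k p V v \<Longrightarrow> Ck k p V (\<lambda>x. u x * v x)"
proof (induction k arbitrary: u v)
  case (Suc k)
  show ?case
  proof (rule Ck_SucI[OF V])
    show "continuous_on V (\<lambda>x. u x * v x)" using Suc.prems by (auto intro: continuous_intros)
    fix i assume i: "i < p"
    have "Ck k p V (\<lambda>x. pderiv_at i u x * v x + pderiv_at i v x * u x)"
      using Suc.prems i by (intro Ck_add[OF V] Suc.IH) (auto intro: Ck_Suc_D)
    moreover have "has_pderiv i (\<lambda>x. u x * v x) (pderiv_at i u x * v x + pderiv_at i v x * u x) x" if "x \<in> V" for x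
      using DERIV_mult[of "\<lambda>t. u (x(i := t))" "pderiv_at i u x" "x i" UNIV "\<lambda>t. v (x(i := t))" "pderiv_at i v x"]
        Suc.prems i that by simp
    ultimately show "\<exists>u'. Ck k p V u' \<and> (\<forall>x\<in>V. has_pderiv i (\<lambda>x. u x * v x) (u' x) x)" by blast
  qed
qed (auto intro: continuous_intros)

lemma smooth_fun_add:
  "openin (Euclidean_space p) V \<Longrightarrow> smooth_fun p V u \<Longrightarrow> smooth_fun p V v \<Longrightarrow> smooth_fun p V (\<lambda>x. u x + v x)"
  by (simp add: smooth_fun_iff_Ck Ck_add)

lemma smooth_fun_mult:
  "openin (Euclidean_space p) V \<Longrightarrow> smooth_fun p V u \<Longrightarrow> smooth_fun p V v \<Longrightarrow> smooth_fun p V (\<lambda>x. u x * v x)"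
  by (simp add: smooth_fun_iff_Ck Ck_mult)

lemma smooth_fun_sum:
  assumes "openin (Euclidean_space p) V" "\<And>i. i \<in> A \<Longrightarrow> smooth_fun p V (u i)"
  shows "smooth_fun p V (\<lambda>x. \<Sum>i\<in>A. u i x)"
  using assms(2)
  by (induction A rule: infinite_finite_induct) (auto intro: smooth_fun_const smooth_fun_add assms(1))

lemma smooth_fun_coord: 
  assumes V: "openin (Euclidean_space p) V" shows "smooth_fun p V (\<lambda>x. x i)"
proof (rule smooth_fun_derivI[OF V])
  show "continuous_on V (\<lambda>x. x i)"
    by (rule continuous_on_product_then_coordinatewise) (rule continuous_on_id)
  fix j assume "j < p"
  then show "\<exists>u'. smooth_fun p V u' \<and> (\<forall>x\<in>V. has_pderiv j (\<lambda>x. x i) (u' x) x)"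
    by (intro exI[of _ "\<lambda>_. if i = j then 1 else 0"] conjI smooth_fun_const V ballI)
      (cases "i = j"; auto)
qed

lemma smooth_fun_powr:
  assumes V: "openin (Euclidean_space p) V" and u: "smooth_fun p V u" "\<And>x. x \<in> V \<Longrightarrow> u x > 0"
  shows "smooth_fun p V (\<lambda>x. u x powr r)"
proof -
  have "Ck k p V (\<lambda>x. u x powr r)" for k
  \<comment> \<open>The exponent varies in the induction since the derivative of
    \<open>u powr r\<close> contains \<open>u powr (r - 1)\<close>.\<close>
  proof (induction k arbitrary: r)
    case 0
    then show ?case using u smooth_fun_continuous_on[OF V u(1)]
      by (auto intro!: continuous_intros) force
  next
    case (Suc k)
    show ?case
    proof (rule Ck_SucI[OF V])
      show "continuous_on V (\<lambda>x. u x powr r)"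
        using u smooth_fun_continuous_on[OF V u(1)] by (auto intro!: continuous_intros) force
      fix i assume i: "i < p"
      have "Ck k p V (\<lambda>x. (r * u x powr (r - 1)) * pderiv_at i u x)"
        using smooth_fun_pderiv[OF V u(1) i] smooth_fun_const[OF V]
        by (intro Ck_mult[OF V] Suc.IH) (auto simp: smooth_fun_iff_Ck[OF V])
      moreover have "has_pderiv i (\<lambda>x. u x powr r) ((r * u x powr (r - 1)) * pderiv_at i u x) x" if "x \<in> V" for x
      proof -
        have "DERIV (\<lambda>z. z powr r) (u (x(i := x i))) :> r * u x powr (r - 1)"
          using u(2)[OF that] by (auto intro: has_real_derivative_powr)
        from DERIV_chain2[OF this smooth_fun_has_pderiv[OF V u(1) i that]] show ?thesis .
      qed
      ultimately show "\<exists>u'. Ck k p V u' \<and> (\<forall>x\<in>V. has_pderiv i (\<lambda>x. u x powr r) (u' x) x)" by blast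
    qed
  qed
  then show ?thesis using V smooth_fun_iff_Ck by blast
qed

text \<open>\<open>u * u\<close> is positive wherever \<open>u\<close> is nonzero, so
  \<open>1 / u = (u * u) powr (- 1) * u\<close> reduces the claim to powers of positive functions,
  whatever the sign of \<open>u\<close>.\<close>

lemma smooth_fun_inverse:
  assumes V: "openin (Euclidean_space p) V" and u: "smooth_fun p V u" "\<And>x. x \<in> V \<Longrightarrow> u x \<noteq> 0"
  shows "smooth_fun p V (\<lambda>x. 1 / u x)"
proof -
  have "smooth_fun p V (\<lambda>x. (u x * u x) powr (- 1) * u x)"
    using u by (intro smooth_fun_mult smooth_fun_powr V) (auto simp: zero_less_mult_iff linorder_neq_iff)
  moreover have "(u x * u x) powr (- 1) * u x = 1 / u x" if "x \<in> V" for x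
    using u(2)[OF that] by (simp add: powr_minus_divide)
  ultimately show ?thesis using smooth_fun_cong[OF V] by (metis (no_types, lifting))
qed

lemma smooth_fun_ln_coord:
  assumes V: "openin (Euclidean_space p) V" and u: "\<And>x. x \<in> V \<Longrightarrow> x i > 0"
  shows "smooth_fun p V (\<lambda>x. ln (x i))"
proof (rule smooth_fun_derivI[OF V])
  have c: "continuous_on V (\<lambda>x. x i)"
    by (rule continuous_on_product_then_coordinatewise) (rule continuous_on_id)
  show "continuous_on V (\<lambda>x. ln (x i))"
    using u by (intro continuous_on_ln c) force
  fix j assume "j < p"
  have "smooth_fun p V (\<lambda>x. if i = j then 1 / x i else 0)"
    using smooth_fun_inverse[OF V smooth_fun_coord[OF V, of i]] smooth_fun_const[OF V, of 0] u
    by (cases "i = j") fastforce+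
  moreover have "has_pderiv j (\<lambda>x. ln (x i)) (if i = j then 1 / x i else 0) x" if "x \<in> V" for x
    using DERIV_ln_divide[OF u[OF that]] by (cases "i = j") auto
  ultimately show "\<exists>u'. smooth_fun p V u' \<and> (\<forall>x\<in>V. has_pderiv j (\<lambda>x. ln (x i)) (u' x) x)" by blast
qed

subsection \<open>Averages along a coordinate\<close>

text \<open>Boxes are stable under changing one coordinate within its interval, in particular under
  moving it towards the centre; the constructions below move one coordinate at a time. Entries from
  \<open>p\<close> on are \<open>0\<close>, as for every point of
  \<open>Euclidean_space p\<close>.\<close>

definition ebox :: "nat \<Rightarrow> (nat \<Rightarrow> real) \<Rightarrow> real \<Rightarrow> (nat \<Rightarrow> real) set" where
  "ebox p a r = {x. (\<forall>i<p. \<bar>x i - a i\<bar> < r) \<and> (\<forall>i\<ge>p. x i = 0)}"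

lemma openin_ebox: "openin (Euclidean_space p) (ebox p a r)"
proof -
  have "open (\<Inter>i\<in>{..<p}. {x. \<bar>x i - a i\<bar> < r})"
  proof (intro open_INT ballI finite_lessThan)
    fix i
    have "continuous_on UNIV (\<lambda>x. (x :: nat \<Rightarrow> real) i)"
      by (rule continuous_on_product_then_coordinatewise) (rule continuous_on_id)
    then show "open {x. \<bar>x i - a i\<bar> < r}"
      by (intro open_Collect_less continuous_intros)
  qed
  moreover have "ebox p a r = (\<Inter>i\<in>{..<p}. {x. \<bar>x i - a i\<bar> < r}) \<inter> {x. \<forall>i\<ge>p. x i = 0}"
    by (auto simp: ebox_def)
  ultimately show ?thesis unfolding openin_Euclidean_space_iff by blast
qed

lemma center_in_ebox: "0 < r \<Longrightarrow> \<forall>i\<ge>p. a i = 0 \<Longrightarrow> a \<in> ebox p a r"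
  by (auto simp: ebox_def)

lemma ebox_mono: "(r :: real) \<le> r' \<Longrightarrow> ebox p a r \<subseteq> ebox p a r'"
  by (force simp: ebox_def)

lemma ex_ebox_subset:
  assumes "openin (Euclidean_space p) V" "a \<in> V"
  shows "\<exists>r>0. ebox p a r \<subseteq> V"
proof -
  obtain T where T: "open T" "V = T \<inter> {x. \<forall>i\<ge>p. x i = 0}"
    using assms(1) by (auto simp: openin_Euclidean_space_iff)
  have "openin (powertop_real UNIV) T" using T by (simp add: euclidean_product_topology)
  from product_topology_open_contains_basis[OF this, of a]
  obtain X where X: "a \<in> (\<Pi>\<^sub>E i\<in>UNIV. X i)" "\<And>i. open (X i)" "(\<Pi>\<^sub>E i\<in>UNIV. X i) \<subseteq> T"
    using assms T by auto
  have "\<exists>e>0. ball (a i) e \<subseteq> X i" for i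
    using X(1,2) by (meson PiE_mem UNIV_I open_contains_ball)
  then obtain e where e: "\<And>i. e i > 0" "\<And>i. ball (a i) (e i) \<subseteq> X i" by metis
  \<comment> \<open>The entry \<open>1\<close> keeps the minimum meaningful for
    \<open>p = 0\<close>.\<close>
  define r where "r = Min (insert 1 (e ` {..<p}))"
  have r: "r > 0" "\<And>i. i < p \<Longrightarrow> r \<le> e i"
    unfolding r_def using e(1) by (auto intro: Min_le)
  have "ebox p a r \<subseteq> V"
  proof
    fix x assume x: "x \<in> ebox p a r"
    have "x i \<in> X i" for i
    proof (cases "i < p")
      case True
      then have "x i \<in> ball (a i) (e i)" using x r(2)[of i] by (auto simp: ebox_def dist_real_def)
      then show ?thesis using e(2) by blast
    next
      case False
      then have "x i = a i" using x assms(2) T(2) by (auto simp: ebox_def)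
      then show ?thesis using X(1) by (simp add: PiE_iff)
    qed
    then show "x \<in> V" using X(3) x T(2) by (auto simp: ebox_def)
  qed
  then show ?thesis using r(1) by blast
qed

lemma ebox_fun_upd: "x \<in> ebox p a r \<Longrightarrow> i < p \<Longrightarrow> x(i := t) \<in> ebox p a r \<longleftrightarrow> \<bar>t - a i\<bar> < r"
  by (auto simp: ebox_def)

lemma ebox_contract:
  assumes "x \<in> ebox p a r" "t \<in> {0..1}" "i < p"
  shows "x(i := a i + t * (x i - a i)) \<in> ebox p a r"
proof -
  have "\<bar>t * (x i - a i)\<bar> \<le> 1 * \<bar>x i - a i\<bar>"
    unfolding abs_mult using assms(2) by (intro mult_right_mono) auto
  then have "\<bar>t * (x i - a i)\<bar> < r" using assms by (auto simp: ebox_def)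
  then show ?thesis using assms by (simp add: ebox_fun_upd)
qed

text \<open>For \<open>k = 0\<close> and \<open>u\<close> the \<open>i\<close>-th partial derivative
  of \<open>v\<close>, this is Hadamard's quotient of \<open>v x - v (x(i := c))\<close> by
  \<open>x i - c\<close>. The weight \<open>t ^ k\<close> makes the family closed under
  differentiation: by the chain rule each derivative in direction \<open>i\<close> brings out a
  factor \<open>t\<close>.\<close>

definition avg :: "nat \<Rightarrow> real \<Rightarrow> nat \<Rightarrow> ((nat \<Rightarrow> real) \<Rightarrow> real) \<Rightarrow> (nat \<Rightarrow> real) \<Rightarrow> real" where
  "avg i c k u x = integral {0..1} (\<lambda>t. t ^ k * u (x(i := c + t * (x i - c))))"

text \<open>The parametrisation \<open>f\<close> is left open: it is the identity for the continuity
  of the average, a coordinate line for the Leibniz rule, and a constant point for continuity in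
  \<open>t\<close> alone.\<close>

lemma continuous_on_avg_integrand:
  assumes u: "continuous_on (ebox p a r) u" and i: "i < p" and S: "continuous_on S f" "f ` S \<subseteq> ebox p a r"
  shows "continuous_on (S \<times> cbox 0 1) (\<lambda>(y, t). t ^ k * u ((f y)(i := a i + t * (f y i - a i))))"
proof -
  have c: "continuous_on S (\<lambda>y. f y i)"
    using S(1) by (rule continuous_on_product_then_coordinatewise)
  have "continuous_on (S \<times> cbox 0 1) (\<lambda>z. (f (fst z))(i := a i + snd z * (f (fst z) i - a i)))"
    by (intro continuous_on_fun_upd continuous_intros continuous_on_compose2[OF S(1)] continuous_on_compose2[OF c]) auto
  moreover have "(\<lambda>z. (f (fst z))(i := a i + snd z * (f (fst z) i - a i))) ` (S \<times> cbox 0 1) \<subseteq> ebox p a r"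
  proof (safe, goal_cases)
    case (1 _ y t)
    then have "f y \<in> ebox p a r" using S(2) by auto
    with ebox_contract[OF this _ i, of t] 1 show ?case by simp
  qed
  ultimately have "continuous_on (S \<times> cbox 0 1) (\<lambda>z. u ((f (fst z))(i := a i + snd z * (f (fst z) i - a i))))"
    using continuous_on_compose2[OF u] by blast
  then show ?thesis
    unfolding case_prod_beta by (intro continuous_intros)
qed

lemma continuous_on_avg:
  assumes u: "continuous_on (ebox p a r) u" and i: "i < p"
  shows "continuous_on (ebox p a r) (avg i (a i) k u)"
  using integral_continuous_on_param[OF continuous_on_avg_integrand[OF u i continuous_on_id, where k = k]]
  unfolding avg_def[abs_def] cbox_interval by simp

lemma continuous_on_avg_line:
  assumes u: "continuous_on (ebox p a r) u" and i: "i < p" and x: "x \<in> ebox p a r"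
  shows "continuous_on {0..1} (\<lambda>t. t ^ k * u (x(i := a i + t * (x i - a i))))"
proof -
  note c = continuous_on_avg_integrand[OF u i, of "{0::real}" "\<lambda>_. x", where k = k]
  have "continuous_on ({0::real} \<times> {0..1}) (\<lambda>z. snd z ^ k * u (x(i := a i + snd z * (x i - a i))))"
    using c x unfolding case_prod_beta cbox_interval by simp
  from continuous_on_compose2[OF this, of "{0..1}" "\<lambda>t. (0, t)"]
  show ?thesis by (simp add: image_subset_iff continuous_on_Pair continuous_on_id)
qed

text \<open>The derivative passes under the integral by the Leibniz rule, over the interval in which
  the coordinate \<open>j\<close> may vary inside the box. If \<open>j = i\<close>, the segment
  itself depends on the parameter, which gives the extra factor \<open>t\<close>.\<close>

lemma has_pderiv_avg:
  assumes u: "smooth_fun p (ebox p a r) u" and i: "i < p" and j: "j < p" and x: "x \<in> ebox p a r"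
  shows "has_pderiv j (avg i (a i) k u) (avg i (a i) (if i = j then Suc k else k) (pderiv_at j u) x) x"
proof -
  let ?B = "ebox p a r" and ?U = "{a j - r<..<a j + r}" and ?l = "if i = j then Suc k else k"
  note V = openin_ebox[of p a r]
  have up: "x(j := y) \<in> ?B" if "y \<in> ?U" for y
    using that x j by (auto simp: ebox_fun_upd)
  have xU: "x j \<in> ?U" using x j by (auto simp: ebox_def)
  let ?f = "\<lambda>y t. t ^ k * u ((x(j := y))(i := a i + t * ((x(j := y)) i - a i)))"
  let ?g = "\<lambda>y t. t ^ ?l * pderiv_at j u ((x(j := y))(i := a i + t * ((x(j := y)) i - a i)))"
  have "((\<lambda>y. integral (cbox 0 1) (?f y)) has_field_derivative integral (cbox 0 1) (?g (x j))) (at (x j) within ?U)"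
  proof (rule leibniz_rule_field_derivative[where fx = ?g])
    show "x j \<in> ?U" "convex ?U" using xU by auto
    have "continuous_on ?U (\<lambda>y. x(j := y))"
      by (intro continuous_on_fun_upd continuous_intros)
    then show "continuous_on (?U \<times> cbox 0 1) (\<lambda>(y, t). ?g y t)"
      using up
      by (intro continuous_on_avg_integrand[where f = "\<lambda>y. x(j := y)", OF
              smooth_fun_continuous_on[OF V smooth_fun_pderiv[OF V u j]] i]) auto
    show "?f y integrable_on cbox 0 1" if "y \<in> ?U" for y
      using continuous_on_avg_line[OF smooth_fun_continuous_on[OF V u] i up[OF that], of k]
      by (simp add: integrable_continuous_real)
    fix y t assume y: "y \<in> ?U" and t: "t \<in> cbox (0::real) 1"
    let ?z = "(x(j := y))(i := a i + t * ((x(j := y)) i - a i))"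
    have z: "?z \<in> ?B" using ebox_contract[OF up[OF y] _ i] t by simp
    note D = smooth_fun_has_pderiv[OF V u j z]
    show "((\<lambda>y. ?f y t) has_field_derivative ?g y t) (at y within ?U)"
    proof (cases "i = j")
      case True
      have A: "((\<lambda>y. a j + t * (y - a j)) has_real_derivative t) (at y)"
        by (auto intro!: derivative_eq_intros)
      have B: "((\<lambda>s. u (x(j := s))) has_real_derivative pderiv_at j u ?z) (at (a j + t * (y - a j)))"
        using D True by simp
      have "((\<lambda>y. u (x(j := a j + t * (y - a j)))) has_real_derivative pderiv_at j u ?z * t) (at y)"
        by (rule DERIV_chain2[OF B A])
      from DERIV_cmult[OF this, of "t ^ k"] show ?thesis
        using True by (auto intro!: has_field_derivative_at_within simp: algebra_simps)
    next
      case False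
      then have *: "(x(j := y))(i := a i + t * ((x(j := y)) i - a i)) = (x(i := a i + t * (x i - a i)))(j := y)" for y
        by (simp add: fun_upd_twist)
      have "((\<lambda>y. u ((x(i := a i + t * (x i - a i)))(j := y))) has_real_derivative pderiv_at j u ?z) (at y)"
        using D False unfolding * by simp
      from DERIV_cmult[OF this, of "t ^ k"] show ?thesis
        using False unfolding * by (auto intro!: has_field_derivative_at_within)
    qed
  qed
  then show ?thesis
    using xU by (simp add: avg_def at_within_open[of _ ?U])
qed

lemma smooth_fun_avg:
  assumes u: "smooth_fun p (ebox p a r) u" and i: "i < p"
  shows "smooth_fun p (ebox p a r) (avg i (a i) k u)"
proof -
  note V = openin_ebox[of p a r]
  have "Ck n p (ebox p a r) (avg i (a i) k u)" for n
    using u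
  proof (induction n arbitrary: u k)
    case 0
    then show ?case using continuous_on_avg[OF smooth_fun_continuous_on[OF V] i] by simp
  next
    case (Suc n)
    show ?case
    proof (rule Ck_SucI[OF V])
      show "continuous_on (ebox p a r) (avg i (a i) k u)"
        by (rule continuous_on_avg[OF smooth_fun_continuous_on[OF V Suc.prems] i])
      fix j assume j: "j < p"
      let ?u' = "avg i (a i) (if i = j then Suc k else k) (pderiv_at j u)"
      have "Ck n p (ebox p a r) ?u'" by (rule Suc.IH[OF smooth_fun_pderiv[OF V Suc.prems j]])
      moreover have "\<forall>x\<in>ebox p a r. has_pderiv j (avg i (a i) k u) (?u' x) x"
        using has_pderiv_avg[OF Suc.prems i j] by blast
      ultimately show "\<exists>u'. Ck n p (ebox p a r) u' \<and> (\<forall>x\<in>ebox p a r. has_pderiv j (avg i (a i) k u) (u' x) x)"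
        by blast
    qed
  qed
  then show ?thesis using smooth_fun_iff_Ck[OF V] by blast
qed

text \<open>Both are the fundamental theorem of calculus along the segment from
  \<open>x(i := a i)\<close> to \<open>x\<close>, the second for \<open>t\<close> times
  \<open>u\<close> on the segment. Together with \<open>has_pderiv_avg\<close> the second says that
  the average of \<open>u\<close>, multiplied by \<open>x i - a i\<close>, is a primitive of
  \<open>u\<close> in the coordinate \<open>i\<close>.\<close>

lemma avg_ftc:
  assumes u: "smooth_fun p (ebox p a r) u" and i: "i < p" and x: "x \<in> ebox p a r"
  shows "(x i - a i) * avg i (a i) 0 (pderiv_at i u) x = u x - u (x(i := a i))"
    and "avg i (a i) 0 u x + (x i - a i) * avg i (a i) 1 (pderiv_at i u) x = u x"
proof -
  note V = openin_ebox[of p a r]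
  let ?h = "\<lambda>t. x(i := a i + t * (x i - a i))"
  have D: "((\<lambda>t. u (?h t)) has_real_derivative pderiv_at i u (?h t) * (x i - a i)) (at t within {0..1})"
    if t: "t \<in> {0..1}" for t
  proof -
    have A: "((\<lambda>t. a i + t * (x i - a i)) has_real_derivative (x i - a i)) (at t)"
      by (auto intro!: derivative_eq_intros)
    have B: "((\<lambda>s. u (x(i := s))) has_real_derivative pderiv_at i u (?h t)) (at (a i + t * (x i - a i)))"
      using smooth_fun_has_pderiv[OF V u i ebox_contract[OF x t i]] by simp
    show ?thesis
      by (rule has_field_derivative_at_within) (rule DERIV_chain2[OF B A])
  qed
  note cu = continuous_on_avg_line[OF smooth_fun_continuous_on[OF V u] i x]
  note cd = continuous_on_avg_line[OF smooth_fun_continuous_on[OF V smooth_fun_pderiv[OF V u i]] i x]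
  have "((\<lambda>t. pderiv_at i u (?h t) * (x i - a i)) has_integral (u (?h 1) - u (?h 0))) {0..1}"
    using D by (intro fundamental_theorem_of_calculus) (auto simp: has_real_derivative_iff_has_vector_derivative fun_upd_def)
  from integral_unique[OF this] show "(x i - a i) * avg i (a i) 0 (pderiv_at i u) x = u x - u (x(i := a i))"
    by (simp add: avg_def mult.commute)
  have "((\<lambda>t. u (?h t) + t * (pderiv_at i u (?h t) * (x i - a i))) has_integral (1 * u (?h 1) - 0 * u (?h 0))) {0..1}"
    using DERIV_mult[OF DERIV_ident D]
    by (intro fundamental_theorem_of_calculus)
      (auto simp: has_real_derivative_iff_has_vector_derivative[symmetric] algebra_simps fun_upd_def)
  from integral_unique[OF this]
  have "integral {0..1} (\<lambda>t. t ^ 0 * u (?h t) + (x i - a i) * (t ^ 1 * pderiv_at i u (?h t))) = u x"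
    by (simp add: algebra_simps)
  moreover have "integral {0..1} (\<lambda>t. t ^ 0 * u (?h t) + (x i - a i) * (t ^ 1 * pderiv_at i u (?h t)))
      = avg i (a i) 0 u x + (x i - a i) * avg i (a i) 1 (pderiv_at i u) x"
    unfolding avg_def
    by (simp only: integral_mult_right
        integral_add[OF integrable_continuous_real[OF cu[of 0]]
          integrable_on_cmult_left[OF integrable_continuous_real[OF cd[of 1]], of "x i - a i", unfolded of_real_eq_id id_apply]])
  ultimately show "avg i (a i) 0 u x + (x i - a i) * avg i (a i) 1 (pderiv_at i u) x = u x" by simp
qed

text \<open>Hadamard's formula for \<open>u\<close> around \<open>x\<close>, differentiated in
  direction \<open>j\<close> under the integral, and Hadamard's formula for the \<open>j\<close>-th
  derivative of \<open>u\<close> contain the two mixed derivatives under the same integral. Hence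
  the average of their difference \<open>v\<close>, times \<open>y i - x i\<close>, vanishes on the
  box, and the \<open>i\<close>-th derivative of this product at the centre \<open>x\<close> is
  \<open>v x\<close>.\<close>

lemma pderiv_at_commute:
  assumes V: "openin (Euclidean_space p) V" and u: "smooth_fun p V u" and i: "i < p" and j: "j < p" and x: "x \<in> V"
  shows "pderiv_at i (pderiv_at j u) x = pderiv_at j (pderiv_at i u) x"
proof (cases "i = j")
  case False
  obtain r where r: "r > 0" "ebox p x r \<subseteq> V" using ex_ebox_subset[OF V x] by blast
  let ?B = "ebox p x r"
  note B = openin_ebox[of p x r]
  have xB: "x \<in> ?B" using center_in_ebox[OF r(1)] Euclidean_space_open_subset[OF V] x by auto
  note S = smooth_fun_subset[OF V B r(2)]
  note uB = S[OF u]
  note uj = smooth_fun_pderiv[OF B uB j] and ui = smooth_fun_pderiv[OF B uB i]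
  note uij = smooth_fun_pderiv[OF B uj i] and uji = smooth_fun_pderiv[OF B ui j]
  define v where "v = (\<lambda>y. pderiv_at i (pderiv_at j u) y - pderiv_at j (pderiv_at i u) y)"
  have v: "smooth_fun p ?B v"
    using smooth_fun_add[OF B uij smooth_fun_mult[OF B smooth_fun_const[OF B, of "-1"] uji]] by (simp add: v_def)
  have K0: "(y i - x i) * avg i (x i) 0 v y = 0" if y: "y \<in> ?B" for y
  proof -
    have y0: "y(i := x i) \<in> ?B" using y r i by (simp add: ebox_fun_upd)
    have "has_pderiv j (\<lambda>y. u (y(i := x i)) + (y i - x i) * avg i (x i) 0 (pderiv_at i u) y)
       (pderiv_at j u (y(i := x i)) + (y i - x i) * avg i (x i) 0 (pderiv_at j (pderiv_at i u)) y) y"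
    proof -
      have "has_pderiv j (\<lambda>y. u (y(i := x i))) (pderiv_at j u (y(i := x i))) y"
        using smooth_fun_has_pderiv[OF B uB j y0] False by (simp add: fun_upd_twist)
      moreover have "has_pderiv j (\<lambda>y. (y i - x i) * avg i (x i) 0 (pderiv_at i u) y)
          ((y i - x i) * avg i (x i) 0 (pderiv_at j (pderiv_at i u)) y) y"
        using DERIV_cmult[OF has_pderiv_avg[OF ui i j y, of 0], of "y i - x i"] False by simp
      ultimately show ?thesis by (rule DERIV_add)
    qed
    then have "has_pderiv j u (pderiv_at j u (y(i := x i)) + (y i - x i) * avg i (x i) 0 (pderiv_at j (pderiv_at i u)) y) y"
      by (rule has_pderiv_cong[OF B y j, THEN iffD1, rotated]) (simp add: avg_ftc(1)[OF uB i] fun_upd_def)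
    then have "pderiv_at j u y = pderiv_at j u (y(i := x i)) + (y i - x i) * avg i (x i) 0 (pderiv_at j (pderiv_at i u)) y"
      by (rule pderiv_at_eqI)
    moreover have "avg i (x i) 0 v y = avg i (x i) 0 (pderiv_at i (pderiv_at j u)) y - avg i (x i) 0 (pderiv_at j (pderiv_at i u)) y"
      unfolding avg_def v_def
      by (simp only: right_diff_distrib[of "_ ^ _"] integral_diff[OF
            integrable_continuous_real[OF continuous_on_avg_line[OF smooth_fun_continuous_on[OF B uij] i y]]
            integrable_continuous_real[OF continuous_on_avg_line[OF smooth_fun_continuous_on[OF B uji] i y]]])
    ultimately show ?thesis using avg_ftc(1)[OF uj i y]
      by (simp only: right_diff_distrib[of "y i - x i"])
  qed
  \<comment> \<open>At the centre the segment shrinks to a point, so the average of \<open>v\<close>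
    is \<open>v x\<close>, and the second term of the product rule has the factor
    \<open>x i - x i\<close>.\<close>
  have "has_pderiv i (\<lambda>y. (y i - x i) * avg i (x i) 0 v y) (1 * avg i (x i) 0 v x + avg i (x i) 1 (pderiv_at i v) x * (x i - x i)) x"
    using DERIV_mult[OF DERIV_diff[OF DERIV_ident DERIV_const[of "x i"]] has_pderiv_avg[OF v i i xB, of 0]] by simp
  then have "has_pderiv i (\<lambda>y. 0) (v x) x"
    using avg_ftc(2)[OF v i xB] K0
      has_pderiv_cong[OF B xB i, of "\<lambda>y. (y i - x i) * avg i (x i) 0 v y" "\<lambda>_. 0"] by simp
  then have "v x = 0" using DERIV_const DERIV_unique by blast
  then show ?thesis by (simp add: v_def)
qed simp

section \<open>Superfunctions\<close>

lemma sum_fun_apply: "(\<Sum>i\<in>A. f i) x = (\<Sum>i\<in>A. f i x)"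
  by (induction A rule: infinite_finite_induct) auto

text \<open>The relative form is for derivatives, morphisms and derivations, whose additivity is
  known only on the superfunctions over a given set.\<close>

lemma additive_on_sum:
  fixes F :: "'b::comm_monoid_add \<Rightarrow> 'c::comm_monoid_add"
  assumes "0 \<in> C" "F 0 = 0" "\<And>x y. x \<in> C \<Longrightarrow> y \<in> C \<Longrightarrow> x + y \<in> C"
    and "\<And>x y. x \<in> C \<Longrightarrow> y \<in> C \<Longrightarrow> F (x + y) = F x + F y"
    and "\<And>i. i \<in> A \<Longrightarrow> f i \<in> C"
  shows "(\<Sum>i\<in>A. f i) \<in> C" and "F (\<Sum>i\<in>A. f i) = (\<Sum>i\<in>A. F (f i))"
proof -
  have "(\<Sum>i\<in>A. f i) \<in> C \<and> F (\<Sum>i\<in>A. f i) = (\<Sum>i\<in>A. F (f i))"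
    using assms(5) by (induction A rule: infinite_finite_induct) (use assms(1-4) in auto)
  then show "(\<Sum>i\<in>A. f i) \<in> C" "F (\<Sum>i\<in>A. f i) = (\<Sum>i\<in>A. F (f i))" by auto
qed

lemmas additive_sum = additive_on_sum(2)[where C = UNIV, simplified]

lemma sum_closed:
  fixes f :: "'a \<Rightarrow> 'b::comm_monoid_add"
  assumes "P 0" "\<And>x y. P x \<Longrightarrow> P y \<Longrightarrow> P (x + y)" "\<And>i. i \<in> A \<Longrightarrow> P (f i)"
  shows "P (\<Sum>i\<in>A. f i)"
  using assms(3) by (induction A rule: infinite_finite_induct) (use assms(1,2) in auto)

definition sf_scale :: "real \<Rightarrow> sfun \<Rightarrow> sfun" where
  "sf_scale a f = (\<lambda>J x. a * f J x)"

text \<open>The sign rule for moving \<open>f\<close> past a factor of parity \<open>k\<close>.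
  Written coefficient by coefficient, it also applies to \<open>f\<close> of mixed parity.\<close>

definition sf_twist :: "nat \<Rightarrow> sfun \<Rightarrow> sfun" where
  "sf_twist k f = (\<lambda>J x. (- 1) ^ (k * card J) * f J x)"

text \<open>Parities are natural numbers read modulo 2, so that they can be added and used as
  exponents of \<open>- 1\<close>. The zero function has every parity.\<close>

definition sf_par :: "nat \<Rightarrow> sfun \<Rightarrow> bool" where
  "sf_par k f \<longleftrightarrow> (\<forall>J x. f J x \<noteq> 0 \<longrightarrow> even (card J + k))"

definition cpar :: "nat \<Rightarrow> nat \<Rightarrow> nat" where
  "cpar p i = (if i < p then 0 else 1)"

lemma minus_one_power_cong: "even (k + l) \<Longrightarrow> (- 1 :: real) ^ k = (- 1) ^ l"
  by (simp add: minus_one_power_iff)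

section \<open>Bilinearity of the product\<close>

lemma sf_mult_add_left: "sf_mult (f + g) h = sf_mult f h + sf_mult g h"
  by (simp add: sf_mult_def fun_eq_iff algebra_simps sum.distrib)

lemma sf_mult_add_right: "sf_mult f (g + h) = sf_mult f g + sf_mult f h"
  by (simp add: sf_mult_def fun_eq_iff algebra_simps sum.distrib)

lemma sf_mult_0_left [simp]: "sf_mult 0 f = 0"
  by (simp add: sf_mult_def fun_eq_iff)

lemma sf_mult_0_right [simp]: "sf_mult f 0 = 0"
  by (simp add: sf_mult_def fun_eq_iff)

lemma sf_mult_scale_left: "sf_mult (sf_scale a f) g = sf_scale a (sf_mult f g)"
  by (simp add: sf_mult_def sf_scale_def fun_eq_iff sum_distrib_left algebra_simps)

lemma sf_mult_scale_right: "sf_mult f (sf_scale a g) = sf_scale a (sf_mult f g)"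
  by (simp add: sf_mult_def sf_scale_def fun_eq_iff sum_distrib_left algebra_simps)

lemma sf_mult_sum_left: "sf_mult (\<Sum>i\<in>A. f i) g = (\<Sum>i\<in>A. sf_mult (f i) g)"
  by (rule additive_sum[of "\<lambda>f. sf_mult f g"]) (simp_all add: sf_mult_add_left)

lemma sf_mult_sum_right: "sf_mult f (\<Sum>i\<in>A. g i) = (\<Sum>i\<in>A. sf_mult f (g i))"
  by (rule additive_sum[of "sf_mult f"]) (simp_all add: sf_mult_add_right)

lemma sf_scale_0 [simp]: "sf_scale 0 f = 0" "sf_scale a 0 = 0"
  by (simp_all add: sf_scale_def fun_eq_iff)

lemma sf_scale_1 [simp]: "sf_scale 1 f = f"
  by (simp add: sf_scale_def)

lemma sf_scale_minus_1: "sf_scale (- 1) f = - f"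
  by (simp add: sf_scale_def fun_eq_iff)

lemma sf_scale_scale [simp]: "sf_scale a (sf_scale b f) = sf_scale (a * b) f"
  by (simp add: sf_scale_def fun_eq_iff)

lemma sf_scale_add: "sf_scale a (f + g) = sf_scale a f + sf_scale a g"
  by (simp add: sf_scale_def fun_eq_iff algebra_simps)

lemma sf_scale_sum: "sf_scale a (\<Sum>i\<in>A. f i) = (\<Sum>i\<in>A. sf_scale a (f i))"
  by (rule additive_sum[of "sf_scale a"]) (simp_all add: sf_scale_add)

section \<open>Sorting signs, associativity and graded commutativity\<close>

lemma grass_sign_empty [simp]: "grass_sign {} K = 1" "grass_sign J {} = 1"
  by (simp_all add: grass_sign_def)

lemma grass_sign_union_left:
  assumes "finite J" "finite K" "finite N" "J \<inter> K = {}"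
  shows "grass_sign (J \<union> K) N = grass_sign J N * grass_sign K N"
proof -
  have "{(j, k). j \<in> J \<union> K \<and> k \<in> N \<and> k < j} = {(j, k). j \<in> J \<and> k \<in> N \<and> k < j} \<union> {(j, k). j \<in> K \<and> k \<in> N \<and> k < j}"
    by auto
  moreover have "finite {(j, k). j \<in> J \<and> k \<in> N \<and> k < j}" "finite {(j, k). j \<in> K \<and> k \<in> N \<and> k < j}"
    using assms by (auto intro: finite_subset[of _ "J \<times> N"] finite_subset[of _ "K \<times> N"])
  ultimately show ?thesis
    using assms(4) unfolding grass_sign_def power_add[symmetric]
    by (subst card_Un_disjoint[symmetric]) auto
qed

lemma grass_sign_union_right:
  assumes "finite J" "finite K" "finite N" "K \<inter> N = {}"
  shows "grass_sign J (K \<union> N) = grass_sign J K * grass_sign J N"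
proof -
  have "{(j, k). j \<in> J \<and> k \<in> K \<union> N \<and> k < j} = {(j, k). j \<in> J \<and> k \<in> K \<and> k < j} \<union> {(j, k). j \<in> J \<and> k \<in> N \<and> k < j}"
    by auto
  moreover have "finite {(j, k). j \<in> J \<and> k \<in> K \<and> k < j}" "finite {(j, k). j \<in> J \<and> k \<in> N \<and> k < j}"
    using assms by (auto intro: finite_subset[of _ "J \<times> K"] finite_subset[of _ "J \<times> N"])
  ultimately show ?thesis
    using assms(4) unfolding grass_sign_def power_add[symmetric]
    by (subst card_Un_disjoint[symmetric]) auto
qed

text \<open>Every pair in \<open>J \<times> K\<close> is an inversion in exactly one of the two
  orders, so the two inversion numbers add up to \<open>card J * card K\<close>.\<close>

lemma grass_sign_commute:
  assumes "finite J" "finite K" "J \<inter> K = {}"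
  shows "grass_sign J K = (- 1) ^ (card J * card K) * grass_sign K J"
proof -
  let ?A = "{(j, k). j \<in> J \<and> k \<in> K \<and> k < j}" and ?B = "{(k, j). k \<in> K \<and> j \<in> J \<and> j < k}"
  have f: "finite ?A" "finite ?B"
    using assms by (auto intro: finite_subset[of _ "J \<times> K"] finite_subset[of _ "K \<times> J"])
  have "J \<times> K = ?A \<union> prod.swap ` ?B"
    using assms(3) by (auto simp: image_iff)
  moreover have "?A \<inter> prod.swap ` ?B = {}" by auto
  ultimately have "card (J \<times> K) = card ?A + card (prod.swap ` ?B)"
    using card_Un_disjoint[of ?A "prod.swap ` ?B"] f by simp
  also have "card (prod.swap ` ?B) = card ?B"
    by (rule card_image) simp
  finally have "card J * card K + card ?B = card ?A + 2 * card ?B"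
    by (simp add: card_cartesian_product)
  then have "(- 1 :: real) ^ (card J * card K + card ?B) = (- 1) ^ card ?A"
    by (simp add: power_add power_mult)
  then show ?thesis by (simp add: grass_sign_def power_add)
qed

text \<open>Both sides sum over the splittings of \<open>L\<close> into three parts with the sign
  that sorts all three, because \<open>grass_sign\<close> is multiplicative over disjoint unions in
  each argument. For infinite \<open>L\<close> the sums over \<open>Pow L\<close> are
  \<open>0\<close> by convention.\<close>

lemma sf_mult_assoc: "sf_mult (sf_mult f g) h = sf_mult f (sf_mult g h)"
proof (intro ext)
  fix L x
  show "sf_mult (sf_mult f g) h L x = sf_mult f (sf_mult g h) L x"
  proof (cases "finite L")
    case True
    have "sf_mult (sf_mult f g) h L x =
      (\<Sum>M\<in>Pow L. \<Sum>J\<in>Pow M. grass_sign M (L - M) * grass_sign J (M - J) * f J x * g (M - J) x * h (L - M) x)"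
      by (simp add: sf_mult_def sum_distrib_left sum_distrib_right algebra_simps)
    also have "\<dots> = (\<Sum>(M, J)\<in>(SIGMA M:Pow L. Pow M). grass_sign M (L - M) * grass_sign J (M - J) * f J x * g (M - J) x * h (L - M) x)"
      using True by (subst sum.Sigma) (auto intro: finite_subset)
    also have "\<dots> = (\<Sum>(J, K)\<in>(SIGMA J:Pow L. Pow (L - J)). grass_sign J (L - J) * grass_sign K (L - J - K) * f J x * g K x * h (L - J - K) x)"
    proof (rule sum.reindex_bij_witness[of _ "\<lambda>(J, K). (J \<union> K, J)" "\<lambda>(M, J). (J, M - J)"], goal_cases)
      case (5 a)
      then obtain M J where a: "a = (M, J)" "J \<subseteq> M" "M \<subseteq> L" by auto
      define K N where "K = M - J" and "N = L - M"
      have M: "M = J \<union> K" "L - M = N" "L - J = K \<union> N" "L - J - K = N" "M - J = K"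
        using a by (auto simp: K_def N_def)
      have fin: "finite J" "finite K" "finite N" using a True by (auto simp: K_def N_def intro: finite_subset)
      have d: "J \<inter> K = {}" "K \<inter> N = {}" using a by (auto simp: K_def N_def)
      have "grass_sign J (K \<union> N) * grass_sign K N = grass_sign (J \<union> K) N * grass_sign J K"
        using grass_sign_union_left[OF fin d(1)] grass_sign_union_right[OF fin d(2)] by simp
      then show ?case using a(1) M by simp
    qed auto
    also have "\<dots> = (\<Sum>J\<in>Pow L. \<Sum>K\<in>Pow (L - J). grass_sign J (L - J) * grass_sign K (L - J - K) * f J x * g K x * h (L - J - K) x)"
      using True by (subst sum.Sigma) (auto intro: finite_subset)
    also have "\<dots> = sf_mult f (sf_mult g h) L x"
      by (simp add: sf_mult_def sum_distrib_left sum_distrib_right algebra_simps)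
    finally show ?thesis .
  qed (simp add: sf_mult_def)
qed

lemma sf_twist_add: "sf_twist k (f + g) = sf_twist k f + sf_twist k g"
  by (simp add: sf_twist_def fun_eq_iff algebra_simps)

lemma sf_twist_0 [simp]: "sf_twist k 0 = 0" "sf_twist 0 f = f"
  by (simp_all add: sf_twist_def fun_eq_iff)

lemma sf_twist_sum: "sf_twist k (\<Sum>i\<in>A. f i) = (\<Sum>i\<in>A. sf_twist k (f i))"
  by (rule additive_sum[of "sf_twist k"]) (simp_all add: sf_twist_add)

lemma sf_twist_scale: "sf_twist k (sf_scale a f) = sf_scale a (sf_twist k f)"
  by (simp add: sf_twist_def sf_scale_def fun_eq_iff algebra_simps)

lemma sf_twist_twist [simp]: "sf_twist k (sf_twist l f) = sf_twist (k + l) f"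
  by (simp add: sf_twist_def fun_eq_iff algebra_simps power_add)

lemma sf_twist_cong: "even (k + l) \<Longrightarrow> sf_twist k f = sf_twist l f"
proof -
  assume "even (k + l)"
  then have "(- 1 :: real) ^ (k * n) = (- 1) ^ (l * n)" for n
    by (intro minus_one_power_cong) (metis add_mult_distrib dvd_mult2)
  then show ?thesis by (simp add: sf_twist_def)
qed

lemma sf_twist_mult: "sf_twist k (sf_mult f g) = sf_mult (sf_twist k f) (sf_twist k g)"
proof (intro ext)
  fix L x
  show "sf_twist k (sf_mult f g) L x = sf_mult (sf_twist k f) (sf_twist k g) L x"
  proof (cases "finite L")
    case True
    have "(- 1 :: real) ^ (k * card L) = (- 1) ^ (k * card J) * (- 1) ^ (k * card (L - J))" if "J \<subseteq> L" for J
    proof -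
      have "card L = card J + card (L - J)"
        using that True by (metis card_Diff_subset card_mono finite_subset le_add_diff_inverse)
      then show ?thesis by (simp add: algebra_simps power_add)
    qed
    then show ?thesis
      by (auto simp: sf_twist_def sf_mult_def sum_distrib_left algebra_simps intro!: sum.cong)
  qed (simp add: sf_mult_def sf_twist_def)
qed

lemma sf_twist_par: "sf_par l f \<Longrightarrow> sf_twist k f = sf_scale ((- 1) ^ (k * l)) f"
  unfolding sf_twist_def sf_scale_def fun_eq_iff
proof (intro allI)
  fix J x assume "sf_par l f"
  then have "f J x = 0 \<or> even (card J + l)" by (auto simp: sf_par_def)
  moreover have "even (card J + l) \<Longrightarrow> (- 1 :: real) ^ (k * card J) = (- 1) ^ (k * l)"
    by (rule minus_one_power_cong) (simp flip: distrib_left)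
  ultimately show "(- 1) ^ (k * card J) * f J x = (- 1) ^ (k * l) * f J x" by auto
qed

text \<open>Exchange \<open>J\<close> and \<open>L - J\<close>. The sign is \<open>- 1\<close> to
  the power \<open>card (L - J) * card J\<close>, and wherever the coefficient of \<open>g\<close>
  at \<open>J\<close> is nonzero, \<open>card J\<close> has the parity of \<open>k\<close>. So the
  sign depends only on the coefficient of \<open>f\<close> in question and is the one of its
  twist.\<close>

lemma sf_mult_commute:
  assumes "sf_par k g"
  shows "sf_mult f g = sf_mult g (sf_twist k f)"
proof (intro ext)
  fix L x
  show "sf_mult f g L x = sf_mult g (sf_twist k f) L x"
  proof (cases "finite L")
    case True
    have "sf_mult f g L x = (\<Sum>J\<in>Pow L. grass_sign (L - J) J * f (L - J) x * g J x)"
      unfolding sf_mult_def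
      by (rule sum.reindex_bij_witness[of _ "\<lambda>J. L - J" "\<lambda>J. L - J"]) (auto simp: double_diff)
    also have "\<dots> = sf_mult g (sf_twist k f) L x"
      unfolding sf_mult_def
    proof (rule sum.cong[OF refl])
      fix J assume J: "J \<in> Pow L"
      then have fin: "finite J" "finite (L - J)" using True by (auto intro: finite_subset)
      have "grass_sign (L - J) J = (- 1) ^ (card (L - J) * card J) * grass_sign J (L - J)"
        by (rule grass_sign_commute[OF fin(2,1)]) auto
      moreover have "g J x = 0 \<or> (- 1 :: real) ^ (card (L - J) * card J) = (- 1) ^ (k * card (L - J))"
      proof (cases "g J x = 0")
        case False
        then have "even (card J + k)" using assms by (auto simp: sf_par_def)
        then have "even (card (L - J) * (card J + k))" by simp
        then show ?thesis by (intro disjI2 minus_one_power_cong) (simp add: algebra_simps)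
      qed simp
      ultimately show "grass_sign (L - J) J * f (L - J) x * g J x = grass_sign J (L - J) * g J x * sf_twist k f (L - J) x"
        by (auto simp: sf_twist_def)
    qed
    finally show ?thesis .
  qed (simp add: sf_mult_def)
qed

lemma sf_mult_empty: "sf_mult f g {} x = f {} x * g {} x"
  by (simp add: sf_mult_def)

lemma sf_par_mult:
  assumes "sf_par k f" "sf_par l g"
  shows "sf_par (k + l) (sf_mult f g)"
  unfolding sf_par_def
proof (intro allI impI)
  fix L x assume "sf_mult f g L x \<noteq> 0"
  then have nz: "(\<Sum>J\<in>Pow L. grass_sign J (L - J) * f J x * g (L - J) x) \<noteq> 0" by (simp add: sf_mult_def)
  have "finite L" by (rule ccontr) (use nz in simp)
  moreover have "\<exists>J\<in>Pow L. grass_sign J (L - J) * f J x * g (L - J) x \<noteq> 0"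
  proof (rule ccontr)
    assume "\<not> ?thesis"
    then have "(\<Sum>J\<in>Pow L. grass_sign J (L - J) * f J x * g (L - J) x) = 0" by (intro sum.neutral) simp
    with nz show False ..
  qed
  ultimately obtain J where J: "finite L" "J \<subseteq> L" "f J x \<noteq> 0" "g (L - J) x \<noteq> 0" by auto
  have "card L = card J + card (L - J)"
    using J by (metis card_Diff_subset card_mono finite_subset le_add_diff_inverse)
  moreover have "even (card J + k)" "even (card (L - J) + l)" using assms J by (auto simp: sf_par_def)
  ultimately show "even (card L + (k + l))" by auto
qed

lemma sf_par_add: "sf_par k f \<Longrightarrow> sf_par k g \<Longrightarrow> sf_par k (f + g)"
  unfolding sf_par_def plus_fun_apply by (metis add_0)

lemma sf_par_0 [simp]: "sf_par k 0"
  by (simp add: sf_par_def)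

lemma sf_par_sum: "(\<And>i. i \<in> A \<Longrightarrow> sf_par k (f i)) \<Longrightarrow> sf_par k (\<Sum>i\<in>A. f i)"
  by (rule sum_closed[of "sf_par k"]) (auto intro: sf_par_add)

lemma sf_par_scale: "sf_par k f \<Longrightarrow> sf_par k (sf_scale a f)"
  by (auto simp: sf_par_def sf_scale_def)

lemma sf_par_cong: "even (k + l) \<Longrightarrow> sf_par k f \<longleftrightarrow> sf_par l f"
  unfolding sf_par_def by (metis even_add)

lemma sf_par_of_fun [simp]: "sf_par 0 (sf_of_fun V u)"
  by (auto simp: sf_par_def sf_of_fun_def)

lemma sf_par_coord: "sf_par (cpar p i) (sf_coord p V i)"
  by (auto simp: sf_par_def sf_coord_def cpar_def sf_of_fun_def)

section \<open>Derivatives in odd directions\<close>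

lemma sf_pderiv_outside: "x \<notin> V \<Longrightarrow> sf_pderiv p V i f J x = 0"
  by (simp add: sf_pderiv_def)

text \<open>The sign of moving the odd coordinate \<open>i\<close> into its sorted place in the
  monomial of \<open>J\<close>.\<close>

definition odd_sign :: "nat set \<Rightarrow> nat \<Rightarrow> real" where
  "odd_sign J i = (- 1) ^ card {j \<in> J. j < i}"

lemma odd_sign_square [simp]: "odd_sign J i * odd_sign J i = 1"
  by (simp add: odd_sign_def)

lemma odd_sign_union: "finite J \<Longrightarrow> finite K \<Longrightarrow> J \<inter> K = {} \<Longrightarrow> odd_sign (J \<union> K) i = odd_sign J i * odd_sign K i"
proof -
  assume a: "finite J" "finite K" "J \<inter> K = {}"
  have "{j \<in> J \<union> K. j < i} = {j \<in> J. j < i} \<union> {j \<in> K. j < i}" by auto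
  moreover have "card ({j \<in> J. j < i} \<union> {j \<in> K. j < i}) = card {j \<in> J. j < i} + card {j \<in> K. j < i}"
    using a by (intro card_Un_disjoint) auto
  ultimately show ?thesis by (simp add: odd_sign_def power_add)
qed

lemma grass_sign_single_left: "finite K \<Longrightarrow> grass_sign {i} K = odd_sign K i"
proof -
  have "{(j, k). j \<in> {i} \<and> k \<in> K \<and> k < j} = Pair i ` {j \<in> K. j < i}" by auto
  then show ?thesis by (simp add: grass_sign_def odd_sign_def card_image inj_on_def)
qed

lemma grass_sign_single_right: "finite J \<Longrightarrow> i \<notin> J \<Longrightarrow> grass_sign J {i} = (- 1) ^ card J * odd_sign J i"
  using grass_sign_commute[of J "{i}"] by (simp add: grass_sign_single_left)

lemma grass_sign_insert_left:
  "finite J \<Longrightarrow> finite K \<Longrightarrow> i \<notin> J \<Longrightarrow> grass_sign (insert i J) K = grass_sign J K * odd_sign K i"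
  using grass_sign_union_left[of J "{i}" K] by (simp add: grass_sign_single_left)

lemma grass_sign_insert_right:
  "finite J \<Longrightarrow> finite K \<Longrightarrow> i \<notin> J \<Longrightarrow> i \<notin> K \<Longrightarrow>
    grass_sign J (insert i K) = grass_sign J K * ((- 1) ^ card J * odd_sign J i)"
  using grass_sign_union_right[of J K "{i}"] by (simp add: grass_sign_single_right)

lemma sf_pderiv_odd:
  "p \<le> i \<Longrightarrow> sf_pderiv p V i f J x = (if x \<in> V \<and> i \<notin> J then odd_sign J i * f (insert i J) x else 0)"
  by (simp add: sf_pderiv_def odd_sign_def)

lemma sum_Pow_insert:
  assumes "finite L" "i \<notin> L"
  shows "(\<Sum>J\<in>Pow (insert i L). h J) = (\<Sum>J\<in>Pow L. h J + (h (insert i J) :: real))"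
proof -
  have "inj_on (insert i) (Pow L)" using assms(2) by (auto simp: inj_on_def)
  then show ?thesis
    unfolding Pow_insert using assms
    by (subst sum.union_disjoint) (auto simp: sum.distrib sum.reindex)
qed

text \<open>For \<open>i \<notin> L\<close>, a subset of \<open>insert i L\<close> either contains
  \<open>i\<close>, and the derivative falls on \<open>f\<close>, or it does not, and the derivative
  passes \<open>f\<close> at the cost of the twist and falls on \<open>g\<close>. For
  \<open>i \<in> L\<close> the left side vanishes, and on the right the terms of \<open>J\<close>
  and \<open>insert i J\<close> cancel.\<close>

lemma sf_pderiv_mult_odd:
  assumes i: "p \<le> i" and x: "x \<in> V" and L: "finite L"
  shows "sf_pderiv p V i (sf_mult f g) L x =
    sf_mult (sf_pderiv p V i f) g L x + sf_mult (sf_twist 1 f) (sf_pderiv p V i g) L x"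
proof (cases "i \<in> L")
  case False
  have "sf_pderiv p V i (sf_mult f g) L x = odd_sign L i * (\<Sum>J\<in>Pow L.
     grass_sign J (insert i L - J) * f J x * g (insert i L - J) x +
     grass_sign (insert i J) (insert i L - insert i J) * f (insert i J) x * g (insert i L - insert i J) x)"
    using False i x L by (simp add: sf_pderiv_odd sf_mult_def sum_Pow_insert del: Pow_insert)
  also have "\<dots> = (\<Sum>J\<in>Pow L. grass_sign J (L - J) * sf_pderiv p V i f J x * g (L - J) x
     + grass_sign J (L - J) * sf_twist 1 f J x * sf_pderiv p V i g (L - J) x)"
    unfolding sum_distrib_left
  proof (rule sum.cong[OF refl])
    fix J assume J: "J \<in> Pow L"
    then have fin: "finite J" "finite (L - J)" using L by (auto intro: finite_subset)
    have i': "i \<notin> J" "i \<notin> L - J" using J False by auto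
    have e: "insert i L - J = insert i (L - J)" "insert i L - insert i J = L - J" using J False by auto
    have "odd_sign L i = odd_sign J i * odd_sign (L - J) i"
      using odd_sign_union[OF fin] J by (metis Diff_disjoint Diff_partition PowD)
    then show "odd_sign L i * (grass_sign J (insert i L - J) * f J x * g (insert i L - J) x +
     grass_sign (insert i J) (insert i L - insert i J) * f (insert i J) x * g (insert i L - insert i J) x) =
      grass_sign J (L - J) * sf_pderiv p V i f J x * g (L - J) x
     + grass_sign J (L - J) * sf_twist 1 f J x * sf_pderiv p V i g (L - J) x"
      using i' fin i x unfolding e
      by (simp add: grass_sign_insert_left grass_sign_insert_right sf_pderiv_odd sf_twist_def algebra_simps)
        (simp add: odd_sign_def algebra_simps)
  qed
  finally show ?thesis by (simp add: sf_mult_def sum.distrib)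
next
  case True
  define M where "M = L - {i}"
  have M: "L = insert i M" "i \<notin> M" "finite M" using True L by (auto simp: M_def)
  have "(\<Sum>J\<in>Pow (insert i M). grass_sign J (insert i M - J) * sf_pderiv p V i f J x * g (insert i M - J) x
     + grass_sign J (insert i M - J) * sf_twist 1 f J x * sf_pderiv p V i g (insert i M - J) x) = 0"
    unfolding sum_Pow_insert[OF M(3,2)]
  proof (rule sum.neutral, rule ballI)
    fix J assume J: "J \<in> Pow M"
    then have fin: "finite J" "finite (M - J)" using M by (auto intro: finite_subset)
    have i': "i \<notin> J" "i \<notin> M - J" using J M by auto
    have e: "insert i M - J = insert i (M - J)" "insert i M - insert i J = M - J" using J M by auto
    show "grass_sign J (insert i M - J) * sf_pderiv p V i f J x * g (insert i M - J) x +
       grass_sign J (insert i M - J) * sf_twist 1 f J x * sf_pderiv p V i g (insert i M - J) x +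
       (grass_sign (insert i J) (insert i M - insert i J) * sf_pderiv p V i f (insert i J) x * g (insert i M - insert i J) x +
        grass_sign (insert i J) (insert i M - insert i J) * sf_twist 1 f (insert i J) x *
        sf_pderiv p V i g (insert i M - insert i J) x) = 0"
      using i' fin i x unfolding e
      by (simp add: grass_sign_insert_left grass_sign_insert_right sf_pderiv_odd sf_twist_def algebra_simps)
  qed
  then show ?thesis using True i x unfolding M(1) by (simp add: sf_pderiv_odd sf_mult_def sum.distrib)
qed

subsection \<open>Superfunctions over an open set\<close>

locale coordinate_dims =
  fixes p q :: nat

locale superdomain = coordinate_dims +
  fixes V :: "(nat \<Rightarrow> real) set"
  assumes openV: "openin (Euclidean_space p) V"
begin

abbreviation "S \<equiv> sfuns p q V"
abbreviation "unit_sf \<equiv> sf_of_fun V (\<lambda>_. 1)"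
abbreviation "X \<equiv> sf_coord p V"
abbreviation "pd \<equiv> sf_pderiv p V"

lemma sfunsD:
  assumes "f \<in> S"
  shows "smooth_fun p V (f J)" "x \<notin> V \<Longrightarrow> f J x = 0" "\<not> J \<subseteq> {p..<p + q} \<Longrightarrow> f J x = 0"
  using assms by (auto simp: sfuns_def)

lemma sfuns_infinite: "f \<in> S \<Longrightarrow> infinite J \<Longrightarrow> f J x = 0"
  by (rule sfunsD(3)) (auto intro: finite_subset)

lemma sfunsI:
  assumes "\<And>J. J \<subseteq> {p..<p + q} \<Longrightarrow> smooth_fun p V (f J)" "\<And>J x. x \<notin> V \<Longrightarrow> f J x = 0"
    "\<And>J x. \<not> J \<subseteq> {p..<p + q} \<Longrightarrow> x \<in> V \<Longrightarrow> f J x = 0"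
  shows "f \<in> S"
proof -
  have "f J = (\<lambda>_. 0)" if "\<not> J \<subseteq> {p..<p + q}" for J
    using assms(2,3) that by (intro ext) metis
  moreover have "smooth_fun p V (f J)" for J
    using assms(1)[of J] smooth_fun_const[OF openV, of 0] calculation[of J] by (cases "J \<subseteq> {p..<p + q}") simp_all
  ultimately show ?thesis using assms(2) by (auto simp: sfuns_def)
qed

lemma sfuns_0 [simp]: "0 \<in> S"
  by (rule sfunsI) (auto simp: zero_fun_def smooth_fun_const openV)

lemma sfuns_add: "f \<in> S \<Longrightarrow> g \<in> S \<Longrightarrow> f + g \<in> S"
  by (rule sfunsI) (auto simp: plus_fun_def sfunsD intro!: smooth_fun_add[OF openV])

lemma sfuns_scale: "f \<in> S \<Longrightarrow> sf_scale a f \<in> S"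
  unfolding sf_scale_def
  by (rule sfunsI) (auto simp: sfunsD intro!: smooth_fun_mult[OF openV] smooth_fun_const[OF openV])

lemma sfuns_minus: "f \<in> S \<Longrightarrow> - f \<in> S"
  using sfuns_scale[of f "-1"] by (simp add: sf_scale_minus_1)

lemma sfuns_diff: "f \<in> S \<Longrightarrow> g \<in> S \<Longrightarrow> f - g \<in> S"
  using sfuns_add[of f "- g"] sfuns_minus by simp

lemma sfuns_sum: "(\<And>i. i \<in> A \<Longrightarrow> f i \<in> S) \<Longrightarrow> (\<Sum>i\<in>A. f i) \<in> S"
  by (rule sum_closed[of "\<lambda>f. f \<in> S"]) (auto intro: sfuns_add)

lemma sfuns_twist: "f \<in> S \<Longrightarrow> sf_twist k f \<in> S"
  unfolding sf_twist_def
  by (rule sfunsI) (auto simp: sfunsD intro!: smooth_fun_mult[OF openV] smooth_fun_const[OF openV])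

lemma sfuns_mult:
  assumes "f \<in> S" "g \<in> S"
  shows "sf_mult f g \<in> S"
  unfolding sf_mult_def
proof (rule sfunsI)
  fix L :: "nat set" and x
  show "smooth_fun p V (\<lambda>x. \<Sum>J\<in>Pow L. grass_sign J (L - J) * f J x * g (L - J) x)"
    using assms sfunsD(1) by (intro smooth_fun_sum smooth_fun_mult smooth_fun_const openV)
  show "(\<Sum>J\<in>Pow L. grass_sign J (L - J) * f J x * g (L - J) x) = 0" if "x \<notin> V"
    using sfunsD(2)[OF assms(1) that] by simp
  show "(\<Sum>J\<in>Pow L. grass_sign J (L - J) * f J x * g (L - J) x) = 0" if L: "\<not> L \<subseteq> {p..<p + q}"
  proof (rule sum.neutral, rule ballI)
    fix J assume "J \<in> Pow L"
    then have "\<not> J \<subseteq> {p..<p + q} \<or> \<not> L - J \<subseteq> {p..<p + q}" using L by auto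
    then have "f J x = 0 \<or> g (L - J) x = 0"
      using sfunsD(3)[OF assms(1), of J x] sfunsD(3)[OF assms(2), of "L - J" x] by blast
    then show "grass_sign J (L - J) * f J x * g (L - J) x = 0" by auto
  qed
qed

lemma sfuns_of_fun: "smooth_fun p V u \<Longrightarrow> sf_of_fun V u \<in> S"
proof (rule sfunsI)
  fix J :: "nat set" assume "smooth_fun p V u"
  then show "smooth_fun p V (sf_of_fun V u J)"
    using smooth_fun_cong[OF openV, of "sf_of_fun V u J" "if J = {} then u else (\<lambda>_. 0)"] smooth_fun_const[OF openV]
    by (auto simp: sf_of_fun_def)
qed (auto simp: sf_of_fun_def)

lemma unit_in_sfuns [simp]: "unit_sf \<in> S"
  by (rule sfuns_of_fun smooth_fun_const openV)+

lemma sf_coord_odd_eq: "p \<le> i \<Longrightarrow> X i J x = (if J = {i} \<and> x \<in> V then 1 else 0)"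
  by (simp add: sf_coord_def)

lemma sf_coord_in_sfuns: "i < p + q \<Longrightarrow> X i \<in> S"
proof (cases "i < p")
  case True
  then show ?thesis by (simp add: sf_coord_def sfuns_of_fun smooth_fun_coord openV)
next
  case False
  assume "i < p + q"
  then show ?thesis
  proof (intro sfunsI)
    fix J :: "nat set"
    show "smooth_fun p V (X i J)"
      using False smooth_fun_cong[OF openV, of "X i J" "\<lambda>_. if J = {i} then 1 else 0"] smooth_fun_const[OF openV]
      by (auto simp: sf_coord_odd_eq)
  qed (use False in \<open>auto simp: sf_coord_odd_eq\<close>)
qed

lemma sf_mult_of_fun_left: "f \<in> S \<Longrightarrow> sf_mult (sf_of_fun V u) f = (\<lambda>J x. u x * f J x)"
proof (intro ext)
  fix J x assume f: "f \<in> S"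
  show "sf_mult (sf_of_fun V u) f J x = u x * f J x"
  proof (cases "finite J")
    case True
    have "sf_mult (sf_of_fun V u) f J x = (\<Sum>K\<in>Pow J. if K = {} then (if x \<in> V then u x * f J x else 0) else 0)"
      unfolding sf_mult_def sf_of_fun_def by (intro sum.cong) auto
    then show ?thesis using True sfunsD(2)[OF f] by (simp add: sum.delta')
  qed (simp add: sf_mult_def sfuns_infinite[OF f])
qed

lemma sf_mult_of_fun_right: "f \<in> S \<Longrightarrow> sf_mult f (sf_of_fun V u) = (\<lambda>J x. u x * f J x)"
  using sf_mult_of_fun_left sf_mult_commute[OF sf_par_of_fun, of f V u] by simp

lemma sf_mult_unit [simp]: "f \<in> S \<Longrightarrow> sf_mult unit_sf f = f" "f \<in> S \<Longrightarrow> sf_mult f unit_sf = f"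
  by (simp_all add: sf_mult_of_fun_left sf_mult_of_fun_right)

lemma sf_mult_coord_odd:
  assumes "f \<in> S" "p \<le> i" "x \<in> V"
  shows "sf_mult (X i) f J x = (if i \<in> J then odd_sign J i * f (J - {i}) x else 0)"
proof (cases "finite J")
  case True
  have "sf_mult (X i) f J x = (\<Sum>K\<in>Pow J. if K = {i} then grass_sign {i} (J - {i}) * f (J - {i}) x else 0)"
    unfolding sf_mult_def using assms by (intro sum.cong) (auto simp: sf_coord_odd_eq)
  moreover have "{j. j \<in> J \<and> j \<noteq> i \<and> j < i} = {j \<in> J. j < i}" by auto
  ultimately show ?thesis using True by (simp add: sum.delta' grass_sign_single_left odd_sign_def)
qed (use sfuns_infinite[OF assms(1)] in \<open>simp add: sf_mult_def\<close>)

section \<open>Partial derivatives of superfunctions\<close>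

lemma sf_pderiv_even_eq: "i < p \<Longrightarrow> x \<in> V \<Longrightarrow> pd i f J x = pderiv_at i (f J) x"
  by (simp add: sf_pderiv_def)

lemma sf_pderiv_in_sfuns: 
  assumes f: "f \<in> S" and i: "i < p + q" 
  shows "pd i f \<in> S"
proof (cases "i < p")
  case True
  show ?thesis
  proof (rule sfunsI)
    fix J x
    show "smooth_fun p V (pd i f J)"
      using smooth_fun_cong[OF openV, of "pd i f J" "pderiv_at i (f J)"] True
        smooth_fun_pderiv[OF openV sfunsD(1)[OF f] True] by (simp add: sf_pderiv_even_eq)
    assume "\<not> J \<subseteq> {p..<p + q}" "x \<in> V"
    then have "f J = (\<lambda>_. 0)" using f by (simp add: sfuns_def)
    then show "pd i f J x = 0" using True by (simp add: sf_pderiv_def pderiv_at_def)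
  qed (simp add: sf_pderiv_def)
next
  case False
  show ?thesis
  proof (rule sfunsI)
    fix J x
    show "smooth_fun p V (pd i f J)"
      using smooth_fun_cong[OF openV, of "pd i f J" "if i \<in> J then (\<lambda>_. 0) else (\<lambda>x. odd_sign J i * f (insert i J) x)"] False
        smooth_fun_const[OF openV] sfunsD(1)[OF f] by (auto simp: sf_pderiv_odd intro!: smooth_fun_mult[OF openV])
    assume "\<not> J \<subseteq> {p..<p + q}" "x \<in> V"
    then have "f (insert i J) x = 0" by (intro sfunsD(3)[OF f]) auto
    then show "pd i f J x = 0" using False by (simp add: sf_pderiv_odd)
  qed (simp add: sf_pderiv_def)
qed

lemma sf_has_pderiv: "f \<in> S \<Longrightarrow> i < p \<Longrightarrow> x \<in> V \<Longrightarrow> has_pderiv i (f J) (pd i f J x) x"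
  using smooth_fun_has_pderiv[OF openV sfunsD(1)] by (simp add: sf_pderiv_even_eq)

lemma sf_pderiv_eqI:
  "i < p \<Longrightarrow> x \<in> V \<Longrightarrow> has_pderiv i (f J) d x \<Longrightarrow> pd i f J x = d"
  by (simp add: sf_pderiv_even_eq pderiv_at_eqI)

lemma sf_pderiv_add: "f \<in> S \<Longrightarrow> g \<in> S \<Longrightarrow> i < p + q \<Longrightarrow> pd i (f + g) = pd i f + pd i g"
proof (intro ext)
  fix J x assume a: "f \<in> S" "g \<in> S" "i < p + q"
  show "pd i (f + g) J x = (pd i f + pd i g) J x"
  proof (cases "x \<in> V \<and> i < p")
    case True
    then show ?thesis using a by (simp, intro sf_pderiv_eqI) (auto intro!: DERIV_add sf_has_pderiv)
  qed (auto simp: sf_pderiv_outside sf_pderiv_odd algebra_simps)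
qed

lemma sf_pderiv_0 [simp]: "pd i 0 = 0"
  by (simp add: sf_pderiv_def pderiv_at_def fun_eq_iff zero_fun_def)

lemma sf_pderiv_sum:
  "(\<And>k. k \<in> A \<Longrightarrow> f k \<in> S) \<Longrightarrow> i < p + q \<Longrightarrow> pd i (\<Sum>k\<in>A. f k) = (\<Sum>k\<in>A. pd i (f k))"
  by (rule additive_on_sum(2)[of S "pd i"]) (auto simp: sf_pderiv_add intro: sfuns_add)

lemma sf_pderiv_scale: "f \<in> S \<Longrightarrow> i < p + q \<Longrightarrow> pd i (sf_scale a f) = sf_scale a (pd i f)"
proof (intro ext)
  fix J x assume a: "f \<in> S" "i < p + q"
  show "pd i (sf_scale a f) J x = sf_scale a (pd i f) J x"
  proof (cases "x \<in> V \<and> i < p")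
    case True
    then show ?thesis using a unfolding sf_scale_def by (intro sf_pderiv_eqI) (auto intro!: DERIV_cmult sf_has_pderiv)
  qed (auto simp: sf_pderiv_outside sf_pderiv_odd sf_scale_def)
qed

lemma sf_pderiv_minus: "f \<in> S \<Longrightarrow> i < p + q \<Longrightarrow> pd i (- f) = - pd i f"
  using sf_pderiv_scale[of f i "-1"] by (simp add: sf_scale_minus_1)

lemma sf_pderiv_diff: "f \<in> S \<Longrightarrow> g \<in> S \<Longrightarrow> i < p + q \<Longrightarrow> pd i (f - g) = pd i f - pd i g"
  using sf_pderiv_add[of f "- g" i] by (simp add: sf_pderiv_minus sfuns_minus)

lemma sf_pderiv_twist: "f \<in> S \<Longrightarrow> i < p + q \<Longrightarrow> pd i (sf_twist k f) = sf_scale ((- 1) ^ (k * cpar p i)) (sf_twist k (pd i f))"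
proof (intro ext)
  fix J x assume a: "f \<in> S" "i < p + q"
  show "pd i (sf_twist k f) J x = sf_scale ((- 1) ^ (k * cpar p i)) (sf_twist k (pd i f)) J x"
  proof (cases "x \<in> V \<and> i < p")
    case True
    then have "pd i (sf_twist k f) J x = (- 1) ^ (k * card J) * pd i f J x"
      using a unfolding sf_twist_def by (intro sf_pderiv_eqI) (auto intro!: DERIV_cmult sf_has_pderiv)
    then show ?thesis using True by (simp add: sf_scale_def cpar_def sf_twist_def)
  next
    case False
    show ?thesis
    proof (cases "x \<in> V \<and> i \<notin> J")
      case True
      show ?thesis
      proof (cases "finite J")
        assume "finite J"
        then show ?thesis using True False by (simp add: sf_pderiv_odd sf_scale_def sf_twist_def cpar_def power_add)
      next
        assume "infinite J"
        then show ?thesis using True False sfuns_infinite[OF a(1), of "insert i J"]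
          by (simp add: sf_pderiv_odd sf_scale_def sf_twist_def)
      qed
    qed (use False in \<open>auto simp: sf_pderiv_outside sf_pderiv_odd sf_scale_def sf_twist_def\<close>)
  qed
qed

lemma sf_pderiv_mult:
  assumes f: "f \<in> S" and g: "g \<in> S" and i: "i < p + q"
  shows "pd i (sf_mult f g) = sf_mult (pd i f) g + sf_mult (sf_twist (cpar p i) f) (pd i g)"
proof (intro ext)
  fix L x
  have D: "pd i f \<in> S" "pd i g \<in> S" "sf_twist (cpar p i) f \<in> S" "sf_mult f g \<in> S"
    using assms by (simp_all add: sf_pderiv_in_sfuns sfuns_twist sfuns_mult)
  show "pd i (sf_mult f g) L x = (sf_mult (pd i f) g + sf_mult (sf_twist (cpar p i) f) (pd i g)) L x"
  proof (cases "x \<in> V \<and> finite L")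
    case True
    show ?thesis
    proof (cases "i < p")
      case i: True
      have "pd i (sf_mult f g) L x = (\<Sum>J\<in>Pow L. grass_sign J (L - J) * (pd i f J x * g (L - J) x + pd i g (L - J) x * f J x))"
      proof (rule sf_pderiv_eqI[OF i])
        show "has_pderiv i (sf_mult f g L) (\<Sum>J\<in>Pow L. grass_sign J (L - J) * (pd i f J x * g (L - J) x + pd i g (L - J) x * f J x)) x"
          unfolding sf_mult_def mult.assoc
        proof (intro DERIV_sum DERIV_cmult)
          fix J
          show "((\<lambda>t. f J (x(i := t)) * g (L - J) (x(i := t))) has_real_derivative pd i f J x * g (L - J) x + pd i g (L - J) x * f J x) (at (x i))"
            using DERIV_mult[OF sf_has_pderiv[OF f i, of x J] sf_has_pderiv[OF g i, of x "L - J"]] True by simp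
        qed
      qed (use True in simp)
      then show ?thesis using i by (simp add: sf_mult_def cpar_def sum.distrib[symmetric] algebra_simps)
    next
      case False
      then show ?thesis using sf_pderiv_mult_odd[of p i x V L f g] True by (simp add: cpar_def)
    qed
  next
    case False
    then show ?thesis
      using sfuns_infinite[OF sf_pderiv_in_sfuns[OF D(4) i]] sfunsD(2)[OF sf_pderiv_in_sfuns[OF D(4) i]]
        sfunsD(2)[OF sfuns_mult[OF D(1) g]] sfunsD(2)[OF sfuns_mult[OF D(3,2)]]
      by (cases "finite L") (simp_all add: sf_mult_def)
  qed
qed

text \<open>Even directions act on the coefficients, where second derivatives are symmetric; an even
  and an odd direction do not interact. For two different odd directions the sign is that of
  \<open>odd_sign {i} j = - odd_sign {j} i\<close>: exactly one of the two indices has to pass the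
  other.\<close>

lemma sf_pderiv_commute:
  assumes f: "f \<in> S" and i: "i < p + q" and j: "j < p + q"
  shows "pd i (pd j f) = sf_scale ((- 1) ^ (cpar p i * cpar p j)) (pd j (pd i f))"
proof (intro ext)
  fix L x
  have mixed: "pd i (pd j f) L x = pd j (pd i f) L x" if "i < p" "\<not> j < p" "x \<in> V" for i j
  proof (cases "j \<in> L")
    case True
    then have "pd j f L = (\<lambda>_. 0)" using that by (auto simp: sf_pderiv_odd)
    then show ?thesis using that True by (simp add: sf_pderiv_even_eq sf_pderiv_odd pderiv_at_def)
  next
    case False
    have "has_pderiv i (\<lambda>y. odd_sign L j * f (insert j L) y) (odd_sign L j * pd i f (insert j L) x) x"
      by (intro DERIV_cmult sf_has_pderiv f that)
    then have "has_pderiv i (pd j f L) (odd_sign L j * pd i f (insert j L) x) x"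
      by (rule has_pderiv_cong[OF openV that(3,1), THEN iffD1, rotated]) (use that False in \<open>simp add: sf_pderiv_odd\<close>)
    then show ?thesis using that False by (simp add: sf_pderiv_eqI sf_pderiv_odd)
  qed
  show "pd i (pd j f) L x = sf_scale ((- 1) ^ (cpar p i * cpar p j)) (pd j (pd i f)) L x"
  proof (cases "x \<in> V")
    case x: True
    consider "i < p" "j < p" | "i < p" "\<not> j < p" | "\<not> i < p" "j < p" | "\<not> i < p" "\<not> j < p" by blast
    then show ?thesis
    proof cases
      case 1
      have "pd i (pd j f) L x = pderiv_at i (pderiv_at j (f L)) x" if "i < p" "j < p" for i j
        using that x by (subst sf_pderiv_even_eq) (auto intro!: pderiv_at_cong[OF openV] simp: sf_pderiv_even_eq)
      then show ?thesis using 1 pderiv_at_commute[OF openV sfunsD(1)[OF f] 1 x]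
        by (simp add: cpar_def sf_scale_def)
    next
      case 2
      then show ?thesis using mixed x by (simp add: cpar_def sf_scale_def)
    next
      case 3
      then show ?thesis using mixed[of j i] x by (simp add: cpar_def sf_scale_def)
    next
      case 4
      show ?thesis
      proof (cases "i \<in> L \<or> j \<in> L \<or> i = j \<or> infinite L")
        case True
        have "infinite L \<Longrightarrow> f (insert i (insert j L)) x = 0" "infinite L \<Longrightarrow> f (insert j (insert i L)) x = 0"
          by (simp_all add: sfuns_infinite[OF f])
        then show ?thesis using True 4 by (auto simp: sf_pderiv_odd sf_scale_def)
      next
        case False
        have "odd_sign (insert i L) j = odd_sign L j * odd_sign {i} j" "odd_sign (insert j L) i = odd_sign L i * odd_sign {j} i"
          using odd_sign_union[of L "{i}" j] odd_sign_union[of L "{j}" i] False by simp_all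
        moreover have "odd_sign {i} j = - odd_sign {j} i"
        proof -
          have "{k. k = i \<and> k < j} = (if i < j then {i} else {})" "{k. k = j \<and> k < i} = (if j < i then {j} else {})" by auto
          then show ?thesis using False by (auto simp: odd_sign_def)
        qed
        ultimately show ?thesis using False 4 x
          by (simp add: sf_pderiv_odd sf_scale_def cpar_def insert_commute)
      qed
    qed
  qed (simp add: sf_pderiv_outside sf_scale_def)
qed

lemma sf_par_pderiv:
  assumes "f \<in> S" "sf_par k f"
  shows "sf_par (k + cpar p i) (pd i f)"
proof (cases "i < p")
  case True
  have "even (card J + k)" if "pd i f J x \<noteq> 0" for J x
  proof (rule ccontr)
    assume "odd (card J + k)"
    then have "f J = (\<lambda>_. 0)" using assms(2) unfolding sf_par_def by (intro ext) blast
    then show False using that True by (auto simp: sf_pderiv_def pderiv_at_def split: if_splits)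
  qed
  then show ?thesis using True by (simp add: sf_par_def cpar_def)
next
  case False
  show ?thesis
    unfolding sf_par_def
  proof (intro allI impI)
    fix J x assume "pd i f J x \<noteq> 0"
    then have "i \<notin> J" "f (insert i J) x \<noteq> 0" using False by (auto simp: sf_pderiv_odd split: if_splits)
    moreover from this have "finite (insert i J)"
      using sfuns_infinite[OF assms(1), of "insert i J" x] by argo
    ultimately have "even (card (insert i J) + k)" "finite (insert i J)" "i \<notin> J"
      using assms(2) unfolding sf_par_def by blast+
    then show "even (card J + (k + cpar p i))" using False by (auto simp: cpar_def)
  qed
qed

lemma sf_pderiv_of_fun:
  assumes "i < p + q"
  shows "pd i (sf_of_fun V u) = (if i < p then sf_of_fun V (pderiv_at i u) else 0)"
proof (cases "i < p")
  case True
  have "pd i (sf_of_fun V u) J x = sf_of_fun V (pderiv_at i u) J x" for J x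
  proof (cases "x \<in> V")
    case x: True
    show ?thesis
    proof (cases "J = {}")
      case True
      then show ?thesis using pderiv_at_cong[OF openV x \<open>i < p\<close>, of "sf_of_fun V u {}" u] \<open>i < p\<close> x
        by (simp add: sf_pderiv_even_eq) (simp add: sf_of_fun_def)
    next
      case False
      then have "sf_of_fun V u J = (\<lambda>_. 0)" by (auto simp: sf_of_fun_def)
      then show ?thesis using x \<open>i < p\<close> False by (simp add: sf_pderiv_even_eq pderiv_at_def sf_of_fun_def[of _ "\<lambda>_. _"]) (simp add: sf_of_fun_def)
    qed
  qed (simp add: sf_pderiv_outside sf_of_fun_def)
  then show ?thesis using True by (simp add: fun_eq_iff)
qed (auto simp: fun_eq_iff sf_pderiv_odd sf_of_fun_def)

lemma sf_pderiv_const: "i < p + q \<Longrightarrow> pd i (sf_of_fun V (\<lambda>_. c)) = 0"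
  unfolding sf_pderiv_of_fun using pderiv_at_eqI[where u = "\<lambda>_. c" and d = 0]
  by (auto simp: fun_eq_iff sf_of_fun_def)

lemma sf_pderiv_coord:
  assumes "i < p + q" "j < p + q"
  shows "pd i (X j) = (if i = j then unit_sf else 0)"
proof (cases "j < p")
  case True
  show ?thesis
  proof (cases "i < p")
    case i: True
    have "pderiv_at i (\<lambda>x. x j) = (\<lambda>x. if i = j then 1 else 0)"
      by (intro ext pderiv_at_eqI) auto
    then have "pd i (X j) = sf_of_fun V (\<lambda>x. if i = j then 1 else 0)"
      using True i assms by (simp add: sf_coord_def sf_pderiv_of_fun)
    then show ?thesis by (simp add: fun_eq_iff sf_of_fun_def)
  next
    case False
    then show ?thesis using True assms by (auto simp: sf_coord_def sf_pderiv_of_fun)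
  qed
next
  case False
  show ?thesis
  proof (cases "i < p")
    case i: True
    have "pderiv_at i (X j J) x = 0" if "x \<in> V" for J x
      using False pderiv_at_cong[OF openV that i, of "X j J" "\<lambda>_. if J = {j} then 1 else 0"]
      by (auto simp: sf_coord_odd_eq pderiv_at_def)
    then show ?thesis using i False by (auto simp: fun_eq_iff sf_pderiv_def)
  next
    case i: False
    have "insert i J = {j} \<longleftrightarrow> i = j \<and> J = {}" if "i \<notin> J" for J using that by auto
    then show ?thesis using i False
      by (auto simp: fun_eq_iff sf_pderiv_odd sf_coord_odd_eq sf_of_fun_def odd_sign_def)
  qed
qed

text \<open>By Hadamard's lemma every superfunction on a box is a constant plus multiples of the
  functions \<open>x^i - a i\<close> for even \<open>x^i\<close> and of the odd \<open>x^i\<close>.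
  A property closed under sums has to be checked only on constants and on such multiples. The
  cofactor \<open>h\<close> is arbitrary and comes without an induction hypothesis.\<close>

lemma hadamard_induct [consumes 2, case_names const add even odd]:
  assumes VB: "V = ebox p a r" and f: "f \<in> S"
    and const: "\<And>c. Q (sf_of_fun V (\<lambda>_. c))"
    and add: "\<And>f g. f \<in> S \<Longrightarrow> g \<in> S \<Longrightarrow> Q f \<Longrightarrow> Q g \<Longrightarrow> Q (f + g)"
    and even: "\<And>i h. i < p \<Longrightarrow> h \<in> S \<Longrightarrow> Q (sf_mult (X i - sf_of_fun V (\<lambda>_. a i)) h)"
    and odd: "\<And>i h. p \<le> i \<Longrightarrow> i < p + q \<Longrightarrow> h \<in> S \<Longrightarrow> Q (sf_mult (X i) h)"
  shows "Q f"
proof -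
  \<comment> \<open>\<open>indep k f\<close>: no coordinate from the \<open>k\<close>-th on occurs
    in \<open>f\<close>. The induction removes coordinates from the last one down, so the odd ones
    go before the even ones.\<close>
  define indep where "indep k f \<longleftrightarrow> (\<forall>J x. f J x \<noteq> 0 \<longrightarrow> J \<subseteq> {..<k}) \<and>
     (\<forall>i<p. k \<le> i \<longrightarrow> (\<forall>J. \<forall>x\<in>V. \<forall>t. x(i := t) \<in> V \<longrightarrow> f J (x(i := t)) = f J x))" for k and f :: sfun
  have "Q f" if "k \<le> p + q" "f \<in> S" "indep k f" for k f
    using that
  proof (induction k arbitrary: f)
    case 0
    \<comment> \<open>\<open>a\<close> may be nonzero from \<open>p\<close> on, where all points of
      \<open>V\<close> are \<open>0\<close>.\<close>
    define c where "c = f {} (\<lambda>i. if i < p then a i else 0)"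
    have "f {} x = c" if x: "x \<in> V" for x
    proof -
      \<comment> \<open>Independence allows changing one coordinate at a time, so all intermediate
        points on the way to the centre have to lie in the box.\<close>
      have in_V: "(\<lambda>i. if i < j then a i else x i) \<in> V" if "j \<le> p" for j
        using x that unfolding VB ebox_def by (auto intro: le_less_trans[OF abs_ge_zero])
      have "f {} x = f {} (\<lambda>i. if i < j then a i else x i)" if "j \<le> p" for j
        using that
      proof (induction j)
        case (Suc j)
        have "(\<lambda>i. if i < Suc j then a i else x i) = (\<lambda>i. if i < j then a i else x i)(j := a j)"
          by (auto simp: fun_eq_iff less_Suc_eq)
        moreover have "f {} ((\<lambda>i. if i < j then a i else x i)(j := a j)) = f {} (\<lambda>i. if i < j then a i else x i)"
          using 0(3)[unfolded indep_def, THEN conjunct2, rule_format, of j "\<lambda>i. if i < j then a i else x i" "a j"]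
            Suc.prems in_V[of j] in_V[of "Suc j", unfolded calculation] by simp
        ultimately show ?case using Suc by simp
      qed simp
      moreover have "(\<lambda>i. if i < p then a i else x i) = (\<lambda>i. if i < p then a i else 0)"
        using x by (auto simp: fun_eq_iff VB ebox_def)
      ultimately show ?thesis unfolding c_def by (metis order_refl)
    qed
    moreover have "f J x = 0" if "J \<noteq> {}" for J x using 0(3) that unfolding indep_def by auto
    ultimately have "f = sf_of_fun V (\<lambda>_. c)"
      using sfunsD(2)[OF 0(2)] by (auto simp: fun_eq_iff sf_of_fun_def)
    then show ?case using const by simp
  next
    case (Suc k)
    show ?case
    proof (cases "k < p")
      case True
      \<comment> \<open>Hadamard's quotient, chosen so that \<open>f1\<close> below takes the values
        of \<open>f\<close> on the slice where the \<open>k\<close>-th coordinate is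
        \<open>a k\<close>.\<close>
      define h where "h = (\<lambda>J x. if x \<in> V then avg k (a k) 0 (pderiv_at k (f J)) x else 0)"
      have h: "h \<in> S"
      proof (rule sfunsI)
        fix J
        have "smooth_fun p V (avg k (a k) 0 (pderiv_at k (f J)))"
          using smooth_fun_pderiv[OF openV sfunsD(1)[OF Suc.prems(2)] True] unfolding VB by (rule smooth_fun_avg[OF _ True])
        then show "smooth_fun p V (h J)"
          using smooth_fun_cong[OF openV, of "h J" "avg k (a k) 0 (pderiv_at k (f J))"] by (simp add: h_def)
      next
        fix J x assume "\<not> J \<subseteq> {p..<p + q}"
        then have "f J = (\<lambda>_. 0)" using Suc.prems(2) by (simp add: sfuns_def)
        moreover have "pderiv_at k (\<lambda>_. 0) y = 0" for y
          by (rule pderiv_at_eqI) simp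
        ultimately show "h J x = 0" by (simp add: h_def avg_def)
      qed (simp add: h_def)
      define u where "u = X k - sf_of_fun V (\<lambda>_. a k)"
      have ue: "u = sf_of_fun V (\<lambda>x. x k - a k)"
        using True by (auto simp: u_def sf_coord_def sf_of_fun_def fun_eq_iff)
      have uh: "sf_mult u h J x = f J x - f J (x(k := a k))" if "x \<in> V" for J x
        using avg_ftc(1)[of p a r "f J" k x] sfunsD(1)[OF Suc.prems(2)] True that
        unfolding ue sf_mult_of_fun_left[OF h] VB[symmetric] by (simp add: h_def)
      define f1 where "f1 = f - sf_mult u h"
      have uS: "u \<in> S" unfolding ue
        by (intro sfuns_of_fun) (use smooth_fun_add[OF openV smooth_fun_coord[OF openV, of k] smooth_fun_const[OF openV, of "- a k"]] in simp)
      have f1: "f1 \<in> S" unfolding f1_def by (intro sfuns_diff sfuns_mult uS h Suc.prems)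
      have f1e: "f1 J x = f J (x(k := a k))" if "x \<in> V" for J x
        using uh[OF that] by (simp add: f1_def)
      have r: "r > 0" if "x \<in> V" for x
      proof -
        have "\<bar>x k - a k\<bar> < r" using that True by (simp add: VB ebox_def)
        then show ?thesis by linarith
      qed
      have "indep k f1"
        unfolding indep_def
      proof (intro conjI allI impI ballI)
        fix J x assume nz: "f1 J x \<noteq> 0"
        then have "x \<in> V" using sfunsD(2)[OF f1] by blast
        then have "J \<subseteq> {..<Suc k}" "J \<subseteq> {p..<p + q}" 
          using nz f1e[of x J] Suc.prems(3) sfunsD(3)[OF Suc.prems(2)] unfolding indep_def by auto
        then show "J \<subseteq> {..<k}" using True by fastforce
      next
        fix i J x t assume i: "i < p" "k \<le> i" and x: "x \<in> V" "x(i := t) \<in> V"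
        show "f1 J (x(i := t)) = f1 J x"
        proof (cases "i = k")
          case False
          have "x(k := a k) \<in> V" using x(1) r[OF x(1)] True unfolding VB by (simp add: ebox_fun_upd)
          moreover have "(x(k := a k))(i := t) \<in> V" using x(2) r[OF x(1)] True False unfolding VB
            by (subst fun_upd_twist) (simp_all add: ebox_fun_upd)
          moreover have "(x(i := t))(k := a k) = (x(k := a k))(i := t)" using False by (simp add: fun_upd_twist)
          moreover have "Suc k \<le> i" using i False by simp
          ultimately show ?thesis
            using Suc.prems(3) i(1) unfolding indep_def f1e[OF x(1)] f1e[OF x(2)] by simp
        qed (use f1e x in simp)
      qed
      then have "Q f1" using Suc.IH[OF _ f1] Suc.prems(1) by simp
      then have "Q (f1 + sf_mult u h)"
        using even[OF True h] f1 sfuns_mult[OF uS h] by (intro add) (auto simp: u_def)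
      then show ?thesis by (simp add: f1_def)
    next
      case False
      then have k: "p \<le> k" "k < p + q" using Suc.prems(1) by auto
      \<comment> \<open>An odd coordinate occurs at most to the first power, so its derivative is
        the exact cofactor and \<open>f1\<close> is the part of \<open>f\<close> without it.\<close>
      define h where "h = pd k f"
      have h: "h \<in> S" unfolding h_def by (rule sf_pderiv_in_sfuns[OF Suc.prems(2) k(2)])
      define f1 where "f1 = f - sf_mult (X k) h"
      have uS: "X k \<in> S" using sf_coord_in_sfuns k by simp
      have f1: "f1 \<in> S" unfolding f1_def by (intro sfuns_diff sfuns_mult uS h Suc.prems)
      have f1e: "f1 J x = (if k \<in> J then 0 else f J x)" for J x
      proof (cases "x \<in> V")
        case True
        have "{j. j \<in> J \<and> j \<noteq> k \<and> j < k} = {j \<in> J. j < k}" by auto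
        then have "odd_sign (J - {k}) k = odd_sign J k" by (simp add: odd_sign_def)
        then show ?thesis using True k sf_mult_coord_odd[OF h k(1) True, of J]
          by (simp add: f1_def) (simp add: h_def sf_pderiv_odd insert_absorb)
      qed (use sfunsD(2)[OF f1] sfunsD(2)[OF Suc.prems(2)] in simp)
      have "indep k f1"
        using Suc.prems(3) k unfolding indep_def f1e by (auto simp: less_Suc_eq subset_iff)
      then have "Q f1" using Suc.IH[OF _ f1] Suc.prems(1) by simp
      then have "Q (f1 + sf_mult (X k) h)"
        using odd[OF k h] f1 sfuns_mult[OF uS h] by (intro add) auto
      then show ?thesis by (simp add: f1_def)
    qed
  qed
  moreover have "indep (p + q) f"
    using sfunsD(3)[OF f] unfolding indep_def by (auto simp: subset_iff)
  ultimately show ?thesis using f by blast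
qed

end

section \<open>The algebra of differential forms\<close>

definition df_scale :: "real \<Rightarrow> dform \<Rightarrow> dform" where
  "df_scale a \<alpha> = (\<lambda>I. sf_scale a (\<alpha> I))"

abbreviation fun_form :: "sfun \<Rightarrow> dform" where
  "fun_form f \<equiv> dmonom_form {#} f"

definition repeats :: "nat \<Rightarrow> nat multiset \<Rightarrow> bool" where
  "repeats p L \<longleftrightarrow> (\<exists>i<p. 1 < count L i)"

lemma finite_submultisets [simp]: "finite {I. I \<subseteq># L}"
proof (rule finite_subset)
  show "{I. I \<subseteq># L} \<subseteq> (\<Union>n\<le>size L. multisets_of_size (set_mset L) n)"
    by (auto simp: multisets_of_size_def size_mset_mono dest: mset_subset_eqD)
qed auto

lemma wedge_eq:
  "wedge p \<alpha> \<beta> L = (if repeats p L then 0 else \<Sum>I\<in>{I. I \<subseteq># L}.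
     sf_scale (dmonom_sign p I (L - I)) (sf_mult (sf_twist (odd_size p (L - I)) (\<alpha> I)) (\<beta> (L - I))))"
  by (auto simp: wedge_def repeats_def sf_twist_def sf_scale_def fun_eq_iff sum_fun_apply)

lemma wedge_add_left: "wedge p (\<alpha> + \<beta>) \<gamma> = wedge p \<alpha> \<gamma> + wedge p \<beta> \<gamma>"
  by (rule ext) (simp add: wedge_eq sf_twist_add sf_mult_add_left sf_scale_add sum.distrib)

lemma wedge_add_right: "wedge p \<alpha> (\<beta> + \<gamma>) = wedge p \<alpha> \<beta> + wedge p \<alpha> \<gamma>"
  by (rule ext) (simp add: wedge_eq sf_mult_add_right sf_scale_add sum.distrib)

lemma wedge_0_left [simp]: "wedge p 0 \<alpha> = 0"
  by (rule ext) (simp add: wedge_eq)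

lemma wedge_0_right [simp]: "wedge p \<alpha> 0 = 0"
  by (rule ext) (simp add: wedge_eq)

lemma wedge_sum_left: "wedge p (\<Sum>i\<in>A. \<alpha> i) \<beta> = (\<Sum>i\<in>A. wedge p (\<alpha> i) \<beta>)"
  by (rule additive_sum[of "\<lambda>\<alpha>. wedge p \<alpha> \<beta>"]) (simp_all add: wedge_add_left)

lemma wedge_sum_right: "wedge p \<beta> (\<Sum>i\<in>A. \<alpha> i) = (\<Sum>i\<in>A. wedge p \<beta> (\<alpha> i))"
  by (rule additive_sum[of "wedge p \<beta>"]) (simp_all add: wedge_add_right)

lemma wedge_scale_left: "wedge p (df_scale a \<alpha>) \<beta> = df_scale a (wedge p \<alpha> \<beta>)"
  by (rule ext) (simp add: wedge_eq df_scale_def sf_twist_scale sf_mult_scale_left sf_scale_sum mult.commute)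

lemma wedge_scale_right: "wedge p \<alpha> (df_scale a \<beta>) = df_scale a (wedge p \<alpha> \<beta>)"
  by (rule ext) (simp add: wedge_eq df_scale_def sf_mult_scale_right sf_scale_sum mult.commute)

lemma df_scale_add: "df_scale a (\<alpha> + \<beta>) = df_scale a \<alpha> + df_scale a \<beta>"
  by (simp add: df_scale_def sf_scale_add fun_eq_iff)

lemma df_scale_0 [simp]: "df_scale 0 \<alpha> = 0" "df_scale a 0 = 0"
  by (simp_all add: df_scale_def fun_eq_iff)

lemma df_scale_1 [simp]: "df_scale 1 \<alpha> = \<alpha>"
  by (simp add: df_scale_def)

lemma df_scale_scale [simp]: "df_scale a (df_scale b \<alpha>) = df_scale (a * b) \<alpha>"
  by (simp add: df_scale_def)

lemma df_scale_sum: "df_scale a (\<Sum>i\<in>A. \<alpha> i) = (\<Sum>i\<in>A. df_scale a (\<alpha> i))"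
  by (rule additive_sum[of "df_scale a"]) (simp_all add: df_scale_add)

lemma df_scale_minus_1: "df_scale (- 1) \<alpha> = - \<alpha>"
  by (simp add: df_scale_def sf_scale_minus_1 fun_eq_iff)

lemma df_scale_neg: "df_scale (- a) \<alpha> = - df_scale a \<alpha>"
  by (simp add: df_scale_def sf_scale_def fun_eq_iff)

lemma dmonom_form_apply: "dmonom_form I f K = (if K = I then f else 0)"
  by (simp add: dmonom_form_def zero_fun_def)

lemma dmonom_form_add: "dmonom_form I (f + g) = dmonom_form I f + dmonom_form I g"
  by (simp add: dmonom_form_apply fun_eq_iff)

lemma dmonom_form_0 [simp]: "dmonom_form I 0 = 0"
  by (simp add: dmonom_form_apply fun_eq_iff)

lemma dmonom_form_scale: "dmonom_form I (sf_scale a f) = df_scale a (dmonom_form I f)"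
  by (simp add: dmonom_form_apply fun_eq_iff df_scale_def)

lemma dmonom_form_sum: "dmonom_form I (\<Sum>i\<in>A. f i) = (\<Sum>i\<in>A. dmonom_form I (f i))"
  by (rule additive_sum[of "dmonom_form I"]) (simp_all add: dmonom_form_add)

section \<open>Sorting signs of differentials and associativity of the wedge product\<close>

lemma dmonom_sign_add_left: "dmonom_sign p (A + B) C = dmonom_sign p A C * dmonom_sign p B C"
  by (simp add: dmonom_sign_def power_add)

lemma dmonom_sign_add_right: "dmonom_sign p A (B + C) = dmonom_sign p A B * dmonom_sign p A C"
  by (simp add: dmonom_sign_def power_add[symmetric] sum_mset.distrib[symmetric])

lemma dmonom_sign_empty [simp]: "dmonom_sign p {#} A = 1" "dmonom_sign p A {#} = 1"
  by (simp_all add: dmonom_sign_def)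

lemma dmonom_sign_single: "dmonom_sign p {#i#} {#j#} = (if j < i \<and> j < p then - 1 else 1)"
  by (simp add: dmonom_sign_def)

lemma odd_size_add [simp]: "odd_size p (A + B) = odd_size p A + odd_size p B"
  by (simp add: odd_size_def)

lemma odd_size_empty [simp]: "odd_size p {#} = 0"
  by (simp add: odd_size_def)

lemma odd_size_single [simp]: "odd_size p {#i#} = cpar p i"
  by (simp add: odd_size_def cpar_def)

lemma odd_size_add_mset [simp]: "odd_size p (add_mset i A) = cpar p i + odd_size p A"
  by (simp add: odd_size_def cpar_def)

lemma repeats_mono: "repeats p A \<Longrightarrow> A \<subseteq># B \<Longrightarrow> repeats p B"
  unfolding repeats_def by (meson less_le_trans mset_subset_eq_count)

text \<open>As for superfunctions, both sides sum over splittings, here of a multiset into three.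
  The sorting signs are multiplicative in each argument, and the twist of the first coefficient by
  the odd differentials of the other two parts splits accordingly. If an even differential repeats
  in \<open>L\<close>, both sides are \<open>0\<close>; otherwise it repeats in no part of
  \<open>L\<close> either.\<close>

lemma wedge_assoc: "wedge p (wedge p \<alpha> \<beta>) \<gamma> = wedge p \<alpha> (wedge p \<beta> \<gamma>)"
proof
  fix L
  let ?t = "\<lambda>A B C. sf_scale (dmonom_sign p A B * dmonom_sign p A C * dmonom_sign p B C)
      (sf_mult (sf_twist (odd_size p B + odd_size p C) (\<alpha> A)) (sf_mult (sf_twist (odd_size p C) (\<beta> B)) (\<gamma> C)))"
  show "wedge p (wedge p \<alpha> \<beta>) \<gamma> L = wedge p \<alpha> (wedge p \<beta> \<gamma>) L"
  proof (cases "repeats p L")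
    case False
    then have nr: "\<not> repeats p M" if "M \<subseteq># L" for M using repeats_mono that by blast
    have "wedge p (wedge p \<alpha> \<beta>) \<gamma> L = (\<Sum>M\<in>{M. M \<subseteq># L}. \<Sum>A\<in>{A. A \<subseteq># M}. ?t A (M - A) (L - M))"
      unfolding wedge_eq[of p _ \<gamma>] if_not_P[OF False]
    proof (rule sum.cong[OF refl])
      fix M assume M: "M \<in> {M. M \<subseteq># L}"
      show "sf_scale (dmonom_sign p M (L - M)) (sf_mult (sf_twist (odd_size p (L - M)) (wedge p \<alpha> \<beta> M)) (\<gamma> (L - M)))
        = (\<Sum>A\<in>{A. A \<subseteq># M}. ?t A (M - A) (L - M))"
        unfolding wedge_eq[of p \<alpha> \<beta> M] using nr M
      proof (simp add: sf_twist_sum sf_mult_sum_left sf_scale_sum, intro sum.cong refl)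
        fix A assume A: "A \<in> {A. A \<subseteq># M}"
        have "dmonom_sign p M (L - M) = dmonom_sign p A (L - M) * dmonom_sign p (M - A) (L - M)"
          using A by (simp flip: dmonom_sign_add_left)
        then show "sf_scale (dmonom_sign p M (L - M)) (sf_mult (sf_twist (odd_size p (L - M))
           (sf_scale (dmonom_sign p A (M - A)) (sf_mult (sf_twist (odd_size p (M - A)) (\<alpha> A)) (\<beta> (M - A))))) (\<gamma> (L - M)))
          = ?t A (M - A) (L - M)"
          by (simp add: sf_twist_scale sf_mult_scale_left sf_twist_mult sf_mult_assoc add.commute mult_ac)
      qed
    qed
    also have "\<dots> = (\<Sum>(M, A)\<in>(SIGMA M:{M. M \<subseteq># L}. {A. A \<subseteq># M}). ?t A (M - A) (L - M))"
      by (subst sum.Sigma) auto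
    also have "\<dots> = (\<Sum>(A, B)\<in>(SIGMA A:{A. A \<subseteq># L}. {B. B \<subseteq># L - A}). ?t A B (L - A - B))"
      by (rule sum.reindex_bij_witness[of _ "\<lambda>(A, B). (A + B, A)" "\<lambda>(M, A). (A, M - A)"])
        (auto simp: subset_mset.le_diff_conv2 subset_mset.add_diff_inverse add.commute
          intro: subset_mset.trans)
    also have "\<dots> = (\<Sum>A\<in>{A. A \<subseteq># L}. \<Sum>B\<in>{B. B \<subseteq># L - A}. ?t A B (L - A - B))"
      by (subst sum.Sigma) auto
    also have "\<dots> = wedge p \<alpha> (wedge p \<beta> \<gamma>) L"
      unfolding wedge_eq[of p \<alpha>] if_not_P[OF False]
    proof (rule sum.cong[OF refl])
      fix A assume A: "A \<in> {A. A \<subseteq># L}"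
      have nr': "\<not> repeats p (L - A)" by (rule nr) simp
      show "(\<Sum>B\<in>{B. B \<subseteq># L - A}. ?t A B (L - A - B)) =
        sf_scale (dmonom_sign p A (L - A)) (sf_mult (sf_twist (odd_size p (L - A)) (\<alpha> A)) (wedge p \<beta> \<gamma> (L - A)))"
        unfolding wedge_eq[of p \<beta> \<gamma>] if_not_P[OF nr'] sf_mult_sum_right sf_scale_sum
      proof (rule sum.cong[OF refl])
        fix B assume B: "B \<in> {B. B \<subseteq># L - A}"
        have "dmonom_sign p A (L - A) = dmonom_sign p A B * dmonom_sign p A (L - A - B)"
          using B by (metis dmonom_sign_add_right mem_Collect_eq subset_mset.add_diff_inverse)
        moreover have "odd_size p (L - A) = odd_size p B + odd_size p (L - A - B)"
          using B by (metis odd_size_add mem_Collect_eq subset_mset.add_diff_inverse)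
        ultimately show "?t A B (L - A - B) = sf_scale (dmonom_sign p A (L - A)) (sf_mult (sf_twist (odd_size p (L - A)) (\<alpha> A))
            (sf_scale (dmonom_sign p B (L - A - B)) (sf_mult (sf_twist (odd_size p (L - A - B)) (\<beta> B)) (\<gamma> (L - A - B)))))"
          by (simp add: sf_mult_scale_right mult_ac)
      qed
    qed
    finally show ?thesis .
  qed (simp add: wedge_eq)
qed

lemma wedge_fun_right: "wedge p \<alpha> (fun_form f) L = (if repeats p L then 0 else sf_mult (\<alpha> L) f)"
proof -
  have "(\<Sum>I\<in>{I. I \<subseteq># L}. sf_scale (dmonom_sign p I (L - I)) (sf_mult (sf_twist (odd_size p (L - I)) (\<alpha> I)) (fun_form f (L - I))))
    = (\<Sum>I\<in>{I. I \<subseteq># L}. if I = L then sf_mult (\<alpha> L) f else 0)"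
  proof (rule sum.cong[OF refl])
    fix I assume "I \<in> {I. I \<subseteq># L}"
    then have "L - I = {#} \<longleftrightarrow> I = L"
      by (metis Diff_eq_empty_iff_mset mem_Collect_eq subset_mset.antisym diff_cancel)
    then show "sf_scale (dmonom_sign p I (L - I)) (sf_mult (sf_twist (odd_size p (L - I)) (\<alpha> I)) (fun_form f (L - I))) =
      (if I = L then sf_mult (\<alpha> L) f else 0)"
      by (auto simp: dmonom_form_apply)
  qed
  then show ?thesis by (simp add: wedge_eq sum.delta')
qed

lemma wedge_fun_left: "wedge p (fun_form f) \<beta> L = (if repeats p L then 0 else sf_mult (sf_twist (odd_size p L) f) (\<beta> L))"
proof -
  have "(\<Sum>I\<in>{I. I \<subseteq># L}. sf_scale (dmonom_sign p I (L - I)) (sf_mult (sf_twist (odd_size p (L - I)) (fun_form f I)) (\<beta> (L - I))))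
    = (\<Sum>I\<in>{I. I \<subseteq># L}. if I = {#} then sf_mult (sf_twist (odd_size p L) f) (\<beta> L) else 0)"
    by (rule sum.cong[OF refl]) (auto simp: dmonom_form_apply)
  then show ?thesis by (simp add: wedge_eq sum.delta')
qed

lemma repeats_empty [simp]: "\<not> repeats p {#}"
  by (simp add: repeats_def)

lemma wedge_fun_fun: "wedge p (fun_form f) (fun_form g) = fun_form (sf_mult f g)"
  by (rule ext) (simp add: wedge_fun_right, simp add: dmonom_form_apply)

text \<open>The total parity, odd differentials included. The form degree contributes its signs
  separately, as in Deligne's convention.\<close>

definition df_par :: "nat \<Rightarrow> nat \<Rightarrow> dform \<Rightarrow> bool" where
  "df_par p k \<alpha> \<longleftrightarrow> (\<forall>I. sf_par (k + odd_size p I) (\<alpha> I))"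

lemma sf_par_twist: "sf_par k f \<Longrightarrow> sf_par k (sf_twist l f)"
  by (auto simp: sf_par_def sf_twist_def)

lemma df_par_wedge:
  assumes "df_par p k \<alpha>" "df_par p l \<beta>"
  shows "df_par p (k + l) (wedge p \<alpha> \<beta>)"
  unfolding df_par_def
proof
  fix L
  show "sf_par (k + l + odd_size p L) (wedge p \<alpha> \<beta> L)"
  proof (cases "repeats p L")
    case False
    show ?thesis
      unfolding wedge_eq if_not_P[OF False]
    proof (intro sf_par_sum sf_par_scale)
      fix I assume "I \<in> {I. I \<subseteq># L}"
      then have "k + l + odd_size p L = (k + odd_size p I) + (l + odd_size p (L - I))"
        by (simp add: algebra_simps flip: odd_size_add)
      then show "sf_par (k + l + odd_size p L) (sf_mult (sf_twist (odd_size p (L - I)) (\<alpha> I)) (\<beta> (L - I)))"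
        using assms sf_par_mult[OF sf_par_twist] unfolding df_par_def by presburger
    qed
  qed (simp add: wedge_eq)
qed

lemma df_par_fun: "sf_par k f \<Longrightarrow> df_par p k (fun_form f)"
  by (simp add: df_par_def dmonom_form_apply)

lemma df_par_cong: "even (k + l) \<Longrightarrow> df_par p k \<alpha> \<longleftrightarrow> df_par p l \<alpha>"
  unfolding df_par_def by (intro all_cong1 sf_par_cong) auto

context coordinate_dims
begin

abbreviation wedge_op :: "dform \<Rightarrow> dform \<Rightarrow> dform" (infixr "\<diamondop>" 70) where
  "\<alpha> \<diamondop> \<beta> \<equiv> wedge p \<alpha> \<beta>"

lemma finite_dmonoms [simp]: "finite (dmonoms p q n)"
proof (rule finite_subset)
  show "dmonoms p q n \<subseteq> multisets_of_size {..<p + q} n"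
    by (auto simp: dmonoms_def multisets_of_size_def)
qed auto

lemma dmonoms_not_repeats: "I \<in> dmonoms p q n \<Longrightarrow> \<not> repeats p I"
  by (auto simp: dmonoms_def repeats_def not_less)

lemma dmonoms_iff: "I \<in> dmonoms p q n \<longleftrightarrow> size I = n \<and> set_mset I \<subseteq> {..<p + q} \<and> \<not> repeats p I"
  unfolding dmonoms_def repeats_def by (simp only: mem_Collect_eq not_less[symmetric] not_ex not_all de_Morgan_conj) blast

lemma dmonoms_0 [simp]: "dmonoms p q 0 = {{#}}"
  by (auto simp: dmonoms_def)

lemma repeats_add_mset: "\<not> repeats p I \<Longrightarrow> repeats p (add_mset i I) \<longleftrightarrow> i < p \<and> i \<in># I"
proof -
  assume a: "\<not> repeats p I"
  have "repeats p (add_mset i I) \<longleftrightarrow> i < p \<and> 1 < count (add_mset i I) i"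
  proof
    assume "repeats p (add_mset i I)"
    then obtain j where j: "j < p" "1 < count (add_mset i I) j" by (auto simp: repeats_def)
    then have "j = i" using a by (auto simp: repeats_def split: if_splits)
    then show "i < p \<and> 1 < count (add_mset i I) i" using j by auto
  qed (auto simp: repeats_def)
  then show ?thesis by simp
qed

end

section \<open>Forms of fixed degree over a superdomain\<close>

context superdomain
begin

abbreviation "\<Omega> \<equiv> dforms p q V"
abbreviation "dX j \<equiv> dmonom_form {#j#} unit_sf"

lemma dformsD:
  assumes "\<omega> \<in> \<Omega> n"
  shows "\<omega> I \<in> S" "I \<notin> dmonoms p q n \<Longrightarrow> \<omega> I = 0"
  using assms by (auto simp: dforms_def zero_fun_def[symmetric] simp flip: sfuns_0)
    (metis sfuns_0)

lemma dformsI: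
  assumes "\<And>I. I \<in> dmonoms p q n \<Longrightarrow> \<omega> I \<in> S" "\<And>I. I \<notin> dmonoms p q n \<Longrightarrow> \<omega> I = 0"
  shows "\<omega> \<in> \<Omega> n"
  using assms by (auto simp: dforms_def zero_fun_def)

lemma dforms_0 [simp]: "0 \<in> \<Omega> n"
  by (rule dformsI) auto

lemma dforms_add: "\<alpha> \<in> \<Omega> n \<Longrightarrow> \<beta> \<in> \<Omega> n \<Longrightarrow> \<alpha> + \<beta> \<in> \<Omega> n"
  using dformsD[of \<alpha> n] dformsD[of \<beta> n] by (intro dformsI) (simp_all add: sfuns_add)

lemma dforms_scale: "\<alpha> \<in> \<Omega> n \<Longrightarrow> df_scale a \<alpha> \<in> \<Omega> n"
  using dformsD[of \<alpha> n] by (intro dformsI) (simp_all add: sfuns_scale df_scale_def)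

lemma dforms_minus: "\<alpha> \<in> \<Omega> n \<Longrightarrow> - \<alpha> \<in> \<Omega> n"
  using dforms_scale[of \<alpha> n "-1"] by (simp add: df_scale_minus_1)

lemma dforms_diff: "\<alpha> \<in> \<Omega> n \<Longrightarrow> \<beta> \<in> \<Omega> n \<Longrightarrow> \<alpha> - \<beta> \<in> \<Omega> n"
  using dforms_add[of \<alpha> n "- \<beta>"] by (simp add: dforms_minus)

lemma dforms_sum: "(\<And>i. i \<in> A \<Longrightarrow> \<alpha> i \<in> \<Omega> n) \<Longrightarrow> (\<Sum>i\<in>A. \<alpha> i) \<in> \<Omega> n"
  by (rule sum_closed[of "\<lambda>f. f \<in> \<Omega> n"]) (auto intro: dforms_add)

lemma dforms_fun: "f \<in> S \<Longrightarrow> fun_form f \<in> \<Omega> 0"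
  by (rule dformsI) (auto simp: dmonom_form_apply)

lemma dforms_0_iff: "\<alpha> \<in> \<Omega> 0 \<longleftrightarrow> (\<exists>f\<in>S. \<alpha> = fun_form f)"
proof
  assume a: "\<alpha> \<in> \<Omega> 0"
  then have "\<alpha> = fun_form (\<alpha> {#})"
    using dformsD(2)[OF a] by (auto simp: fun_eq_iff dmonom_form_apply)
  then show "\<exists>f\<in>S. \<alpha> = fun_form f" using dformsD(1)[OF a] by blast
qed (auto intro: dforms_fun)

lemma dforms_dX: "j < p + q \<Longrightarrow> dX j \<in> \<Omega> 1"
  by (rule dformsI) (auto simp: dmonom_form_apply dmonoms_def split: if_splits)

lemma dforms_wedge:
  assumes "\<alpha> \<in> \<Omega> n" "\<beta> \<in> \<Omega> m"
  shows "\<alpha> \<diamondop> \<beta> \<in> \<Omega> (n + m)"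
proof (rule dformsI)
  fix L
  show "(\<alpha> \<diamondop> \<beta>) L \<in> S"
    unfolding wedge_eq using dformsD(1)[OF assms(1)] dformsD(1)[OF assms(2)]
    by (auto intro!: sfuns_sum sfuns_scale sfuns_mult sfuns_twist)
  assume L: "L \<notin> dmonoms p q (n + m)"
  show "(\<alpha> \<diamondop> \<beta>) L = 0"
  proof (cases "repeats p L")
    case False
    have "sf_mult (sf_twist (odd_size p (L - I)) (\<alpha> I)) (\<beta> (L - I)) = 0" if "I \<subseteq># L" for I
    proof (rule ccontr)
      assume "\<not> ?thesis"
      then have "\<alpha> I \<noteq> 0" "\<beta> (L - I) \<noteq> 0" by auto
      then have "I \<in> dmonoms p q n" "L - I \<in> dmonoms p q m" using assms dformsD(2) by blast+
      then have "size L = n + m" "set_mset L \<subseteq> {..<p + q}"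
        using that unfolding dmonoms_iff
        by (metis size_union subset_mset.add_diff_inverse, metis le_sup_iff set_mset_union subset_mset.add_diff_inverse)
      then show False using False L by (simp add: dmonoms_iff)
    qed
    then show ?thesis by (simp add: wedge_eq)
  qed (simp add: wedge_eq)
qed

lemma wedge_fun_form_eq:
  assumes "\<alpha> \<in> \<Omega> n"
  shows "(\<alpha> \<diamondop> fun_form f) L = sf_mult (\<alpha> L) f" "(fun_form f \<diamondop> \<alpha>) L = sf_mult (sf_twist (odd_size p L) f) (\<alpha> L)"
proof -
  have "\<alpha> L = 0" if "repeats p L"
    using dformsD(2)[OF assms, of L] dmonoms_not_repeats[of L n] that by blast
  then show "(\<alpha> \<diamondop> fun_form f) L = sf_mult (\<alpha> L) f" "(fun_form f \<diamondop> \<alpha>) L = sf_mult (sf_twist (odd_size p L) f) (\<alpha> L)"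
    by (cases "repeats p L"; simp add: wedge_fun_right wedge_fun_left)+
qed

lemma wedge_unit [simp]:
  assumes "\<alpha> \<in> \<Omega> n"
  shows "\<alpha> \<diamondop> fun_form unit_sf = \<alpha>"
proof
  fix L
  show "(\<alpha> \<diamondop> fun_form unit_sf) L = \<alpha> L"
    using wedge_fun_form_eq(1)[OF assms] dformsD(1)[OF assms] by simp
qed

lemma sf_twist_unit [simp]: "sf_twist k unit_sf = unit_sf"
  by (auto simp: sf_twist_def sf_of_fun_def fun_eq_iff)

lemma wedge_dX:
  assumes "\<beta> L' \<in> S" "L' = L - {#j#}"
  shows "(dX j \<diamondop> \<beta>) L = (if repeats p L \<or> j \<notin># L then 0 else sf_scale (dmonom_sign p {#j#} (L - {#j#})) (\<beta> (L - {#j#})))"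
proof -
  have "(\<Sum>I\<in>{I. I \<subseteq># L}. sf_scale (dmonom_sign p I (L - I)) (sf_mult (sf_twist (odd_size p (L - I)) (dX j I)) (\<beta> (L - I))))
    = (\<Sum>I\<in>{I. I \<subseteq># L}. if I = {#j#} then sf_scale (dmonom_sign p {#j#} (L - {#j#})) (\<beta> (L - {#j#})) else 0)"
    using assms by (intro sum.cong[OF refl]) (auto simp: dmonom_form_apply)
  then show ?thesis by (simp add: wedge_eq sum.delta')
qed

lemma wedge_dX_dforms:
  assumes "\<beta> \<in> \<Omega> n"
  shows "(dX j \<diamondop> \<beta>) L = (if repeats p L \<or> j \<notin># L then 0 else sf_scale (dmonom_sign p {#j#} (L - {#j#})) (\<beta> (L - {#j#})))"
  using wedge_dX[OF dformsD(1)[OF assms] refl] .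

lemma df_par_dX: "df_par p (cpar p j) (dX j)"
  using sf_par_cong[of "cpar p j + cpar p j" 0 unit_sf] by (simp add: df_par_def dmonom_form_apply)

text \<open>In degree two each term pairs one differential of \<open>\<alpha>\<close> with one of
  \<open>\<beta>\<close>. Signs arise from exchanging the two differentials, the two coefficients,
  and each coefficient with the differential of the other form; the parities in their exponents
  combine to \<open>a * b\<close>.\<close>

lemma wedge_1_commute:
  assumes \<alpha>: "\<alpha> \<in> \<Omega> 1" "df_par p a \<alpha>" and \<beta>: "\<beta> \<in> \<Omega> 1" "df_par p b \<beta>"
  shows "\<alpha> \<diamondop> \<beta> = df_scale (- ((- 1) ^ (a * b))) (\<beta> \<diamondop> \<alpha>)"
proof
  fix L
  show "(\<alpha> \<diamondop> \<beta>) L = df_scale (- ((- 1) ^ (a * b))) (\<beta> \<diamondop> \<alpha>) L"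
  proof (cases "repeats p L")
    case False
    have "(\<Sum>I\<in>{I. I \<subseteq># L}. sf_scale (dmonom_sign p I (L - I)) (sf_mult (sf_twist (odd_size p (L - I)) (\<alpha> I)) (\<beta> (L - I)))) =
      (\<Sum>K\<in>{K. K \<subseteq># L}. sf_scale (- ((- 1) ^ (a * b))) (sf_scale (dmonom_sign p K (L - K)) (sf_mult (sf_twist (odd_size p (L - K)) (\<beta> K)) (\<alpha> (L - K)))))"
    proof (rule sum.reindex_bij_witness[of _ "\<lambda>I. L - I" "\<lambda>I. L - I"], goal_cases)
      case (5 I)
      then have IL: "I \<subseteq># L" by simp
      then have LI: "L - (L - I) = I" by (metis add_diff_cancel_right' subset_mset.add_diff_inverse)
      define K where "K = L - I"
      have "sf_scale (dmonom_sign p I K) (sf_mult (sf_twist (odd_size p K) (\<alpha> I)) (\<beta> K)) =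
          sf_scale (- ((- 1) ^ (a * b))) (sf_scale (dmonom_sign p K I) (sf_mult (sf_twist (odd_size p I) (\<beta> K)) (\<alpha> I)))"
      proof (cases "I \<in> dmonoms p q 1 \<and> K \<in> dmonoms p q 1")
        case True
        then obtain i k where ik: "I = {#i#}" "K = {#k#}"
          unfolding dmonoms_iff using size_1_singleton_mset by metis
        \<comment> \<open>For an even \<open>i = k\<close> the sign relation \<open>sg\<close> would
          fail, but then \<open>L\<close> repeats an even differential.\<close>
        have "\<not> (i = k \<and> i < p)"
        proof
          assume "i = k \<and> i < p"
          moreover have "L = {#i#} + {#k#}" using IL ik K_def by (metis subset_mset.add_diff_inverse)
          ultimately show False using False by (auto simp: repeats_def)
        qed
        then have sg: "dmonom_sign p I K = - ((- 1) ^ (cpar p i * cpar p k)) * dmonom_sign p K I"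
          unfolding ik dmonom_sign_single by (auto simp: cpar_def)
        have pa: "sf_par (a + cpar p i) (\<alpha> I)" "sf_par (b + cpar p k) (\<beta> K)"
          using assms unfolding df_par_def by (metis ik odd_size_single)+
        have "sf_mult (sf_twist (odd_size p K) (\<alpha> I)) (\<beta> K) = sf_mult (\<beta> K) (sf_twist (b + cpar p k + odd_size p K) (\<alpha> I))"
          by (subst sf_mult_commute[OF pa(2)]) simp
        also have "\<dots> = sf_scale ((- 1) ^ ((b + cpar p k + cpar p k) * (a + cpar p i))) (sf_mult (\<beta> K) (\<alpha> I))"
          using sf_twist_par[OF pa(1)] by (simp add: ik sf_mult_scale_right)
        also have "sf_mult (\<beta> K) (\<alpha> I) = sf_scale ((- 1) ^ (cpar p i * (b + cpar p k))) (sf_mult (sf_twist (odd_size p I) (\<beta> K)) (\<alpha> I))"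
          using sf_twist_par[OF pa(2)] by (simp add: ik sf_mult_scale_left)
        finally show ?thesis
          unfolding sg by (simp add: power_add algebra_simps)
      next
        case False
        then have "\<alpha> I = 0 \<or> \<beta> K = 0" using dformsD(2)[OF \<alpha>(1)] dformsD(2)[OF \<beta>(1)] by blast
        then show ?thesis by auto
      qed
      then show ?case by (simp only: K_def LI)
    qed (auto simp: multiset_eq_iff, (metis diff_diff_cancel mset_subset_eq_count)+)
    then show ?thesis using False by (simp add: wedge_eq df_scale_def sf_scale_sum)
  qed (simp add: wedge_eq df_scale_def)
qed

lemma wedge_1_self:
  assumes \<alpha>: "\<alpha> \<in> \<Omega> 1" "df_par p a \<alpha>" and a: "even a"
  shows "\<alpha> \<diamondop> \<alpha> = 0"
proof -
  have "(- 1 :: real) ^ (a * a) = 1" using a by simp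
  then have "\<alpha> \<diamondop> \<alpha> = - (\<alpha> \<diamondop> \<alpha>)"
    using wedge_1_commute[OF \<alpha> \<alpha>] by (simp add: df_scale_minus_1)
  then show ?thesis by (simp add: fun_eq_iff)
qed

lemma fun_wedge_commute:
  assumes \<alpha>: "\<alpha> \<in> \<Omega> n" "df_par p a \<alpha>"
  shows "fun_form h \<diamondop> \<alpha> = \<alpha> \<diamondop> fun_form (sf_twist a h)"
proof
  fix L
  have "sf_mult (sf_twist (odd_size p L) h) (\<alpha> L) = sf_mult (\<alpha> L) (sf_twist (a + odd_size p L) (sf_twist (odd_size p L) h))"
    using \<alpha>(2) unfolding df_par_def by (intro sf_mult_commute) blast
  also have "sf_twist (a + odd_size p L) (sf_twist (odd_size p L) h) = sf_twist a h"
    unfolding sf_twist_twist by (rule sf_twist_cong) auto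
  finally show "(fun_form h \<diamondop> \<alpha>) L = (\<alpha> \<diamondop> fun_form (sf_twist a h)) L"
    by (simp add: wedge_fun_form_eq[OF \<alpha>(1)])
qed

end

section \<open>Exterior derivative, pullback and Lie derivative\<close>

lemmas fun_ops_apply = plus_fun_apply zero_fun_apply minus_apply uminus_apply

text \<open>As rewrite rules these would unfold the algebra of superfunctions and forms wherever a term is
  eta-expanded.\<close>

declare fun_ops_apply [simp del] One_nat_def [simp del]

lemma dmonom_sign_add_mset_right:
  "dmonom_sign p A (add_mset y B) = dmonom_sign p A {#y#} * dmonom_sign p A B"
  using dmonom_sign_add_right[of p A "{#y#}" B] by simp

lemma dmonom_sign_add_mset_left:
  "dmonom_sign p (add_mset y A) B = dmonom_sign p {#y#} B * dmonom_sign p A B"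
  using dmonom_sign_add_left[of p "{#y#}" A B] by simp

lemma dmonom_sign_le: "(\<And>k. k \<in># B \<Longrightarrow> j \<le> k) \<Longrightarrow> dmonom_sign p {#j#} B = 1"
proof (induction B)
  case (add k B)
  then show ?case using dmonom_sign_add_mset_right[of p "{#j#}" k B]
    by (auto simp: dmonom_sign_single not_less)
qed simp

text \<open>The left side is the sign in \<open>ext_d\<close>, where the new differential is
  appended on the right. With the differential in front there remain the sign of multiplying by
  \<open>dx^j\<close> from the left and the sign that the derivative picks up when it passes the odd
  differentials of \<open>I\<close>, as in \<open>npd\<close>.\<close>

lemma dmonom_sign_swap:
  "\<not> (j < p \<and> j \<in># I) \<Longrightarrow>
    (- 1) ^ size I * dmonom_sign p I {#j#} = dmonom_sign p {#j#} I * (- 1) ^ (cpar p j * odd_size p I)"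
proof (induction I)
  case (add k I)
  let ?a = "dmonom_sign p {#k#} {#j#}" and ?b = "dmonom_sign p {#j#} {#k#}" and ?e = "(- 1 :: real) ^ (cpar p j * cpar p k)"
  have 1: "- ?a = ?b * ?e"
    using add.prems by (auto simp: dmonom_sign_single cpar_def)
  have 2: "(- 1) ^ size I * dmonom_sign p I {#j#} = dmonom_sign p {#j#} I * (- 1) ^ (cpar p j * odd_size p I)"
    using add.IH add.prems by simp
  have "(- 1) ^ size (add_mset k I) * dmonom_sign p (add_mset k I) {#j#} = - ?a * ((- 1) ^ size I * dmonom_sign p I {#j#})"
    using dmonom_sign_add_mset_left[of p k I "{#j#}"] by simp
  also have "\<dots> = (?b * dmonom_sign p {#j#} I) * (?e * (- 1) ^ (cpar p j * odd_size p I))"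
    unfolding 1 2 by simp
  also have "\<dots> = dmonom_sign p {#j#} (add_mset k I) * (- 1) ^ (cpar p j * odd_size p (add_mset k I))"
    using dmonom_sign_add_mset_right[of p "{#j#}" k I] by (simp add: distrib_left power_add)
  finally show ?case .
qed simp

text \<open>The partial derivative applied to a whole form from the left, so that it passes the
  differentials before it reaches the coefficient. With it \<open>d\<close> becomes the sum of the
  \<open>dX i \<diamondop> npd p V i\<close>, and the rules for \<open>d\<close> follow from those
  of \<open>dX\<close> and \<open>npd\<close> by algebra.\<close>

definition npd :: "nat \<Rightarrow> (nat \<Rightarrow> real) set \<Rightarrow> nat \<Rightarrow> dform \<Rightarrow> dform" where
  "npd p V i \<alpha> = (\<lambda>I. sf_scale ((- 1) ^ (cpar p i * odd_size p I)) (sf_pderiv p V i (\<alpha> I)))"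

lemma npd_apply: "npd p V i \<alpha> I = sf_scale ((- 1) ^ (cpar p i * odd_size p I)) (sf_pderiv p V i (\<alpha> I))"
  by (simp add: npd_def)

context superdomain
begin

lemma dforms_wedge_1: "\<alpha> \<in> \<Omega> 1 \<Longrightarrow> \<beta> \<in> \<Omega> n \<Longrightarrow> \<alpha> \<diamondop> \<beta> \<in> \<Omega> (Suc n)"
  using dforms_wedge[of \<alpha> 1 \<beta> n] by (simp add: One_nat_def)

lemma npd_dforms: "\<alpha> \<in> \<Omega> n \<Longrightarrow> i < p + q \<Longrightarrow> npd p V i \<alpha> \<in> \<Omega> n"
  using dformsD[of \<alpha> n] by (intro dformsI) (simp_all add: npd_apply sfuns_scale sf_pderiv_in_sfuns)

lemma npd_add: "\<alpha> \<in> \<Omega> n \<Longrightarrow> \<beta> \<in> \<Omega> n \<Longrightarrow> i < p + q \<Longrightarrow> npd p V i (\<alpha> + \<beta>) = npd p V i \<alpha> + npd p V i \<beta>"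
  using dformsD(1)[of \<alpha> n] dformsD(1)[of \<beta> n]
  by (intro ext[of "npd p V i (\<alpha> + \<beta>)"]) (simp add: npd_apply sf_pderiv_add sf_scale_add fun_ops_apply)

lemma npd_scale: "\<alpha> \<in> \<Omega> n \<Longrightarrow> i < p + q \<Longrightarrow> npd p V i (df_scale a \<alpha>) = df_scale a (npd p V i \<alpha>)"
  using dformsD(1)[of \<alpha> n]
  by (intro ext[of "npd p V i (df_scale a \<alpha>)"]) (simp add: npd_apply df_scale_def sf_pderiv_scale mult.commute)

lemma npd_fun: "npd p V i (fun_form f) = fun_form (pd i f)"
  by (intro ext[of "npd p V i (fun_form f)"]) (simp add: npd_apply dmonom_form_apply)

lemma npd_fun_wedge:
  assumes h: "h \<in> S" and b: "\<beta> \<in> \<Omega> n" and i: "i < p + q"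
  shows "npd p V i (fun_form h \<diamondop> \<beta>) = fun_form (pd i h) \<diamondop> \<beta> + fun_form (sf_twist (cpar p i) h) \<diamondop> npd p V i \<beta>"
proof
  fix I
  let ?c = "cpar p i" and ?o = "odd_size p I"
  have "npd p V i (fun_form h \<diamondop> \<beta>) I = sf_scale ((- 1) ^ (?c * ?o)) (pd i (sf_mult (sf_twist ?o h) (\<beta> I)))"
    by (simp add: npd_apply wedge_fun_form_eq[OF b])
  also have "pd i (sf_mult (sf_twist ?o h) (\<beta> I)) = sf_scale ((- 1) ^ (?o * ?c)) (sf_mult (sf_twist ?o (pd i h)) (\<beta> I))
      + sf_mult (sf_twist (?c + ?o) h) (pd i (\<beta> I))"
    by (simp add: sf_pderiv_mult[OF sfuns_twist[OF h] dformsD(1)[OF b] i] sf_pderiv_twist[OF h i] sf_mult_scale_left)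
  finally show "npd p V i (fun_form h \<diamondop> \<beta>) I = (fun_form (pd i h) \<diamondop> \<beta> + fun_form (sf_twist ?c h) \<diamondop> npd p V i \<beta>) I"
    by (simp add: wedge_fun_form_eq[OF b] wedge_fun_form_eq[OF npd_dforms[OF b i]] sf_scale_add mult.commute[of ?o]
        sf_mult_scale_right npd_apply add.commute plus_fun_apply[of _ _ I])
qed

lemma npd_dX_wedge:
  assumes b: "\<beta> \<in> \<Omega> n" and i: "i < p + q"
  shows "npd p V i (dX j \<diamondop> \<beta>) = df_scale ((- 1) ^ (cpar p i * cpar p j)) (dX j \<diamondop> npd p V i \<beta>)"
proof
  fix L
  show "npd p V i (dX j \<diamondop> \<beta>) L = df_scale ((- 1) ^ (cpar p i * cpar p j)) (dX j \<diamondop> npd p V i \<beta>) L"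
  proof (cases "repeats p L \<or> j \<notin># L")
    case False
    then have "odd_size p L = cpar p j + odd_size p (L - {#j#})"
      by (metis insert_DiffM odd_size_add_mset)
    then show ?thesis
      using False by (simp add: npd_apply wedge_dX_dforms[OF b] wedge_dX_dforms[OF npd_dforms[OF b i]] df_scale_def
          sf_pderiv_scale[OF dformsD(1)[OF b] i] power_add algebra_simps)
  qed (simp add: npd_apply wedge_dX_dforms[OF b] wedge_dX_dforms[OF npd_dforms[OF b i]] df_scale_def)
qed

lemma npd_commute:
  assumes a: "\<alpha> \<in> \<Omega> n" and i: "i < p + q" and j: "j < p + q"
  shows "npd p V i (npd p V j \<alpha>) = df_scale ((- 1) ^ (cpar p i * cpar p j)) (npd p V j (npd p V i \<alpha>))"
proof
  fix I
  note S = dformsD(1)[OF a, of I]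
  show "npd p V i (npd p V j \<alpha>) I = df_scale ((- 1) ^ (cpar p i * cpar p j)) (npd p V j (npd p V i \<alpha>)) I"
    unfolding npd_apply df_scale_def
      sf_pderiv_scale[OF sf_pderiv_in_sfuns[OF S j] i] sf_pderiv_scale[OF sf_pderiv_in_sfuns[OF S i] j]
    by (subst sf_pderiv_commute[OF S i j]) (simp add: mult_ac)
qed

lemma ext_d_eq:
  assumes a: "\<alpha> \<in> \<Omega> n"
  shows "ext_d p q V \<alpha> = (\<Sum>i<p + q. dX i \<diamondop> npd p V i \<alpha>)"
proof
  fix L
  have R: "(\<Sum>i<p + q. dX i \<diamondop> npd p V i \<alpha>) \<in> \<Omega> (1 + n)"
    by (intro dforms_sum dforms_wedge dforms_dX npd_dforms a) auto
  show "ext_d p q V \<alpha> L = (\<Sum>i<p + q. dX i \<diamondop> npd p V i \<alpha>) L"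
  proof (cases "L \<in> dmonoms p q (size L)")
    case True
    then have nr: "\<not> repeats p L" and sub: "set_mset L \<subseteq> {..<p + q}" by (auto simp: dmonoms_iff)
    have "ext_d p q V \<alpha> L = (\<Sum>j\<in>set_mset L. sf_scale ((- 1) ^ size (L - {#j#}) * dmonom_sign p (L - {#j#}) {#j#}) (pd j (\<alpha> (L - {#j#}))))"
      using True by (simp add: ext_d_def sf_scale_def fun_eq_iff sum_fun_apply)
    also have "\<dots> = (\<Sum>j\<in>set_mset L. (dX j \<diamondop> npd p V j \<alpha>) L)"
    proof (rule sum.cong[OF refl])
      fix j assume j: "j \<in> set_mset L"
      then have jn: "j < p + q" using sub by auto
      have "\<not> (j < p \<and> j \<in># L - {#j#})"
        using nr repeats_add_mset[of "L - {#j#}" j] j repeats_mono[of p "L - {#j#}" L] by auto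
      from dmonom_sign_swap[OF this]
      show "sf_scale ((- 1) ^ size (L - {#j#}) * dmonom_sign p (L - {#j#}) {#j#}) (pd j (\<alpha> (L - {#j#}))) = (dX j \<diamondop> npd p V j \<alpha>) L"
        using nr j unfolding wedge_dX_dforms[OF npd_dforms[OF a jn]] by (simp add: npd_apply)
    qed
    also have "\<dots> = (\<Sum>j<p + q. (dX j \<diamondop> npd p V j \<alpha>) L)"
      using wedge_dX_dforms[OF npd_dforms[OF a]] sub by (intro sum.mono_neutral_left) auto
    finally show ?thesis by (simp add: sum_fun_apply)
  next
    case False
    then have "L \<notin> dmonoms p q (1 + n)" by (auto simp: dmonoms_iff)
    from dformsD(2)[OF R this] show ?thesis using False by (simp add: ext_d_def zero_fun_def)
  qed
qed

lemma ext_d_dforms: "\<alpha> \<in> \<Omega> n \<Longrightarrow> ext_d p q V \<alpha> \<in> \<Omega> (Suc n)"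
  unfolding ext_d_eq by (intro dforms_sum dforms_wedge_1 dforms_dX npd_dforms) auto

lemma ext_d_add: "\<alpha> \<in> \<Omega> n \<Longrightarrow> \<beta> \<in> \<Omega> n \<Longrightarrow> ext_d p q V (\<alpha> + \<beta>) = ext_d p q V \<alpha> + ext_d p q V \<beta>"
  by (simp add: ext_d_eq[of \<alpha> n] ext_d_eq[of \<beta> n] ext_d_eq[OF dforms_add] npd_add wedge_add_right sum.distrib)

lemma ext_d_0 [simp]: "ext_d p q V 0 = 0"
  by (intro ext) (simp add: ext_d_def zero_fun_def[symmetric] fun_ops_apply)

lemma ext_d_scale: "\<alpha> \<in> \<Omega> n \<Longrightarrow> ext_d p q V (df_scale a \<alpha>) = df_scale a (ext_d p q V \<alpha>)"
  by (simp add: ext_d_eq[of \<alpha> n] ext_d_eq[OF dforms_scale] npd_scale wedge_scale_right df_scale_sum)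

lemma ext_d_diff: "\<alpha> \<in> \<Omega> n \<Longrightarrow> \<beta> \<in> \<Omega> n \<Longrightarrow> ext_d p q V (\<alpha> - \<beta>) = ext_d p q V \<alpha> - ext_d p q V \<beta>"
  using ext_d_add[of \<alpha> n "- \<beta>"] ext_d_scale[of \<beta> n "-1"] by (simp add: dforms_minus df_scale_minus_1)

lemma ext_d_sum: "(\<And>k. k \<in> A \<Longrightarrow> f k \<in> \<Omega> n) \<Longrightarrow> ext_d p q V (\<Sum>k\<in>A. f k) = (\<Sum>k\<in>A. ext_d p q V (f k))"
  by (rule additive_on_sum(2)[of "\<Omega> n" "ext_d p q V"]) (auto simp: ext_d_add intro: dforms_add)

lemma sf_d_eq: "f \<in> S \<Longrightarrow> sf_d p q V f = (\<Sum>i<p + q. dX i \<diamondop> fun_form (pd i f))"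
  by (simp add: sf_d_def ext_d_eq[OF dforms_fun] npd_fun)

lemma sf_d_dforms: "f \<in> S \<Longrightarrow> sf_d p q V f \<in> \<Omega> 1"
  using ext_d_dforms[OF dforms_fun, of f] by (simp add: sf_d_def One_nat_def)

lemma sf_d_apply:
  assumes "f \<in> S" shows "j < p + q \<Longrightarrow> sf_d p q V f {#j#} = pd j f" "size I \<noteq> 1 \<Longrightarrow> sf_d p q V f I = 0"
proof -
  assume j: "j < p + q"
  then have "{#j#} \<in> dmonoms p q 1" by (auto simp: dmonoms_def)
  then show "sf_d p q V f {#j#} = pd j f"
    by (simp add: sf_d_def ext_d_def dmonom_form_apply fun_eq_iff One_nat_def)
next
  assume "size I \<noteq> 1"
  then show "sf_d p q V f I = 0" using dformsD(2)[OF sf_d_dforms[OF assms], of I] by (auto simp: dmonoms_def)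
qed

lemma wedge_dX_fun: "(dX i \<diamondop> fun_form f) = dmonom_form {#i#} (sf_mult unit_sf f)"
  by (rule ext) (simp add: wedge_fun_right dmonom_form_apply repeats_def)

lemma sf_d_coord: "j < p + q \<Longrightarrow> sf_d p q V (X j) = dX j"
proof -
  assume j: "j < p + q"
  have "sf_d p q V (X j) = (\<Sum>i<p + q. if i = j then dX j else 0)"
    unfolding sf_d_eq[OF sf_coord_in_sfuns[OF j]]
    by (rule sum.cong) (use j in \<open>auto simp: sf_pderiv_coord wedge_dX_fun\<close>)
  then show ?thesis using j by simp
qed

lemma sf_d_add: "f \<in> S \<Longrightarrow> g \<in> S \<Longrightarrow> sf_d p q V (f + g) = sf_d p q V f + sf_d p q V g"
  by (simp add: sf_d_def dmonom_form_add ext_d_add[OF dforms_fun dforms_fun])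

lemma sf_d_sum: "(\<And>k. k \<in> A \<Longrightarrow> f k \<in> S) \<Longrightarrow> sf_d p q V (\<Sum>k\<in>A. f k) = (\<Sum>k\<in>A. sf_d p q V (f k))"
  unfolding sf_d_def dmonom_form_sum by (rule ext_d_sum) (rule dforms_fun)

lemma sf_d_scale: "f \<in> S \<Longrightarrow> sf_d p q V (sf_scale a f) = df_scale a (sf_d p q V f)"
  by (simp add: sf_d_def dmonom_form_scale ext_d_scale[OF dforms_fun])

lemma df_par_add: "df_par p k \<alpha> \<Longrightarrow> df_par p k \<beta> \<Longrightarrow> df_par p k (\<alpha> + \<beta>)"
  by (simp add: df_par_def sf_par_add fun_ops_apply)

lemma df_par_sum: "(\<And>i. i \<in> A \<Longrightarrow> df_par p k (f i)) \<Longrightarrow> df_par p k (\<Sum>i\<in>A. f i)"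
  by (rule sum_closed[of "df_par p k"]) (auto simp: df_par_add, simp add: df_par_def fun_ops_apply)

lemma df_par_sf_d: "f \<in> S \<Longrightarrow> sf_par k f \<Longrightarrow> df_par p k (sf_d p q V f)"
proof -
  assume f: "f \<in> S" "sf_par k f"
  have "df_par p k (dX i \<diamondop> fun_form (pd i f))" for i
    using df_par_wedge[OF df_par_dX df_par_fun[OF sf_par_pderiv[OF f]], of i i] df_par_cong[of "cpar p i + (k + cpar p i)" k p] by auto
  then show ?thesis unfolding sf_d_eq[OF f(1)] by (intro df_par_sum)
qed

section \<open>Leibniz rules and the square of the exterior derivative\<close>

lemma dX_commute: "i < p + q \<Longrightarrow> j < p + q \<Longrightarrow> dX i \<diamondop> dX j = df_scale (- ((- 1) ^ (cpar p i * cpar p j))) (dX j \<diamondop> dX i)"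
  by (rule wedge_1_commute[OF dforms_dX df_par_dX dforms_dX df_par_dX])

lemma dX_dX_wedge:
  assumes "i < p + q" "j < p + q"
  shows "dX i \<diamondop> dX j \<diamondop> \<gamma> = df_scale (- ((- 1) ^ (cpar p i * cpar p j))) (dX j \<diamondop> dX i \<diamondop> \<gamma>)"
  by (simp add: wedge_assoc[symmetric] dX_commute[OF assms] wedge_scale_left)

lemma ext_d_fun_wedge:
  assumes h: "h \<in> S" and b: "\<beta> \<in> \<Omega> n"
  shows "ext_d p q V (fun_form h \<diamondop> \<beta>) = sf_d p q V h \<diamondop> \<beta> + fun_form h \<diamondop> ext_d p q V \<beta>"
proof -
  have "fun_form h \<diamondop> \<beta> \<in> \<Omega> n" using dforms_wedge[OF dforms_fun[OF h] b] by simp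
  then have "ext_d p q V (fun_form h \<diamondop> \<beta>) = (\<Sum>i<p + q. dX i \<diamondop> npd p V i (fun_form h \<diamondop> \<beta>))"
    by (rule ext_d_eq)
  also have "\<dots> = (\<Sum>i<p + q. (dX i \<diamondop> fun_form (pd i h)) \<diamondop> \<beta> + fun_form h \<diamondop> (dX i \<diamondop> npd p V i \<beta>))"
  proof (rule sum.cong[OF refl])
    fix i assume "i \<in> {..<p + q}"
    then have i: "i < p + q" by simp
    have "fun_form h \<diamondop> dX i = dX i \<diamondop> fun_form (sf_twist (cpar p i) h)"
      by (rule fun_wedge_commute[OF dforms_dX[OF i] df_par_dX])
    then show "dX i \<diamondop> npd p V i (fun_form h \<diamondop> \<beta>) = (dX i \<diamondop> fun_form (pd i h)) \<diamondop> \<beta> + fun_form h \<diamondop> (dX i \<diamondop> npd p V i \<beta>)"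
      by (simp add: npd_fun_wedge[OF h b i] wedge_add_right wedge_assoc[symmetric])
  qed
  finally show ?thesis
    by (simp add: sum.distrib sf_d_eq[OF h] ext_d_eq[OF b] wedge_sum_left wedge_sum_right)
qed

text \<open>Moving \<open>npd\<close> past \<open>dX j\<close> and \<open>dX i\<close> past
  \<open>dX j\<close> gives the same sign of parities twice; what is left is the \<open>- 1\<close>
  of two differentials changing places.\<close>

lemma ext_d_dX_wedge:
  assumes b: "\<beta> \<in> \<Omega> n" and j: "j < p + q"
  shows "ext_d p q V (dX j \<diamondop> \<beta>) = - (dX j \<diamondop> ext_d p q V \<beta>)"
proof -
  have "ext_d p q V (dX j \<diamondop> \<beta>) = (\<Sum>i<p + q. dX i \<diamondop> npd p V i (dX j \<diamondop> \<beta>))"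
    using dforms_wedge[OF dforms_dX[OF j] b] by (rule ext_d_eq)
  also have "\<dots> = (\<Sum>i<p + q. df_scale (- 1) (dX j \<diamondop> dX i \<diamondop> npd p V i \<beta>))"
    using j by (intro sum.cong refl)
      (simp add: npd_dX_wedge[OF b] wedge_scale_right dX_dX_wedge[of _ j])
  finally show ?thesis
    by (simp add: ext_d_eq[OF b] wedge_sum_right df_scale_minus_1 sum_negf)
qed

text \<open>Second derivatives commute up to a sign of parities, and differentials anticommute up to
  the same sign; so the double sum \<open>?T\<close> equals its own negative.\<close>

lemma ext_d_ext_d:
  assumes a: "\<alpha> \<in> \<Omega> n"
  shows "ext_d p q V (ext_d p q V \<alpha>) = 0"
proof -
  let ?T = "\<Sum>i<p + q. \<Sum>j<p + q. dX j \<diamondop> dX i \<diamondop> npd p V i (npd p V j \<alpha>)"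
  have "ext_d p q V (ext_d p q V \<alpha>) = (\<Sum>j<p + q. ext_d p q V (dX j \<diamondop> npd p V j \<alpha>))"
    unfolding ext_d_eq[OF a] by (rule ext_d_sum[of _ _ "Suc n"]) (auto intro!: dforms_wedge_1 dforms_dX npd_dforms a)
  also have "\<dots> = (\<Sum>j<p + q. - (dX j \<diamondop> (\<Sum>i<p + q. dX i \<diamondop> npd p V i (npd p V j \<alpha>))))"
    by (intro sum.cong refl) (simp add: ext_d_dX_wedge[OF npd_dforms[OF a]] ext_d_eq[OF npd_dforms[OF a]])
  also have "\<dots> = - (\<Sum>j<p + q. \<Sum>i<p + q. dX j \<diamondop> dX i \<diamondop> npd p V i (npd p V j \<alpha>))"
    by (simp add: wedge_sum_right sum_negf)
  also have "(\<Sum>j<p + q. \<Sum>i<p + q. dX j \<diamondop> dX i \<diamondop> npd p V i (npd p V j \<alpha>)) = ?T"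
    by (rule sum.swap)
  finally have "ext_d p q V (ext_d p q V \<alpha>) = - ?T" .
  moreover have "?T = - ?T"
  proof -
    have "?T = (\<Sum>i<p + q. \<Sum>j<p + q. - (dX i \<diamondop> dX j \<diamondop> npd p V j (npd p V i \<alpha>)))"
    proof (intro sum.cong refl)
      fix i j assume "i \<in> {..<p + q}" "j \<in> {..<p + q}"
      then have ij: "i < p + q" "j < p + q" by auto
      have e: "cpar p j * cpar p i = cpar p i * cpar p j" by simp
      show "dX j \<diamondop> dX i \<diamondop> npd p V i (npd p V j \<alpha>) = - (dX i \<diamondop> dX j \<diamondop> npd p V j (npd p V i \<alpha>))"
        unfolding npd_commute[OF a ij] dX_dX_wedge[OF ij(2,1)] wedge_scale_right e
        by (simp add: df_scale_minus_1)
    qed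
    also have "\<dots> = - (\<Sum>i<p + q. \<Sum>j<p + q. dX i \<diamondop> dX j \<diamondop> npd p V j (npd p V i \<alpha>))"
      by (simp add: sum_negf)
    also have "(\<Sum>i<p + q. \<Sum>j<p + q. dX i \<diamondop> dX j \<diamondop> npd p V j (npd p V i \<alpha>)) = ?T"
      by (rule sum.swap)
    finally show ?thesis .
  qed
  then have "?T = 0" by (simp add: fun_eq_iff fun_ops_apply)
  ultimately show ?thesis by simp
qed

lemma sum_dX_sf_d_pd:
  assumes g: "g \<in> S"
  shows "(\<Sum>j<p + q. dX j \<diamondop> sf_d p q V (pd j g)) = 0"
proof -
  have "ext_d p q V (sf_d p q V g) = (\<Sum>j<p + q. ext_d p q V (dX j \<diamondop> fun_form (pd j g)))"
    unfolding sf_d_eq[OF g] by (rule ext_d_sum[of _ _ "Suc 0"]) (auto intro!: dforms_wedge_1 dforms_dX dforms_fun sf_pderiv_in_sfuns g)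
  also have "\<dots> = (\<Sum>j<p + q. - (dX j \<diamondop> sf_d p q V (pd j g)))"
    by (intro sum.cong refl) (simp add: ext_d_dX_wedge[OF dforms_fun[OF sf_pderiv_in_sfuns[OF g]]] sf_d_def)
  finally show ?thesis using ext_d_ext_d[OF dforms_fun[OF g]] by (simp add: sum_negf sf_d_def)
qed

text \<open>The analogue of \<open>ext_d_dX_wedge\<close> for the differential of any function. A
  pullback replaces the coordinate differentials by such differentials
  \<open>d(\<theta>(x^i))\<close>.\<close>

lemma ext_d_sf_d_wedge:
  assumes g: "g \<in> S" and b: "\<beta> \<in> \<Omega> n"
  shows "ext_d p q V (sf_d p q V g \<diamondop> \<beta>) = - (sf_d p q V g \<diamondop> ext_d p q V \<beta>)"
proof -
  have gb: "fun_form (pd j g) \<diamondop> \<beta> \<in> \<Omega> n" if "j < p + q" for j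
    using dforms_wedge[OF dforms_fun[OF sf_pderiv_in_sfuns[OF g that]] b] by simp
  have "ext_d p q V (sf_d p q V g \<diamondop> \<beta>) = (\<Sum>j<p + q. ext_d p q V (dX j \<diamondop> fun_form (pd j g) \<diamondop> \<beta>))"
    unfolding sf_d_eq[OF g] wedge_sum_left wedge_assoc
    by (rule ext_d_sum[of _ _ "Suc n"]) (auto intro!: dforms_wedge_1 dforms_dX gb)
  also have "\<dots> = (\<Sum>j<p + q. - (dX j \<diamondop> (sf_d p q V (pd j g) \<diamondop> \<beta> + fun_form (pd j g) \<diamondop> ext_d p q V \<beta>)))"
    by (intro sum.cong refl) (simp add: ext_d_dX_wedge[OF gb] ext_d_fun_wedge[OF sf_pderiv_in_sfuns[OF g] b])
  also have "\<dots> = - ((\<Sum>j<p + q. dX j \<diamondop> sf_d p q V (pd j g)) \<diamondop> \<beta> + sf_d p q V g \<diamondop> ext_d p q V \<beta>)"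
    by (simp add: sum_subtractf sum_negf wedge_add_right sum.distrib wedge_sum_left sf_d_eq[OF g] wedge_assoc)
  finally show ?thesis by (simp add: sum_dX_sf_d_pd[OF g])
qed

subsection \<open>Monomials in a coframe\<close>

text \<open>Sorting a product of 1-forms uses nothing but their parities. So the families
  \<open>d(\<theta>(x^j))\<close> and \<open>d(D(x^j))\<close> are subject to the same sorting rules
  as the \<open>dx^j\<close>, even where they are linearly dependent.\<close>

definition coframe :: "(nat \<Rightarrow> dform) \<Rightarrow> bool" where
  "coframe U \<longleftrightarrow> (\<forall>j<p + q. U j \<in> \<Omega> 1 \<and> df_par p (cpar p j) (U j))"

definition wlist :: "(nat \<Rightarrow> dform) \<Rightarrow> nat list \<Rightarrow> dform" where
  "wlist U xs = foldr (wedge p) (map U xs) (fun_form unit_sf)"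

lemma wlist_simps [simp]: "wlist U [] = fun_form unit_sf" "wlist U (x # xs) = U x \<diamondop> wlist U xs"
  by (simp_all add: wlist_def)

text \<open>The sum over the positions \<open>r\<close> in \<open>lie_deriv\<close>, in recursive
  form; see \<open>sum_wlist_update\<close>.\<close>

primrec wlist_deriv :: "(nat \<Rightarrow> dform) \<Rightarrow> (nat \<Rightarrow> dform) \<Rightarrow> nat list \<Rightarrow> dform" where
  "wlist_deriv U W [] = 0"
| "wlist_deriv U W (x # xs) = W x \<diamondop> wlist U xs + U x \<diamondop> wlist_deriv U W xs"

lemma coframe_dX: "coframe (\<lambda>j. dX j)"
  by (simp add: coframe_def dforms_dX df_par_dX)

lemma wlist_dforms: "coframe U \<Longrightarrow> set xs \<subseteq> {..<p + q} \<Longrightarrow> wlist U xs \<in> \<Omega> (length xs)"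
proof (induction xs)
  case Nil
  then show ?case by (simp add: dforms_fun)
next
  case (Cons x xs)
  then show ?case using dforms_wedge_1[of "U x" "wlist U xs" "length xs"] by (simp add: coframe_def)
qed

lemma wlist_deriv_dforms:
  "coframe U \<Longrightarrow> coframe W \<Longrightarrow> set xs \<subseteq> {..<p + q} \<Longrightarrow> wlist_deriv U W xs \<in> \<Omega> (length xs)"
proof (induction xs)
  case (Cons x xs)
  then show ?case using dforms_wedge_1[of "U x" "wlist_deriv U W xs" "length xs"]
    dforms_wedge_1[of "W x" "wlist U xs" "length xs"] wlist_dforms[of U xs] by (simp add: coframe_def dforms_add)
qed simp

lemma df_par_wlist: "coframe U \<Longrightarrow> set xs \<subseteq> {..<p + q} \<Longrightarrow> df_par p (odd_size p (mset xs)) (wlist U xs)"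
proof (induction xs)
  case Nil
  then show ?case by (simp add: df_par_fun)
next
  case (Cons x xs)
  then show ?case by (auto simp: coframe_def intro!: df_par_wedge)
qed

lemma df_par_wlist_deriv:
  "coframe U \<Longrightarrow> coframe W \<Longrightarrow> set xs \<subseteq> {..<p + q} \<Longrightarrow> df_par p (odd_size p (mset xs)) (wlist_deriv U W xs)"
proof (induction xs)
  case Nil
  have "df_par p k 0" for k by (simp add: df_par_def zero_fun_apply)
  then show ?case by simp
next
  case (Cons x xs)
  then show ?case using df_par_wlist[of U xs] by (auto simp: coframe_def intro!: df_par_wedge df_par_add)
qed

lemma coframe_commute:
  assumes "coframe U" "coframe W" "i < p + q" "j < p + q"
  shows "U i \<diamondop> W j \<diamondop> \<gamma> = df_scale (- ((- 1) ^ (cpar p i * cpar p j))) (W j \<diamondop> U i \<diamondop> \<gamma>)"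
proof -
  have "U i \<diamondop> W j = df_scale (- ((- 1) ^ (cpar p i * cpar p j))) (W j \<diamondop> U i)"
    using assms by (intro wedge_1_commute) (auto simp: coframe_def)
  then show ?thesis by (simp add: wedge_assoc[symmetric] wedge_scale_left)
qed

lemma coframe_self:
  assumes "coframe U" "i < p"
  shows "U i \<diamondop> U i \<diamondop> \<gamma> = 0"
proof -
  have "U i \<diamondop> U i = 0"
    using assms by (intro wedge_1_self[of _ "cpar p i"]) (auto simp: coframe_def, simp add: cpar_def)
  then show ?thesis by (simp add: wedge_assoc[symmetric])
qed

lemma sorted_insert_sign:
  assumes "sorted (y # ys)" "j \<le> y"
  shows "dmonom_sign p {#j#} (mset (y # ys)) = 1"
  using assms by (intro dmonom_sign_le) auto

text \<open>Commutation of 1-forms depends only on their parities, so inserting \<open>U j\<close>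
  costs the same sign as inserting \<open>dx^j\<close>, and an even factor that repeats gives
  \<open>0\<close>.\<close>

lemma wlist_insort:
  assumes U: "coframe U" and j: "j < p + q"
  shows "sorted xs \<Longrightarrow> set xs \<subseteq> {..<p + q} \<Longrightarrow> U j \<diamondop> wlist U xs =
    (if j < p \<and> j \<in> set xs then 0 else df_scale (dmonom_sign p {#j#} (mset xs)) (wlist U (insort j xs)))"
proof (induction xs)
  case (Cons y ys)
  show ?case
  proof (cases "j \<le> y")
    case True
    show ?thesis
    proof (cases "j < p \<and> j \<in> set (y # ys)")
      case j: True
      then have "j = y" using True Cons.prems by auto
      then show ?thesis using j coframe_self[OF U] by simp
    next
      case False
      then show ?thesis using True sorted_insert_sign[OF Cons.prems(1) True] by (auto simp del: mset.simps)
    qed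
  next
    case False
    have "U j \<diamondop> wlist U (y # ys) = df_scale (- ((- 1) ^ (cpar p j * cpar p y))) (U y \<diamondop> U j \<diamondop> wlist U ys)"
      using coframe_commute[OF U U j] Cons.prems by simp
    also have "U j \<diamondop> wlist U ys = (if j < p \<and> j \<in> set ys then 0 else df_scale (dmonom_sign p {#j#} (mset ys)) (wlist U (insort j ys)))"
      using Cons by simp
    finally have *: "U j \<diamondop> wlist U (y # ys) = (if j < p \<and> j \<in> set ys then 0 else
       df_scale (- ((- 1) ^ (cpar p j * cpar p y)) * dmonom_sign p {#j#} (mset ys)) (wlist U (insort j (y # ys))))"
      using False by (simp add: wedge_scale_right)
    moreover have "dmonom_sign p {#j#} (mset (y # ys)) = - ((- 1) ^ (cpar p j * cpar p y)) * dmonom_sign p {#j#} (mset ys)"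
      using False by (simp add: dmonom_sign_add_mset_right[of p _ y "mset ys"] dmonom_sign_single cpar_def)
    ultimately show ?thesis using False by (auto simp del: wlist_simps mset.simps)
  qed
qed simp

text \<open>The Leibniz expansion of \<open>wlist_insort\<close>. If an even \<open>j\<close> is
  already present, the terms with \<open>W j\<close> before \<open>U j\<close> and with
  \<open>U j\<close> before \<open>W j\<close> cancel, because the two anticommute.\<close>

lemma wlist_deriv_insort:
  assumes U: "coframe U" and W: "coframe W" and j: "j < p + q"
  shows "sorted xs \<Longrightarrow> set xs \<subseteq> {..<p + q} \<Longrightarrow> W j \<diamondop> wlist U xs + U j \<diamondop> wlist_deriv U W xs =
    (if j < p \<and> j \<in> set xs then 0 else df_scale (dmonom_sign p {#j#} (mset xs)) (wlist_deriv U W (insort j xs)))"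
proof (induction xs)
  case (Cons y ys)
  then have y: "y < p + q" by simp
  show ?case
  proof (cases "j \<le> y")
    case True
    show ?thesis
    proof (cases "j < p \<and> j \<in> set (y # ys)")
      case jp: True
      then have jy: "j = y" using True Cons.prems by auto
      have "W j \<diamondop> U j \<diamondop> wlist U ys = - (U j \<diamondop> W j \<diamondop> wlist U ys)"
        using coframe_commute[OF W U j j] jp by (simp add: cpar_def df_scale_minus_1)
      then show ?thesis using jp coframe_self[OF U] by (simp add: jy[symmetric] wedge_add_right)
    next
      case False
      then show ?thesis using True sorted_insert_sign[OF Cons.prems(1) True] by (auto simp del: mset.simps)
    qed
  next
    case False
    let ?e = "- ((- 1 :: real) ^ (cpar p j * cpar p y))"
    have "W j \<diamondop> wlist U (y # ys) + U j \<diamondop> wlist_deriv U W (y # ys) =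
       df_scale ?e (U y \<diamondop> W j \<diamondop> wlist U ys) + df_scale ?e (W y \<diamondop> U j \<diamondop> wlist U ys)
       + df_scale ?e (U y \<diamondop> U j \<diamondop> wlist_deriv U W ys)"
      using coframe_commute[OF U U j y, of "wlist_deriv U W ys"] coframe_commute[OF W U j y, of "wlist U ys"]
        coframe_commute[OF U W j y, of "wlist U ys"] by (simp add: wedge_add_right)
    also have "\<dots> = df_scale ?e (U y \<diamondop> (W j \<diamondop> wlist U ys + U j \<diamondop> wlist_deriv U W ys) + W y \<diamondop> (U j \<diamondop> wlist U ys))"
      by (simp add: wedge_add_right df_scale_add add_ac)
    also have "W j \<diamondop> wlist U ys + U j \<diamondop> wlist_deriv U W ys =
      (if j < p \<and> j \<in> set ys then 0 else df_scale (dmonom_sign p {#j#} (mset ys)) (wlist_deriv U W (insort j ys)))"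
      using Cons by simp
    also have "U j \<diamondop> wlist U ys = (if j < p \<and> j \<in> set ys then 0 else df_scale (dmonom_sign p {#j#} (mset ys)) (wlist U (insort j ys)))"
      using Cons.prems by (intro wlist_insort U j) auto
    finally have *: "W j \<diamondop> wlist U (y # ys) + U j \<diamondop> wlist_deriv U W (y # ys) = (if j < p \<and> j \<in> set ys then 0 else
       df_scale (?e * dmonom_sign p {#j#} (mset ys)) (wlist_deriv U W (insort j (y # ys))))"
      using False by (simp add: wedge_scale_right df_scale_add add.commute)
    moreover have "dmonom_sign p {#j#} (mset (y # ys)) = ?e * dmonom_sign p {#j#} (mset ys)"
      using False by (simp add: dmonom_sign_add_mset_right[of p _ y "mset ys"] dmonom_sign_single cpar_def)
    ultimately show ?thesis using False by (auto simp del: wlist_simps wlist_deriv.simps mset.simps)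
  qed
qed simp

lemma wlist_dX:
  assumes "sorted xs" "set xs \<subseteq> {..<p + q}" "\<not> repeats p (mset xs)"
  shows "wlist (\<lambda>j. dX j) xs = dmonom_form (mset xs) unit_sf"
  using assms
proof (induction xs)
  case (Cons y ys)
  have nr: "\<not> repeats p (mset ys)" using repeats_mono[of p "mset ys" "mset (y # ys)"] Cons.prems by auto
  have "wlist (\<lambda>j. dX j) (y # ys) = dX y \<diamondop> dmonom_form (mset ys) unit_sf"
    using Cons nr by simp
  also have "\<dots> = dmonom_form (mset (y # ys)) unit_sf"
  proof
    fix L
    have "L = add_mset y (mset ys) \<longleftrightarrow> y \<in># L \<and> L - {#y#} = mset ys"
      by (metis add_mset_remove_trivial insert_DiffM union_single_eq_member)
    then show "(dX y \<diamondop> dmonom_form (mset ys) unit_sf) L = dmonom_form (mset (y # ys)) unit_sf L"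
      using Cons.prems dmonom_sign_le[of "mset ys" y p]
      by (subst wedge_dX[OF _ refl]) (auto simp: dmonom_form_apply)
  qed
  finally show ?case .
qed simp

lemma set_sorted_list_dmonoms: "I \<in> dmonoms p q n \<Longrightarrow> set (sorted_list_of_multiset I) \<subseteq> {..<p + q}"
  by (auto simp: dmonoms_def)

lemma length_sorted_list_dmonoms: "I \<in> dmonoms p q n \<Longrightarrow> length (sorted_list_of_multiset I) = n"
  by (metis (mono_tags, lifting) dmonoms_iff mset_sorted_list_of_multiset size_mset)

text \<open>With monomials written as products of the \<open>dX j\<close>, rules for products extend
  to arbitrary forms.\<close>

lemma dform_expand:
  assumes "\<omega> \<in> \<Omega> n"
  shows "\<omega> = (\<Sum>I\<in>dmonoms p q n. wlist (\<lambda>j. dX j) (sorted_list_of_multiset I) \<diamondop> fun_form (\<omega> I))"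
proof
  fix L
  have "(\<Sum>I\<in>dmonoms p q n. wlist (\<lambda>j. dX j) (sorted_list_of_multiset I) \<diamondop> fun_form (\<omega> I)) L
     = (\<Sum>I\<in>dmonoms p q n. if I = L then \<omega> L else 0)"
    unfolding sum_fun_apply[of _ _ L]
  proof (rule sum.cong[OF refl])
    fix I assume I: "I \<in> dmonoms p q n"
    have "wlist (\<lambda>j. dX j) (sorted_list_of_multiset I) = dmonom_form I unit_sf"
      using I set_sorted_list_dmonoms[OF I] dmonoms_not_repeats[OF I] by (subst wlist_dX) auto
    then show "(wlist (\<lambda>j. dX j) (sorted_list_of_multiset I) \<diamondop> fun_form (\<omega> I)) L = (if I = L then \<omega> L else 0)"
      using I dmonoms_not_repeats[OF I] dformsD(1)[OF assms] by (auto simp: wedge_fun_right dmonom_form_apply)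
  qed
  then show "\<omega> L = (\<Sum>I\<in>dmonoms p q n. wlist (\<lambda>j. dX j) (sorted_list_of_multiset I) \<diamondop> fun_form (\<omega> I)) L"
    using dformsD(2)[OF assms, of L] by (simp add: sum.delta') 
qed

text \<open>Reindexing by \<open>L = add_mset j I\<close>. \<open>F\<close> is left open because
  both the pullback and the Lie derivative of a product with \<open>dX j\<close> are computed this
  way.\<close>

lemma sum_wedge_dX:
  assumes b: "\<beta> \<in> \<Omega> n" and j: "j < p + q" and F: "\<And>L. F L 0 = (0 :: dform)"
  shows "(\<Sum>L\<in>dmonoms p q (Suc n). F L ((dX j \<diamondop> \<beta>) L)) =
    (\<Sum>I\<in>dmonoms p q n. if j < p \<and> j \<in># I then 0 else F (add_mset j I) (sf_scale (dmonom_sign p {#j#} I) (\<beta> I)))"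
proof -
  have "(\<Sum>L\<in>dmonoms p q (Suc n). F L ((dX j \<diamondop> \<beta>) L)) =
     (\<Sum>L\<in>{L \<in> dmonoms p q (Suc n). j \<in># L}. F L (sf_scale (dmonom_sign p {#j#} (L - {#j#})) (\<beta> (L - {#j#}))))"
    by (rule sum.mono_neutral_cong_right)
      (auto simp: wedge_dX_dforms[OF b] F dest: dmonoms_not_repeats)
  also have "\<dots> = (\<Sum>I\<in>{I \<in> dmonoms p q n. \<not> (j < p \<and> j \<in># I)}. F (add_mset j I) (sf_scale (dmonom_sign p {#j#} I) (\<beta> I)))"
  proof (rule sum.reindex_bij_witness[of _ "\<lambda>I. add_mset j I" "\<lambda>L. L - {#j#}"], goal_cases)
    case (2 L)
    then have L: "L = add_mset j (L - {#j#})" "\<not> repeats p L" "size L = Suc n" "set_mset L \<subseteq> {..<p + q}"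
      by (auto simp: dmonoms_iff)
    then have "\<not> repeats p (L - {#j#})" using repeats_mono[of p "L - {#j#}" L] by auto
    then have "\<not> (j < p \<and> j \<in># L - {#j#})" using repeats_add_mset[of "L - {#j#}" j] L by simp
    moreover have "L - {#j#} \<in> dmonoms p q n"
      using \<open>\<not> repeats p (L - {#j#})\<close> L 2 by (auto simp: dmonoms_iff size_Diff_singleton dest: in_diffD)
    ultimately show ?case by blast
  next
    case (4 I)
    then show ?case using j repeats_add_mset[of I j] by (auto simp: dmonoms_iff)
  qed auto
  also have "\<dots> = (\<Sum>I\<in>dmonoms p q n. if j < p \<and> j \<in># I then 0 else F (add_mset j I) (sf_scale (dmonom_sign p {#j#} I) (\<beta> I)))"
    by (rule sum.mono_neutral_cong_left) auto
  finally show ?thesis .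
qed

end

lemma df_scale_apply: "df_scale a \<alpha> I = sf_scale a (\<alpha> I)"
  by (simp add: df_scale_def)

section \<open>Pullback along morphisms of superdomains\<close>

locale superdomain_pair = dom: superdomain p q V + cod: superdomain p q V' for p q V V'

text \<open>With the chain rule as an axiom, pullbacks are pure algebra; that changes of coordinates
  satisfy it is proved in \<open>trans_morphism\<close>. The axiom \<open>deriv_chain\<close> of
  \<open>even_derivation\<close> has the same role for vector fields and is proved in
  \<open>vl_derivation\<close>.\<close>

locale sf_morphism = superdomain_pair p q V V' for p q V V' +
  fixes \<theta> :: "sfun \<Rightarrow> sfun"
  assumes morph_closed: "f \<in> dom.S \<Longrightarrow> \<theta> f \<in> cod.S"
    and morph_add: "f \<in> dom.S \<Longrightarrow> g \<in> dom.S \<Longrightarrow> \<theta> (f + g) = \<theta> f + \<theta> g"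
    and morph_scale: "f \<in> dom.S \<Longrightarrow> \<theta> (sf_scale a f) = sf_scale a (\<theta> f)"
    and morph_mult: "f \<in> dom.S \<Longrightarrow> g \<in> dom.S \<Longrightarrow> \<theta> (sf_mult f g) = sf_mult (\<theta> f) (\<theta> g)"
    and morph_unit: "\<theta> dom.unit_sf = cod.unit_sf"
    and morph_par: "f \<in> dom.S \<Longrightarrow> sf_par k f \<Longrightarrow> sf_par k (\<theta> f)"
    and chain_rule: "f \<in> dom.S \<Longrightarrow> j < p + q \<Longrightarrow>
      cod.pd j (\<theta> f) = (\<Sum>i<p + q. sf_mult (cod.pd j (\<theta> (dom.X i))) (\<theta> (dom.pd i f)))"

lemma sf_par_even_part: "f \<in> sfuns p q V \<Longrightarrow> sf_par 0 (f + sf_twist 1 f)"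
  by (auto simp: sf_par_def sf_twist_def minus_one_power_iff plus_fun_apply)

lemma sf_par_odd_part: "f \<in> sfuns p q V \<Longrightarrow> sf_par 1 (f - sf_twist 1 f)"
  by (auto simp: sf_par_def sf_twist_def minus_one_power_iff minus_apply)

context superdomain
begin

text \<open>The twist is a scalar on functions of one parity, and half the sum and half the
  difference of \<open>f\<close> and \<open>sf_twist 1 f\<close> are the even and the odd part of
  \<open>f\<close>.\<close>

lemma twist_natural:
  assumes add: "\<And>f g. f \<in> S \<Longrightarrow> g \<in> S \<Longrightarrow> T (f + g) = T f + T g"
    and scale: "\<And>f a. f \<in> S \<Longrightarrow> T (sf_scale a f) = sf_scale a (T f)"
    and par: "\<And>f k. f \<in> S \<Longrightarrow> sf_par k f \<Longrightarrow> sf_par k (T f)"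
    and f: "f \<in> S"
  shows "T (sf_twist k f) = sf_twist k (T f)"
proof -
  define f0 where "f0 = sf_scale (1/2) (f + sf_twist 1 f)"
  define f1 where "f1 = sf_scale (1/2) (f - sf_twist 1 f)"
  have S: "f0 \<in> S" "f1 \<in> S"
    unfolding f0_def f1_def by (intro sfuns_scale sfuns_add sfuns_diff sfuns_twist f)+
  have P: "sf_par 0 f0" "sf_par 1 f1"
    unfolding f0_def f1_def by (intro sf_par_scale sf_par_even_part[OF f] sf_par_odd_part[OF f])+
  have ff: "f = f0 + f1"
    by (auto simp: f0_def f1_def sf_scale_def fun_eq_iff plus_fun_apply minus_apply algebra_simps)
  have tw: "T (sf_twist k g) = sf_twist k (T g)" if "g \<in> S" "sf_par l g" for g l
    using that sf_twist_par[OF that(2), of k] sf_twist_par[OF par[OF that], of k] scale by simp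
  have "T (sf_twist k f) = T (sf_twist k f0) + T (sf_twist k f1)"
    unfolding ff sf_twist_add using S by (intro add sfuns_twist)
  also have "\<dots> = sf_twist k (T f0) + sf_twist k (T f1)" using tw S P by simp
  finally show ?thesis using add[OF S] ff by (simp add: sf_twist_add)
qed

lemma wlist_cong: "(\<And>x. x \<in> set xs \<Longrightarrow> U x = W x) \<Longrightarrow> wlist U xs = wlist W xs"
  by (induction xs) auto

lemmas fun_form_mult = wedge_fun_fun[symmetric, where p = p]

lemma additive_zero:
  assumes "\<And>f g. f \<in> S \<Longrightarrow> g \<in> S \<Longrightarrow> T (f + g) = T f + (T g :: sfun)"
  shows "T 0 = 0"
  using assms[OF sfuns_0 sfuns_0] by simp

end

context sf_morphism
begin

lemma morph_0 [simp]: "\<theta> 0 = 0"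
  by (rule dom.additive_zero[OF morph_add])

lemma morph_twist: "f \<in> dom.S \<Longrightarrow> \<theta> (sf_twist k f) = sf_twist k (\<theta> f)"
  by (rule dom.twist_natural[OF morph_add morph_scale morph_par])

abbreviation "dXi i \<equiv> sf_d p q V' (\<theta> (dom.X i))"
abbreviation "pull \<equiv> pullback p q V V' \<theta>"

lemma coframe_pull: "cod.coframe dXi"
  unfolding cod.coframe_def using sf_par_coord dom.sf_coord_in_sfuns
  by (auto intro!: cod.sf_d_dforms cod.df_par_sf_d morph_closed morph_par)

text \<open>\<open>pullback\<close> sums over the monomials of the same degree as the output
  monomial \<open>L\<close>. For a form of degree \<open>n\<close> the sum over degree
  \<open>n\<close> gives the same, since all other terms vanish.\<close>

lemma pullback_eq:
  assumes w: "\<omega> \<in> dom.\<Omega> n"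
  shows "pull \<omega> = (\<Sum>I\<in>dmonoms p q n. wedge p (cod.wlist dXi (sorted_list_of_multiset I)) (fun_form (\<theta> (\<omega> I))))"
    (is "_ = (\<Sum>I\<in>_. ?T I)")
proof
  fix L
  have *: "pull \<omega> L = (\<Sum>I\<in>dmonoms p q (size L). ?T I L)"
    by (simp add: pullback_def cod.wlist_def wedge_list_def sum_fun_apply fun_eq_iff)
  have T: "?T I \<in> cod.\<Omega> n" if "I \<in> dmonoms p q n" for I
    using cod.dforms_wedge[OF cod.wlist_dforms[OF coframe_pull dom.set_sorted_list_dmonoms[OF that]]
        cod.dforms_fun[OF morph_closed[OF dom.dformsD(1)[OF w]]]] dom.length_sorted_list_dmonoms[OF that] by simp
  show "pull \<omega> L = (\<Sum>I\<in>dmonoms p q n. ?T I) L"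
  proof (cases "size L = n")
    case True
    then show ?thesis using * by (simp add: sum_fun_apply[of _ _ L])
  next
    case False
    then have "I \<notin> dmonoms p q n" if "I \<in> dmonoms p q (size L)" for I using that by (auto simp: dom.dmonoms_iff)
    then have "pull \<omega> L = 0" unfolding * using dom.dformsD(2)[OF w] by (simp add: zero_fun_apply[of L])
    moreover have "L \<notin> dmonoms p q n" using False by (auto simp: dom.dmonoms_iff)
    moreover have "(\<Sum>I\<in>dmonoms p q n. ?T I) \<in> cod.\<Omega> n" by (intro cod.dforms_sum T)
    ultimately have "(\<Sum>I\<in>dmonoms p q n. ?T I) L = 0" "pull \<omega> L = 0" by (blast intro: cod.dformsD(2))+
    then show ?thesis by simp
  qed
qed

lemma pullback_term_dforms:
  assumes "I \<in> dmonoms p q n" "f \<in> cod.S"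
  shows "wedge p (cod.wlist dXi (sorted_list_of_multiset I)) (fun_form f) \<in> cod.\<Omega> n"
  using cod.dforms_wedge[OF cod.wlist_dforms[OF coframe_pull dom.set_sorted_list_dmonoms[OF assms(1)]]
      cod.dforms_fun[OF assms(2)]] dom.length_sorted_list_dmonoms[OF assms(1)] by simp

lemma pullback_dforms: "\<omega> \<in> dom.\<Omega> n \<Longrightarrow> pull \<omega> \<in> cod.\<Omega> n"
  unfolding pullback_eq by (intro cod.dforms_sum pullback_term_dforms morph_closed dom.dformsD(1))

lemma pullback_add:
  assumes a: "\<alpha> \<in> dom.\<Omega> n" and b: "\<beta> \<in> dom.\<Omega> n"
  shows "pull (\<alpha> + \<beta>) = pull \<alpha> + pull \<beta>"
  unfolding pullback_eq[OF a] pullback_eq[OF b] pullback_eq[OF dom.dforms_add[OF a b]] plus_fun_apply[of \<alpha> \<beta>]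
    morph_add[OF dom.dformsD(1)[OF a] dom.dformsD(1)[OF b]] dmonom_form_add wedge_add_right sum.distrib ..

lemma pullback_0 [simp]: "pull 0 = 0"
  using pullback_eq[OF dom.dforms_0[of 0]] by (simp add: zero_fun_apply[of "{#}"])

lemma pullback_sum: "(\<And>i. i \<in> A \<Longrightarrow> f i \<in> dom.\<Omega> n) \<Longrightarrow> pull (\<Sum>i\<in>A. f i) = (\<Sum>i\<in>A. pull (f i))"
  by (rule additive_on_sum(2)[of "dom.\<Omega> n" pull]) (auto simp: pullback_add intro: dom.dforms_add)

lemma pullback_scale:
  assumes a: "\<alpha> \<in> dom.\<Omega> n"
  shows "pull (df_scale c \<alpha>) = df_scale c (pull \<alpha>)"
  unfolding pullback_eq[OF a] pullback_eq[OF dom.dforms_scale[OF a]] df_scale_apply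
    morph_scale[OF dom.dformsD(1)[OF a]] dmonom_form_scale wedge_scale_right df_scale_sum ..

lemma pullback_fun: "f \<in> dom.S \<Longrightarrow> pull (fun_form f) = fun_form (\<theta> f)"
  using morph_closed[of f]
  by (simp add: pullback_eq[OF dom.dforms_fun] dmonom_form_apply wedge_fun_fun)

text \<open>\<open>h\<close> has to pass the differentials of each monomial. Since
  \<open>\<theta>\<close> preserves parity, so do their images, and the sign is the same on both
  sides.\<close>

lemma pullback_fun_wedge:
  assumes h: "h \<in> dom.S" and b: "\<beta> \<in> dom.\<Omega> n"
  shows "pull (wedge p (fun_form h) \<beta>) = wedge p (fun_form (\<theta> h)) (pull \<beta>)"
proof -
  have hb: "wedge p (fun_form h) \<beta> \<in> dom.\<Omega> n" using dom.dforms_wedge[OF dom.dforms_fun[OF h] b] by simp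
  show ?thesis
    unfolding pullback_eq[OF hb] pullback_eq[OF b] wedge_sum_right
  proof (rule sum.cong[OF refl])
    fix I assume I: "I \<in> dmonoms p q n"
    let ?W = "cod.wlist dXi (sorted_list_of_multiset I)"
    have "df_par p (odd_size p I) ?W"
      using cod.df_par_wlist[OF coframe_pull dom.set_sorted_list_dmonoms[OF I]] by simp
    note cod.fun_wedge_commute[OF cod.wlist_dforms[OF coframe_pull dom.set_sorted_list_dmonoms[OF I]] this, of "\<theta> h"]
    moreover have "\<theta> (wedge p (fun_form h) \<beta> I) = sf_mult (sf_twist (odd_size p I) (\<theta> h)) (\<theta> (\<beta> I))"
      using dom.wedge_fun_form_eq(2)[OF b] morph_mult[OF dom.sfuns_twist[OF h] dom.dformsD(1)[OF b]] morph_twist[OF h] by simp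
    ultimately show "wedge p ?W (fun_form (\<theta> (wedge p (fun_form h) \<beta> I))) = wedge p (fun_form (\<theta> h)) (wedge p ?W (fun_form (\<theta> (\<beta> I))))"
      by (simp add: dom.fun_form_mult wedge_assoc[symmetric])
  qed
qed

lemma pullback_dX_wedge:
  assumes b: "\<beta> \<in> dom.\<Omega> n" and j: "j < p + q"
  shows "pull (wedge p (dom.dX j) \<beta>) = wedge p (dXi j) (pull \<beta>)"
proof -
  let ?W = "\<lambda>I. cod.wlist dXi (sorted_list_of_multiset I)"
  have "pull (wedge p (dom.dX j) \<beta>) = (\<Sum>L\<in>dmonoms p q (Suc n). wedge p (?W L) (fun_form (\<theta> (wedge p (dom.dX j) \<beta> L))))"
    by (rule pullback_eq[OF dom.dforms_wedge_1[OF dom.dforms_dX[OF j] b]])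
  also have "\<dots> = (\<Sum>I\<in>dmonoms p q n. if j < p \<and> j \<in># I then 0 else wedge p (?W (add_mset j I)) (fun_form (\<theta> (sf_scale (dmonom_sign p {#j#} I) (\<beta> I)))))"
    by (rule dom.sum_wedge_dX[OF b j]) simp
  also have "\<dots> = (\<Sum>I\<in>dmonoms p q n. wedge p (wedge p (dXi j) (?W I)) (fun_form (\<theta> (\<beta> I))))"
  proof (rule sum.cong[OF refl])
    fix I assume I: "I \<in> dmonoms p q n"
    show "(if j < p \<and> j \<in># I then 0 else wedge p (?W (add_mset j I)) (fun_form (\<theta> (sf_scale (dmonom_sign p {#j#} I) (\<beta> I)))))
      = wedge p (wedge p (dXi j) (?W I)) (fun_form (\<theta> (\<beta> I)))"
      using cod.wlist_insort[OF coframe_pull j, of "sorted_list_of_multiset I"] dom.set_sorted_list_dmonoms[OF I]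
      by (simp add: morph_scale[OF dom.dformsD(1)[OF b]] dmonom_form_scale wedge_scale_right wedge_scale_left)
  qed
  finally show ?thesis by (simp add: pullback_eq[OF b] wedge_sum_right wedge_assoc)
qed

text \<open>By the chain rule \<open>d(\<theta> g)\<close> is the sum of the
  \<open>d(\<theta>(x^j))\<close> times \<open>\<theta>\<close> of the \<open>j\<close>-th
  derivative of \<open>g\<close>. This is what the pullback makes of \<open>dg\<close> expanded in
  the \<open>dX j\<close>.\<close>

lemma pullback_sf_d_wedge:
  assumes g: "g \<in> dom.S" and b: "\<beta> \<in> dom.\<Omega> n"
  shows "pull (wedge p (sf_d p q V g) \<beta>) = wedge p (sf_d p q V' (\<theta> g)) (pull \<beta>)"
proof -
  have gb: "wedge p (fun_form (dom.pd j g)) \<beta> \<in> dom.\<Omega> n" if "j < p + q" for j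
    using dom.dforms_wedge[OF dom.dforms_fun[OF dom.sf_pderiv_in_sfuns[OF g that]] b] by simp
  have "pull (wedge p (sf_d p q V g) \<beta>) = (\<Sum>j<p + q. pull (wedge p (dom.dX j) (wedge p (fun_form (dom.pd j g)) \<beta>)))"
    unfolding dom.sf_d_eq[OF g] wedge_sum_left wedge_assoc
    by (rule pullback_sum[of _ _ "Suc n"]) (auto intro!: dom.dforms_wedge_1 dom.dforms_dX gb)
  also have "\<dots> = (\<Sum>j<p + q. wedge p (wedge p (dXi j) (fun_form (\<theta> (dom.pd j g)))) (pull \<beta>))"
    by (intro sum.cong refl)
      (simp add: pullback_dX_wedge[OF gb] pullback_fun_wedge[OF dom.sf_pderiv_in_sfuns[OF g] b] wedge_assoc)
  also have "\<dots> = wedge p (\<Sum>j<p + q. wedge p (dXi j) (fun_form (\<theta> (dom.pd j g)))) (pull \<beta>)"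
    by (simp add: wedge_sum_left)
  also have "(\<Sum>j<p + q. wedge p (dXi j) (fun_form (\<theta> (dom.pd j g)))) = sf_d p q V' (\<theta> g)"
  proof -
    have 1: "(\<Sum>j<p + q. wedge p (dXi j) (fun_form (\<theta> (dom.pd j g)))) \<in> cod.\<Omega> 1"
      using cod.dforms_wedge[OF cod.sf_d_dforms[OF morph_closed[OF dom.sf_coord_in_sfuns]]
          cod.dforms_fun[OF morph_closed[OF dom.sf_pderiv_in_sfuns[OF g]]]]
      by (intro cod.dforms_sum) simp
    show ?thesis
    proof
      fix I
      show "(\<Sum>j<p + q. wedge p (dXi j) (fun_form (\<theta> (dom.pd j g)))) I = sf_d p q V' (\<theta> g) I"
      proof (cases "I \<in> dmonoms p q 1")
        case True
        then have "size I = 1" "set_mset I \<subseteq> {..<p + q}" by (simp_all add: dom.dmonoms_iff)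
        then obtain k where k: "I = {#k#}" "k < p + q" using size_1_singleton_mset[of I] by auto
        have "(\<Sum>j<p + q. wedge p (dXi j) (fun_form (\<theta> (dom.pd j g)))) I = (\<Sum>j<p + q. sf_mult (cod.pd k (\<theta> (dom.X j))) (\<theta> (dom.pd j g)))"
          unfolding sum_fun_apply[of _ _ I]
          using k cod.wedge_fun_form_eq(1)[OF cod.sf_d_dforms[OF morph_closed[OF dom.sf_coord_in_sfuns]]]
            cod.sf_d_apply(1)[OF morph_closed[OF dom.sf_coord_in_sfuns]]
          by (intro sum.cong refl) simp
        then show ?thesis using chain_rule[OF g k(2)] cod.sf_d_apply(1)[OF morph_closed[OF g] k(2)] k(1) by simp
      next
        case False
        show ?thesis unfolding cod.dformsD(2)[OF 1 False] cod.dformsD(2)[OF cod.sf_d_dforms[OF morph_closed[OF g]] False] ..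
      qed
    qed
  qed
  finally show ?thesis .
qed

lemma pullback_sf_d: "g \<in> dom.S \<Longrightarrow> pull (sf_d p q V g) = sf_d p q V' (\<theta> g)"
  using pullback_sf_d_wedge[OF _ dom.dforms_fun[OF dom.unit_in_sfuns], of g]
  by (simp add: pullback_fun morph_unit dom.sf_d_dforms[THEN dom.wedge_unit] cod.sf_d_dforms[THEN cod.wedge_unit] morph_closed)

text \<open>Membership is proved along with the formula because each factor is split off by a rule
  about forms of known degree.\<close>

lemma pullback_wlist_wedge:
  assumes g: "\<And>i. i < p + q \<Longrightarrow> g i \<in> dom.S" and b: "\<beta> \<in> dom.\<Omega> n" and xs: "set xs \<subseteq> {..<p + q}"
  shows "wedge p (dom.wlist (\<lambda>i. sf_d p q V (g i)) xs) \<beta> \<in> dom.\<Omega> (length xs + n) \<and>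
    pull (wedge p (dom.wlist (\<lambda>i. sf_d p q V (g i)) xs) \<beta>) = wedge p (cod.wlist (\<lambda>i. sf_d p q V' (\<theta> (g i))) xs) (pull \<beta>)"
  using xs
proof (induction xs)
  case Nil
  have "wedge p (fun_form dom.unit_sf) \<beta> = \<beta>" "wedge p (fun_form cod.unit_sf) (pull \<beta>) = pull \<beta>"
    using dom.wedge_fun_form_eq(2)[OF b] cod.wedge_fun_form_eq(2)[OF pullback_dforms[OF b]]
      dom.dformsD(1)[OF b] cod.dformsD(1)[OF pullback_dforms[OF b]] by (auto intro!: ext[of _ \<beta>] ext[of _ "pull \<beta>"])
  then show ?case using b by simp
next
  case (Cons x xs)
  then have x: "x < p + q" and IH: "wedge p (dom.wlist (\<lambda>i. sf_d p q V (g i)) xs) \<beta> \<in> dom.\<Omega> (length xs + n)"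
    "pull (wedge p (dom.wlist (\<lambda>i. sf_d p q V (g i)) xs) \<beta>) = wedge p (cod.wlist (\<lambda>i. sf_d p q V' (\<theta> (g i))) xs) (pull \<beta>)"
    by auto
  show ?case
    using dom.dforms_wedge_1[OF dom.sf_d_dforms[OF g[OF x]] IH(1)] pullback_sf_d_wedge[OF g[OF x] IH(1)] IH(2)
    by (simp add: wedge_assoc)
qed

text \<open>Each term of \<open>\<omega>\<close> is a product of \<open>n\<close> differentials
  times a coefficient. On either side \<open>d\<close> passes the differentials with the sign
  \<open>(- 1) ^ n\<close> and falls on the coefficient, where the pullback of \<open>df\<close> is
  \<open>d(\<theta> f)\<close>.\<close>

lemma pullback_ext_d:
  assumes w: "\<omega> \<in> dom.\<Omega> n"
  shows "pull (ext_d p q V \<omega>) = ext_d p q V' (pull \<omega>)"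
proof -
  have dw: "ext_d p q V (wedge p (dom.wlist (\<lambda>i. sf_d p q V (dom.X i)) xs) (fun_form f))
      = df_scale ((- 1) ^ length xs) (wedge p (dom.wlist (\<lambda>i. sf_d p q V (dom.X i)) xs) (sf_d p q V f))"
    if "set xs \<subseteq> {..<p + q}" "f \<in> dom.S" for xs f
    using that
  proof (induction xs)
    case Nil
    have "wedge p (fun_form dom.unit_sf) (sf_d p q V f) = sf_d p q V f"
      using dom.wedge_fun_form_eq(2)[OF dom.sf_d_dforms[OF Nil(2)]] dom.dformsD(1)[OF dom.sf_d_dforms[OF Nil(2)]]
      by (auto intro!: ext[of _ "sf_d p q V f"])
    then show ?case using Nil by (simp add: wedge_fun_fun sf_d_def)
  next
    case (Cons x xs)
    have "wedge p (dom.wlist (\<lambda>i. sf_d p q V (dom.X i)) xs) (fun_form f) \<in> dom.\<Omega> (length xs)"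
      using pullback_wlist_wedge[where g = dom.X, OF dom.sf_coord_in_sfuns dom.dforms_fun[OF Cons.prems(2)], where xs = xs] Cons.prems by simp
    from dom.ext_d_sf_d_wedge[OF dom.sf_coord_in_sfuns this, of x]
    show ?case using Cons by (simp add: wedge_assoc wedge_scale_right df_scale_neg)
  qed
  have dw': "ext_d p q V' (wedge p (cod.wlist dXi xs) (fun_form f))
      = df_scale ((- 1) ^ length xs) (wedge p (cod.wlist dXi xs) (sf_d p q V' f))"
    if "set xs \<subseteq> {..<p + q}" "f \<in> cod.S" for xs f
    using that
  proof (induction xs)
    case Nil
    have "wedge p (fun_form cod.unit_sf) (sf_d p q V' f) = sf_d p q V' f"
      using cod.wedge_fun_form_eq(2)[OF cod.sf_d_dforms[OF Nil(2)]] cod.dformsD(1)[OF cod.sf_d_dforms[OF Nil(2)]]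
      by (auto intro!: ext[of _ "sf_d p q V' f"])
    then show ?case using Nil by (simp add: wedge_fun_fun sf_d_def)
  next
    case (Cons x xs)
    have "wedge p (cod.wlist dXi xs) (fun_form f) \<in> cod.\<Omega> (length xs)"
      using cod.dforms_wedge[OF cod.wlist_dforms[OF coframe_pull] cod.dforms_fun] Cons.prems by fastforce
    from cod.ext_d_sf_d_wedge[OF morph_closed[OF dom.sf_coord_in_sfuns] this, of x]
    show ?case using Cons by (simp add: wedge_assoc wedge_scale_right df_scale_neg)
  qed
  define W where "W I = dom.wlist (\<lambda>i. sf_d p q V (dom.X i)) (sorted_list_of_multiset I)" for I
  define W' where "W' I = cod.wlist dXi (sorted_list_of_multiset I)" for I
  have Wd: "W I = dom.wlist (\<lambda>j. dom.dX j) (sorted_list_of_multiset I)" if "I \<in> dmonoms p q n" for I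
    unfolding W_def using dom.sf_d_coord dom.set_sorted_list_dmonoms[OF that] by (intro dom.wlist_cong) auto
  have e: "\<omega> = (\<Sum>I\<in>dmonoms p q n. wedge p (W I) (fun_form (\<omega> I)))"
    using dom.dform_expand[OF w] Wd by simp
  have Wf: "wedge p (W I) (fun_form (\<omega> I)) \<in> dom.\<Omega> n" if "I \<in> dmonoms p q n" for I
    using pullback_wlist_wedge[where g = dom.X, OF dom.sf_coord_in_sfuns dom.dforms_fun[OF dom.dformsD(1)[OF w]] dom.set_sorted_list_dmonoms[OF that]]
      dom.length_sorted_list_dmonoms[OF that] by (simp add: W_def)
  have Wsd: "wedge p (W I) (sf_d p q V (\<omega> I)) \<in> dom.\<Omega> (Suc n)" 
      "pull (wedge p (W I) (sf_d p q V (\<omega> I))) = wedge p (W' I) (sf_d p q V' (\<theta> (\<omega> I)))" if "I \<in> dmonoms p q n" for I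
    using pullback_wlist_wedge[where g = dom.X, OF dom.sf_coord_in_sfuns dom.sf_d_dforms[OF dom.dformsD(1)[OF w]] dom.set_sorted_list_dmonoms[OF that]]
      dom.length_sorted_list_dmonoms[OF that] by (simp_all add: W_def W'_def pullback_sf_d[OF dom.dformsD(1)[OF w]] Suc_eq_plus1)
  have "ext_d p q V \<omega> = (\<Sum>I\<in>dmonoms p q n. df_scale ((- 1) ^ n) (wedge p (W I) (sf_d p q V (\<omega> I))))"
    apply (subst e, subst dom.ext_d_sum[OF Wf], assumption)
    using dw dom.set_sorted_list_dmonoms dom.dformsD(1)[OF w] dom.length_sorted_list_dmonoms
    by (intro sum.cong refl) (simp add: W_def)
  then have "pull (ext_d p q V \<omega>) = (\<Sum>I\<in>dmonoms p q n. df_scale ((- 1) ^ n) (wedge p (W' I) (sf_d p q V' (\<theta> (\<omega> I)))))"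
    using pullback_sum[where f = "\<lambda>I. df_scale ((- 1) ^ n) (wedge p (W I) (sf_d p q V (\<omega> I)))",
        OF dom.dforms_scale[OF Wsd(1)]] pullback_scale[OF Wsd(1)] Wsd(2) by simp
  also have "\<dots> = (\<Sum>I\<in>dmonoms p q n. ext_d p q V' (wedge p (W' I) (fun_form (\<theta> (\<omega> I)))))"
    using dw' dom.set_sorted_list_dmonoms morph_closed[OF dom.dformsD(1)[OF w]] dom.length_sorted_list_dmonoms
    by (intro sum.cong refl) (simp add: W'_def)
  also have "\<dots> = ext_d p q V' (pull \<omega>)"
    unfolding pullback_eq[OF w] W'_def
    by (rule cod.ext_d_sum[symmetric]) (intro pullback_term_dforms morph_closed dom.dformsD(1)[OF w])
  finally show ?thesis .
qed

lemma df_par_pullback: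
  assumes w: "\<omega> \<in> dom.\<Omega> n" and k: "df_par p k \<omega>"
  shows "df_par p k (pull \<omega>)"
  unfolding pullback_eq[OF w]
proof (rule cod.df_par_sum)
  fix I assume I: "I \<in> dmonoms p q n"
  have "df_par p (odd_size p I + (k + odd_size p I)) (wedge p (cod.wlist dXi (sorted_list_of_multiset I)) (fun_form (\<theta> (\<omega> I))))"
    using cod.df_par_wlist[OF coframe_pull dom.set_sorted_list_dmonoms[OF I]] k
    by (intro df_par_wedge df_par_fun morph_par dom.dformsD(1)[OF w]) (simp_all add: df_par_def)
  then show "df_par p k (wedge p (cod.wlist dXi (sorted_list_of_multiset I)) (fun_form (\<theta> (\<omega> I))))"
    using df_par_cong[of "odd_size p I + (k + odd_size p I)" k p] by auto
qed

end

lemma pullback_comp: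
  assumes 1: "sf_morphism p q V V' \<theta>" and 2: "sf_morphism p q V' V'' \<theta>'" and 3: "sf_morphism p q V V'' \<theta>''"
    and comp: "\<And>f. f \<in> sfuns p q V \<Longrightarrow> \<theta>'' f = \<theta>' (\<theta> f)"
    and w: "\<omega> \<in> dforms p q V n"
  shows "pullback p q V' V'' \<theta>' (pullback p q V V' \<theta> \<omega>) = pullback p q V V'' \<theta>'' \<omega>"
proof -
  interpret A: sf_morphism p q V V' \<theta> by (rule 1)
  interpret B: sf_morphism p q V' V'' \<theta>' by (rule 2)
  interpret C: sf_morphism p q V V'' \<theta>'' by (rule 3)
  have X: "\<theta>'' (A.dom.X i) = \<theta>' (\<theta> (A.dom.X i))" if "i < p + q" for i
    using comp A.dom.sf_coord_in_sfuns[OF that] .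
  have W: "B.cod.wlist C.dXi (sorted_list_of_multiset I) = B.cod.wlist (\<lambda>i. sf_d p q V'' (\<theta>' (\<theta> (A.dom.X i)))) (sorted_list_of_multiset I)"
    if "I \<in> dmonoms p q n" for I
    using X A.dom.set_sorted_list_dmonoms[OF that] by (intro B.cod.wlist_cong) auto
  have "B.pull (A.pull \<omega>) = (\<Sum>I\<in>dmonoms p q n. B.pull (wedge p (A.cod.wlist A.dXi (sorted_list_of_multiset I)) (fun_form (\<theta> (\<omega> I)))))"
    unfolding A.pullback_eq[OF w]
    by (rule B.pullback_sum) (intro A.pullback_term_dforms A.morph_closed A.dom.dformsD(1)[OF w])
  also have "\<dots> = C.pull \<omega>"
    unfolding C.pullback_eq[OF w]
  proof (rule sum.cong[OF refl])
    fix I assume I: "I \<in> dmonoms p q n"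
    have t: "\<theta> (\<omega> I) \<in> A.cod.S" using A.morph_closed A.dom.dformsD(1)[OF w] .
    show "B.pull (wedge p (A.cod.wlist A.dXi (sorted_list_of_multiset I)) (fun_form (\<theta> (\<omega> I)))) =
      wedge p (B.cod.wlist C.dXi (sorted_list_of_multiset I)) (fun_form (\<theta>'' (\<omega> I)))"
      unfolding W[OF I] comp[OF A.dom.dformsD(1)[OF w]]
      using B.pullback_wlist_wedge[OF A.morph_closed[OF A.dom.sf_coord_in_sfuns] A.cod.dforms_fun[OF t]
          A.dom.set_sorted_list_dmonoms[OF I]] B.pullback_fun[OF t] by simp
  qed
  finally show ?thesis .
qed

section \<open>Lie derivatives along even derivations\<close>

locale even_derivation = superdomain +
  fixes D :: "sfun \<Rightarrow> sfun"
  assumes deriv_closed: "f \<in> S \<Longrightarrow> D f \<in> S"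
    and deriv_add: "f \<in> S \<Longrightarrow> g \<in> S \<Longrightarrow> D (f + g) = D f + D g"
    and deriv_scale: "f \<in> S \<Longrightarrow> D (sf_scale a f) = sf_scale a (D f)"
    and deriv_mult: "f \<in> S \<Longrightarrow> g \<in> S \<Longrightarrow> D (sf_mult f g) = sf_mult (D f) g + sf_mult f (D g)"
    and deriv_par: "f \<in> S \<Longrightarrow> sf_par k f \<Longrightarrow> sf_par k (D f)"
    and deriv_chain: "f \<in> S \<Longrightarrow> D f = (\<Sum>i<p + q. sf_mult (D (X i)) (pd i f))"
begin

lemma deriv_0 [simp]: "D 0 = 0"
  by (rule additive_zero[OF deriv_add])

lemma deriv_twist: "f \<in> S \<Longrightarrow> D (sf_twist k f) = sf_twist k (D f)"
  by (rule twist_natural[OF deriv_add deriv_scale deriv_par])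

lemma deriv_sum: "(\<And>i. i \<in> A \<Longrightarrow> f i \<in> S) \<Longrightarrow> D (\<Sum>i\<in>A. f i) = (\<Sum>i\<in>A. D (f i))"
  by (rule additive_on_sum(2)[of S D]) (auto simp: deriv_add intro: sfuns_add)

abbreviation "lie \<equiv> lie_deriv p q V D"
abbreviation "DX i \<equiv> sf_d p q V (D (X i))"

lemma coframe_DX: "coframe DX"
  unfolding coframe_def using sf_par_coord sf_coord_in_sfuns
  by (auto intro!: sf_d_dforms df_par_sf_d deriv_closed deriv_par)

lemma sum_wlist_update:
  "(\<Sum>r<length xs. foldr (wedge p) ((map U xs)[r := W (xs ! r)]) (fun_form unit_sf)) = wlist_deriv U W xs"
proof (induction xs)
  case (Cons x xs)
  then show ?case by (simp add: sum.lessThan_Suc_shift wlist_def[symmetric] wedge_sum_right[symmetric] del: sum.lessThan_Suc)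
qed simp

lemma lie_eq:
  assumes w: "\<omega> \<in> \<Omega> n"
  shows "lie \<omega> = (\<Sum>I\<in>dmonoms p q n. wlist_deriv (\<lambda>j. dX j) DX (sorted_list_of_multiset I) \<diamondop> fun_form (\<omega> I)
     + wlist (\<lambda>j. dX j) (sorted_list_of_multiset I) \<diamondop> fun_form (D (\<omega> I)))"
proof -
  let ?T = "\<lambda>I. wlist_deriv (\<lambda>j. dX j) DX (sorted_list_of_multiset I) \<diamondop> fun_form (\<omega> I)"
  have D\<omega>: "(\<lambda>L. D (\<omega> L)) \<in> \<Omega> n"
    using dformsD[OF w] by (intro dformsI) (simp_all add: deriv_closed)
  have T: "?T I \<in> \<Omega> n" if "I \<in> dmonoms p q n" for I
    using dforms_wedge[OF wlist_deriv_dforms[OF coframe_dX coframe_DX set_sorted_list_dmonoms[OF that]] dforms_fun[OF dformsD(1)[OF w, of I]]]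
      length_sorted_list_dmonoms[OF that] by simp
  have *: "lie \<omega> L = (\<Sum>I\<in>dmonoms p q (size L). ?T I L) + D (\<omega> L)" for L
  proof -
    have "(\<Sum>r<size I. wedge_list p V ((map (\<lambda>i. sf_d p q V (X i)) (sorted_list_of_multiset I))[r := sf_d p q V (D (X (sorted_list_of_multiset I ! r)))]))
      = wlist_deriv (\<lambda>j. dX j) DX (sorted_list_of_multiset I)" if "I \<in> dmonoms p q (size L)" for I
    proof -
      have m: "map (\<lambda>i. sf_d p q V (X i)) (sorted_list_of_multiset I) = map (\<lambda>j. dX j) (sorted_list_of_multiset I)"
        using sf_d_coord set_sorted_list_dmonoms[OF that] by auto
      show ?thesis unfolding m
        using sum_wlist_update[where U = "\<lambda>j. dX j" and W = DX and xs = "sorted_list_of_multiset I"] length_sorted_list_dmonoms[OF that] that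
        by (simp add: wedge_list_def dmonoms_iff)
    qed
    then have "(\<Sum>I\<in>dmonoms p q (size L). \<Sum>r<size I. wedge_list p V ((map (\<lambda>i. sf_d p q V (X i)) (sorted_list_of_multiset I))[r := sf_d p q V (D (X (sorted_list_of_multiset I ! r)))])
      \<diamondop> fun_form (\<omega> I)) = (\<Sum>I\<in>dmonoms p q (size L). ?T I)"
      unfolding wedge_sum_left[symmetric] by simp
    from fun_cong[OF this, of L] show ?thesis
      by (simp add: lie_deriv_def fun_eq_iff sum_fun_apply plus_fun_apply)
  qed
  have "lie \<omega> L = ((\<Sum>I\<in>dmonoms p q n. ?T I) + (\<lambda>L. D (\<omega> L))) L" for L
  proof (cases "size L = n")
    case True
    then show ?thesis using * by (simp add: sum_fun_apply[of _ _ L] plus_fun_apply[of _ _ L])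
  next
    case False
    then have "I \<notin> dmonoms p q n" if "I \<in> dmonoms p q (size L)" for I using that by (auto simp: dmonoms_iff)
    then have "(\<Sum>I\<in>dmonoms p q (size L). ?T I L) = 0" using dformsD(2)[OF w] by (simp add: zero_fun_apply[of L])
    moreover have "L \<notin> dmonoms p q n" using False by (auto simp: dmonoms_iff)
    moreover have "(\<Sum>I\<in>dmonoms p q n. ?T I) \<in> \<Omega> n" by (intro dforms_sum T)
    ultimately have "(\<Sum>I\<in>dmonoms p q n. ?T I) L = 0" "(\<Sum>I\<in>dmonoms p q (size L). ?T I L) = 0" by (blast intro: dformsD(2))+
    then show ?thesis using * by (simp add: plus_fun_apply[of _ _ L])
  qed
  then have "lie \<omega> = (\<Sum>I\<in>dmonoms p q n. ?T I) + (\<lambda>L. D (\<omega> L))" by blast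
  with dform_expand[OF D\<omega>] show ?thesis by (simp add: sum.distrib)
qed

lemma lie_add:
  assumes a: "\<alpha> \<in> \<Omega> n" and b: "\<beta> \<in> \<Omega> n"
  shows "lie (\<alpha> + \<beta>) = lie \<alpha> + lie \<beta>"
  unfolding lie_eq[OF a] lie_eq[OF b] lie_eq[OF dforms_add[OF a b]] plus_fun_apply[of \<alpha> \<beta>]
    deriv_add[OF dformsD(1)[OF a] dformsD(1)[OF b]] dmonom_form_add wedge_add_right sum.distrib
  by (simp add: add_ac)

lemma lie_0 [simp]: "lie 0 = 0"
  using lie_eq[OF dforms_0[of 0]] by (simp add: zero_fun_apply[of "{#}"])

lemma lie_sum: "(\<And>i. i \<in> A \<Longrightarrow> f i \<in> \<Omega> n) \<Longrightarrow> lie (\<Sum>i\<in>A. f i) = (\<Sum>i\<in>A. lie (f i))"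
  by (rule additive_on_sum(2)[of "\<Omega> n" lie]) (auto simp: lie_add intro: dforms_add)

lemma lie_fun: "f \<in> S \<Longrightarrow> lie (fun_form f) = fun_form (D f)"
  using deriv_closed[of f] by (simp add: lie_eq[OF dforms_fun] dmonom_form_apply wedge_fun_fun)

lemma lie_fun_wedge:
  assumes h: "h \<in> S" and b: "\<beta> \<in> \<Omega> n"
  shows "lie (fun_form h \<diamondop> \<beta>) = fun_form (D h) \<diamondop> \<beta> + fun_form h \<diamondop> lie \<beta>"
proof -
  have hb: "fun_form h \<diamondop> \<beta> \<in> \<Omega> n" using dforms_wedge[OF dforms_fun[OF h] b] by simp
  have be: "fun_form (D h) \<diamondop> \<beta> = (\<Sum>I\<in>dmonoms p q n. fun_form (D h) \<diamondop> wlist (\<lambda>j. dX j) (sorted_list_of_multiset I) \<diamondop> fun_form (\<beta> I))"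
    using arg_cong[OF dform_expand[OF b], of "\<lambda>\<gamma>. fun_form (D h) \<diamondop> \<gamma>"] by (simp only: wedge_sum_right)
  show ?thesis
    unfolding lie_eq[OF hb] lie_eq[OF b] wedge_sum_right be sum.distrib[symmetric]
  proof (rule sum.cong[OF refl])
    fix I assume I: "I \<in> dmonoms p q n"
    let ?W = "wlist (\<lambda>j. dX j) (sorted_list_of_multiset I)" and ?W' = "wlist_deriv (\<lambda>j. dX j) DX (sorted_list_of_multiset I)"
    note sl = set_sorted_list_dmonoms[OF I]
    have "df_par p (odd_size p I) ?W" "df_par p (odd_size p I) ?W'"
      using df_par_wlist[OF coframe_dX sl] df_par_wlist_deriv[OF coframe_dX coframe_DX sl] by simp_all
    note c1 = fun_wedge_commute[OF wlist_dforms[OF coframe_dX sl] this(1)]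
      and c2 = fun_wedge_commute[OF wlist_deriv_dforms[OF coframe_dX coframe_DX sl] this(2)]
    have "D ((fun_form h \<diamondop> \<beta>) I) = sf_mult (sf_twist (odd_size p I) (D h)) (\<beta> I) + sf_mult (sf_twist (odd_size p I) h) (D (\<beta> I))"
      unfolding wedge_fun_form_eq(2)[OF b] deriv_mult[OF sfuns_twist[OF h] dformsD(1)[OF b]] deriv_twist[OF h] ..
    moreover have "(fun_form h \<diamondop> \<beta>) I = sf_mult (sf_twist (odd_size p I) h) (\<beta> I)"
      using wedge_fun_form_eq(2)[OF b] by simp
    ultimately show "?W' \<diamondop> fun_form ((fun_form h \<diamondop> \<beta>) I) + ?W \<diamondop> fun_form (D ((fun_form h \<diamondop> \<beta>) I)) =
      fun_form (D h) \<diamondop> ?W \<diamondop> fun_form (\<beta> I) + fun_form h \<diamondop> (?W' \<diamondop> fun_form (\<beta> I) + ?W \<diamondop> fun_form (D (\<beta> I)))"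
      by (simp add: fun_form_mult wedge_add_right wedge_assoc[symmetric] c1 c2 dmonom_form_add add_ac)
  qed
qed

lemma lie_dX_wedge:
  assumes b: "\<beta> \<in> \<Omega> n" and j: "j < p + q"
  shows "lie (dX j \<diamondop> \<beta>) = DX j \<diamondop> \<beta> + dX j \<diamondop> lie \<beta>"
proof -
  let ?W = "\<lambda>I. wlist (\<lambda>j. dX j) (sorted_list_of_multiset I)" and ?W' = "\<lambda>I. wlist_deriv (\<lambda>j. dX j) DX (sorted_list_of_multiset I)"
  have "lie (dX j \<diamondop> \<beta>) = (\<Sum>L\<in>dmonoms p q (Suc n). ?W' L \<diamondop> fun_form ((dX j \<diamondop> \<beta>) L) + ?W L \<diamondop> fun_form (D ((dX j \<diamondop> \<beta>) L)))"
    by (rule lie_eq[OF dforms_wedge_1[OF dforms_dX[OF j] b]])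
  also have "\<dots> = (\<Sum>I\<in>dmonoms p q n. if j < p \<and> j \<in># I then 0 else
      ?W' (add_mset j I) \<diamondop> fun_form (sf_scale (dmonom_sign p {#j#} I) (\<beta> I)) +
      ?W (add_mset j I) \<diamondop> fun_form (D (sf_scale (dmonom_sign p {#j#} I) (\<beta> I))))"
    by (rule sum_wedge_dX[OF b j, of "\<lambda>L f. ?W' L \<diamondop> fun_form f + ?W L \<diamondop> fun_form (D f)"]) simp
  also have "\<dots> = (\<Sum>I\<in>dmonoms p q n. (DX j \<diamondop> ?W I + dX j \<diamondop> ?W' I) \<diamondop> fun_form (\<beta> I) + (dX j \<diamondop> ?W I) \<diamondop> fun_form (D (\<beta> I)))"
  proof (rule sum.cong[OF refl])
    fix I assume I: "I \<in> dmonoms p q n"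
    note sl = set_sorted_list_dmonoms[OF I]
    show "(if j < p \<and> j \<in># I then 0 else
      ?W' (add_mset j I) \<diamondop> fun_form (sf_scale (dmonom_sign p {#j#} I) (\<beta> I)) +
      ?W (add_mset j I) \<diamondop> fun_form (D (sf_scale (dmonom_sign p {#j#} I) (\<beta> I)))) =
      (DX j \<diamondop> ?W I + dX j \<diamondop> ?W' I) \<diamondop> fun_form (\<beta> I) + (dX j \<diamondop> ?W I) \<diamondop> fun_form (D (\<beta> I))"
      using wlist_insort[OF coframe_dX j, of "sorted_list_of_multiset I"] wlist_deriv_insort[OF coframe_dX coframe_DX j, of "sorted_list_of_multiset I"] sl
      by (simp add: deriv_scale[OF dformsD(1)[OF b]] dmonom_form_scale wedge_scale_right wedge_scale_left)
  qed
  also have "\<dots> = DX j \<diamondop> (\<Sum>I\<in>dmonoms p q n. ?W I \<diamondop> fun_form (\<beta> I)) + dX j \<diamondop> lie \<beta>"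
    by (simp add: lie_eq[OF b] wedge_sum_right wedge_add_left wedge_add_right sum.distrib wedge_assoc add_ac)
  finally show ?thesis by (simp only: dform_expand[OF b, symmetric])
qed

text \<open>The left side is the Lie derivative of \<open>dg\<close>. After expansion by
  \<open>deriv_chain\<close>, the terms in which \<open>d\<close> falls on \<open>D (X i)\<close>
  agree at once; the others contain second derivatives of \<open>g\<close>, symmetric up to the sign
  of moving \<open>D (X i)\<close> past \<open>dX j\<close>.\<close>

lemma sum_dX_D:
  assumes g: "g \<in> S"
  shows "(\<Sum>j<p + q. DX j \<diamondop> fun_form (pd j g) + dX j \<diamondop> fun_form (D (pd j g))) = sf_d p q V (D g)"
proof -
  have DXS: "D (X i) \<in> S" if "i < p + q" for i using deriv_closed sf_coord_in_sfuns that by blast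
  note gS = sf_pderiv_in_sfuns[OF g]
  have t: "dX j \<diamondop> fun_form (D (X i)) \<diamondop> fun_form (pd i (pd j g)) = fun_form (D (X i)) \<diamondop> dX j \<diamondop> fun_form (sf_scale ((- 1) ^ (cpar p i * cpar p j)) (pd i (pd j g)))"
    if "i < p + q" "j < p + q" for i j
  proof -
    have "fun_form (D (X i)) \<diamondop> dX j = dX j \<diamondop> fun_form (sf_scale ((- 1) ^ (cpar p i * cpar p j)) (D (X i)))"
      using sf_twist_par[OF deriv_par[OF sf_coord_in_sfuns[OF that(1)] sf_par_coord], of "cpar p j"]
      by (simp add: fun_wedge_commute[OF dforms_dX[OF that(2)] df_par_dX] mult.commute)
    then show ?thesis
      by (simp add: wedge_assoc[symmetric] dmonom_form_scale wedge_scale_left wedge_scale_right)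
  qed
  have c: "sf_scale ((- 1) ^ (cpar p i * cpar p j)) (pd i (pd j g)) = pd j (pd i g)" if "i < p + q" "j < p + q" for i j
    by (subst sf_pderiv_commute[OF g that]) simp
  have "(\<Sum>j<p + q. dX j \<diamondop> fun_form (D (pd j g))) = (\<Sum>j<p + q. \<Sum>i<p + q. dX j \<diamondop> fun_form (D (X i)) \<diamondop> fun_form (pd i (pd j g)))"
    by (intro sum.cong refl) (simp add: deriv_chain[OF gS] dmonom_form_sum wedge_sum_right wedge_fun_fun)
  also have "\<dots> = (\<Sum>j<p + q. \<Sum>i<p + q. fun_form (D (X i)) \<diamondop> dX j \<diamondop> fun_form (pd j (pd i g)))"
    using t c by (intro sum.cong refl) simp
  also have "\<dots> = (\<Sum>i<p + q. fun_form (D (X i)) \<diamondop> sf_d p q V (pd i g))"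
    by (subst sum.swap, intro sum.cong refl) (simp add: sf_d_eq[OF gS] wedge_sum_right)
  finally have 1: "(\<Sum>j<p + q. dX j \<diamondop> fun_form (D (pd j g))) = (\<Sum>i<p + q. fun_form (D (X i)) \<diamondop> sf_d p q V (pd i g))" .
  have "sf_d p q V (D g) = (\<Sum>i<p + q. sf_d p q V (sf_mult (D (X i)) (pd i g)))"
    unfolding deriv_chain[OF g] by (rule sf_d_sum) (auto intro: sfuns_mult DXS gS)
  also have "\<dots> = (\<Sum>i<p + q. DX i \<diamondop> fun_form (pd i g) + fun_form (D (X i)) \<diamondop> sf_d p q V (pd i g))"
    by (intro sum.cong refl)
      (simp add: sf_d_def[of p q V "sf_mult _ _"] fun_form_mult ext_d_fun_wedge[OF DXS dforms_fun[OF gS]] sf_d_def[of p q V "pd _ _"])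
  finally show ?thesis by (simp add: 1 sum.distrib)
qed

lemma lie_sf_d_wedge:
  assumes g: "g \<in> S" and b: "\<beta> \<in> \<Omega> n"
  shows "lie (sf_d p q V g \<diamondop> \<beta>) = sf_d p q V (D g) \<diamondop> \<beta> + sf_d p q V g \<diamondop> lie \<beta>"
proof -
  have gb: "fun_form (pd j g) \<diamondop> \<beta> \<in> \<Omega> n" if "j < p + q" for j
    using dforms_wedge[OF dforms_fun[OF sf_pderiv_in_sfuns[OF g that]] b] by simp
  have "lie (sf_d p q V g \<diamondop> \<beta>) = (\<Sum>j<p + q. lie (dX j \<diamondop> fun_form (pd j g) \<diamondop> \<beta>))"
    unfolding sf_d_eq[OF g] wedge_sum_left wedge_assoc
    by (rule lie_sum[of _ _ "Suc n"]) (auto intro!: dforms_wedge_1 dforms_dX gb)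
  also have "\<dots> = (\<Sum>j<p + q. (DX j \<diamondop> fun_form (pd j g) + dX j \<diamondop> fun_form (D (pd j g))) \<diamondop> \<beta> + (dX j \<diamondop> fun_form (pd j g)) \<diamondop> lie \<beta>)"
    by (intro sum.cong refl)
      (simp add: lie_dX_wedge[OF gb] lie_fun_wedge[OF sf_pderiv_in_sfuns[OF g] b] wedge_add_right wedge_add_left wedge_assoc add_ac)
  also have "\<dots> = sf_d p q V (D g) \<diamondop> \<beta> + sf_d p q V g \<diamondop> lie \<beta>"
    by (subst sum_dX_D[OF g, symmetric]) (simp add: sum.distrib wedge_sum_left wedge_add_left sf_d_eq[OF g])
  finally show ?thesis .
qed

text \<open>By the Leibniz rule the weights of the factors add up. The \<open>g i\<close> are
  arbitrary homogeneous functions: in a chart that is not homogeneous they are the expressions of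
  the homogeneous coordinates of another chart.\<close>

lemma lie_wlist_weights:
  assumes g: "\<And>i. i < p + q \<Longrightarrow> g i \<in> S" and Dg: "\<And>i. i < p + q \<Longrightarrow> D (g i) = sf_scale (w i) (g i)"
    and f: "f \<in> S" and Df: "D f = sf_scale \<mu> f" and xs: "set xs \<subseteq> {..<p + q}"
  shows "wlist (\<lambda>i. sf_d p q V (g i)) xs \<diamondop> fun_form f \<in> \<Omega> (length xs) \<and>
    lie (wlist (\<lambda>i. sf_d p q V (g i)) xs \<diamondop> fun_form f) =
      df_scale (sum_list (map w xs) + \<mu>) (wlist (\<lambda>i. sf_d p q V (g i)) xs \<diamondop> fun_form f)"
  using xs
proof (induction xs)
  case Nil
  then show ?case using f Df by (simp add: wedge_fun_fun dforms_fun lie_fun dmonom_form_scale)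
next
  case (Cons x xs)
  let ?b = "wlist (\<lambda>i. sf_d p q V (g i)) xs \<diamondop> fun_form f"
  have x: "x < p + q" using Cons.prems by simp
  have add: "df_scale a \<gamma> + df_scale b \<gamma> = df_scale (a + b) \<gamma>" for a b \<gamma>
    by (simp add: df_scale_def sf_scale_def fun_eq_iff plus_fun_apply algebra_simps)
  have IH: "?b \<in> \<Omega> (length xs)" "lie ?b = df_scale (sum_list (map w xs) + \<mu>) ?b" using Cons by auto
  show ?case
    using dforms_wedge_1[OF sf_d_dforms[OF g[OF x]] IH(1)] lie_sf_d_wedge[OF g[OF x] IH(1)] IH(2) Dg[OF x] sf_d_scale[OF g[OF x]]
    by (simp add: wedge_assoc wedge_scale_left wedge_scale_right add add.assoc)
qed

lemma lie_homogeneous_coords: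
  assumes w: "\<And>i. i < p + q \<Longrightarrow> D (X i) = sf_scale (w i) (X i)" and om: "\<omega> \<in> \<Omega> n"
  shows "lie \<omega> I = sf_scale (\<Sum>i\<in>#I. w i) (\<omega> I) + D (\<omega> I)"
proof -
  have d: "wlist_deriv (\<lambda>j. dX j) DX xs = df_scale (sum_list (map w xs)) (wlist (\<lambda>j. dX j) xs)" if "set xs \<subseteq> {..<p + q}" for xs
    using that
  proof (induction xs)
    case (Cons x xs)
    have add: "df_scale a \<gamma> + df_scale b \<gamma> = df_scale (a + b) \<gamma>" for a b \<gamma>
      by (simp add: df_scale_def sf_scale_def fun_eq_iff plus_fun_apply algebra_simps)
    show ?case using Cons w[of x] sf_d_scale[OF sf_coord_in_sfuns, of x] sf_d_coord[of x]
      by (simp add: wedge_scale_left wedge_scale_right add)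
  qed simp
  have sl: "sum_list (map w (sorted_list_of_multiset J)) = (\<Sum>i\<in>#J. w i)" for J
    by (metis mset_map mset_sorted_list_of_multiset sum_mset_sum_list)
  have sc: "(\<lambda>I. sf_scale (\<Sum>i\<in>#I. w i) (\<omega> I) + D (\<omega> I)) \<in> \<Omega> n" (is "?R \<in> _")
    using dformsD[OF om] by (intro dformsI) (simp_all add: sfuns_add sfuns_scale deriv_closed)
  have "lie \<omega> = (\<Sum>I\<in>dmonoms p q n. wlist (\<lambda>j. dX j) (sorted_list_of_multiset I) \<diamondop> fun_form (?R I))"
    unfolding lie_eq[OF om]
  proof (rule sum.cong[OF refl])
    fix I assume I: "I \<in> dmonoms p q n"
    show "wlist_deriv (\<lambda>j. dX j) DX (sorted_list_of_multiset I) \<diamondop> fun_form (\<omega> I) + wlist (\<lambda>j. dX j) (sorted_list_of_multiset I) \<diamondop> fun_form (D (\<omega> I))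
      = wlist (\<lambda>j. dX j) (sorted_list_of_multiset I) \<diamondop> fun_form (?R I)"
      by (simp add: d[OF set_sorted_list_dmonoms[OF I]] sl dmonom_form_add dmonom_form_scale wedge_add_right wedge_scale_left wedge_scale_right)
  qed
  also have "\<dots> = ?R" by (rule dform_expand[OF sc, symmetric])
  finally show ?thesis by simp
qed

end

text \<open>Homogeneity is asked for in every chart of a neighbourhood, also in those that are not
  homogeneous. There the pulled back differentials are still eigenforms, because the Lie derivative
  of \<open>dg\<close> is \<open>d(D g)\<close> and \<open>\<theta>(x^i)\<close> keeps the weight
  \<open>w i\<close>.\<close>

lemma lie_pullback:
  assumes 1: "sf_morphism p q V V' \<theta>" and 2: "even_derivation p q V' D'"
    and X: "\<And>i. i < p + q \<Longrightarrow> D' (\<theta> (sf_coord p V i)) = sf_scale (w i) (\<theta> (sf_coord p V i))"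
    and om: "\<omega> \<in> dforms p q V n"
    and D: "\<And>I. I \<in> dmonoms p q n \<Longrightarrow> D' (\<theta> (\<omega> I)) = sf_scale (\<mu> - (\<Sum>i\<in>#I. w i)) (\<theta> (\<omega> I))"
  shows "lie_deriv p q V' D' (pullback p q V V' \<theta> \<omega>) = df_scale \<mu> (pullback p q V V' \<theta> \<omega>)"
proof -
  interpret A: sf_morphism p q V V' \<theta> by (rule 1)
  interpret E: even_derivation p q V' D' by (rule 2)
  have sl: "sum_list (map w (sorted_list_of_multiset J)) = (\<Sum>i\<in>#J. w i)" for J
    by (metis mset_map mset_sorted_list_of_multiset sum_mset_sum_list)
  have "E.lie (A.pull \<omega>) = (\<Sum>I\<in>dmonoms p q n. E.lie (wedge p (A.cod.wlist A.dXi (sorted_list_of_multiset I)) (fun_form (\<theta> (\<omega> I)))))"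
    unfolding A.pullback_eq[OF om]
    by (rule E.lie_sum) (intro A.pullback_term_dforms A.morph_closed A.dom.dformsD(1)[OF om])
  also have "\<dots> = df_scale \<mu> (A.pull \<omega>)"
    unfolding A.pullback_eq[OF om] df_scale_sum
  proof (rule sum.cong[OF refl])
    fix I assume I: "I \<in> dmonoms p q n"
    show "E.lie (wedge p (A.cod.wlist A.dXi (sorted_list_of_multiset I)) (fun_form (\<theta> (\<omega> I)))) =
      df_scale \<mu> (wedge p (A.cod.wlist A.dXi (sorted_list_of_multiset I)) (fun_form (\<theta> (\<omega> I))))"
      using E.lie_wlist_weights[where g = "\<lambda>i. \<theta> (sf_coord p V i)", OF A.morph_closed[OF A.dom.sf_coord_in_sfuns] X
          A.morph_closed[OF A.dom.dformsD(1)[OF om]] D[OF I] A.dom.set_sorted_list_dmonoms[OF I]] by (simp add: sl)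
  qed
  finally show ?thesis .
qed

section \<open>The chain rule\<close>

lemma (in superdomain) sf_par_odd_empty: "sf_par 1 f \<Longrightarrow> f {} x = 0"
  by (auto simp: sf_par_def)

context superdomain_pair
begin

text \<open>Both sides are derivations along \<open>\<theta>\<close> that agree on coordinates.  By Hadamard's lemma their
  difference at a point lies in every power of the ideal of functions vanishing there, so all
  coefficients of it vanish at the point.\<close>

lemma derivation_chain_box:
  assumes VB: "V = ebox p a r" and f: "f \<in> dom.S"
    and t_closed: "\<And>f. f \<in> dom.S \<Longrightarrow> \<theta> f \<in> cod.S"
    and t_add: "\<And>f g. f \<in> dom.S \<Longrightarrow> g \<in> dom.S \<Longrightarrow> \<theta> (f + g) = \<theta> f + \<theta> g"
    and t_scale: "\<And>f c. f \<in> dom.S \<Longrightarrow> \<theta> (sf_scale c f) = sf_scale c (\<theta> f)"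
    and t_mult: "\<And>f g. f \<in> dom.S \<Longrightarrow> g \<in> dom.S \<Longrightarrow> \<theta> (sf_mult f g) = sf_mult (\<theta> f) (\<theta> g)"
    and t_unit: "\<theta> dom.unit_sf = cod.unit_sf"
    and t_par: "\<And>f k. f \<in> dom.S \<Longrightarrow> sf_par k f \<Longrightarrow> sf_par k (\<theta> f)"
    and y: "y \<in> V'" and t_body: "\<And>i. i < p \<Longrightarrow> \<theta> (dom.X i) {} y = a i"
    and d_closed: "\<And>f. f \<in> dom.S \<Longrightarrow> \<delta> f \<in> cod.S"
    and d_add: "\<And>f g. f \<in> dom.S \<Longrightarrow> g \<in> dom.S \<Longrightarrow> \<delta> (f + g) = \<delta> f + \<delta> g"
    and d_const: "\<And>c. \<delta> (sf_of_fun V (\<lambda>_. c)) = 0"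
    and d_par: "\<And>f k. f \<in> dom.S \<Longrightarrow> sf_par k f \<Longrightarrow> sf_par (k + \<rho>) (\<delta> f)"
    and d_mult: "\<And>f g. f \<in> dom.S \<Longrightarrow> g \<in> dom.S \<Longrightarrow>
      \<delta> (sf_mult f g) = sf_mult (\<delta> f) (\<theta> g) + sf_mult (sf_twist \<rho> (\<theta> f)) (\<delta> g)"
  shows "\<delta> f J y = (\<Sum>i<p + q. sf_mult (\<delta> (dom.X i)) (\<theta> (dom.pd i f))) J y"
proof -
  \<comment> \<open>\<open>\<rho>\<close> is the parity of \<open>\<delta>\<close>. The lemma serves
    for the composite of a partial derivative with a change of coordinates and, with
    \<open>\<theta>\<close> the identity, for a vector field.\<close>
  define R where "R f = (\<Sum>i<p + q. sf_mult (\<delta> (dom.X i)) (\<theta> (dom.pd i f)))" for f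
  define \<Delta> where "\<Delta> f = \<delta> f - R f" for f
  note XS = dom.sf_coord_in_sfuns and pdS = dom.sf_pderiv_in_sfuns
  have cS: "sf_of_fun V (\<lambda>_. c) \<in> dom.S" for c by (rule dom.sfuns_of_fun smooth_fun_const dom.openV)+
  have cc: "sf_of_fun W (\<lambda>_. c) = sf_scale c (sf_of_fun W (\<lambda>_. 1))" for W c
    by (auto simp: sf_of_fun_def sf_scale_def fun_eq_iff)
  have t0: "\<theta> 0 = 0" by (rule dom.additive_zero[OF t_add])
  have t_const: "\<theta> (sf_of_fun V (\<lambda>_. c)) = sf_of_fun V' (\<lambda>_. c)" for c
    using t_scale[OF dom.unit_in_sfuns, of c] t_unit cc[of V c] cc[of V' c] by metis
  have t_twist: "\<theta> (sf_twist k f) = sf_twist k (\<theta> f)" if "f \<in> dom.S" for k f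
    by (rule dom.twist_natural[OF t_add t_scale t_par that])
  have R_closed: "R f \<in> cod.S" if "f \<in> dom.S" for f
    unfolding R_def by (intro cod.sfuns_sum cod.sfuns_mult d_closed t_closed XS pdS that) auto
  have D_closed: "\<Delta> f \<in> cod.S" if "f \<in> dom.S" for f
    unfolding \<Delta>_def by (intro cod.sfuns_diff d_closed R_closed that)
  have R_add: "R (f + g) = R f + R g" if "f \<in> dom.S" "g \<in> dom.S" for f g
    unfolding R_def sum.distrib[symmetric]
    using that by (intro sum.cong refl) (simp add: dom.sf_pderiv_add t_add pdS sf_mult_add_right)
  have D_add: "\<Delta> (f + g) = \<Delta> f + \<Delta> g" if "f \<in> dom.S" "g \<in> dom.S" for f g
    unfolding \<Delta>_def using d_add[OF that] R_add[OF that] by simp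
  have D_const: "\<Delta> (sf_of_fun V (\<lambda>_. c)) = 0" for c
    by (simp add: \<Delta>_def R_def d_const dom.sf_pderiv_const t0)
  have D_coord: "\<Delta> (dom.X i) = 0" if i: "i < p + q" for i
  proof -
    have "R (dom.X i) = (\<Sum>k<p + q. if k = i then \<delta> (dom.X i) else 0)"
      unfolding R_def using i d_closed[OF XS[OF i]]
      by (intro sum.cong refl) (auto simp: dom.sf_pderiv_coord t_unit t0)
    then show ?thesis using i by (simp add: \<Delta>_def)
  qed
  \<comment> \<open>\<open>\<Delta>\<close> inherits the product rule of \<open>\<delta>\<close>:
    the sign of moving \<open>\<theta> u\<close> past \<open>\<delta> (dom.X i)\<close>, which has
    parity \<open>cpar p i + \<rho>\<close>, cancels the twist by \<open>cpar p i\<close> and leaves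
    the one by \<open>\<rho>\<close>.\<close>
  have D_mult: "\<Delta> (sf_mult u h) = sf_mult (\<Delta> u) (\<theta> h) + sf_scale ((- 1) ^ (\<rho> * s)) (sf_mult (\<theta> u) (\<Delta> h))"
    if u: "u \<in> dom.S" "sf_par s u" and h: "h \<in> dom.S" for u s h
  proof -
    note tu = t_par[OF u]
    have R: "sf_mult (\<delta> (dom.X i)) (\<theta> (dom.pd i (sf_mult u h))) = sf_mult (sf_mult (\<delta> (dom.X i)) (\<theta> (dom.pd i u))) (\<theta> h)
      + sf_scale ((- 1) ^ (\<rho> * s)) (sf_mult (\<theta> u) (sf_mult (\<delta> (dom.X i)) (\<theta> (dom.pd i h))))" if i: "i < p + q" for i
    proof -
      have dp: "sf_par (cpar p i + \<rho>) (\<delta> (dom.X i))" by (rule d_par[OF XS[OF i] sf_par_coord])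
      have "sf_mult (\<delta> (dom.X i)) (\<theta> u) = sf_scale ((- 1) ^ (s * (cpar p i + \<rho>))) (sf_mult (\<theta> u) (\<delta> (dom.X i)))"
        by (simp add: sf_mult_commute[OF tu] sf_twist_par[OF dp] sf_mult_scale_right)
      then have "sf_mult (\<delta> (dom.X i)) (sf_twist (cpar p i) (\<theta> u)) = sf_scale ((- 1) ^ (\<rho> * s)) (sf_mult (\<theta> u) (\<delta> (dom.X i)))"
        by (simp add: sf_twist_par[OF tu] sf_mult_scale_right power_add distrib_left mult.commute[of s])
      then show ?thesis
        using t_add[OF dom.sfuns_mult[OF pdS[OF u(1) i] h] dom.sfuns_mult[OF dom.sfuns_twist[OF u(1)] pdS[OF h i]]]
          t_mult[OF pdS[OF u(1) i] h] t_mult[OF dom.sfuns_twist[OF u(1)] pdS[OF h i]] t_twist[OF u(1)]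
        by (simp add: dom.sf_pderiv_mult[OF u(1) h i] sf_mult_add_right sf_mult_assoc[symmetric] sf_mult_scale_left)
    qed
    have "R (sf_mult u h) = sf_mult (R u) (\<theta> h) + sf_scale ((- 1) ^ (\<rho> * s)) (sf_mult (\<theta> u) (R h))"
      unfolding R_def sf_mult_sum_left sf_mult_sum_right sf_scale_sum sum.distrib[symmetric]
      using R by (intro sum.cong refl) simp
    moreover have diff: "sf_mult (A - B) C = sf_mult A C - sf_mult B C" "sf_mult C (A - B) = sf_mult C A - sf_mult C B"
      "sf_scale c (A - B) = sf_scale c A - sf_scale c B" for A B C c
      by (simp_all add: sf_mult_def sf_scale_def fun_eq_iff minus_apply algebra_simps sum_subtractf)
    ultimately show ?thesis
      unfolding \<Delta>_def d_mult[OF u(1) h] diff by (simp add: sf_twist_par[OF tu] sf_mult_scale_left algebra_simps)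
  qed
  have "\<forall>f\<in>dom.S. \<forall>J. finite J \<longrightarrow> card J < N \<longrightarrow> \<Delta> f J y = 0" for N
  proof (induction N)
    case (Suc N)
    \<comment> \<open>The coefficient of \<open>\<theta> u\<close> at the empty set vanishes at
      \<open>y\<close>. So only coefficients of \<open>\<Delta> h\<close> at proper subsets of
      \<open>L\<close> enter the product, and these are covered by the induction hypothesis.\<close>
    have key: "\<forall>J. finite J \<longrightarrow> card J < Suc N \<longrightarrow> \<Delta> (sf_mult u h) J y = 0"
      if u: "u \<in> dom.S" "sf_par s u" "\<Delta> u = 0" "\<theta> u {} y = 0" and h: "h \<in> dom.S" for u s h
    proof (intro allI impI)
      fix L :: "nat set" assume L: "finite L" "card L < Suc N"
      have "sf_mult (\<theta> u) (\<Delta> h) L y = 0"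
        unfolding sf_mult_def
      proof (rule sum.neutral, rule ballI)
        fix K assume K: "K \<in> Pow L"
        show "grass_sign K (L - K) * \<theta> u K y * \<Delta> h (L - K) y = 0"
        proof (cases "K = {}")
          case False
          then have "L - K \<subset> L" using K by auto
          then have "card (L - K) < card L" using L by (intro psubset_card_mono)
          then show ?thesis using Suc.IH h L by simp
        qed (use u(4) in simp)
      qed
      then show "\<Delta> (sf_mult u h) L y = 0"
        using D_mult[OF u(1,2) h] u(3) by (simp add: sf_scale_def)
    qed
    show ?case
    proof
      fix f assume f: "f \<in> dom.S"
      from VB f show "\<forall>J. finite J \<longrightarrow> card J < Suc N \<longrightarrow> \<Delta> f J y = 0"
      proof (induction rule: dom.hadamard_induct)
        case (const c)
        show ?case by (simp add: D_const zero_fun_apply)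
      next
        case (add f g)
        have "(\<lambda>a b. f a b + g a b) = f + g" by (simp add: fun_eq_iff plus_fun_apply)
        then show ?case using add(3,4) D_add[OF add(1,2)] by (simp add: plus_fun_apply)
      next
        case (even i h)
        have S: "dom.X i \<in> dom.S" "- sf_of_fun V (\<lambda>_. a i) \<in> dom.S" using even(1) XS cS by (auto intro: dom.sfuns_minus)
        have mc: "- sf_of_fun V (\<lambda>_. a i) = sf_of_fun V (\<lambda>_. - a i)" by (auto simp: sf_of_fun_def fun_eq_iff uminus_apply)
        have e: "dom.X i - sf_of_fun V (\<lambda>_. a i) = dom.X i + sf_of_fun V (\<lambda>_. - a i)" using mc by (metis add_uminus_conv_diff)
        have "sf_par 0 (dom.X i)" using sf_par_coord[of p i V] even(1) by (simp add: cpar_def)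
        moreover have "\<Delta> (dom.X i + sf_of_fun V (\<lambda>_. - a i)) = 0"
          using D_add[OF S(1) cS, of "- a i"] D_coord[of i] D_const even(1) by simp
        moreover have "\<theta> (dom.X i + sf_of_fun V (\<lambda>_. - a i)) {} y = 0"
          using t_add[OF S(1) cS, of "- a i"] t_const t_body[OF even(1)] y by (simp add: plus_fun_apply sf_of_fun_def)
        ultimately show ?case
          unfolding e using S(1) cS[of "- a i"] even(2)
          by (intro key[of _ 0]) (auto intro: dom.sfuns_add sf_par_add)
      next
        case (odd i h)
        have "sf_par 1 (dom.X i)" using sf_par_coord[of p i V] odd(1) by (simp add: cpar_def)
        moreover have "\<theta> (dom.X i) {} y = 0"
          by (rule cod.sf_par_odd_empty[OF t_par[OF XS[OF odd(2)] calculation]])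
        ultimately show ?case using key[OF XS[OF odd(2)] _ D_coord[OF odd(2)] _ odd(3), of 1] by blast
      qed
    qed
  qed simp
  then have "\<Delta> f J y = 0" using f cod.sfuns_infinite[OF D_closed[OF f]] by (cases "finite J") (blast, simp)
  then show ?thesis by (simp add: \<Delta>_def R_def minus_apply)
qed

end

section \<open>Charts\<close>

lemma of_nat_bit_eq_iff: "(of_nat m :: bit) = of_nat n \<longleftrightarrow> even (m + n)"
proof -
  have "(of_nat k :: bit) = (if even k then 0 else 1)" for k
    by (induction k) auto
  then show ?thesis by auto
qed

lemma ex_of_nat_bit: "\<exists>k. (\<sigma> :: bit) = of_nat k"
  by (metis bit_not_one_iff of_nat_0 of_nat_1)

lemma sf_alg_simps [simp]:
  "carrier (sf_alg p q V) = sfuns p q V" "mult (sf_alg p q V) = sf_mult"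
  "one (sf_alg p q V) = sf_of_fun V (\<lambda>_. 1)" "add (sf_alg p q V) = (+)" "smult (sf_alg p q V) = sf_scale"
  by (auto simp: sf_alg_def fun_eq_iff sf_scale_def plus_fun_apply)

lemma hpart_sf_alg: "hpart (sf_alg p q V) (of_nat k) = {f \<in> sfuns p q V. sf_par k f}"
  by (auto simp: sf_alg_def sf_par_def of_nat_bit_eq_iff)

locale smfd =
  fixes p q :: nat and M :: "('a, 's) superspace"
  assumes supermanifold: "supermanifold p q M"
begin

abbreviation "C \<equiv> charts p q M"
abbreviation "opn U \<equiv> openin (body M) U"
abbreviation "sec U \<equiv> sections M U"
abbreviation "Sf c \<equiv> sfuns p q (cimg c)"

lemma sheaf: "sheaf_of_superalgebras M"
  using supermanifold by (simp add: supermanifold_def)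

lemma superalgebra_sec: "opn U \<Longrightarrow> superalgebra (sec U)"
  using sheaf by (simp add: sheaf_of_superalgebras_def)

lemma restr_hom: "opn U \<Longrightarrow> opn W \<Longrightarrow> W \<subseteq> U \<Longrightarrow> restr M U W \<in> superalg_hom (sec U) (sec W)"
  using sheaf by (simp add: sheaf_of_superalgebras_def)

lemma restr_id: "opn U \<Longrightarrow> s \<in> carrier (sec U) \<Longrightarrow> restr M U U s = s"
  using sheaf by (simp add: sheaf_of_superalgebras_def)

lemma restr_restr: "opn U \<Longrightarrow> opn W \<Longrightarrow> opn T \<Longrightarrow> T \<subseteq> W \<Longrightarrow> W \<subseteq> U \<Longrightarrow> s \<in> carrier (sec U) \<Longrightarrow>
    restr M W T (restr M U W s) = restr M U T s"
  using sheaf unfolding sheaf_of_superalgebras_def by blast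

lemma restr_closed: "opn U \<Longrightarrow> opn W \<Longrightarrow> W \<subseteq> U \<Longrightarrow> s \<in> carrier (sec U) \<Longrightarrow> restr M U W s \<in> carrier (sec W)"
  using restr_hom[of U W] by (auto simp: superalg_hom_def ring_hom_def)

lemma chartD:
  assumes "c \<in> C"
  shows "opn (cdom c)" "openin (Euclidean_space p) (cimg c)"
    "homeomorphic_map (subtopology (body M) (cdom c)) (subtopology (Euclidean_space p) (cimg c)) (cmap c)"
    "opn W \<Longrightarrow> W \<subseteq> cdom c \<Longrightarrow> ciso c W \<in> superalg_iso (sf_alg p q (cmap c ` W)) (sections M W)"
    "opn U \<Longrightarrow> opn W \<Longrightarrow> W \<subseteq> U \<Longrightarrow> U \<subseteq> cdom c \<Longrightarrow> f \<in> sfuns p q (cmap c ` U) \<Longrightarrow>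
       restr M U W (ciso c U f) = ciso c W (sf_restrict (cmap c ` W) f)"
  using assms by (auto simp: charts_def)

lemma chart_superdomain: "c \<in> C \<Longrightarrow> superdomain p (cimg c)"
  using chartD(2) by unfold_locales

lemma chart_restrict_simps [simp]:
  "cdom (chart_restrict c U) = U" "cmap (chart_restrict c U) = cmap c" "ciso (chart_restrict c U) = ciso c"
  "cimg (chart_restrict c U) = cmap c ` U"
  by (simp_all add: chart_restrict_def cimg_def)

lemma topspace_chart: "c \<in> C \<Longrightarrow> topspace (subtopology (body M) (cdom c)) = cdom c"
  using openin_subset[OF chartD(1), of c] by (simp add: Int_absorb1)

lemma chart_image_open:
  assumes c: "c \<in> C" and U: "opn U" "U \<subseteq> cdom c"
  shows "openin (Euclidean_space p) (cmap c ` U)"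
proof -
  have "openin (subtopology (body M) (cdom c)) U"
    using U chartD(1)[OF c] by (simp add: openin_open_subtopology)
  then have "openin (subtopology (Euclidean_space p) (cimg c)) (cmap c ` U)"
    using homeomorphic_imp_open_map[OF chartD(3)[OF c]] by (simp add: open_map_def)
  then show ?thesis using chartD(2)[OF c] by (simp add: openin_open_subtopology)
qed

lemma chart_inj: "c \<in> C \<Longrightarrow> inj_on (cmap c) (cdom c)"
  using homeomorphic_imp_injective_map[OF chartD(3)] topspace_chart by metis

lemma chart_preimage_open:
  assumes c: "c \<in> C" and W: "openin (Euclidean_space p) W"
  shows "opn {x \<in> cdom c. cmap c x \<in> W}"
proof -
  have "openin (subtopology (Euclidean_space p) (cimg c)) (cimg c \<inter> W)"
    using W openin_subtopology_Int2 by blast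
  from openin_continuous_map_preimage[OF homeomorphic_imp_continuous_map[OF chartD(3)[OF c]] this]
  have "openin (subtopology (body M) (cdom c)) {x \<in> cdom c. cmap c x \<in> cimg c \<inter> W}"
    unfolding topspace_chart[OF c] .
  moreover have "{x \<in> cdom c. cmap c x \<in> cimg c \<inter> W} = {x \<in> cdom c. cmap c x \<in> W}"
    by (auto simp: cimg_def)
  ultimately show ?thesis using chartD(1)[OF c] by (simp add: openin_open_subtopology)
qed

lemma chart_restrict_in: 
  assumes c: "c \<in> C" and U: "opn U" "U \<subseteq> cdom c"
  shows "chart_restrict c U \<in> C"
proof -
  have "homeomorphic_map (subtopology (subtopology (body M) (cdom c)) U) (subtopology (subtopology (Euclidean_space p) (cimg c)) (cmap c ` U)) (cmap c)"
  proof (rule homeomorphic_map_subtopologies[OF chartD(3)[OF c]])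
    have "topspace (subtopology (Euclidean_space p) (cimg c)) = cimg c"
      using openin_subset[OF chartD(2)[OF c]] by (simp add: Int_absorb1)
    then show "cmap c ` (topspace (subtopology (body M) (cdom c)) \<inter> U) =
      topspace (subtopology (Euclidean_space p) (cimg c)) \<inter> cmap c ` U"
      unfolding topspace_chart[OF c] using U(2) by (auto simp: cimg_def)
  qed
  moreover have "cdom c \<inter> U = U" "cimg c \<inter> cmap c ` U = cmap c ` U" using U by (auto simp: cimg_def)
  ultimately have "homeomorphic_map (subtopology (body M) U) (subtopology (Euclidean_space p) (cmap c ` U)) (cmap c)"
    by (simp add: subtopology_subtopology)
  moreover have "ciso c W \<in> superalg_iso (sf_alg p q (cmap c ` W)) (sections M W)" if "opn W" "W \<subseteq> U" for W
    using chartD(4)[OF c that(1)] that(2) U(2) by blast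
  moreover have "restr M U' W (ciso c U' f) = ciso c W (sf_restrict (cmap c ` W) f)"
    if "opn U'" "opn W" "W \<subseteq> U'" "U' \<subseteq> U" "f \<in> sfuns p q (cmap c ` U')" for U' W f
    using chartD(5)[OF c that(1,2,3) _ that(5)] that(4) U(2) by blast
  ultimately show ?thesis
    using U(1) chart_image_open[OF c U] by (simp add: charts_def)
qed

lemma iso_properties:
  assumes c: "c \<in> C"
  shows "bij_betw (ciso c (cdom c)) (Sf c) (carrier (sec (cdom c)))"
    and "f \<in> Sf c \<Longrightarrow> ciso c (cdom c) f \<in> carrier (sec (cdom c))"
    and "f \<in> Sf c \<Longrightarrow> g \<in> Sf c \<Longrightarrow> ciso c (cdom c) (f + g) = ciso c (cdom c) f \<oplus>\<^bsub>sec (cdom c)\<^esub> ciso c (cdom c) g"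
    and "f \<in> Sf c \<Longrightarrow> g \<in> Sf c \<Longrightarrow> ciso c (cdom c) (sf_mult f g) = ciso c (cdom c) f \<otimes>\<^bsub>sec (cdom c)\<^esub> ciso c (cdom c) g"
    and "f \<in> Sf c \<Longrightarrow> ciso c (cdom c) (sf_scale a f) = a \<odot>\<^bsub>sec (cdom c)\<^esub> ciso c (cdom c) f"
    and "ciso c (cdom c) (sf_of_fun (cimg c) (\<lambda>_. 1)) = \<one>\<^bsub>sec (cdom c)\<^esub>"
    and "f \<in> Sf c \<Longrightarrow> sf_par k f \<Longrightarrow> ciso c (cdom c) f \<in> hpart (sec (cdom c)) (of_nat k)"
proof -
  note I = chartD(4)[OF c chartD(1)[OF c] order_refl, unfolded superalg_iso_def superalg_hom_def ring_hom_def cimg_def[symmetric]]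
  show "bij_betw (ciso c (cdom c)) (Sf c) (carrier (sec (cdom c)))"
    and "f \<in> Sf c \<Longrightarrow> ciso c (cdom c) f \<in> carrier (sec (cdom c))"
    and "f \<in> Sf c \<Longrightarrow> g \<in> Sf c \<Longrightarrow> ciso c (cdom c) (f + g) = ciso c (cdom c) f \<oplus>\<^bsub>sec (cdom c)\<^esub> ciso c (cdom c) g"
    and "f \<in> Sf c \<Longrightarrow> g \<in> Sf c \<Longrightarrow> ciso c (cdom c) (sf_mult f g) = ciso c (cdom c) f \<otimes>\<^bsub>sec (cdom c)\<^esub> ciso c (cdom c) g"
    and "f \<in> Sf c \<Longrightarrow> ciso c (cdom c) (sf_scale a f) = a \<odot>\<^bsub>sec (cdom c)\<^esub> ciso c (cdom c) f"
    and "ciso c (cdom c) (sf_of_fun (cimg c) (\<lambda>_. 1)) = \<one>\<^bsub>sec (cdom c)\<^esub>"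
    using I by auto
  assume "f \<in> Sf c" "sf_par k f"
  then have "f \<in> hpart (sf_alg p q (cimg c)) (of_nat k)" by (simp add: hpart_sf_alg)
  moreover have "ciso c (cdom c) ` hpart (sf_alg p q (cimg c)) (of_nat k) \<subseteq> hpart (sec (cdom c)) (of_nat k)"
    using I by blast
  ultimately show "ciso c (cdom c) f \<in> hpart (sec (cdom c)) (of_nat k)" by blast
qed

lemma iso_zero:
  assumes c: "c \<in> C"
  shows "ciso c (cdom c) 0 = \<zero>\<^bsub>sec (cdom c)\<^esub>"
proof -
  interpret S: superdomain p q "cimg c" by (rule chart_superdomain[OF c])
  interpret R: ring "sec (cdom c)"
    using superalgebra_sec[OF chartD(1)[OF c]] by (simp add: superalgebra_def)
  note P = iso_properties[OF c]
  have "ciso c (cdom c) 0 \<oplus>\<^bsub>sec (cdom c)\<^esub> ciso c (cdom c) 0 = ciso c (cdom c) 0"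
    using P(3)[OF S.sfuns_0 S.sfuns_0] by simp
  then show ?thesis using P(2)[OF S.sfuns_0] by simp
qed

lemma local_expr_spec:
  assumes c: "c \<in> C" and U: "opn U" "cdom c \<subseteq> U" and s: "s \<in> carrier (sec U)"
  shows "local_expr p q M U c s \<in> Sf c" "ciso c (cdom c) (local_expr p q M U c s) = restr M U (cdom c) s"
proof -
  have r: "restr M U (cdom c) s \<in> carrier (sec (cdom c))" by (rule restr_closed[OF U(1) chartD(1)[OF c] U(2) s])
  note b = iso_properties(1)[OF c]
  show "local_expr p q M U c s \<in> Sf c" "ciso c (cdom c) (local_expr p q M U c s) = restr M U (cdom c) s"
    unfolding local_expr_def using the_inv_into_into[OF bij_betw_imp_inj_on[OF b], of _ "Sf c"]
      f_the_inv_into_f_bij_betw[OF b] r b by (auto simp: bij_betw_def)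
qed

lemma local_expr_eqI:
  assumes c: "c \<in> C" and f: "f \<in> Sf c" "ciso c (cdom c) f = restr M U (cdom c) s"
  shows "local_expr p q M U c s = f"
  unfolding local_expr_def f(2)[symmetric]
  by (rule the_inv_into_f_f[OF bij_betw_imp_inj_on[OF iso_properties(1)[OF c]] f(1)])

lemma iso_inj: "c \<in> C \<Longrightarrow> f \<in> Sf c \<Longrightarrow> g \<in> Sf c \<Longrightarrow> ciso c (cdom c) f = ciso c (cdom c) g \<Longrightarrow> f = g"
  using iso_properties(1) by (auto simp: bij_betw_def dest: inj_onD)

text \<open>An isomorphism is only known to map each parity into the same parity. Its inverse does
  so as well, because the decomposition of a section into an even and an odd part is unique: the
  images of the even and the odd part of \<open>f\<close> have to be the section itself and
  \<open>0\<close>, in the order given by \<open>k\<close>.\<close>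

lemma iso_par_inverse:
  assumes c: "c \<in> C" and f: "f \<in> Sf c" and h: "ciso c (cdom c) f \<in> hpart (sec (cdom c)) (of_nat k)"
  shows "sf_par k f"
proof -
  interpret S: superdomain p q "cimg c" by (rule chart_superdomain[OF c])
  let ?B = "sec (cdom c)" and ?h = "ciso c (cdom c)"
  note sa = superalgebra_sec[OF chartD(1)[OF c], unfolded superalgebra_def]
  interpret R: ring ?B using sa by simp
  note P = iso_properties[OF c]
  define f0 where "f0 = sf_scale (1/2) (f + sf_twist 1 f)"
  define f1 where "f1 = sf_scale (1/2) (f - sf_twist 1 f)"
  have S: "f0 \<in> Sf c" "f1 \<in> Sf c"
    unfolding f0_def f1_def by (intro S.sfuns_scale S.sfuns_add S.sfuns_diff S.sfuns_twist f)+
  have par: "sf_par 0 f0" "sf_par 1 f1"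
    unfolding f0_def f1_def by (intro sf_par_scale sf_par_even_part[OF f] sf_par_odd_part[OF f])+
  have ff: "f = f0 + f1"
    by (auto simp: f0_def f1_def sf_scale_def fun_eq_iff plus_fun_apply minus_apply algebra_simps)
  have hp: "?h f0 \<in> hpart ?B 0" "?h f1 \<in> hpart ?B 1" "?h f = ?h f0 \<oplus>\<^bsub>?B\<^esub> ?h f1"
    using P(7)[OF S(1) par(1)] P(7)[OF S(2) par(2)] P(3)[OF S] ff by simp_all
  have z: "\<zero>\<^bsub>?B\<^esub> \<in> hpart ?B \<sigma>" for \<sigma>
    using iso_properties(7)[OF c S.sfuns_0] iso_zero[OF c] ex_of_nat_bit[of \<sigma>] by auto
  have uniq: "\<And>y z. fst y \<in> hpart ?B 0 \<Longrightarrow> snd y \<in> hpart ?B 1 \<Longrightarrow> ?h f = fst y \<oplus>\<^bsub>?B\<^esub> snd y \<Longrightarrow>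
      fst z \<in> hpart ?B 0 \<Longrightarrow> snd z \<in> hpart ?B 1 \<Longrightarrow> ?h f = fst z \<oplus>\<^bsub>?B\<^esub> snd z \<Longrightarrow> y = z"
    using sa P(2)[OF f] by blast
  show ?thesis
  proof (cases "even k")
    case True
    then have "?h f \<in> hpart ?B 0" using h of_nat_bit_eq_iff[of k 0] by simp
    then have "(?h f0, ?h f1) = (?h f, \<zero>\<^bsub>?B\<^esub>)" using hp z P(2)[OF f] by (intro uniq) simp_all
    then have "f = f0" using iso_inj[OF c S(1) f] by simp
    then show ?thesis using par(1) sf_par_cong[of k 0 f] True by simp
  next
    case False
    then have "?h f \<in> hpart ?B 1" using h of_nat_bit_eq_iff[of k 1] by simp
    then have "(?h f0, ?h f1) = (\<zero>\<^bsub>?B\<^esub>, ?h f)" using hp z P(2)[OF f] by (intro uniq) simp_all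
    then have "f = f1" using iso_inj[OF c S(2) f] by simp
    then show ?thesis using par(2) sf_par_cong[of k 1 f] False by simp
  qed
qed

section \<open>Changes of coordinates\<close>

abbreviation "chg \<equiv> transition p q M"

lemma trans_spec:
  assumes "c \<in> C" "c' \<in> C" "cdom c' \<subseteq> cdom c" "f \<in> Sf c"
  shows "chg c c' f \<in> Sf c'" "ciso c' (cdom c') (chg c c' f) = restr M (cdom c) (cdom c') (ciso c (cdom c) f)"
  unfolding transition_def
  using local_expr_spec[OF assms(2) chartD(1)[OF assms(1)] assms(3) iso_properties(2)[OF assms(1,4)]] by auto

lemma trans_eqI:
  assumes "c' \<in> C" "g \<in> Sf c'" "ciso c' (cdom c') g = restr M (cdom c) (cdom c') (ciso c (cdom c) f)"
  shows "chg c c' f = g"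
  unfolding transition_def by (rule local_expr_eqI[OF assms])

lemma trans_trans:
  assumes "c \<in> C" "c' \<in> C" "c'' \<in> C" "cdom c' \<subseteq> cdom c" "cdom c'' \<subseteq> cdom c'" "f \<in> Sf c"
  shows "chg c' c'' (chg c c' f) = chg c c'' f"
proof -
  note 1 = trans_spec[OF assms(1,2,4,6)] and 2 = trans_spec[OF assms(1,3) _ assms(6)]
  have "ciso c'' (cdom c'') (chg c c'' f) = restr M (cdom c') (cdom c'') (ciso c' (cdom c') (chg c c' f))"
    using assms restr_restr[OF chartD(1)[OF assms(1)] chartD(1)[OF assms(2)] chartD(1)[OF assms(3)] assms(5,4) iso_properties(2)[OF assms(1,6)]]
      1(2) 2(2) by simp
  then show ?thesis using assms 2(1) by (intro trans_eqI) auto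
qed

lemma trans_restrict:
  assumes c: "c \<in> C" and U: "opn U" "U \<subseteq> cdom c" and f: "f \<in> Sf c"
  shows "chg c (chart_restrict c U) f = sf_restrict (cmap c ` U) f"
proof (rule trans_eqI[OF chart_restrict_in[OF c U]])
  interpret S: superdomain p q "cimg c" by (rule chart_superdomain[OF c])
  interpret S': superdomain p q "cmap c ` U" using chart_image_open[OF c U] by unfold_locales
  have sub: "cmap c ` U \<subseteq> cimg c" using U by (auto simp: cimg_def)
  show "sf_restrict (cmap c ` U) f \<in> Sf (chart_restrict c U)"
  proof (simp, rule S'.sfunsI)
    fix J
    have "smooth_fun p (cmap c ` U) (f J)"
      by (rule smooth_fun_subset[OF S.openV S'.openV sub S.sfunsD(1)[OF f]])
    then show "smooth_fun p (cmap c ` U) (sf_restrict (cmap c ` U) f J)"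
      using smooth_fun_cong[OF S'.openV, of "sf_restrict (cmap c ` U) f J" "f J"] by (simp add: sf_restrict_def)
  qed (use S.sfunsD(3)[OF f] in \<open>auto simp: sf_restrict_def\<close>)
  show "ciso (chart_restrict c U) (cdom (chart_restrict c U)) (sf_restrict (cmap c ` U) f) =
    restr M (cdom c) (cdom (chart_restrict c U)) (ciso c (cdom c) f)"
    using chartD(5)[OF c chartD(1)[OF c] U(1) U(2) order_refl, of f] f by (simp add: cimg_def)
qed

lemma trans_hom:
  assumes c: "c \<in> C" "c' \<in> C" "cdom c' \<subseteq> cdom c"
  shows "f \<in> Sf c \<Longrightarrow> g \<in> Sf c \<Longrightarrow> chg c c' (f + g) = chg c c' f + chg c c' g"
    and "f \<in> Sf c \<Longrightarrow> chg c c' (sf_scale a f) = sf_scale a (chg c c' f)"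
    and "f \<in> Sf c \<Longrightarrow> g \<in> Sf c \<Longrightarrow> chg c c' (sf_mult f g) = sf_mult (chg c c' f) (chg c c' g)"
    and "chg c c' (sf_of_fun (cimg c) (\<lambda>_. 1)) = sf_of_fun (cimg c') (\<lambda>_. 1)"
    and "f \<in> Sf c \<Longrightarrow> sf_par k f \<Longrightarrow> sf_par k (chg c c' f)"
proof -
  interpret S: superdomain p q "cimg c" by (rule chart_superdomain[OF c(1)])
  interpret S': superdomain p q "cimg c'" by (rule chart_superdomain[OF c(2)])
  note h = restr_hom[OF chartD(1)[OF c(1)] chartD(1)[OF c(2)] c(3)]
  note P = iso_properties[OF c(1)] and P' = iso_properties[OF c(2)] and T = trans_spec[OF c]
  show "chg c c' (f + g) = chg c c' f + chg c c' g" if "f \<in> Sf c" "g \<in> Sf c"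
    using that T P P' h by (intro trans_eqI[OF c(2)]) (auto intro: S'.sfuns_add simp: superalg_hom_def ring_hom_def)
  show "chg c c' (sf_scale a f) = sf_scale a (chg c c' f)" if "f \<in> Sf c"
    using that T P P' h by (intro trans_eqI[OF c(2)]) (auto intro: S'.sfuns_scale simp: superalg_hom_def ring_hom_def)
  show "chg c c' (sf_mult f g) = sf_mult (chg c c' f) (chg c c' g)" if "f \<in> Sf c" "g \<in> Sf c"
    using that T P P' h by (intro trans_eqI[OF c(2)]) (auto intro: S'.sfuns_mult simp: superalg_hom_def ring_hom_def)
  show "chg c c' (sf_of_fun (cimg c) (\<lambda>_. 1)) = sf_of_fun (cimg c') (\<lambda>_. 1)"
    using P(6) P'(6) h by (intro trans_eqI[OF c(2)]) (auto simp: superalg_hom_def ring_hom_def)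
  show "sf_par k (chg c c' f)" if f: "f \<in> Sf c" "sf_par k f"
  proof (rule iso_par_inverse[OF c(2) T(1)[OF f(1)]])
    show "ciso c' (cdom c') (chg c c' f) \<in> hpart (sec (cdom c')) (of_nat k)"
      unfolding T(2)[OF f(1)] using P(7)[OF f] h by (auto simp: superalg_hom_def image_subset_iff)
  qed
qed

end

subsection \<open>Restriction to smaller domains\<close>

lemma sf_restrict_apply: "sf_restrict W f J x = (if x \<in> W then f J x else 0)"
  by (simp add: sf_restrict_def)

lemma sf_restrict_coord: "W \<subseteq> V \<Longrightarrow> sf_restrict W (sf_coord p V i) = sf_coord p W i"
  by (auto simp: sf_restrict_def sf_coord_def sf_of_fun_def fun_eq_iff)

lemma sf_mult_restrict: "x \<in> W \<Longrightarrow> sf_mult (sf_restrict W f) (sf_restrict W g) J x = sf_mult f g J x"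
  by (simp add: sf_mult_def sf_restrict_def)

lemma sf_restrict_in_sfuns:
  assumes V: "openin (Euclidean_space p) V" and W: "openin (Euclidean_space p) W" "W \<subseteq> V" and f: "f \<in> sfuns p q V"
  shows "sf_restrict W f \<in> sfuns p q W"
proof -
  interpret S: superdomain p q V using V by unfold_locales
  interpret S': superdomain p q W using W(1) by unfold_locales
  show ?thesis
  proof (rule S'.sfunsI)
    fix J
    show "smooth_fun p W (sf_restrict W f J)"
      using smooth_fun_cong[OF W(1), of "sf_restrict W f J" "f J"] smooth_fun_subset[OF V W S.sfunsD(1)[OF f]]
      by (simp add: sf_restrict_def)
  qed (use S.sfunsD(3)[OF f] in \<open>auto simp: sf_restrict_def\<close>)
qed

lemma sf_pderiv_restrict:
  assumes W: "openin (Euclidean_space p) W" "W \<subseteq> V"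
  shows "sf_pderiv p W i (sf_restrict W f) = sf_restrict W (sf_pderiv p V i f)"
proof (intro ext)
  fix J x
  show "sf_pderiv p W i (sf_restrict W f) J x = sf_restrict W (sf_pderiv p V i f) J x"
  proof (cases "x \<in> W")
    case True
    show ?thesis
    proof (cases "i < p")
      case i: True
      have "pderiv_at i (sf_restrict W f J) x = pderiv_at i (f J) x"
        by (rule pderiv_at_cong[OF W(1) True i]) (simp add: sf_restrict_def)
      then show ?thesis using True W(2) i by (auto simp: sf_pderiv_def sf_restrict_apply)
    qed (use True W(2) in \<open>auto simp: sf_pderiv_def sf_restrict_apply\<close>)
  qed (simp add: sf_pderiv_def sf_restrict_apply)
qed

context smfd
begin

text \<open>The bound \<open>r0\<close> lets a coordinate be kept away from a prescribed value on
  the whole box.\<close>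

lemma chart_box:
  assumes c: "c \<in> C" and m: "m \<in> cdom c" and N: "opn N" "m \<in> N" and r0: "r0 > 0"
  obtains U r where "opn U" "m \<in> U" "U \<subseteq> N" "U \<subseteq> cdom c" "0 < r" "r \<le> r0" "cmap c ` U = ebox p (cmap c m) r"
proof -
  have "opn (N \<inter> cdom c)" using N(1) chartD(1)[OF c] by blast
  from chart_image_open[OF c this] have "openin (Euclidean_space p) (cmap c ` (N \<inter> cdom c))" by simp
  from ex_ebox_subset[OF this, of "cmap c m"] obtain r1 where r1: "r1 > 0" "ebox p (cmap c m) r1 \<subseteq> cmap c ` (N \<inter> cdom c)"
    using m N by auto
  define r where "r = min r1 r0"
  have r: "r > 0" "r \<le> r0" "ebox p (cmap c m) r \<subseteq> cmap c ` (N \<inter> cdom c)"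
    using r1 r0 ebox_mono[of r r1 p "cmap c m"] by (auto simp: r_def)
  define U where "U = {x \<in> cdom c. cmap c x \<in> ebox p (cmap c m) r}"
  have "opn U" unfolding U_def by (rule chart_preimage_open[OF c openin_ebox])
  moreover have "m \<in> U"
  proof -
    have "cmap c m \<in> cimg c" using m by (simp add: cimg_def)
    then have "\<forall>i\<ge>p. cmap c m i = 0" using Euclidean_space_open_subset[OF chartD(2)[OF c]] by auto
    then show ?thesis unfolding U_def using m center_in_ebox[OF r(1)] by simp
  qed
  moreover have "U \<subseteq> N"
  proof
    fix x assume x: "x \<in> U"
    then obtain z where "z \<in> N \<inter> cdom c" "cmap c x = cmap c z" using r(3) by (auto simp: U_def)
    then show "x \<in> N" using x chart_inj[OF c] by (auto simp: U_def inj_on_def)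
  qed
  moreover have "cmap c ` U = ebox p (cmap c m) r" using r(3) by (auto simp: U_def)
  ultimately show ?thesis using that r by (auto simp: U_def)
qed

text \<open>Both sides are the change of coordinates from \<open>c\<close> to the restriction of
  \<open>c'\<close> to \<open>U\<close>, by way of the restricted \<open>c\<close> and by way of
  \<open>c'\<close>.\<close>

lemma trans_restrict_restrict:
  assumes c: "c \<in> C" "c' \<in> C" "cdom c' \<subseteq> cdom c" and U: "opn U" "U \<subseteq> cdom c'" and f: "f \<in> Sf c"
  shows "chg (chart_restrict c U) (chart_restrict c' U) (sf_restrict (cmap c ` U) f) = sf_restrict (cmap c' ` U) (chg c c' f)"
proof -
  have Uc: "U \<subseteq> cdom c" using U c by auto
  note r = chart_restrict_in[OF c(1) U(1) Uc] and r' = chart_restrict_in[OF c(2) U]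
  have "chg (chart_restrict c U) (chart_restrict c' U) (chg c (chart_restrict c U) f) = chg c (chart_restrict c' U) f"
    using Uc by (intro trans_trans c r r' f) auto
  moreover have "chg c' (chart_restrict c' U) (chg c c' f) = chg c (chart_restrict c' U) f"
    using U by (intro trans_trans c r r' f) auto
  ultimately show ?thesis
    using trans_restrict[OF c(1) U(1) Uc f] trans_restrict[OF c(2) U trans_spec(1)[OF c f]] by simp
qed

text \<open>The homeomorphism and the isomorphisms of algebras in a chart are separate data, linked
  only by locality. If the pulled back coordinate had a value \<open>l\<close> at \<open>m\<close>
  other than \<open>cmap c m i\<close>, then \<open>x^i - l\<close> would be invertible on a small
  box around \<open>cmap c m\<close>, hence so would be its pullback, whose value at
  \<open>m\<close> is \<open>0\<close>.\<close>

lemma body_coord: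
  assumes c: "c \<in> C" "c' \<in> C" "cdom c' \<subseteq> cdom c" and m: "m \<in> cdom c'" and i: "i < p"
  shows "chg c c' (sf_coord p (cimg c) i) {} (cmap c' m) = cmap c m i"
proof (rule ccontr)
  define l where "l = chg c c' (sf_coord p (cimg c) i) {} (cmap c' m)"
  assume "chg c c' (sf_coord p (cimg c) i) {} (cmap c' m) \<noteq> cmap c m i"
  then have "\<bar>l - cmap c m i\<bar> > 0" by (simp add: l_def)
  note l0 = this
  have mc: "m \<in> cdom c" using m c(3) by blast
  obtain U r where U: "opn U" "m \<in> U" "U \<subseteq> cdom c'" "U \<subseteq> cdom c" and r: "0 < r" "r \<le> \<bar>l - cmap c m i\<bar>"
    and img: "cmap c ` U = ebox p (cmap c m) r"
    by (rule chart_box[OF c(1) mc chartD(1)[OF c(2)] m l0])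
  let ?c = "chart_restrict c U" and ?c' = "chart_restrict c' U"
  define B where "B = cmap c ` U"
  interpret S: superdomain p q B using chart_image_open[OF c(1) U(1,4)] unfolding B_def by unfold_locales
  have cc: "?c \<in> C" "?c' \<in> C" "cdom ?c' \<subseteq> cdom ?c" using U chart_restrict_in c by auto
  note T = trans_hom[OF cc]
  have B: "B = cimg ?c" by (simp add: B_def)
  \<comment> \<open>The radius of the box is at most the distance of \<open>l\<close> from the
    centre in direction \<open>i\<close>.\<close>
  have nz: "x i \<noteq> l" if "x \<in> B" for x
    using that i r(2) unfolding B_def img ebox_def by force
  have sm: "smooth_fun p B (\<lambda>x. x i - l)"
    using smooth_fun_add[OF S.openV smooth_fun_coord[OF S.openV, of i] smooth_fun_const[OF S.openV, of "- l"]] by simp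
  define g where "g = sf_of_fun B (\<lambda>x. x i - l)"
  define h where "h = sf_of_fun B (\<lambda>x. 1 / (x i - l))"
  have S: "g \<in> Sf ?c" "h \<in> Sf ?c" unfolding B[symmetric] g_def h_def
    by (intro S.sfuns_of_fun sm smooth_fun_inverse[OF S.openV sm]; simp add: nz)+
  have "sf_mult g h = sf_of_fun (cimg ?c) (\<lambda>_. 1)"
    unfolding g_def S.sf_mult_of_fun_left[OF S(2)[folded B]] B[symmetric]
    using nz by (auto simp: h_def sf_of_fun_def fun_eq_iff)
  then have "sf_mult (chg ?c ?c' g) (chg ?c ?c' h) {} (cmap c' m) = 1"
    using T(3)[OF S] T(4) U(2) by (simp add: sf_of_fun_def)
  moreover have "chg ?c ?c' g {} (cmap c' m) = 0"
  proof -
    have X: "sf_coord p B i \<in> Sf ?c" "sf_of_fun B (\<lambda>_. 1) \<in> Sf ?c"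
      unfolding B[symmetric] using i by (auto intro!: S.sf_coord_in_sfuns)
    interpret Sc: superdomain p q "cimg c" by (rule chart_superdomain[OF c(1)])
    have BV: "B \<subseteq> cimg c" using U by (auto simp: B_def cimg_def)
    have "g = sf_coord p B i + sf_scale (- l) (sf_of_fun B (\<lambda>_. 1))"
      using i by (auto simp: g_def sf_coord_def sf_of_fun_def sf_scale_def fun_eq_iff plus_fun_apply)
    then have "chg ?c ?c' g = chg ?c ?c' (sf_coord p B i) + sf_scale (- l) (sf_of_fun (cimg ?c') (\<lambda>_. 1))"
      using T(1)[OF X(1), of "sf_scale (- l) (sf_of_fun B (\<lambda>_. 1))"] T(2)[OF X(2)] T(4) X(2) S.sfuns_scale[of _ "- l"] B by simp
    moreover have "chg ?c ?c' (sf_coord p B i) = sf_restrict (cmap c' ` U) (chg c c' (sf_coord p (cimg c) i))"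
      using trans_restrict_restrict[OF c U(1,3), of "sf_coord p (cimg c) i"] sf_restrict_coord[OF BV] Sc.sf_coord_in_sfuns[of i] i
      by (simp add: B_def)
    ultimately show ?thesis using U(2) by (simp add: plus_fun_apply sf_restrict_apply sf_scale_def sf_of_fun_def l_def)
  qed
  ultimately show False by (simp add: sf_mult_empty)
qed

text \<open>Evaluation at a point is additive and multiplicative, so Hadamard's lemma leaves only
  constants and multiples of the functions \<open>x^i - x^i(m)\<close>, whose pullbacks vanish at
  \<open>m\<close> by \<open>body_coord\<close>. Odd functions have value \<open>0\<close> on both
  sides.\<close>

lemma body_value:
  assumes c: "c \<in> C" "c' \<in> C" "cdom c' \<subseteq> cdom c" and m: "m \<in> cdom c'" and f: "f \<in> Sf c"
  shows "chg c c' f {} (cmap c' m) = f {} (cmap c m)"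
proof -
  have mc: "m \<in> cdom c" using m c(3) by blast
  obtain U r where U: "opn U" "m \<in> U" "U \<subseteq> cdom c'" "U \<subseteq> cdom c" and "0 < r" "r \<le> 1"
    and img: "cmap c ` U = ebox p (cmap c m) r"
    by (rule chart_box[OF c(1) mc chartD(1)[OF c(2)] m zero_less_one])
  let ?c = "chart_restrict c U" and ?c' = "chart_restrict c' U"
  define B where "B = cmap c ` U"
  interpret S: superdomain p q B using chart_image_open[OF c(1) U(1,4)] unfolding B_def by unfold_locales
  have cc: "?c \<in> C" "?c' \<in> C" "cdom ?c' \<subseteq> cdom ?c" using U chart_restrict_in c by auto
  interpret S': superdomain p q "cimg ?c'" by (rule chart_superdomain[OF cc(2)])
  note T = trans_hom[OF cc]
  have B: "Sf ?c = sfuns p q B" by (simp add: B_def)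
  have BV: "B \<subseteq> cimg c" using U by (auto simp: B_def cimg_def)
  have mB: "cmap c m \<in> B" using U by (simp add: B_def)
  have unit: "chg ?c ?c' (sf_of_fun B (\<lambda>_. 1)) = sf_of_fun (cimg ?c') (\<lambda>_. 1)" using T(4) by (simp add: B_def)
  have tc: "chg ?c ?c' (sf_of_fun B (\<lambda>_. k)) {} (cmap c' m) = k" for k
  proof -
    have "sf_of_fun B (\<lambda>_. k) = sf_scale k (sf_of_fun B (\<lambda>_. 1))" by (auto simp: sf_of_fun_def sf_scale_def fun_eq_iff)
    then have "chg ?c ?c' (sf_of_fun B (\<lambda>_. k)) = sf_scale k (sf_of_fun (cimg ?c') (\<lambda>_. 1))"
      using T(2)[of "sf_of_fun B (\<lambda>_. 1)" k] unit B by simp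
    then show ?thesis using U(2) by (simp add: sf_scale_def sf_of_fun_def)
  qed
  have "chg ?c ?c' g {} (cmap c' m) = g {} (cmap c m)" if "g \<in> sfuns p q B" for g
    using img[folded B_def] that
  proof (induction rule: S.hadamard_induct)
    case (const k)
    then show ?case using tc mB by (simp add: sf_of_fun_def[of B])
  next
    case (add f g)
    have "(\<lambda>a b. f a b + g a b) = f + g" by (simp add: fun_eq_iff plus_fun_apply)
    then show ?case using add T(1)[of f g] B by (simp add: plus_fun_apply)
  next
    case (even i h)
    have X: "S.X i \<in> Sf ?c" "sf_of_fun B (\<lambda>_. - cmap c m i) \<in> Sf ?c"
      unfolding B using even(1) by (auto intro!: S.sf_coord_in_sfuns S.sfuns_of_fun smooth_fun_const S.openV)
    have e: "S.X i - sf_of_fun B (\<lambda>_. cmap c m i) = S.X i + sf_of_fun B (\<lambda>_. - cmap c m i)"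
      by (auto simp: fun_eq_iff plus_fun_apply minus_apply sf_of_fun_def)
    have "chg ?c ?c' (S.X i) {} (cmap c' m) = cmap c m i"
      using body_coord[OF cc _ even(1), of m] U(2) by (simp add: B_def)
    then have "chg ?c ?c' (S.X i + sf_of_fun B (\<lambda>_. - cmap c m i)) {} (cmap c' m) = 0"
      using T(1)[OF X] tc by (simp add: plus_fun_apply)
    moreover have "(S.X i + sf_of_fun B (\<lambda>_. - cmap c m i)) {} (cmap c m) = 0"
      using mB even(1) by (simp add: plus_fun_apply sf_coord_def sf_of_fun_def)
    ultimately show ?case
      using T(3)[of "S.X i + sf_of_fun B (\<lambda>_. - cmap c m i)" h] X even(2) S.sfuns_add[of "S.X i" "sf_of_fun B (\<lambda>_. - cmap c m i)"] B
      unfolding e by (simp add: sf_mult_empty)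
  next
    case (odd i h)
    have X: "S.X i \<in> Sf ?c" unfolding B using odd by (auto intro!: S.sf_coord_in_sfuns)
    have p1: "sf_par 1 (S.X i)" using sf_par_coord[of p i B] odd(1) by (simp add: cpar_def)
    have "chg ?c ?c' (S.X i) {} (cmap c' m) = 0" using S'.sf_par_odd_empty[OF T(5)[OF X p1]] .
    then show ?case using T(3)[OF X, of h] odd(3) B S.sf_par_odd_empty[OF p1] by (simp add: sf_mult_empty)
  qed
  from this[of "sf_restrict B f"] sf_restrict_in_sfuns[OF chartD(2)[OF c(1)] S.openV BV f]
  have "chg ?c ?c' (sf_restrict B f) {} (cmap c' m) = f {} (cmap c m)" using mB by (simp add: sf_restrict_apply)
  then show ?thesis using trans_restrict_restrict[OF c U(1,3) f] U(2) by (simp add: B_def sf_restrict_apply)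
qed

text \<open>The point is the chain rule. It is an equality of coefficients at each point, so it can
  be checked after restriction to a box around the corresponding point of \<open>cimg c\<close>,
  where \<open>derivation_chain_box\<close> applies.\<close>

lemma trans_morphism:
  assumes c: "c \<in> C" "c' \<in> C" "cdom c' \<subseteq> cdom c"
  shows "sf_morphism p q (cimg c) (cimg c') (chg c c')"
proof -
  interpret P: superdomain_pair p q "cimg c" "cimg c'"
    using chartD(2) c by unfold_locales auto
  note T = trans_hom[OF c]
  show ?thesis
  proof
    fix f j assume f: "f \<in> Sf c" and j: "j < p + q"
    let ?R = "\<Sum>i<p + q. sf_mult (P.cod.pd j (chg c c' (P.dom.X i))) (chg c c' (P.dom.pd i f))"
    have RS: "?R \<in> Sf c'"
      using trans_spec(1)[OF c] f j
      by (intro P.cod.sfuns_sum P.cod.sfuns_mult P.cod.sf_pderiv_in_sfuns) (auto intro: P.dom.sf_coord_in_sfuns P.dom.sf_pderiv_in_sfuns)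
    show "P.cod.pd j (chg c c' f) = ?R"
    proof (intro ext)
      fix J y
      show "P.cod.pd j (chg c c' f) J y = ?R J y"
      proof (cases "y \<in> cimg c'")
        case True
        then obtain m where m: "m \<in> cdom c'" "y = cmap c' m" by (auto simp: cimg_def)
        have mc: "m \<in> cdom c" using m c(3) by blast
        obtain U r where U: "opn U" "m \<in> U" "U \<subseteq> cdom c'" "U \<subseteq> cdom c" and "0 < r" "r \<le> 1"
          and img: "cmap c ` U = ebox p (cmap c m) r"
          by (rule chart_box[OF c(1) mc chartD(1)[OF c(2)] m(1) zero_less_one])
        let ?c = "chart_restrict c U" and ?c' = "chart_restrict c' U"
        define B B' where "B = cmap c ` U" and "B' = cmap c' ` U"
        interpret Q: superdomain_pair p q B B'
          using chart_image_open[OF c(1) U(1,4)] chart_image_open[OF c(2) U(1,3)] unfolding B_def B'_def by unfold_locales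
        have cc: "?c \<in> C" "?c' \<in> C" "cdom ?c' \<subseteq> cdom ?c" using U chart_restrict_in c by auto
        have BV: "B \<subseteq> cimg c" "B' \<subseteq> cimg c'" using U by (auto simp: B_def B'_def cimg_def)
        have yB: "y \<in> B'" using U m by (simp add: B'_def)
        note T' = trans_hom[OF cc, unfolded chart_restrict_simps, folded B_def B'_def]
        note Tc = trans_spec(1)[OF cc, unfolded chart_restrict_simps, folded B_def B'_def]
        have rr: "chg ?c ?c' (sf_restrict B g) = sf_restrict B' (chg c c' g)" if "g \<in> Sf c" for g
          using trans_restrict_restrict[OF c U(1,3) that] by (simp add: B_def B'_def)
        have rS: "sf_restrict B g \<in> sfuns p q B" if "g \<in> Sf c" for g
          using sf_restrict_in_sfuns[OF chartD(2)[OF c(1)] Q.dom.openV BV(1) that] .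
        have "Q.cod.pd j (chg ?c ?c' (sf_restrict B f)) J y =
          (\<Sum>i<p + q. sf_mult (Q.cod.pd j (chg ?c ?c' (Q.dom.X i))) (chg ?c ?c' (Q.dom.pd i (sf_restrict B f)))) J y"
        proof (rule Q.derivation_chain_box[where a = "cmap c m" and \<theta> = "chg ?c ?c'" and \<rho> = "cpar p j" and \<delta> = "\<lambda>f. Q.cod.pd j (chg ?c ?c' f)"])
          show "B = ebox p (cmap c m) r" using img by (simp add: B_def)
          show "sf_restrict B f \<in> sfuns p q B" by (rule rS[OF f])
          show "chg ?c ?c' (Q.dom.X i) {} y = cmap c m i" if "i < p" for i
            using body_coord[OF cc _ that, of m] U m by (simp add: B_def)
          show "Q.cod.pd j (chg ?c ?c' (sf_of_fun B (\<lambda>_. k))) = 0" for k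
          proof -
            have e: "sf_of_fun W (\<lambda>_. k) = sf_scale k (sf_of_fun W (\<lambda>_. 1))" for W
              by (auto simp: sf_of_fun_def sf_scale_def fun_eq_iff)
            have "chg ?c ?c' (sf_of_fun B (\<lambda>_. k)) = sf_of_fun B' (\<lambda>_. k)"
              using T'(2)[OF Q.dom.unit_in_sfuns, of k] T'(4) e[of B] e[of B'] by metis
            then show ?thesis using Q.cod.sf_pderiv_const[OF j] by simp
          qed
          show "Q.cod.pd j (chg ?c ?c' (sf_mult f g)) = sf_mult (Q.cod.pd j (chg ?c ?c' f)) (chg ?c ?c' g) +
            sf_mult (sf_twist (cpar p j) (chg ?c ?c' f)) (Q.cod.pd j (chg ?c ?c' g))"
            if "f \<in> sfuns p q B" "g \<in> sfuns p q B" for f g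
            using T'(3)[OF that] Q.cod.sf_pderiv_mult[OF Tc[OF that(1)] Tc[OF that(2)] j] by simp
        qed (use T' Tc yB Q.cod.sf_par_pderiv j in \<open>auto simp: Q.cod.sf_pderiv_add intro: Q.cod.sf_pderiv_in_sfuns\<close>)
        also have "\<dots> = ?R J y"
        proof -
          have "sf_mult (Q.cod.pd j (chg ?c ?c' (Q.dom.X i))) (chg ?c ?c' (Q.dom.pd i (sf_restrict B f))) J y =
            sf_mult (P.cod.pd j (chg c c' (P.dom.X i))) (chg c c' (P.dom.pd i f)) J y" if i: "i < p + q" for i
          proof -
            have "chg ?c ?c' (Q.dom.X i) = sf_restrict B' (chg c c' (P.dom.X i))"
              using rr[OF P.dom.sf_coord_in_sfuns[OF i]] sf_restrict_coord[OF BV(1)] by simp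
            moreover have "chg ?c ?c' (Q.dom.pd i (sf_restrict B f)) = sf_restrict B' (chg c c' (P.dom.pd i f))"
              using rr[OF P.dom.sf_pderiv_in_sfuns[OF f i]] sf_pderiv_restrict[OF Q.dom.openV BV(1)] by simp
            ultimately show ?thesis
              by (simp add: sf_pderiv_restrict[OF Q.cod.openV BV(2)] sf_mult_restrict[OF yB])
          qed
          then show ?thesis by (simp add: sum_fun_apply)
        qed
        finally have "Q.cod.pd j (chg ?c ?c' (sf_restrict B f)) J y = ?R J y" .
        then show ?thesis using yB by (simp add: rr[OF f] sf_pderiv_restrict[OF Q.cod.openV BV(2)] sf_restrict_apply)
      next
        case False
        then show ?thesis using P.cod.sfunsD(2)[OF RS False] by (simp add: sf_pderiv_outside)
      qed
    qed
  qed (use T trans_spec(1)[OF c] in auto)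
qed

end

section \<open>Vector fields in charts\<close>

locale vfd = smfd p q M for p q and M :: "('a, 's) superspace" +
  fixes nabla :: "'a set \<Rightarrow> 's \<Rightarrow> 's"
  assumes vector_field: "even_vector_field M nabla"
begin

abbreviation "vl c \<equiv> vf_local p q M nabla c"

lemma nablaD:
  assumes "opn U"
  shows "nabla U ` hpart (sec U) \<sigma> \<subseteq> hpart (sec U) \<sigma>"
    "f \<in> carrier (sec U) \<Longrightarrow> nabla U f \<in> carrier (sec U)"
    "f \<in> carrier (sec U) \<Longrightarrow> nabla U (a \<odot>\<^bsub>sec U\<^esub> f) = a \<odot>\<^bsub>sec U\<^esub> nabla U f"
    "f \<in> carrier (sec U) \<Longrightarrow> g \<in> carrier (sec U) \<Longrightarrow> nabla U (f \<oplus>\<^bsub>sec U\<^esub> g) = nabla U f \<oplus>\<^bsub>sec U\<^esub> nabla U g"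
    "f \<in> carrier (sec U) \<Longrightarrow> g \<in> carrier (sec U) \<Longrightarrow>
      nabla U (f \<otimes>\<^bsub>sec U\<^esub> g) = (nabla U f \<otimes>\<^bsub>sec U\<^esub> g) \<oplus>\<^bsub>sec U\<^esub> (f \<otimes>\<^bsub>sec U\<^esub> nabla U g)"
    "opn W \<Longrightarrow> W \<subseteq> U \<Longrightarrow> f \<in> carrier (sec U) \<Longrightarrow> restr M U W (nabla U f) = nabla W (restr M U W f)"
proof -
  note V = vector_field[unfolded even_vector_field_def]
  note 1 = V[THEN conjunct1, rule_format, OF assms] and 2 = V[THEN conjunct2, rule_format, OF conjI[OF assms]]
  show "nabla U ` hpart (sec U) \<sigma> \<subseteq> hpart (sec U) \<sigma>"
    "f \<in> carrier (sec U) \<Longrightarrow> nabla U f \<in> carrier (sec U)"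
    "f \<in> carrier (sec U) \<Longrightarrow> nabla U (a \<odot>\<^bsub>sec U\<^esub> f) = a \<odot>\<^bsub>sec U\<^esub> nabla U f"
    "f \<in> carrier (sec U) \<Longrightarrow> g \<in> carrier (sec U) \<Longrightarrow> nabla U (f \<oplus>\<^bsub>sec U\<^esub> g) = nabla U f \<oplus>\<^bsub>sec U\<^esub> nabla U g"
    "f \<in> carrier (sec U) \<Longrightarrow> g \<in> carrier (sec U) \<Longrightarrow>
      nabla U (f \<otimes>\<^bsub>sec U\<^esub> g) = (nabla U f \<otimes>\<^bsub>sec U\<^esub> g) \<oplus>\<^bsub>sec U\<^esub> (f \<otimes>\<^bsub>sec U\<^esub> nabla U g)"
    using 1 by auto
  show "opn W \<Longrightarrow> W \<subseteq> U \<Longrightarrow> f \<in> carrier (sec U) \<Longrightarrow> restr M U W (nabla U f) = nabla W (restr M U W f)"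
    using 2 by auto
qed

lemma vl_spec:
  assumes c: "c \<in> C" and f: "f \<in> Sf c"
  shows "vl c f \<in> Sf c" "ciso c (cdom c) (vl c f) = nabla (cdom c) (ciso c (cdom c) f)"
proof -
  note n = nablaD(2)[OF chartD(1)[OF c] iso_properties(2)[OF c f]]
  show "vl c f \<in> Sf c" "ciso c (cdom c) (vl c f) = nabla (cdom c) (ciso c (cdom c) f)"
    unfolding vf_local_def
    using local_expr_spec[OF c chartD(1)[OF c] order_refl n] restr_id[OF chartD(1)[OF c] n] by auto
qed

lemma vl_eqI:
  assumes c: "c \<in> C" and f: "f \<in> Sf c" and g: "g \<in> Sf c" "ciso c (cdom c) g = nabla (cdom c) (ciso c (cdom c) f)"
  shows "vl c f = g"
  using iso_inj[OF c vl_spec(1)[OF c f] g(1)] vl_spec(2)[OF c f] g(2) by simp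

lemma vl_trans:
  assumes c: "c \<in> C" "c' \<in> C" "cdom c' \<subseteq> cdom c" and f: "f \<in> Sf c"
  shows "vl c' (chg c c' f) = chg c c' (vl c f)"
  using trans_spec[OF c f] trans_spec[OF c vl_spec(1)[OF c(1) f]] vl_spec(2)[OF c(1) f]
    nablaD(6)[OF chartD(1)[OF c(1)] chartD(1)[OF c(2)] c(3) iso_properties(2)[OF c(1) f]]
  by (intro vl_eqI[OF c(2)]) auto

lemma vl_hom:
  assumes c: "c \<in> C"
  shows "f \<in> Sf c \<Longrightarrow> g \<in> Sf c \<Longrightarrow> vl c (f + g) = vl c f + vl c g"
    and "f \<in> Sf c \<Longrightarrow> vl c (sf_scale a f) = sf_scale a (vl c f)"
    and "f \<in> Sf c \<Longrightarrow> g \<in> Sf c \<Longrightarrow> vl c (sf_mult f g) = sf_mult (vl c f) g + sf_mult f (vl c g)"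
    and "f \<in> Sf c \<Longrightarrow> sf_par k f \<Longrightarrow> sf_par k (vl c f)"
proof -
  interpret S: superdomain p q "cimg c" by (rule chart_superdomain[OF c])
  note P = iso_properties[OF c] and T = vl_spec[OF c] and N = nablaD[OF chartD(1)[OF c]]
  show "vl c (f + g) = vl c f + vl c g" if "f \<in> Sf c" "g \<in> Sf c"
    using that P T N by (intro vl_eqI[OF c]) (auto intro: S.sfuns_add)
  show "vl c (sf_scale a f) = sf_scale a (vl c f)" if "f \<in> Sf c"
    using that P T N by (intro vl_eqI[OF c]) (auto intro: S.sfuns_scale)
  show "vl c (sf_mult f g) = sf_mult (vl c f) g + sf_mult f (vl c g)" if "f \<in> Sf c" "g \<in> Sf c"
  proof -
    note m1 = S.sfuns_mult[OF T(1)[OF that(1)] that(2)] and m2 = S.sfuns_mult[OF that(1) T(1)[OF that(2)]]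
    show ?thesis
      by (rule vl_eqI[OF c S.sfuns_mult[OF that] S.sfuns_add[OF m1 m2]])
        (simp add: P(3)[OF m1 m2] P(4)[OF T(1)[OF that(1)] that(2)] P(4)[OF that(1) T(1)[OF that(2)]] P(4)[OF that]
          T(2)[OF that(1)] T(2)[OF that(2)] N(5)[OF P(2)[OF that(1)] P(2)[OF that(2)]])
  qed
  show "sf_par k (vl c f)" if f: "f \<in> Sf c" "sf_par k f"
    using P(7)[OF f] T(2)[OF f(1)] N(1)[of "of_nat k"] by (intro iso_par_inverse[OF c T(1)[OF f(1)]]) auto
qed

lemma vl_restrict:
  assumes c: "c \<in> C" and U: "opn U" "U \<subseteq> cdom c" and f: "f \<in> Sf c"
  shows "vl (chart_restrict c U) (sf_restrict (cmap c ` U) f) = sf_restrict (cmap c ` U) (vl c f)"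
  using vl_trans[OF c chart_restrict_in[OF c U] _ f] trans_restrict[OF c U f] trans_restrict[OF c U vl_spec(1)[OF c f]] U(2)
  by simp

text \<open>The unit is its own square, so by the product rule its derivative equals twice
  itself.\<close>

lemma vl_const:
  assumes c: "c \<in> C"
  shows "vl c (sf_of_fun (cimg c) (\<lambda>_. k)) = 0"
proof -
  interpret S: superdomain p q "cimg c" by (rule chart_superdomain[OF c])
  have e: "sf_of_fun (cimg c) (\<lambda>_. k) = sf_scale k S.unit_sf"
    by (auto simp: sf_of_fun_def sf_scale_def fun_eq_iff)
  have "vl c S.unit_sf = vl c S.unit_sf + vl c S.unit_sf"
    using vl_hom(3)[OF c S.unit_in_sfuns S.unit_in_sfuns] vl_spec(1)[OF c S.unit_in_sfuns] by simp
  then have "vl c S.unit_sf = 0" by simp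
  then show ?thesis using vl_hom(2)[OF c S.unit_in_sfuns, of k] e by simp
qed

text \<open>As in \<open>trans_morphism\<close>, the formula is checked point by point on boxes,
  with the identity in place of the change of coordinates.\<close>

lemma vl_derivation:
  assumes c: "c \<in> C"
  shows "even_derivation p q (cimg c) (vl c)"
proof -
  interpret P: superdomain p q "cimg c" by (rule chart_superdomain[OF c])
  show ?thesis
  proof
    fix f assume f: "f \<in> Sf c"
    let ?R = "\<Sum>i<p + q. sf_mult (vl c (P.X i)) (P.pd i f)"
    have RS: "?R \<in> Sf c"
      using vl_spec(1)[OF c] f
      by (intro P.sfuns_sum P.sfuns_mult) (auto intro: P.sf_coord_in_sfuns P.sf_pderiv_in_sfuns)
    show "vl c f = ?R"
    proof (intro ext)
      fix J y
      show "vl c f J y = ?R J y"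
      proof (cases "y \<in> cimg c")
        case True
        then obtain m where m: "m \<in> cdom c" "y = cmap c m" by (auto simp: cimg_def)
        obtain U r where U: "opn U" "m \<in> U" "U \<subseteq> cdom c" and "U \<subseteq> cdom c" "0 < r" "r \<le> 1"
          and img: "cmap c ` U = ebox p (cmap c m) r"
          by (rule chart_box[OF c m(1) chartD(1)[OF c] m(1) zero_less_one])
        let ?c = "chart_restrict c U"
        define B where "B = cmap c ` U"
        interpret Q: superdomain_pair p q B B
          using chart_image_open[OF c U(1,3)] unfolding B_def by unfold_locales
        have cc: "?c \<in> C" using U chart_restrict_in c by auto
        have BV: "B \<subseteq> cimg c" using U by (auto simp: B_def cimg_def)
        have yB: "y \<in> B" using U m by (simp add: B_def)
        note H = vl_hom[OF cc, unfolded chart_restrict_simps, folded B_def]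
        note Hc = vl_spec(1)[OF cc, unfolded chart_restrict_simps, folded B_def]
        have rr: "vl ?c (sf_restrict B g) = sf_restrict B (vl c g)" if "g \<in> Sf c" for g
          using vl_restrict[OF c U(1,3) that] by (simp add: B_def)
        have "vl ?c (sf_restrict B f) J y =
          (\<Sum>i<p + q. sf_mult (vl ?c (Q.dom.X i)) (Q.dom.pd i (sf_restrict B f))) J y"
        proof (rule Q.derivation_chain_box[where a = "cmap c m" and \<theta> = "\<lambda>f. f" and \<rho> = 0 and \<delta> = "vl ?c"])
          show "B = ebox p (cmap c m) r" using img by (simp add: B_def)
          show "sf_restrict B f \<in> sfuns p q B"
            using sf_restrict_in_sfuns[OF chartD(2)[OF c] Q.dom.openV BV f] .
          show "Q.dom.X i {} y = cmap c m i" if "i < p" for i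
            using that yB m by (simp add: sf_coord_def sf_of_fun_def)
          show "vl ?c (sf_of_fun B (\<lambda>_. k)) = 0" for k
            using vl_const[OF cc, of k] by (simp add: B_def)
        qed (use H Hc yB in auto)
        also have "\<dots> = ?R J y"
        proof -
          have "sf_mult (vl ?c (Q.dom.X i)) (Q.dom.pd i (sf_restrict B f)) J y = sf_mult (vl c (P.X i)) (P.pd i f) J y"
            if i: "i < p + q" for i
            using rr[OF P.sf_coord_in_sfuns[OF i]] sf_restrict_coord[OF BV]
            by (simp add: sf_pderiv_restrict[OF Q.dom.openV BV] sf_mult_restrict[OF yB])
          then show ?thesis by (simp add: sum_fun_apply)
        qed
        finally show ?thesis using yB by (simp add: rr[OF f] sf_restrict_apply)
      next
        case False
        then show ?thesis using P.sfunsD(2)[OF RS False] P.sfunsD(2)[OF vl_spec(1)[OF c f] False] by simp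
      qed
    qed
  qed (use vl_hom[OF c] vl_spec(1)[OF c] in auto)
qed

lemma homogeneous_coords_iff:
  "homogeneous_coords p q M nabla c w \<longleftrightarrow>
    c \<in> C \<and> (\<forall>i<p + q. vl c (sf_coord p (cimg c) i) = sf_scale (w i) (sf_coord p (cimg c) i))"
proof (cases "c \<in> C")
  case True
  interpret P: superdomain p q "cimg c" by (rule chart_superdomain[OF True])
  have "nabla (cdom c) (ciso c (cdom c) (P.X i)) = w i \<odot>\<^bsub>sec (cdom c)\<^esub> ciso c (cdom c) (P.X i) \<longleftrightarrow>
    vl c (P.X i) = sf_scale (w i) (P.X i)" if i: "i < p + q" for i
    using vl_spec[OF True P.sf_coord_in_sfuns[OF i]] iso_properties(5)[OF True P.sf_coord_in_sfuns[OF i], of "w i"]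
      vl_eqI[OF True P.sf_coord_in_sfuns[OF i] P.sfuns_scale[OF P.sf_coord_in_sfuns[OF i]], of "w i"] by auto
  then show ?thesis using True by (auto simp: homogeneous_coords_def)
qed (simp add: homogeneous_coords_def)

lemma homogeneous_coords_restrict:
  assumes h: "homogeneous_coords p q M nabla c w" and U: "opn U" "U \<subseteq> cdom c"
  shows "homogeneous_coords p q M nabla (chart_restrict c U) w"
  unfolding homogeneous_coords_iff
proof (intro conjI allI impI)
  have c: "c \<in> C" using h by (simp add: homogeneous_coords_def)
  show "chart_restrict c U \<in> C" by (rule chart_restrict_in[OF c U])
  interpret P: superdomain p q "cimg c" by (rule chart_superdomain[OF c])
  fix i assume i: "i < p + q"
  have BV: "cmap c ` U \<subseteq> cimg c" using U by (auto simp: cimg_def)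
  have "sf_restrict (cmap c ` U) (sf_scale a f) = sf_scale a (sf_restrict (cmap c ` U) f)" for a f
    by (auto simp: sf_restrict_def sf_scale_def fun_eq_iff)
  then show "vl (chart_restrict c U) (sf_coord p (cimg (chart_restrict c U)) i) = sf_scale (w i) (sf_coord p (cimg (chart_restrict c U)) i)"
    using vl_restrict[OF c U P.sf_coord_in_sfuns[OF i]] h i sf_restrict_coord[OF BV] by (simp add: homogeneous_coords_iff)
qed

end

section \<open>Forms determined by one chart\<close>

context smfd
begin

text \<open>A form on a chart domain is determined by its expression in that chart. On charts not
  inside \<open>cdom c\<close> the value carries no information and is ignored by
  \<open>mform_eq\<close>.\<close>

definition spread :: "('a, 's) chart \<Rightarrow> dform \<Rightarrow> ('a, 's) mform" where
  "spread c \<alpha> = (\<lambda>c'. pullback p q (cimg c) (cimg c') (chg c c') \<alpha>)"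

lemma spread_mforms:
  assumes c: "c \<in> C" and a: "\<alpha> \<in> dforms p q (cimg c) n"
  shows "spread c \<alpha> \<in> mforms p q M (cdom c) n"
  unfolding mforms_def
proof (intro CollectI conjI ballI impI)
  fix c' assume c': "c' \<in> C" "cdom c' \<subseteq> cdom c"
  show "spread c \<alpha> c' \<in> dforms p q (cimg c') n"
    unfolding spread_def by (rule sf_morphism.pullback_dforms[OF trans_morphism[OF c c'] a])
next
  fix c' c'' assume c': "c' \<in> C" "c'' \<in> C" and s: "cdom c'' \<subseteq> cdom c' \<and> cdom c' \<subseteq> cdom c"
  then have s: "cdom c'' \<subseteq> cdom c'" "cdom c' \<subseteq> cdom c" "cdom c'' \<subseteq> cdom c" by auto
  show "spread c \<alpha> c'' = pullback p q (cimg c') (cimg c'') (chg c' c'') (spread c \<alpha> c')"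
    unfolding spread_def
    by (rule pullback_comp[OF trans_morphism[OF c c'(1) s(2)] trans_morphism[OF c' s(1)] trans_morphism[OF c c'(2) s(3)] _ a, symmetric])
      (use trans_trans[OF c c' s(2,1)] in simp)
qed

lemma mforms_spread:
  assumes "\<omega> \<in> mforms p q M U n" "c \<in> C" "cdom c \<subseteq> U" "c' \<in> C" "cdom c' \<subseteq> cdom c"
  shows "\<omega> c' = spread c (\<omega> c) c'"
  unfolding spread_def
  by (rule assms(1)[unfolded mforms_def mem_Collect_eq, THEN conjunct2, rule_format, OF assms(2,4)]) (use assms in simp)

lemma mforms_dforms: "\<omega> \<in> mforms p q M U n \<Longrightarrow> c \<in> C \<Longrightarrow> cdom c \<subseteq> U \<Longrightarrow> \<omega> c \<in> dforms p q (cimg c) n"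
proof -
  assume w: "\<omega> \<in> mforms p q M U n" and c: "c \<in> C" "cdom c \<subseteq> U"
  show "\<omega> c \<in> dforms p q (cimg c) n"
    by (rule w[unfolded mforms_def mem_Collect_eq, THEN conjunct1, rule_format, OF c])
qed

lemma spread_ext_d:
  assumes "c \<in> C" "c' \<in> C" "cdom c' \<subseteq> cdom c" "\<alpha> \<in> dforms p q (cimg c) n"
  shows "ext_d p q (cimg c') (spread c \<alpha> c') = spread c (ext_d p q (cimg c) \<alpha>) c'"
  unfolding spread_def by (rule sf_morphism.pullback_ext_d[OF trans_morphism[OF assms(1-3)] assms(4), symmetric])

lemma local_expr_trans:
  assumes c: "c \<in> C" "c' \<in> C" "cdom c' \<subseteq> cdom c" and U: "opn U" "cdom c \<subseteq> U" and s: "s \<in> carrier (sec U)"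
  shows "local_expr p q M U c' s = chg c c' (local_expr p q M U c s)"
proof (rule local_expr_eqI[OF c(2)])
  note L = local_expr_spec[OF c(1) U s]
  show "chg c c' (local_expr p q M U c s) \<in> Sf c'" by (rule trans_spec(1)[OF c L(1)])
  show "ciso c' (cdom c') (chg c c' (local_expr p q M U c s)) = restr M U (cdom c') s"
    unfolding trans_spec(2)[OF c L(1)] L(2)
    by (rule restr_restr[OF U(1) chartD(1)[OF c(1)] chartD(1)[OF c(2)] c(3) U(2) s])
qed

lemma fun_d_spread:
  assumes c: "c \<in> C" "c' \<in> C" "cdom c' \<subseteq> cdom c" and U: "opn U" "cdom c \<subseteq> U" and s: "s \<in> carrier (sec U)"
  shows "fun_d p q M U s c' = spread c (sf_d p q (cimg c) (local_expr p q M U c s)) c'"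
  unfolding fun_d_def spread_def local_expr_trans[OF assms]
  by (rule sf_morphism.pullback_sf_d[OF trans_morphism[OF c] local_expr_spec(1)[OF c(1) U s], symmetric])

lemma fun_vanishes_iff:
  assumes U: "opn U" and s: "s \<in> carrier (sec U)" and c: "c \<in> C" "cdom c = U" and m: "m \<in> U"
  shows "fun_vanishes_at p q M U s m \<longleftrightarrow> local_expr p q M U c s {} (cmap c m) = 0"
proof -
  have "local_expr p q M U c' s {} (cmap c' m) = local_expr p q M U c s {} (cmap c m)"
    if "c' \<in> C" "m \<in> cdom c'" "cdom c' \<subseteq> U" for c'
    using body_value[OF c(1) that(1) _ that(2) local_expr_spec(1)[OF c(1) U _ s]] that(3) c(2)
      local_expr_trans[OF c(1) that(1) _ U _ s] by simp
  note eq = this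
  show ?thesis
    unfolding fun_vanishes_at_def
  proof
    assume "\<forall>c\<in>C. m \<in> cdom c \<and> cdom c \<subseteq> U \<longrightarrow> local_expr p q M U c s {} (cmap c m) = 0"
    then show "local_expr p q M U c s {} (cmap c m) = 0" using c m by blast
  next
    assume z: "local_expr p q M U c s {} (cmap c m) = 0"
    show "\<forall>c\<in>C. m \<in> cdom c \<and> cdom c \<subseteq> U \<longrightarrow> local_expr p q M U c s {} (cmap c m) = 0"
      using eq z by simp
  qed
qed

text \<open>In other coordinates the coefficients are sums of products with the pulled back
  coefficients, and these vanish at \<open>m\<close> by \<open>body_value\<close>.\<close>

lemma spread_vanishes:
  assumes c: "c \<in> C" and m: "m \<in> cdom c" and a: "\<alpha> \<in> dforms p q (cimg c) n" and z: "\<And>I. \<alpha> I {} (cmap c m) = 0"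
  shows "mform_vanishes_at p q M (cdom c) (spread c \<alpha>) m"
  unfolding mform_vanishes_at_def
proof (intro ballI impI allI)
  fix c' I assume c': "c' \<in> C" and s: "m \<in> cdom c' \<and> cdom c' \<subseteq> cdom c"
  interpret T: sf_morphism p q "cimg c" "cimg c'" "chg c c'" using trans_morphism[OF c c'] s by simp
  have "(wedge p (T.cod.wlist T.dXi (sorted_list_of_multiset K)) (fun_form (chg c c' (\<alpha> K)))) I {} (cmap c' m) = 0" for K
    using body_value[OF c c' _ _ T.dom.dformsD(1)[OF a]] s z by (simp add: wedge_fun_right sf_mult_empty zero_fun_apply)
  then show "spread c \<alpha> c' I {} (cmap c' m) = 0"
    unfolding spread_def T.pullback_eq[OF a] by (simp add: sum_fun_apply)
qed

lemma closed_chart: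
  "closed_mform p q M U \<omega> \<Longrightarrow> c \<in> C \<Longrightarrow> cdom c \<subseteq> U \<Longrightarrow> ext_d p q (cimg c) (\<omega> c) = 0"
  by (auto simp: closed_mform_def mform_eq_def mform_d_def mform_zero_def zero_fun_def)

end

lemma df_par_iff: "df_par p k \<alpha> \<longleftrightarrow> (\<forall>I J x. \<alpha> I J x \<noteq> 0 \<longrightarrow> (of_nat (odd_size p I + card J) :: bit) = of_nat k)"
  unfolding df_par_def sf_par_def of_nat_bit_eq_iff by (simp add: add.commute add.left_commute)

context vfd
begin

lemma spread_homogeneous:
  assumes h: "homogeneous_coords p q M nabla c w" and a: "\<alpha> \<in> dforms p q (cimg c) n" and k: "df_par p k \<alpha>"
    and D: "\<And>I. I \<in> dmonoms p q n \<Longrightarrow> vl c (\<alpha> I) = sf_scale (\<mu> - (\<Sum>i\<in>#I. w i)) (\<alpha> I)"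
  shows "homogeneous_mform p q M nabla (cdom c) (of_nat k, \<mu>) (spread c \<alpha>)"
  unfolding homogeneous_mform_def
proof (intro ballI impI conjI)
  fix c' assume c': "c' \<in> C" and s: "cdom c' \<subseteq> cdom c"
  have c: "c \<in> C" using h by (simp add: homogeneous_coords_def)
  interpret T: sf_morphism p q "cimg c" "cimg c'" "chg c c'" by (rule trans_morphism[OF c c' s])
  show "\<forall>I J x. spread c \<alpha> c' I J x \<noteq> 0 \<longrightarrow> of_nat (odd_size p I + card J) = fst (of_nat k :: bit, \<mu>)"
    using T.df_par_pullback[OF a k] unfolding df_par_iff spread_def fst_conv .
  have "lie_deriv p q (cimg c') (vl c') (T.pull \<alpha>) = df_scale \<mu> (T.pull \<alpha>)"
  proof (rule lie_pullback[OF T.sf_morphism_axioms vl_derivation[OF c'] _ a])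
    show "vl c' (chg c c' (T.dom.X i)) = sf_scale (w i) (chg c c' (T.dom.X i))" if "i < p + q" for i
      using vl_trans[OF c c' s T.dom.sf_coord_in_sfuns[OF that]] h that T.morph_scale[OF T.dom.sf_coord_in_sfuns[OF that]]
      by (simp add: homogeneous_coords_iff)
    show "vl c' (chg c c' (\<alpha> I)) = sf_scale (\<mu> - (\<Sum>i\<in>#I. w i)) (chg c c' (\<alpha> I))" if "I \<in> dmonoms p q n" for I
      using vl_trans[OF c c' s T.dom.dformsD(1)[OF a]] D[OF that] T.morph_scale[OF T.dom.dformsD(1)[OF a]] by simp
  qed
  then show "lie_deriv p q (cimg c') (vl c') (spread c \<alpha> c') = (\<lambda>I J x. snd (of_nat k, \<mu>) * spread c \<alpha> c' I J x)"
    by (simp add: spread_def df_scale_def sf_scale_def)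
qed

lemma homogeneous_chart:
  assumes h: "homogeneous_coords p q M nabla c w" and om: "\<omega> \<in> mforms p q M U n" and s: "cdom c \<subseteq> U"
    and hm: "homogeneous_mform p q M nabla U (of_nat k, \<mu>) \<omega>"
  shows "df_par p k (\<omega> c)" "vl c (\<omega> c I) = sf_scale (\<mu> - (\<Sum>i\<in>#I. w i)) (\<omega> c I)"
proof -
  have c: "c \<in> C" using h by (simp add: homogeneous_coords_def)
  interpret E: even_derivation p q "cimg c" "vl c" by (rule vl_derivation[OF c])
  have w: "\<omega> c \<in> E.\<Omega> n" by (rule mforms_dforms[OF om c s])
  show "df_par p k (\<omega> c)"
    using hm c s unfolding df_par_iff homogeneous_mform_def by auto
  have "E.lie (\<omega> c) = df_scale \<mu> (\<omega> c)"
    using hm c s unfolding homogeneous_mform_def by (auto simp: df_scale_def sf_scale_def)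
  then have "sf_scale \<mu> (\<omega> c I) = sf_scale (\<Sum>i\<in>#I. w i) (\<omega> c I) + vl c (\<omega> c I)"
    using E.lie_homogeneous_coords[OF _ w, of w I] h by (simp add: homogeneous_coords_iff df_scale_apply)
  then show "vl c (\<omega> c I) = sf_scale (\<mu> - (\<Sum>i\<in>#I. w i)) (\<omega> c I)"
    by (auto simp: fun_eq_iff sf_scale_def plus_fun_apply algebra_simps)
qed

end

section \<open>Removing one coordinate from a closed form\<close>

context superdomain
begin

lemma ext_d_apply:
  assumes "\<omega> \<in> \<Omega> n" "L \<in> dmonoms p q (Suc n)"
  shows "ext_d p q V \<omega> L = (\<Sum>j\<in>set_mset L. sf_scale ((- 1) ^ n * dmonom_sign p (L - {#j#}) {#j#}) (pd j (\<omega> (L - {#j#}))))"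
proof -
  have L: "size L = Suc n" "L \<in> dmonoms p q (size L)" using assms(2) by (auto simp: dmonoms_iff)
  have "ext_d p q V \<omega> L = (\<Sum>j\<in>set_mset L. sf_scale ((- 1) ^ size (L - {#j#}) * dmonom_sign p (L - {#j#}) {#j#}) (pd j (\<omega> (L - {#j#}))))"
    using L(2) by (simp add: ext_d_def sf_scale_def fun_eq_iff sum_fun_apply)
  also have "\<dots> = (\<Sum>j\<in>set_mset L. sf_scale ((- 1) ^ n * dmonom_sign p (L - {#j#}) {#j#}) (pd j (\<omega> (L - {#j#}))))"
    using L(1) by (intro sum.cong refl) (simp add: size_Diff_singleton)
  finally show ?thesis .
qed

text \<open>Such a form comes from the superdomain without the coordinate \<open>j\<close>. The
  absence of \<open>dx^j\<close> alone would not be preserved by \<open>d\<close>.\<close>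

definition df_indep :: "nat \<Rightarrow> dform \<Rightarrow> bool" where
  "df_indep j \<omega> \<longleftrightarrow> (\<forall>I. (j \<in># I \<longrightarrow> \<omega> I = 0) \<and> pd j (\<omega> I) = 0)"

lemma sf_scale_eq_0_iff: "sf_scale a f = 0 \<longleftrightarrow> a = 0 \<or> f = 0"
  by (auto simp: sf_scale_def fun_eq_iff zero_fun_apply)

lemma dmonom_sign_nonzero: "dmonom_sign p A B \<noteq> 0"
  by (simp add: dmonom_sign_def)

lemma dmonom_sign_square [simp]: "dmonom_sign p A B * dmonom_sign p A B = 1"
  by (simp add: dmonom_sign_def)

lemma df_indep_ext_d:
  assumes a: "\<alpha> \<in> \<Omega> n" and j: "df_indep j \<alpha>" "j < p + q"
  shows "df_indep j (ext_d p q V \<alpha>)"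
  unfolding df_indep_def
proof (intro allI conjI impI)
  fix L
  show "ext_d p q V \<alpha> L = 0" if "j \<in># L"
  proof (cases "L \<in> dmonoms p q (Suc n)")
    case True
    show ?thesis
      unfolding ext_d_apply[OF a True]
    proof (rule sum.neutral, rule ballI)
      fix l assume l: "l \<in> set_mset L"
      show "sf_scale ((- 1) ^ n * dmonom_sign p (L - {#l#}) {#l#}) (pd l (\<alpha> (L - {#l#}))) = 0"
      proof (cases "l = j")
        case True
        then show ?thesis using j by (simp add: df_indep_def)
      next
        case False
        then have "\<alpha> (L - {#l#}) = 0" using j that unfolding df_indep_def by (metis in_diff_count insert_noteq_member insert_DiffM l)
        then show ?thesis by simp
      qed
    qed
  qed (use dformsD(2)[OF ext_d_dforms[OF a]] in blast)
  show "pd j (ext_d p q V \<alpha> L) = 0"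
  proof (cases "L \<in> dmonoms p q (Suc n)")
    case True
    have l: "l < p + q" if "l \<in># L" for l using True that by (auto simp: dmonoms_iff)
    have S: "pd l (\<alpha> (L - {#l#})) \<in> S" if "l \<in># L" for l
      by (rule sf_pderiv_in_sfuns[OF dformsD(1)[OF a] l[OF that]])
    have z: "pd j (sf_scale e (pd l (\<alpha> (L - {#l#})))) = 0" if "l \<in># L" for l e
      using sf_pderiv_scale[OF S[OF that] j(2)] sf_pderiv_commute[OF dformsD(1)[OF a] j(2) l[OF that]] j(1)
      by (simp add: df_indep_def)
    show ?thesis
      unfolding ext_d_apply[OF a True]
      by (subst sf_pderiv_sum[OF sfuns_scale[OF S] j(2)]) (use z in auto)
  next
    case False
    then have "ext_d p q V \<alpha> L = 0" by (rule dformsD(2)[OF ext_d_dforms[OF a]])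
    then show ?thesis by simp
  qed
qed

lemma df_indep_diff:
  assumes "\<alpha> \<in> \<Omega> n" "\<beta> \<in> \<Omega> n" "df_indep j \<alpha>" "df_indep j \<beta>" "j < p + q"
  shows "df_indep j (\<alpha> - \<beta>)"
proof -
  have "(\<alpha> - \<beta>) I = \<alpha> I - \<beta> I" for I by (simp add: minus_apply)
  then show ?thesis
    using assms sf_pderiv_diff[OF dformsD(1)[OF assms(1)] dformsD(1)[OF assms(2)] assms(5)] by (simp add: df_indep_def)
qed

lemma avg_zero:
  assumes u: "\<And>y. y \<in> ebox p a r \<Longrightarrow> u y = 0" and x: "x \<in> ebox p a r" and i: "i < p"
  shows "avg i (a i) k u x = 0"
proof -
  have "integral {0..1} (\<lambda>t. t ^ k * u (x(i := a i + t * (x i - a i)))) = integral {0..1::real} (\<lambda>t. 0)"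
  proof (rule Henstock_Kurzweil_Integration.integral_cong)
    fix t :: real assume "t \<in> {0..1}"
    from u[OF ebox_contract[OF x this i]] show "t ^ k * u (x(i := a i + t * (x i - a i))) = 0" by simp
  qed
  then show ?thesis by (simp add: avg_def)
qed

text \<open>The primitive in the even coordinate \<open>x\<^sup>i\<close> that vanishes on the slice \<open>x\<^sup>i = a\<^sub>i\<close>.\<close>

definition prim :: "(nat \<Rightarrow> real) \<Rightarrow> nat \<Rightarrow> sfun \<Rightarrow> sfun" where
  "prim a i f = (\<lambda>J x. if x \<in> V then (x i - a i) * avg i (a i) 0 (f J) x else 0)"

lemma prim_slice: "x i = a i \<Longrightarrow> prim a i f J x = 0"
  by (simp add: prim_def)

lemma prim_0 [simp]: "prim a i 0 = 0"
  by (simp add: prim_def fun_eq_iff zero_fun_apply avg_def)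

lemma sf_par_prim:
  assumes "sf_par k f" shows "sf_par k (prim a i f)"
  unfolding sf_par_def
proof (intro allI impI, rule ccontr)
  fix J x assume nz: "prim a i f J x \<noteq> 0" and "odd (card J + k)"
  then have "f J = (\<lambda>_. 0)" using assms unfolding sf_par_def by (intro ext) blast
  then have "prim a i f J x = 0" by (simp add: prim_def avg_def)
  then show False using nz by contradiction
qed

context
  fixes a r
  assumes VB: "V = ebox p a r"
begin

lemma prim_in_sfuns:
  assumes f: "f \<in> S" and i: "i < p"
  shows "prim a i f \<in> S"
proof (rule sfunsI)
  fix J
  have "smooth_fun p V (\<lambda>x. (x i + (- a i)) * avg i (a i) 0 (f J) x)"
    using smooth_fun_avg[OF _ i, of a r "f J" 0] sfunsD(1)[OF f, of J] unfolding VB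
    by (intro smooth_fun_mult smooth_fun_add smooth_fun_coord smooth_fun_const openin_ebox) simp_all
  then show "smooth_fun p V (prim a i f J)"
    using smooth_fun_cong[OF openV, of "prim a i f J" "\<lambda>x. (x i + (- a i)) * avg i (a i) 0 (f J) x"] by (simp add: prim_def)
next
  fix J x assume "\<not> J \<subseteq> {p..<p + q}"
  then have "f J = (\<lambda>_. 0)" using f by (simp add: sfuns_def)
  then show "prim a i f J x = 0" by (simp add: prim_def avg_def)
qed (simp add: prim_def)

lemma pd_prim:
  assumes f: "f \<in> S" and i: "i < p"
  shows "pd i (prim a i f) = f"
proof (intro ext)
  fix J x
  show "pd i (prim a i f) J x = f J x"
  proof (cases "x \<in> V")
    case True
    note sm = sfunsD(1)[OF f, of J, unfolded VB]
    have "has_pderiv i (\<lambda>x. (x i - a i) * avg i (a i) 0 (f J) x) (1 * avg i (a i) 0 (f J) x + avg i (a i) 1 (pderiv_at i (f J)) x * (x i - a i)) x"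
      using DERIV_mult[OF DERIV_diff[OF DERIV_ident DERIV_const[of "a i"]] has_pderiv_avg[OF sm i i, of x 0]] True VB
      by (simp add: One_nat_def)
    then have "has_pderiv i (\<lambda>x. (x i - a i) * avg i (a i) 0 (f J) x) (f J x) x"
      using avg_ftc(2)[OF sm i, of x] True VB by (simp add: mult.commute)
    then have "has_pderiv i (prim a i f J) (f J x) x"
      using has_pderiv_cong[OF openV True i, of "prim a i f J" "\<lambda>x. (x i - a i) * avg i (a i) 0 (f J) x"] by (simp add: prim_def)
    then show ?thesis using True i by (simp add: sf_pderiv_eqI)
  qed (simp add: sf_pderiv_outside sfunsD(2)[OF f])
qed

text \<open>A derivative in another even direction passes under the integral. In an odd direction
  its vanishing says that the coefficients with \<open>j\<close> are zero, and the primitive is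
  taken coefficient by coefficient.\<close>

lemma pd_prim_0:
  assumes f: "f \<in> S" and i: "i < p" and j: "j < p + q" "j \<noteq> i" and z: "pd j f = 0"
  shows "pd j (prim a i f) = 0"
proof (intro ext)
  fix J x
  show "pd j (prim a i f) J x = 0 J x"
  proof (cases "x \<in> V")
    case True
    note sm = sfunsD(1)[OF f, of J, unfolded VB]
    show ?thesis
    proof (cases "j < p")
      case jp: True
      have "pderiv_at j (f J) y = 0" if "y \<in> V" for y
        using z jp that by (metis sf_pderiv_even_eq zero_fun_apply)
      then have "avg i (a i) 0 (pderiv_at j (f J)) x = 0"
        using True i unfolding VB by (intro avg_zero)
      then have "has_pderiv j (\<lambda>x. (x i - a i) * avg i (a i) 0 (f J) x) 0 x"
        using DERIV_cmult[OF has_pderiv_avg[OF sm i jp, of x 0], of "x i - a i"] True VB j(2) by simp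
      then have "has_pderiv j (prim a i f J) 0 x"
        using has_pderiv_cong[OF openV True jp, of "prim a i f J" "\<lambda>x. (x i - a i) * avg i (a i) 0 (f J) x"] by (simp add: prim_def)
      then show ?thesis using True jp by (simp add: sf_pderiv_eqI zero_fun_apply)
    next
      case False
      have "prim a i f (insert j J) x = 0" if "j \<notin> J"
      proof -
        have "f (insert j J) y = 0" for y
          using fun_cong[OF fun_cong[OF z, of J], of y] that False sfunsD(2)[OF f, of y]
          by (cases "y \<in> V") (auto simp: sf_pderiv_odd zero_fun_apply odd_sign_def)
        then show ?thesis by (simp add: prim_def avg_def)
      qed
      then show ?thesis using False by (simp add: sf_pderiv_odd zero_fun_apply)
    qed
  qed (simp add: sf_pderiv_outside zero_fun_apply)
qed

text \<open>By the fundamental theorem along \<open>x^i\<close>, such a function equals its value on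
  the slice, which meets every line in direction \<open>i\<close> inside the box. This identifies
  the weight of a primitive in \<open>D_prim\<close>.\<close>

lemma slice_uniqueness:
  assumes f: "f \<in> S" and i: "i < p" and z: "pd i f = 0" and s: "\<And>J x. x \<in> V \<Longrightarrow> x i = a i \<Longrightarrow> f J x = 0"
  shows "f = 0"
proof (intro ext)
  fix J x
  show "f J x = 0 J x"
  proof (cases "x \<in> V")
    case True
    have "\<bar>x i - a i\<bar> < r" using True VB i by (simp add: ebox_def)
    then have r: "r > 0" by linarith
    have "pderiv_at i (f J) y = 0" if "y \<in> V" for y
      using z i that by (metis sf_pderiv_even_eq zero_fun_apply)
    then have "avg i (a i) 0 (pderiv_at i (f J)) x = 0"
      using True i unfolding VB by (intro avg_zero)
    moreover have "x(i := a i) \<in> V" using True r i unfolding VB by (simp add: ebox_fun_upd)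
    ultimately show ?thesis
      using avg_ftc(1)[of p a r "f J" i x] sfunsD(1)[OF f, of J] i True VB s[of "x(i := a i)" J] by (simp add: zero_fun_apply)
  qed (simp add: sfunsD(2)[OF f] zero_fun_apply)
qed

end

end

section \<open>Weights on a box in homogeneous coordinates\<close>

locale euler_derivation = even_derivation p q V D for p q V D +
  fixes w :: "nat \<Rightarrow> real" and a :: "nat \<Rightarrow> real" and r :: real
  assumes euler: "i < p + q \<Longrightarrow> D (X i) = sf_scale (w i) (X i)"
    and VB: "V = ebox p a r"
begin

text \<open>\<open>D\<close> is the sum of the \<open>i\<close>-th derivatives multiplied by
  \<open>w i\<close> and \<open>x^i\<close>. Differentiation in direction \<open>j\<close> affects
  only the coefficient \<open>x^j\<close>, which gives the extra term; the signs of passing odd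
  coordinates and of exchanging derivatives cancel.\<close>

lemma D_pd:
  assumes f: "f \<in> S" and j: "j < p + q"
  shows "pd j (D f) = D (pd j f) + sf_scale (w j) (pd j f)"
proof -
  note XS = sf_coord_in_sfuns and PS = sf_pderiv_in_sfuns[OF f]
  have t: "pd j (sf_mult (sf_scale (w i) (X i)) (pd i f)) =
    (if i = j then sf_scale (w j) (pd j f) else 0) + sf_mult (sf_scale (w i) (X i)) (pd i (pd j f))"
    if i: "i < p + q" for i
  proof -
    have "sf_mult (sf_twist (cpar p j) (X i)) (pd j (pd i f)) = sf_mult (X i) (pd i (pd j f))"
      unfolding sf_twist_par[OF sf_par_coord] sf_mult_scale_left sf_mult_scale_right[symmetric]
      by (subst sf_pderiv_commute[OF f j i]) simp
    moreover have "pd j (sf_mult (X i) (pd i f)) = (if i = j then pd j f else 0) + sf_mult (sf_twist (cpar p j) (X i)) (pd j (pd i f))"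
      using sf_pderiv_mult[OF XS[OF i] PS[OF i] j] sf_pderiv_coord[OF j i] PS[OF j] by auto
    ultimately show ?thesis
      using sf_pderiv_scale[OF sfuns_mult[OF XS[OF i] PS[OF i]] j, of "w i"]
      by (simp add: sf_mult_scale_left sf_scale_add)
  qed
  have "pd j (D f) = pd j (\<Sum>i<p + q. sf_mult (sf_scale (w i) (X i)) (pd i f))"
    using deriv_chain[OF f] euler by simp
  also have "\<dots> = (\<Sum>i<p + q. pd j (sf_mult (sf_scale (w i) (X i)) (pd i f)))"
    by (rule sf_pderiv_sum[OF _ j]) (auto intro!: sfuns_mult sfuns_scale XS PS)
  also have "\<dots> = (\<Sum>i<p + q. (if i = j then sf_scale (w j) (pd j f) else 0) + sf_mult (sf_scale (w i) (X i)) (pd i (pd j f)))"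
    using t by (intro sum.cong refl) simp
  also have "\<dots> = sf_scale (w j) (pd j f) + D (pd j f)"
    unfolding sum.distrib deriv_chain[OF PS[OF j]] using euler j by simp
  finally show ?thesis by (simp add: add.commute)
qed

text \<open>The difference of the two sides has vanishing \<open>i\<close>-th derivative by
  \<open>D_pd\<close>, so it is determined on the slice \<open>x i = a i\<close>. There the
  primitive vanishes together with its derivatives in all other directions, and the coefficient of
  the remaining one in \<open>D\<close> is \<open>w i * a i = 0\<close>.\<close>

lemma D_prim:
  assumes f: "f \<in> S" and i: "i < p" and wa: "w i = 0 \<or> a i = 0" and Df: "D f = sf_scale l f"
  shows "D (prim a i f) = sf_scale (l + w i) (prim a i f)"
proof -
  have iq: "i < p + q" using i by simp
  let ?g = "prim a i f"
  note gS = prim_in_sfuns[OF VB f i]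
  have hS: "D ?g - sf_scale (l + w i) ?g \<in> S" by (intro sfuns_diff deriv_closed sfuns_scale gS)
  have "pd i (D ?g - sf_scale (l + w i) ?g) = 0"
    unfolding sf_pderiv_diff[OF deriv_closed[OF gS] sfuns_scale[OF gS] iq] D_pd[OF gS iq] sf_pderiv_scale[OF gS iq] pd_prim[OF VB f i] Df
    by (auto simp: fun_eq_iff sf_scale_def minus_apply plus_fun_apply zero_fun_apply algebra_simps)
  moreover have "(D ?g - sf_scale (l + w i) ?g) J x = 0" if x: "x \<in> V" "x i = a i" for J x
  proof -
    have "D ?g J x = (\<Sum>k<p + q. sf_mult (sf_scale (w k) (X k)) (pd k ?g) J x)"
      unfolding deriv_chain[OF gS] sum_fun_apply using euler by simp
    also have "\<dots> = 0"
    proof (rule sum.neutral, rule ballI)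
      fix k assume k: "k \<in> {..<p + q}"
      show "sf_mult (sf_scale (w k) (X k)) (pd k ?g) J x = 0"
      proof (cases "k = i")
        case True
        have "X i = sf_of_fun V (\<lambda>x. x i)" using i by (simp add: sf_coord_def)
        then have "sf_mult (sf_scale (w k) (X k)) (pd k ?g) J x = w i * (x i * pd i ?g J x)"
          using sf_mult_of_fun_left[OF sf_pderiv_in_sfuns[OF gS iq]] True by (simp add: sf_mult_scale_left) (simp add: sf_scale_def)
        then show ?thesis using wa x by auto
      next
        case False
        have "pd k ?g K x = 0" for K
        proof (cases "k < p")
          case True
          have "has_pderiv k (?g K) 0 x" using False x prim_slice[where i = i and a = a and f = f and J = K] by simp
          then show ?thesis using True x by (simp add: sf_pderiv_eqI)
        next
          case False
          then show ?thesis using x prim_slice[where x = x and i = i and a = a and f = f] by (simp add: sf_pderiv_odd)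
        qed
        then show ?thesis by (simp add: sf_mult_def)
      qed
    qed
    finally show ?thesis using prim_slice[where x = x and i = i and a = a and f = f and J = J] x by (simp add: minus_apply sf_scale_def)
  qed
  ultimately have "D ?g - sf_scale (l + w i) ?g = 0" by (rule slice_uniqueness[OF VB hS i])
  then show ?thesis by simp
qed

definition weighted :: "nat \<Rightarrow> nat \<Rightarrow> real \<Rightarrow> dform \<Rightarrow> bool" where
  "weighted n k \<mu> \<omega> \<longleftrightarrow> \<omega> \<in> \<Omega> n \<and> df_par p k \<omega> \<and> (\<forall>I. D (\<omega> I) = sf_scale (\<mu> - (\<Sum>i\<in>#I. w i)) (\<omega> I))"

lemma weightedD:
  assumes "weighted n k \<mu> \<omega>"
  shows "\<omega> \<in> \<Omega> n" "df_par p k \<omega>" "D (\<omega> I) = sf_scale (\<mu> - (\<Sum>i\<in>#I. w i)) (\<omega> I)"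
  using assms by (auto simp: weighted_def)

lemma weighted_add:
  assumes a: "weighted n k \<mu> \<alpha>" and b: "weighted n k \<mu> \<beta>"
  shows "weighted n k \<mu> (\<alpha> + \<beta>)"
proof -
  have "D ((\<alpha> + \<beta>) I) = sf_scale (\<mu> - (\<Sum>i\<in>#I. w i)) ((\<alpha> + \<beta>) I)" for I
    unfolding plus_fun_apply[of \<alpha> \<beta>]
      deriv_add[OF dformsD(1)[OF weightedD(1)[OF a]] dformsD(1)[OF weightedD(1)[OF b]]] weightedD(3)[OF a] weightedD(3)[OF b]
      sf_scale_add ..
  then show ?thesis
    using weightedD(1,2)[OF a] weightedD(1,2)[OF b] by (simp add: weighted_def dforms_add df_par_add)
qed

lemma weighted_scale:
  assumes b: "weighted n k \<mu> \<beta>"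
  shows "weighted n k \<mu> (df_scale c \<beta>)"
proof -
  have "D (df_scale c \<beta> I) = sf_scale (\<mu> - (\<Sum>i\<in>#I. w i)) (df_scale c \<beta> I)" for I
    unfolding df_scale_apply deriv_scale[OF dformsD(1)[OF weightedD(1)[OF b]]] weightedD(3)[OF b]
    by (simp add: mult.commute)
  moreover have "df_par p k (df_scale c \<beta>)"
    using weightedD(2)[OF b] by (simp add: df_par_def df_scale_apply sf_par_scale)
  ultimately show ?thesis
    using weightedD(1)[OF b] by (simp add: weighted_def dforms_scale)
qed

lemma weighted_diff: "weighted n k \<mu> \<alpha> \<Longrightarrow> weighted n k \<mu> \<beta> \<Longrightarrow> weighted n k \<mu> (\<alpha> - \<beta>)"
  using weighted_add[of n k \<mu> \<alpha> "df_scale (- 1) \<beta>"] weighted_scale[of n k \<mu> \<beta> "- 1"] by (simp add: df_scale_minus_1)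

text \<open>Differentiation in direction \<open>j\<close> lowers the weight of a coefficient by
  \<open>w j\<close>, and \<open>dx^j\<close> restores it; likewise for the parity.\<close>

lemma weighted_ext_d:
  assumes "weighted n k \<mu> \<alpha>"
  shows "weighted (Suc n) k \<mu> (ext_d p q V \<alpha>)"
  unfolding weighted_def
proof (intro conjI allI)
  have a: "\<alpha> \<in> \<Omega> n" and par: "df_par p k \<alpha>" and D: "\<And>I. D (\<alpha> I) = sf_scale (\<mu> - (\<Sum>i\<in>#I. w i)) (\<alpha> I)"
    using assms by (auto simp: weighted_def)
  show dS: "ext_d p q V \<alpha> \<in> \<Omega> (Suc n)" by (rule ext_d_dforms[OF a])
  have par': "sf_par (k + odd_size p L) (pd j (\<alpha> (L - {#j#})))" if "j \<in># L" for j L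
  proof -
    have "sf_par (k + odd_size p (L - {#j#}) + cpar p j) (pd j (\<alpha> (L - {#j#})))"
      using par by (intro sf_par_pderiv dformsD(1)[OF a]) (simp add: df_par_def)
    moreover have "odd_size p L = cpar p j + odd_size p (L - {#j#})" using that by (metis insert_DiffM odd_size_add_mset)
    ultimately show ?thesis by (simp add: add_ac)
  qed
  show "df_par p k (ext_d p q V \<alpha>)"
    unfolding df_par_def
  proof
    fix L
    show "sf_par (k + odd_size p L) (ext_d p q V \<alpha> L)"
    proof (cases "L \<in> dmonoms p q (Suc n)")
      case True
      show ?thesis unfolding ext_d_apply[OF a True] using par' by (intro sf_par_sum sf_par_scale) auto
    qed (use dformsD(2)[OF dS] in simp)
  qed
  fix L
  show "D (ext_d p q V \<alpha> L) = sf_scale (\<mu> - (\<Sum>i\<in>#L. w i)) (ext_d p q V \<alpha> L)"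
  proof (cases "L \<in> dmonoms p q (Suc n)")
    case True
    have l: "j < p + q" if "j \<in># L" for j using True that by (auto simp: dmonoms_iff)
    have S: "pd j (\<alpha> (L - {#j#})) \<in> S" if "j \<in># L" for j
      by (rule sf_pderiv_in_sfuns[OF dformsD(1)[OF a] l[OF that]])
    have t: "D (sf_scale e (pd j (\<alpha> (L - {#j#})))) = sf_scale (\<mu> - (\<Sum>i\<in>#L. w i)) (sf_scale e (pd j (\<alpha> (L - {#j#}))))"
      if j: "j \<in># L" for j e
    proof -
      have ws: "(\<Sum>i\<in>#L. w i) = w j + (\<Sum>i\<in>#L - {#j#}. w i)" using j by (metis insert_DiffM sum_mset.insert image_mset_add_mset)
      have "sf_scale (\<mu> - (\<Sum>i\<in>#L - {#j#}. w i)) (pd j (\<alpha> (L - {#j#}))) = D (pd j (\<alpha> (L - {#j#}))) + sf_scale (w j) (pd j (\<alpha> (L - {#j#})))"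
        using D_pd[OF dformsD(1)[OF a] l[OF j]] D sf_pderiv_scale[OF dformsD(1)[OF a] l[OF j]] by simp
      then have "D (pd j (\<alpha> (L - {#j#}))) = sf_scale (\<mu> - (\<Sum>i\<in>#L. w i)) (pd j (\<alpha> (L - {#j#})))"
        unfolding ws by (auto simp: fun_eq_iff sf_scale_def plus_fun_apply algebra_simps)
      then show ?thesis using deriv_scale[OF S[OF j]] by (simp add: mult.commute)
    qed
    show ?thesis
      unfolding ext_d_apply[OF a True] sf_scale_sum
      by (subst deriv_sum[OF sfuns_scale[OF S]]) (use t in auto)
  next
    case False
    then have "ext_d p q V \<alpha> L = 0" by (rule dformsD(2)[OF dS])
    then show ?thesis by simp
  qed
qed

end

section \<open>Coefficients of closed forms and the removal of a coordinate\<close>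

context superdomain
begin

lemma add_mset_dmonoms: "I \<in> dmonoms p q n \<Longrightarrow> i < p + q \<Longrightarrow> \<not> (i < p \<and> i \<in># I) \<Longrightarrow> add_mset i I \<in> dmonoms p q (Suc n)"
  using repeats_add_mset[of I i] by (auto simp: dmonoms_iff)

lemma remove_dmonoms: "L \<in> dmonoms p q (Suc n) \<Longrightarrow> i \<in># L \<Longrightarrow> L - {#i#} \<in> dmonoms p q n \<and> \<not> (i < p \<and> i \<in># L - {#i#})"
proof -
  assume L: "L \<in> dmonoms p q (Suc n)" "i \<in># L"
  then have nr: "\<not> repeats p (L - {#i#})" using repeats_mono[of p "L - {#i#}" L] by (auto simp: dmonoms_iff)
  then show ?thesis
    using L repeats_add_mset[OF nr, of i] by (auto simp: dmonoms_iff size_Diff_singleton dest: in_diffD)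
qed

text \<open>The coefficient of \<open>d\<omega>\<close> at \<open>I\<close> with \<open>i\<close>
  added, its \<open>i\<close>-th term set apart. Once all coefficients of \<open>\<omega>\<close>
  that contain \<open>dx^i\<close> vanish, so does the sum, and \<open>\<omega> I\<close> turns out
  to be independent of \<open>x^i\<close>.\<close>

lemma closed_coefficient:
  assumes om: "\<omega> \<in> \<Omega> n" and cl: "ext_d p q V \<omega> = 0" and I: "I \<in> dmonoms p q n" and i: "i < p + q" "\<not> (i < p \<and> i \<in># I)"
  shows "sf_scale ((- 1) ^ n * dmonom_sign p I {#i#}) (pd i (\<omega> I)) +
    (\<Sum>j\<in>set_mset I - {i}. sf_scale ((- 1) ^ n * dmonom_sign p (add_mset i I - {#j#}) {#j#}) (pd j (\<omega> (add_mset i I - {#j#})))) = 0"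
proof -
  have "0 = ext_d p q V \<omega> (add_mset i I)" by (simp add: cl zero_fun_apply)
  also have "\<dots> = (\<Sum>j\<in>set_mset (add_mset i I). sf_scale ((- 1) ^ n * dmonom_sign p (add_mset i I - {#j#}) {#j#}) (pd j (\<omega> (add_mset i I - {#j#}))))"
    by (rule ext_d_apply[OF om add_mset_dmonoms[OF I i]])
  also have "\<dots> = sf_scale ((- 1) ^ n * dmonom_sign p I {#i#}) (pd i (\<omega> I)) +
    (\<Sum>j\<in>set_mset I - {i}. sf_scale ((- 1) ^ n * dmonom_sign p (add_mset i I - {#j#}) {#j#}) (pd j (\<omega> (add_mset i I - {#j#}))))"
    by (subst sum.remove[of _ i]) auto
  finally show ?thesis by simp
qed

lemma in_add_mset_diff: "j \<noteq> i \<Longrightarrow> i \<in># add_mset i I - {#j#}"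
  by (simp add: in_diff_count)

lemma sf_mult_coord_self:
  assumes i: "p \<le> i" "i < p + q" and f: "f \<in> S"
  shows "sf_mult (X i) (sf_mult (X i) f) = 0"
proof (intro ext)
  fix J x
  show "sf_mult (X i) (sf_mult (X i) f) J x = 0 J x"
  proof (cases "x \<in> V")
    case True
    then show ?thesis using sf_mult_coord_odd[OF sfuns_mult[OF sf_coord_in_sfuns[OF i(2)] f] i(1) True] sf_mult_coord_odd[OF f i(1) True]
      by (simp add: zero_fun_apply)
  next
    case False
    have "sf_mult (X i) (sf_mult (X i) f) \<in> S" using sfuns_mult sf_coord_in_sfuns i f by blast
    from sfunsD(2)[OF this False] show ?thesis by (simp add: zero_fun_apply)
  qed
qed

lemma pd_coord_mult:
  assumes i: "i < p + q" and j: "j < p + q" and f: "f \<in> S"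
  shows "pd j (sf_mult (X i) f) = (if i = j then f else 0) + sf_scale ((- 1) ^ (cpar p j * cpar p i)) (sf_mult (X i) (pd j f))"
  using sf_pderiv_mult[OF sf_coord_in_sfuns[OF i] f j] sf_twist_par[OF sf_par_coord[of p i V], of "cpar p j"] f
  by (auto simp: sf_pderiv_coord[OF j i] sf_mult_scale_left)

end

context euler_derivation
begin

text \<open>\<open>\<alpha>\<close> contains no \<open>dx^i\<close>, so at a monomial with
  \<open>dx^i\<close> only the derivative in direction \<open>i\<close> contributes to
  \<open>d\<alpha>\<close>, and it undoes the primitive: there \<open>\<omega>\<close> and
  \<open>d\<alpha>\<close> agree. Closedness then makes the other coefficients of the difference
  independent of \<open>x^i\<close>. The sign \<open>?e\<close> is its own inverse and cancels the
  one in \<open>ext_d\<close>.\<close>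

lemma step_even:
  assumes om: "weighted (Suc n) k \<mu> \<omega>" and cl: "ext_d p q V \<omega> = 0" and i: "i < p" and wa: "w i = 0 \<or> a i = 0"
  obtains \<alpha> where "weighted n k \<mu> \<alpha>" "\<And>I. \<alpha> I {} a = 0" "df_indep i (\<omega> - ext_d p q V \<alpha>)"
    "\<And>j. j < p + q \<Longrightarrow> j \<noteq> i \<Longrightarrow> df_indep j \<omega> \<Longrightarrow> df_indep j (\<omega> - ext_d p q V \<alpha>)"
proof -
  have iq: "i < p + q" using i by simp
  note om1 = weightedD(1)[OF om]
  let ?e = "\<lambda>I. (- 1) ^ n * dmonom_sign p I {#i#}"
  define \<alpha> where "\<alpha> I = (if I \<in> dmonoms p q n \<and> i \<notin># I then sf_scale (?e I) (prim a i (\<omega> (add_mset i I))) else 0)" for I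
  note prS = prim_in_sfuns[OF VB dformsD(1)[OF om1] i]
  have aS: "\<alpha> \<in> \<Omega> n" using prS by (intro dformsI) (auto simp: \<alpha>_def intro: sfuns_scale)
  have "weighted n k \<mu> \<alpha>"
    unfolding weighted_def
  proof (intro conjI allI aS)
    show "df_par p k \<alpha>"
      unfolding df_par_def
    proof
      fix I
      have "sf_par (k + odd_size p I) (\<omega> (add_mset i I))"
        using weightedD(2)[OF om, unfolded df_par_def, rule_format, of "add_mset i I"] i by (simp add: cpar_def)
      then show "sf_par (k + odd_size p I) (\<alpha> I)" by (auto simp: \<alpha>_def intro: sf_par_scale sf_par_prim)
    qed
    fix I
    have "D (prim a i (\<omega> (add_mset i I))) = sf_scale (\<mu> - (\<Sum>i\<in>#I. w i)) (prim a i (\<omega> (add_mset i I)))"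
      using D_prim[OF dformsD(1)[OF om1] i wa weightedD(3)[OF om], of "add_mset i I"] by simp
    then show "D (\<alpha> I) = sf_scale (\<mu> - (\<Sum>i\<in>#I. w i)) (\<alpha> I)"
      using deriv_scale[OF prS] by (simp add: \<alpha>_def mult.commute)
  qed
  moreover have "\<alpha> I {} a = 0" for I
    by (simp add: \<alpha>_def sf_scale_def prim_slice zero_fun_apply)
  moreover
  define \<omega>' where "\<omega>' = \<omega> - ext_d p q V \<alpha>"
  have w'S: "\<omega>' \<in> \<Omega> (Suc n)" unfolding \<omega>'_def by (intro dforms_diff om1 ext_d_dforms aS)
  have w'cl: "ext_d p q V \<omega>' = 0"
    unfolding \<omega>'_def ext_d_diff[OF om1 ext_d_dforms[OF aS]] cl ext_d_ext_d[OF aS] by simp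
  have no_dx: "\<omega>' L = 0" if L: "i \<in># L" for L
  proof (cases "L \<in> dmonoms p q (Suc n)")
    case True
    note r = remove_dmonoms[OF True L]
    have "ext_d p q V \<alpha> L = (\<Sum>j\<in>set_mset L. if j = i then \<omega> L else 0)"
      unfolding ext_d_apply[OF aS True]
    proof (rule sum.cong[OF refl])
      fix j assume j: "j \<in> set_mset L"
      show "sf_scale ((- 1) ^ n * dmonom_sign p (L - {#j#}) {#j#}) (pd j (\<alpha> (L - {#j#}))) = (if j = i then \<omega> L else 0)"
      proof (cases "j = i")
        case True
        have "pd i (\<alpha> (L - {#i#})) = sf_scale (?e (L - {#i#})) (\<omega> L)"
          using r i L by (simp add: \<alpha>_def sf_pderiv_scale[OF prS iq] pd_prim[OF VB dformsD(1)[OF om1] i])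
        then show ?thesis using True by (simp add: algebra_simps)
      next
        case False
        then have "i \<in># L - {#j#}" using L by (simp add: in_diff_count)
        then show ?thesis using False by (simp add: \<alpha>_def)
      qed
    qed
    then show ?thesis using L by (simp add: \<omega>'_def minus_apply[of _ _ L])
  qed (use dformsD(2)[OF w'S] in blast)
  have "pd i (\<omega>' I) = 0" for I
  proof (cases "I \<in> dmonoms p q (Suc n) \<and> i \<notin># I")
    case True
    have "(\<Sum>j\<in>set_mset I - {i}. sf_scale ((- 1) ^ Suc n * dmonom_sign p (add_mset i I - {#j#}) {#j#}) (pd j (\<omega>' (add_mset i I - {#j#})))) = 0"
      using no_dx[OF in_add_mset_diff] by (intro sum.neutral) auto
    then have "sf_scale ((- 1) ^ Suc n * dmonom_sign p I {#i#}) (pd i (\<omega>' I)) = 0"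
      using closed_coefficient[OF w'S w'cl _ iq, of I] True by simp
    then show ?thesis using dmonom_sign_nonzero by (simp add: sf_scale_eq_0_iff)
  next
    case False
    then have "\<omega>' I = 0" using no_dx dformsD(2)[OF w'S, of I] by blast
    then show ?thesis by simp
  qed
  then have "df_indep i (\<omega> - ext_d p q V \<alpha>)" using no_dx by (simp add: df_indep_def \<omega>'_def)
  moreover have "df_indep j (\<omega> - ext_d p q V \<alpha>)" if j: "j < p + q" "j \<noteq> i" "df_indep j \<omega>" for j
  proof (rule df_indep_diff[OF om1 ext_d_dforms[OF aS] j(3) df_indep_ext_d[OF aS _ j(1)] j(1)])
    show "df_indep j \<alpha>"
      unfolding df_indep_def
    proof (intro allI conjI impI)
      fix I
      show "\<alpha> I = 0" if "j \<in># I"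
      proof -
        have "\<omega> (add_mset i I) = 0" using j(3) that by (simp add: df_indep_def)
        then show ?thesis by (simp add: \<alpha>_def)
      qed
      have "pd j (prim a i (\<omega> (add_mset i I))) = 0"
        using j by (intro pd_prim_0[OF VB dformsD(1)[OF om1] i]) (auto simp: df_indep_def)
      then show "pd j (\<alpha> I) = 0" by (simp add: \<alpha>_def sf_pderiv_scale[OF prS j(1)])
    qed
  qed
  ultimately show ?thesis using that by blast
qed

text \<open>Now \<open>dx^i\<close> may occur in \<open>\<alpha>\<close> as well, to any power, so
  the terms of \<open>d\<alpha>\<close> cannot be isolated as in the even case. They are compared
  after multiplication by \<open>x^i\<close>, whose square is \<open>0\<close>: at every monomial
  with \<open>dx^i\<close> the difference \<open>\<omega>'\<close> has a coefficient killed by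
  \<open>x^i\<close>. Closedness, multiplied by \<open>x^i\<close>, shows that the
  \<open>i\<close>-th derivative of this coefficient is killed as well; differentiating the product
  of \<open>x^i\<close> with the coefficient then gives that the coefficient is
  \<open>0\<close>.\<close>

lemma step_odd:
  assumes om: "weighted (Suc n) k \<mu> \<omega>" and cl: "ext_d p q V \<omega> = 0" and i: "p \<le> i" "i < p + q"
  obtains \<alpha> where "weighted n k \<mu> \<alpha>" "\<And>I. \<alpha> I {} a = 0" "df_indep i (\<omega> - ext_d p q V \<alpha>)"
    "\<And>j. j < p + q \<Longrightarrow> j \<noteq> i \<Longrightarrow> df_indep j \<omega> \<Longrightarrow> df_indep j (\<omega> - ext_d p q V \<alpha>)"
proof -
  note om1 = weightedD(1)[OF om] and XS = sf_coord_in_sfuns[OF i(2)]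
  note oS = dformsD(1)[OF om1]
  have ci: "cpar p i = 1" using i by (simp add: cpar_def)
  let ?e = "\<lambda>I. (- 1) ^ n * dmonom_sign p I {#i#}"
  define \<alpha> where "\<alpha> I = (if I \<in> dmonoms p q n then sf_scale (?e I) (sf_mult (X i) (\<omega> (add_mset i I))) else 0)" for I
  note prS = sfuns_mult[OF XS oS]
  have aS: "\<alpha> \<in> \<Omega> n" using prS by (intro dformsI) (auto simp: \<alpha>_def intro: sfuns_scale)
  have "weighted n k \<mu> \<alpha>"
    unfolding weighted_def
  proof (intro conjI allI aS)
    show "df_par p k \<alpha>"
      unfolding df_par_def
    proof
      fix I
      have "sf_par (cpar p i + (k + odd_size p (add_mset i I))) (sf_mult (X i) (\<omega> (add_mset i I)))"
        using weightedD(2)[OF om, unfolded df_par_def] by (intro sf_par_mult sf_par_coord) blast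
      then have "sf_par (k + odd_size p I) (sf_mult (X i) (\<omega> (add_mset i I)))"
        using sf_par_cong[of "cpar p i + (k + odd_size p (add_mset i I))" "k + odd_size p I"] by (simp add: ci)
      then show "sf_par (k + odd_size p I) (\<alpha> I)" by (auto simp: \<alpha>_def intro: sf_par_scale)
    qed
    fix I
    have "D (sf_mult (X i) (\<omega> (add_mset i I))) = sf_scale (\<mu> - (\<Sum>i\<in>#I. w i)) (sf_mult (X i) (\<omega> (add_mset i I)))"
      unfolding deriv_mult[OF XS oS] euler[OF i(2)] weightedD(3)[OF om] sf_mult_scale_left sf_mult_scale_right
      by (simp add: fun_eq_iff sf_scale_def plus_fun_apply algebra_simps)
    then show "D (\<alpha> I) = sf_scale (\<mu> - (\<Sum>i\<in>#I. w i)) (\<alpha> I)"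
      using deriv_scale[OF prS] by (simp add: \<alpha>_def mult.commute)
  qed
  moreover have "\<alpha> I {} a = 0" for I
    using i by (simp add: \<alpha>_def sf_scale_def sf_mult_empty sf_coord_odd_eq zero_fun_apply)
  moreover
  define \<omega>' where "\<omega>' = \<omega> - ext_d p q V \<alpha>"
  have w'S: "\<omega>' \<in> \<Omega> (Suc n)" unfolding \<omega>'_def by (intro dforms_diff om1 ext_d_dforms aS)
  have w'cl: "ext_d p q V \<omega>' = 0"
    unfolding \<omega>'_def ext_d_diff[OF om1 ext_d_dforms[OF aS]] cl ext_d_ext_d[OF aS] by simp
  note w'f = dformsD(1)[OF w'S]
  have mdiff: "sf_mult f (g - h) = sf_mult f g - sf_mult f h" for f g h
    by (simp add: sf_mult_def fun_eq_iff minus_apply algebra_simps sum_subtractf)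
  have X0: "sf_mult (X i) (\<omega>' L) = 0" if L: "i \<in># L" for L
  proof (cases "L \<in> dmonoms p q (Suc n)")
    case True
    have l: "j < p + q" if "j \<in># L" for j using True that by (auto simp: dmonoms_iff)
    have "sf_mult (X i) (ext_d p q V \<alpha> L) = (\<Sum>j\<in>set_mset L. if j = i then sf_mult (X i) (\<omega> L) else 0)"
      unfolding ext_d_apply[OF aS True] sf_mult_sum_right
    proof (rule sum.cong[OF refl])
      fix j assume j: "j \<in> set_mset L"
      have "L - {#j#} \<in> dmonoms p q n" using remove_dmonoms[OF True j] by simp
      then have "pd j (\<alpha> (L - {#j#})) = sf_scale (?e (L - {#j#})) ((if i = j then \<omega> (add_mset i (L - {#j#})) else 0) +
         sf_scale ((- 1) ^ (cpar p j * cpar p i)) (sf_mult (X i) (pd j (\<omega> (add_mset i (L - {#j#}))))))"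
        using l[OF j] by (simp add: \<alpha>_def sf_pderiv_scale[OF prS l[OF j]] pd_coord_mult[OF i(2) l[OF j] oS])
      moreover have "sf_mult (X i) (sf_mult (X i) (pd j (\<omega> (add_mset i (L - {#j#}))))) = 0"
        by (rule sf_mult_coord_self[OF i sf_pderiv_in_sfuns[OF oS l[OF j]]])
      ultimately show "sf_mult (X i) (sf_scale ((- 1) ^ n * dmonom_sign p (L - {#j#}) {#j#}) (pd j (\<alpha> (L - {#j#})))) =
        (if j = i then sf_mult (X i) (\<omega> L) else 0)"
        using L by (auto simp: sf_mult_scale_right sf_mult_add_right algebra_simps)
    qed
    then show ?thesis using L by (simp add: \<omega>'_def minus_apply[of _ _ L] mdiff)
  next
    case False
    then have "\<omega>' L = 0" by (rule dformsD(2)[OF w'S])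
    then show ?thesis by simp
  qed
  have X_pd: "sf_mult (X i) (pd j (\<omega>' L)) = 0" if "i \<in># L" "j < p + q" "j \<noteq> i" for L j
    using pd_coord_mult[OF i(2) that(2) w'f, of L] X0[OF that(1)] that(3) by (simp add: sf_scale_eq_0_iff)
  have no_dx: "\<omega>' L = 0" if L: "i \<in># L" for L
  proof (cases "L \<in> dmonoms p q (Suc n)")
    case True
    have l: "j < p + q" if "j \<in># L" for j using True that by (auto simp: dmonoms_iff)
    have "sf_mult (X i) (\<Sum>j\<in>set_mset L - {i}. sf_scale ((- 1) ^ Suc n * dmonom_sign p (add_mset i L - {#j#}) {#j#}) (pd j (\<omega>' (add_mset i L - {#j#})))) = 0"
      unfolding sf_mult_sum_right sf_mult_scale_right
      using X_pd[OF in_add_mset_diff l] by (intro sum.neutral) auto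
    then have "sf_scale ((- 1) ^ Suc n * dmonom_sign p L {#i#}) (sf_mult (X i) (pd i (\<omega>' L))) = 0"
      using arg_cong[OF closed_coefficient[OF w'S w'cl True i(2)], of "sf_mult (X i)"] i
      by (simp add: sf_mult_add_right sf_mult_scale_right)
    then have "sf_mult (X i) (pd i (\<omega>' L)) = 0" using dmonom_sign_nonzero by (simp add: sf_scale_eq_0_iff)
    then show ?thesis using pd_coord_mult[OF i(2) i(2) w'f, of L] X0[OF L] by simp
  qed (use dformsD(2)[OF w'S] in blast)
  have "pd i (\<omega>' I) = 0" for I
  proof (cases "I \<in> dmonoms p q (Suc n)")
    case True
    have "(\<Sum>j\<in>set_mset I - {i}. sf_scale ((- 1) ^ Suc n * dmonom_sign p (add_mset i I - {#j#}) {#j#}) (pd j (\<omega>' (add_mset i I - {#j#})))) = 0"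
      using no_dx[OF in_add_mset_diff] by (intro sum.neutral) auto
    then have "sf_scale ((- 1) ^ Suc n * dmonom_sign p I {#i#}) (pd i (\<omega>' I)) = 0"
      using closed_coefficient[OF w'S w'cl True i(2)] i by simp
    then show ?thesis using dmonom_sign_nonzero by (simp add: sf_scale_eq_0_iff)
  next
    case False
    then have "\<omega>' I = 0" using dformsD(2)[OF w'S, of I] by blast
    then show ?thesis by simp
  qed
  then have "df_indep i (\<omega> - ext_d p q V \<alpha>)" using no_dx by (simp add: df_indep_def \<omega>'_def)
  moreover have "df_indep j (\<omega> - ext_d p q V \<alpha>)" if j: "j < p + q" "j \<noteq> i" "df_indep j \<omega>" for j
  proof (rule df_indep_diff[OF om1 ext_d_dforms[OF aS] j(3) df_indep_ext_d[OF aS _ j(1)] j(1)])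
    show "df_indep j \<alpha>"
      unfolding df_indep_def
    proof (intro allI conjI impI)
      fix I
      show "\<alpha> I = 0" if "j \<in># I"
      proof -
        have "\<omega> (add_mset i I) = 0" using j(3) that by (simp add: df_indep_def)
        then show ?thesis by (simp add: \<alpha>_def)
      qed
      have "pd j (\<omega> (add_mset i I)) = 0" using j(3) by (simp add: df_indep_def)
      then have "pd j (sf_mult (X i) (\<omega> (add_mset i I))) = 0"
        using pd_coord_mult[OF i(2) j(1) oS] j(2) by simp
      then show "pd j (\<alpha> I) = 0" by (simp add: \<alpha>_def sf_pderiv_scale[OF prS j(1)])
    qed
  qed
  ultimately show ?thesis using that by blast
qed

text \<open>The last clause of \<open>step_even\<close> and \<open>step_odd\<close> keeps the
  coordinates that were removed before. In an odd direction the primitive is a product with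
  \<open>x^i\<close>, which is homogeneous, so the condition on weights concerns the even
  directions.\<close>

lemma contract_coordinates:
  assumes om: "weighted (Suc n) k \<mu> \<omega>" and cl: "ext_d p q V \<omega> = 0"
    and R: "R \<subseteq> {..<p + q}" "\<And>i. i \<in> R \<Longrightarrow> i < p \<Longrightarrow> w i = 0 \<or> a i = 0"
  obtains \<alpha> where "weighted n k \<mu> \<alpha>" "\<And>I. \<alpha> I {} a = 0" "\<And>i. i \<in> R \<Longrightarrow> df_indep i (\<omega> - ext_d p q V \<alpha>)"
proof -
  have "finite R" using R(1) finite_subset by blast
  then have "\<exists>\<alpha>. weighted n k \<mu> \<alpha> \<and> (\<forall>I. \<alpha> I {} a = 0) \<and> (\<forall>i\<in>R. df_indep i (\<omega> - ext_d p q V \<alpha>))"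
    using R
  proof (induction R rule: finite_induct)
    case empty
    have "weighted n k \<mu> 0" by (simp add: weighted_def df_par_def zero_fun_apply)
    moreover have "0 I {} a = (0 :: real)" for I by (simp add: zero_fun_apply)
    ultimately show ?case by blast
  next
    case (insert i R)
    then obtain \<alpha> where \<alpha>: "weighted n k \<mu> \<alpha>" "\<And>I. \<alpha> I {} a = 0" "\<And>i. i \<in> R \<Longrightarrow> df_indep i (\<omega> - ext_d p q V \<alpha>)"
      by auto
    define \<omega>' where "\<omega>' = \<omega> - ext_d p q V \<alpha>"
    have w': "weighted (Suc n) k \<mu> \<omega>'" unfolding \<omega>'_def by (rule weighted_diff[OF om weighted_ext_d[OF \<alpha>(1)]])
    note aS = weightedD(1)[OF \<alpha>(1)]
    have w'cl: "ext_d p q V \<omega>' = 0"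
      unfolding \<omega>'_def ext_d_diff[OF weightedD(1)[OF om] ext_d_dforms[OF aS]] cl ext_d_ext_d[OF aS] by simp
    obtain \<beta> where \<beta>: "weighted n k \<mu> \<beta>" "\<And>I. \<beta> I {} a = 0" "df_indep i (\<omega>' - ext_d p q V \<beta>)"
      "\<And>j. j < p + q \<Longrightarrow> j \<noteq> i \<Longrightarrow> df_indep j \<omega>' \<Longrightarrow> df_indep j (\<omega>' - ext_d p q V \<beta>)"
    proof (cases "i < p")
      case True
      show ?thesis by (rule step_even[OF w' w'cl True]) (use insert.prems(2)[of i] True that in auto)
    next
      case False
      show ?thesis by (rule step_odd[OF w' w'cl, where i = i]) (use insert.prems(1) False that in auto)
    qed
    have e: "\<omega> - ext_d p q V (\<alpha> + \<beta>) = \<omega>' - ext_d p q V \<beta>"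
      by (simp add: \<omega>'_def ext_d_add[OF aS weightedD(1)[OF \<beta>(1)]])
    have "weighted n k \<mu> (\<alpha> + \<beta>)" by (rule weighted_add[OF \<alpha>(1) \<beta>(1)])
    moreover have "(\<alpha> + \<beta>) I {} a = 0" for I using \<alpha>(2) \<beta>(2) by (simp add: plus_fun_apply)
    moreover have "df_indep j (\<omega>' - ext_d p q V \<beta>)" if "j \<in> insert i R" for j
      using that \<beta>(3,4) \<alpha>(3)[of j] insert.prems(1) by (cases "j = i") (auto simp: \<omega>'_def)
    ultimately show ?case using e by metis
  qed
  then show ?thesis using that by blast
qed

end

section \<open>Homogeneous coordinates adapted to a point\<close>

text \<open>If \<open>x\<^sup>i\<close>, \<open>x\<^sup>j\<close> have weights \<open>w\<^sub>i\<close>, \<open>w\<^sub>j\<close> and \<open>e = w\<^sub>i / w\<^sub>j\<close>, then the new coordinate again has weight \<open>w\<^sub>i\<close>;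
  with \<open>a = x\<^sup>j(m)\<close>, \<open>b = x\<^sup>i(m)\<close> it vanishes at \<open>m\<close>.\<close>

definition shear :: "nat \<Rightarrow> nat \<Rightarrow> real \<Rightarrow> real \<Rightarrow> real \<Rightarrow> (nat \<Rightarrow> real) \<Rightarrow> nat \<Rightarrow> real" where
  "shear i j a e b x = x(i := x i - b * (x j / a) powr e)"

lemma shear_inverse: "i \<noteq> j \<Longrightarrow> shear i j a e b (shear i j a e (- b) x) = x"
  "i \<noteq> j \<Longrightarrow> shear i j a e (- b) (shear i j a e b x) = x"
  by (auto simp: shear_def fun_eq_iff)

lemma continuous_on_shear:
  assumes "S \<subseteq> {x. 0 < x j / a}"
  shows "continuous_on S (shear i j a e b)"
proof -
  have c: "continuous_on S (\<lambda>x. (x :: nat \<Rightarrow> real) k)" for k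
    by (rule continuous_on_product_then_coordinatewise) (rule continuous_on_id)
  have a: "a \<noteq> 0" if "x \<in> S" for x using that assms by (auto simp: zero_less_divide_iff)
  have "continuous_on S (\<lambda>x. x(i := x i - b * (x j * inverse a) powr e))"
    using assms by (intro continuous_on_fun_upd continuous_intros c) (auto simp: divide_inverse)
  then show ?thesis by (simp add: shear_def[abs_def] divide_inverse)
qed

text \<open>Writing \<open>u\<close> as its restriction to the slice \<open>x\<^sup>i = y\<^sup>i\<close> plus \<open>x\<^sup>i - y\<^sup>i\<close> times a continuous function
  avoids total derivatives.\<close>

lemma DERIV_two_coords:
  assumes V: "openin (Euclidean_space p) V" and u: "smooth_fun p V u" and ij: "i < p" "j < p" "i \<noteq> j" and y: "y \<in> V"
    and h: "(h has_real_derivative h') (at (y j))" "h (y j) = y i"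
  shows "((\<lambda>t. u (y(j := t, i := h t))) has_real_derivative (pderiv_at j u y + h' * pderiv_at i u y)) (at (y j))"
proof -
  obtain r where r: "r > 0" "ebox p y r \<subseteq> V" using ex_ebox_subset[OF V y] by blast
  note B = openin_ebox[of p y r]
  note uB = smooth_fun_subset[OF V B r(2) u]
  note ui = smooth_fun_pderiv[OF B uB ij(1)]
  have yB: "y \<in> ebox p y r" using center_in_ebox[OF r(1)] Euclidean_space_open_subset[OF V] y by auto
  let ?z = "\<lambda>t. y(j := t, i := h t)"
  let ?A = "avg i (y i) 0 (pderiv_at i u)"
  note Ac = continuous_on_avg[OF smooth_fun_continuous_on[OF B ui] ij(1), of 0]
  have hc: "isCont h (y j)" using h(1) by (rule DERIV_isCont)
  have zy: "?z (y j) = y" using h(2) by auto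
  have "\<forall>\<^sub>F t in at (y j). \<bar>t - y j\<bar> < r \<and> \<bar>h t - y i\<bar> < r"
  proof (rule eventually_conj)
    show "\<forall>\<^sub>F t in at (y j). \<bar>t - y j\<bar> < r"
      unfolding eventually_at dist_real_def using r(1) by blast
    have "\<forall>\<^sub>F t in at (y j). dist (h t) (h (y j)) < r"
      using hc r(1) unfolding continuous_at tendsto_iff by blast
    then show "\<forall>\<^sub>F t in at (y j). \<bar>h t - y i\<bar> < r" by (simp add: dist_real_def h(2))
  qed
  then have ev: "\<forall>\<^sub>F t in at (y j). ?z t \<in> ebox p y r"
    by eventually_elim (use yB ij in \<open>auto simp: ebox_def\<close>)
  have "((\<lambda>t. ?z t) \<longlongrightarrow> y) (at (y j))"
  proof -
    have "((\<lambda>t. ?z t k) \<longlongrightarrow> y k) (at (y j))" for k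
    proof (cases "k = i")
      case True
      then show ?thesis using hc h(2) by (simp add: continuous_at)
    next
      case False
      then show ?thesis by (cases "k = j") simp_all
    qed
    then have "limitin (product_topology (\<lambda>_. euclidean) UNIV) ?z y (at (y j))"
      unfolding limitin_componentwise by simp
    then show ?thesis by (simp add: euclidean_product_topology)
  qed
  then have A_lim: "((\<lambda>t. ?A (?z t)) \<longlongrightarrow> ?A y) (at (y j))"
    using continuous_on_tendsto_compose[OF Ac _ yB ev] by blast
  have Ay: "?A y = pderiv_at i u y" by (simp add: avg_def)
  have 1: "((\<lambda>t. u (y(j := t))) has_real_derivative pderiv_at j u y) (at (y j))"
    by (rule smooth_fun_has_pderiv[OF V u ij(2) y])
  \<comment> \<open>A difference quotient of \<open>h\<close> times a factor that tends to the
    \<open>i\<close>-th derivative of \<open>u\<close> at \<open>y\<close>, by continuity of the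
    average.\<close>
  have 2: "((\<lambda>t. (h t - y i) * ?A (?z t)) has_real_derivative h' * pderiv_at i u y) (at (y j))"
  proof -
    have "((\<lambda>t. (h t - y i) / (t - y j) * ?A (?z t)) \<longlongrightarrow> h' * ?A y) (at (y j))"
      using h by (intro tendsto_mult A_lim) (simp add: has_field_derivative_iff)
    then show ?thesis using h(2) by (simp add: has_field_derivative_iff Ay)
  qed
  have 3: "((\<lambda>t. u (y(j := t)) + (h t - y i) * ?A (?z t)) has_real_derivative (pderiv_at j u y + h' * pderiv_at i u y)) (at (y j))"
    by (rule DERIV_add[OF 1 2])
  have "\<forall>\<^sub>F t in nhds (y j). u (y(j := t)) + (h t - y i) * ?A (?z t) = u (?z t)"
  proof -
    have "u (y(j := t)) + (h t - y i) * ?A (?z t) = u (?z t)" if "?z t \<in> ebox p y r" for t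
    proof -
      have "(?z t)(i := y i) = y(j := t)" using ij(3) by auto
      then show ?thesis using avg_ftc(1)[OF uB ij(1) that] by simp
    qed
    then have "\<forall>\<^sub>F t in at (y j). u (y(j := t)) + (h t - y i) * ?A (?z t) = u (?z t)"
      using ev by (auto elim: eventually_mono)
    then show ?thesis
      unfolding eventually_at_filter by (rule eventually_mono) (use h(2) zy in \<open>auto simp del: fun_upd_apply\<close>)
  qed
  from DERIV_cong_ev[OF refl this refl, THEN iffD1, OF 3] show ?thesis by simp
qed

text \<open>The derivatives of \<open>u\<close> composed with the shear are built from derivatives
  of \<open>u\<close> composed with it and the smooth factor \<open>?g'\<close>, which closes the
  induction over the order. Only in direction \<open>j\<close> do two coordinates of the argument
  move at once.\<close>

lemma smooth_fun_shear:
  assumes ij: "i < p" "j < p" "i \<noteq> j"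
    and V: "openin (Euclidean_space p) V" "V \<subseteq> {x. 0 < x j / a}"
    and W: "openin (Euclidean_space p) W" "shear i j a e b ` V \<subseteq> W" and u: "smooth_fun p W u"
  shows "smooth_fun p V (\<lambda>x. u (shear i j a e b x))"
proof -
  let ?S = "shear i j a e b"
  have a: "a \<noteq> 0" if "x \<in> V" for x using that V(2) by (auto simp: zero_less_divide_iff)
  have cont: "continuous_on V (\<lambda>x. v (?S x))" if "smooth_fun p W v" for v
    using continuous_on_compose2[OF smooth_fun_continuous_on[OF W(1) that] continuous_on_shear[OF V(2)] W(2)] .
  \<comment> \<open>The \<open>j\<close>-th derivative of the \<open>i\<close>-th component of the
    shear.\<close>
  let ?g' = "\<lambda>x :: nat \<Rightarrow> real. - b * (e * (x j / a) powr (e - 1) / a)"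
  have g': "smooth_fun p V ?g'"
  proof (cases "a = 0")
    case True
    then show ?thesis using smooth_fun_const[OF V(1)] by simp
  next
    case False
    have "smooth_fun p V (\<lambda>x. (- b * e / a) * ((1 / a) * x j) powr (e - 1))"
      using V(2) by (intro smooth_fun_mult smooth_fun_powr smooth_fun_const smooth_fun_coord V(1)) auto
    then show ?thesis by (simp add: mult_ac)
  qed
  have "Ck k p V (\<lambda>x. u (?S x))" for k
    using u
  proof (induction k arbitrary: u)
    case 0
    then show ?case using cont by simp
  next
    case (Suc k)
    show ?case
    proof (rule Ck_SucI[OF V(1)])
      show "continuous_on V (\<lambda>x. u (?S x))" by (rule cont[OF Suc.prems])
      fix l assume l: "l < p"
      note ul = smooth_fun_pderiv[OF W(1) Suc.prems l] and ui = smooth_fun_pderiv[OF W(1) Suc.prems ij(1)]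
      have SW: "?S x \<in> W" if "x \<in> V" for x using that W(2) by blast
      show "\<exists>u'. Ck k p V u' \<and> (\<forall>x\<in>V. has_pderiv l (\<lambda>x. u (?S x)) (u' x) x)"
      proof (cases "l = j")
        case False
        have "has_pderiv l (\<lambda>x. u (?S x)) (pderiv_at l u (?S x)) x" if x: "x \<in> V" for x
        proof (cases "l = i")
          case True
          have "?S (x(i := t)) = (?S x)(i := t - b * (x j / a) powr e)" for t
            using ij(3) by (auto simp: shear_def)
          moreover have "((\<lambda>t. u ((?S x)(i := t + (- b * (x j / a) powr e)))) has_real_derivative pderiv_at i u (?S x)) (at (x i))"
          proof (rule DERIV_shift[THEN iffD1])
            show "((\<lambda>t. u ((?S x)(i := t))) has_real_derivative pderiv_at i u (?S x)) (at (x i + (- b * (x j / a) powr e)))"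
              using smooth_fun_has_pderiv[OF W(1) Suc.prems ij(1) SW[OF x]] by (simp add: shear_def fun_upd_def cong: if_cong)
          qed
          ultimately show ?thesis using True by simp
        next
          case l': False
          have "?S (x(l := t)) = (?S x)(l := t)" for t
            using l' False by (auto simp: shear_def)
          moreover have "?S x l = x l" using l' by (simp add: shear_def)
          ultimately show ?thesis using smooth_fun_has_pderiv[OF W(1) Suc.prems l SW[OF x]] by (simp only:)
        qed
        then show ?thesis using Suc.IH[OF ul] by blast
      next
        case True
        have D: "has_pderiv j (\<lambda>x. u (?S x)) (pderiv_at j u (?S x) + ?g' x * pderiv_at i u (?S x)) x" if x: "x \<in> V" for x
        proof -
          define h where "h t = x i - b * (t / a) powr e" for t
          have "0 < x j / a" using V(2) x by auto
          then have "((\<lambda>t. (t / a) powr e) has_real_derivative (e * (x j / a) powr (e - 1) * (1 / a))) (at (x j))"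
            by (intro DERIV_chain2[where g = "\<lambda>t. t / a"] has_real_derivative_powr) (auto intro!: derivative_eq_intros)
          then have "(h has_real_derivative 0 - b * (e * (x j / a) powr (e - 1) * (1 / a))) (at (x j))"
            unfolding h_def by (intro DERIV_diff DERIV_const DERIV_cmult)
          then have h: "(h has_real_derivative ?g' x) (at (?S x j))" "h (?S x j) = ?S x i"
            using ij(3) by (simp_all add: shear_def h_def)
          have "?S (x(j := t)) = (?S x)(j := t, i := h t)" for t
            using ij(3) by (auto simp: shear_def h_def)
          moreover have "?S x j = x j" using ij(3) by (simp add: shear_def)
          ultimately show ?thesis using DERIV_two_coords[OF W(1) Suc.prems ij SW[OF x] h] by (simp only:)
        qed
        have "Ck k p V ?g'" using g' by (simp add: smooth_fun_iff_Ck[OF V(1)])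
        from Ck_add[OF V(1) Suc.IH[OF ul[unfolded True]] Ck_mult[OF V(1) this Suc.IH[OF ui]]]
        have "Ck k p V (\<lambda>x. pderiv_at j u (?S x) + ?g' x * pderiv_at i u (?S x))" .
        then show ?thesis using D True by blast
      qed
    qed
  qed
  then show ?thesis using V(1) smooth_fun_iff_Ck by blast
qed

lemma open_half_space: "open {x :: nat \<Rightarrow> real. 0 < x j / a}"
proof -
  have "continuous_on UNIV (\<lambda>x. (x :: nat \<Rightarrow> real) j)"
    by (rule continuous_on_product_then_coordinatewise) (rule continuous_on_id)
  then show ?thesis unfolding divide_inverse by (intro open_Collect_less continuous_intros)
qed

text \<open>The shear keeps \<open>x^j\<close> and so the half-space on which the opposite shear is
  continuous; the image is a preimage under the latter.\<close>

lemma openin_shear_image: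
  assumes ij: "i < p" "j < p" "i \<noteq> j" and V: "openin (Euclidean_space p) V" "V \<subseteq> {x. 0 < x j / a}"
  shows "openin (Euclidean_space p) (shear i j a e b ` V)"
proof -
  let ?P = "{x :: nat \<Rightarrow> real. 0 < x j / a}"
  obtain T where T: "open T" "V = T \<inter> {x. \<forall>i\<ge>p. x i = 0}" using V(1) by (auto simp: openin_Euclidean_space_iff)
  note open_half_space[of j a]
  then have "open (?P \<inter> shear i j a e (- b) -` T)"
    using continuous_open_preimage[OF continuous_on_shear[OF order_refl, of j a i e "- b"] _ T(1)] by blast
  moreover have "shear i j a e b ` V = (?P \<inter> shear i j a e (- b) -` T) \<inter> {x. \<forall>i\<ge>p. x i = 0}"
  proof (intro equalityI subsetI)
    fix y assume "y \<in> shear i j a e b ` V"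
    then obtain x where x: "x \<in> V" "y = shear i j a e b x" by blast
    then have "shear i j a e (- b) y = x" using shear_inverse(2)[OF ij(3)] by simp
    then show "y \<in> (?P \<inter> shear i j a e (- b) -` T) \<inter> {x. \<forall>i\<ge>p. x i = 0}"
      using x V(2) T(2) ij by (auto simp: shear_def)
  next
    fix y assume y: "y \<in> (?P \<inter> shear i j a e (- b) -` T) \<inter> {x. \<forall>i\<ge>p. x i = 0}"
    then have "shear i j a e (- b) y \<in> V" using T(2) ij by (auto simp: shear_def)
    then show "y \<in> shear i j a e b ` V" using shear_inverse(1)[OF ij(3), of a e b y] by (metis imageI)
  qed
  ultimately show ?thesis unfolding openin_Euclidean_space_iff by blast
qed

lemma homeomorphic_map_shear:
  assumes ij: "i < p" "j < p" "i \<noteq> j" and V: "openin (Euclidean_space p) V" "V \<subseteq> {x. 0 < x j / a}"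
  shows "homeomorphic_map (subtopology (Euclidean_space p) V) (subtopology (Euclidean_space p) (shear i j a e b ` V)) (shear i j a e b)"
proof -
  let ?S = "shear i j a e b" and ?S' = "shear i j a e (- b)"
  have sub: "subtopology (Euclidean_space p) W = subtopology euclidean W" if "openin (Euclidean_space p) W" for W
    using Euclidean_space_open_subset[OF that]
    by (simp add: Euclidean_space_def subtopology_subtopology euclidean_product_topology Int_absorb1)
  have "homeomorphic_maps (subtopology euclidean V) (subtopology euclidean (?S ` V)) ?S ?S'"
    unfolding homeomorphic_maps_def
  proof (intro conjI)
    show "continuous_map (top_of_set V) (top_of_set (?S ` V)) ?S"
      using continuous_on_shear[OF V(2)] by (simp add: continuous_map_in_subtopology)
    have "?S ` V \<subseteq> {x. 0 < x j / a}" using V(2) ij(3) by (auto simp: shear_def)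
    then show "continuous_map (top_of_set (?S ` V)) (top_of_set V) ?S'"
      using continuous_on_shear[of "?S ` V" j a i e "- b"] shear_inverse(2)[OF ij(3)]
      by (auto simp: continuous_map_in_subtopology image_subset_iff)
  qed (auto simp: shear_inverse[OF ij(3)])
  then show ?thesis
    unfolding sub[OF V(1)] sub[OF openin_shear_image[OF ij V]] by (rule homeomorphic_maps_map[THEN iffD1, THEN conjunct1])
qed

text \<open>A shear moves one even coordinate by a function of another and leaves the odd ones
  alone, so its pullback acts on the coefficients one at a time.\<close>

definition shear_pull :: "((nat \<Rightarrow> real) \<Rightarrow> nat \<Rightarrow> real) \<Rightarrow> (nat \<Rightarrow> real) set \<Rightarrow> sfun \<Rightarrow> sfun" where
  "shear_pull s B f = (\<lambda>J x. if x \<in> B then f J (s x) else 0)"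

lemma shear_pull_in_sfuns:
  assumes ij: "i < p" "j < p" "i \<noteq> j" and V: "openin (Euclidean_space p) V" "V \<subseteq> {x. 0 < x j / a}"
    and W: "openin (Euclidean_space p) W" "shear i j a e b ` V \<subseteq> W" and f: "f \<in> sfuns p q W"
  shows "shear_pull (shear i j a e b) V f \<in> sfuns p q V"
proof -
  interpret S: superdomain p q V using V(1) by unfold_locales
  interpret T: superdomain p q W using W(1) by unfold_locales
  show ?thesis
  proof (rule S.sfunsI)
    fix J
    show "smooth_fun p V (shear_pull (shear i j a e b) V f J)"
      using smooth_fun_shear[OF ij V W T.sfunsD(1)[OF f, of J]]
        smooth_fun_cong[OF V(1), of "shear_pull (shear i j a e b) V f J" "\<lambda>x. f J (shear i j a e b x)"] by (simp add: shear_pull_def)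
  qed (use T.sfunsD(3)[OF f] in \<open>auto simp: shear_pull_def\<close>)
qed

lemma shear_pull_iso:
  assumes ij: "i < p" "j < p" "i \<noteq> j" and V: "openin (Euclidean_space p) V" "V \<subseteq> {x. 0 < x j / a}"
  shows "shear_pull (shear i j a e b) V \<in> superalg_iso (sf_alg p q (shear i j a e b ` V)) (sf_alg p q V)"
proof -
  let ?S = "shear i j a e b" and ?S' = "shear i j a e (- b)"
  let ?P = "shear_pull ?S V" and ?P' = "shear_pull ?S' (?S ` V)"
  note W = openin_shear_image[OF ij V, of e b]
  have Wp: "?S ` V \<subseteq> {x. 0 < x j / a}" using V(2) ij(3) by (auto simp: shear_def)
  have closed: "?P f \<in> sfuns p q V" if "f \<in> sfuns p q (?S ` V)" for f
    by (rule shear_pull_in_sfuns[OF ij V W order_refl that])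
  have inv_sub: "?S' ` ?S ` V \<subseteq> V" using shear_inverse(2)[OF ij(3)] by auto
  have closed': "?P' f \<in> sfuns p q (?S ` V)" if "f \<in> sfuns p q V" for f
    by (rule shear_pull_in_sfuns[OF ij W Wp V(1) inv_sub that])
  interpret S: superdomain p q V using V(1) by unfold_locales
  interpret T: superdomain p q "?S ` V" using W by unfold_locales
  have 1: "?P (?P' f) = f" if "f \<in> sfuns p q V" for f
    using S.sfunsD(2)[OF that] by (auto simp: shear_pull_def fun_eq_iff shear_inverse(2)[OF ij(3)])
  have 2: "?P' (?P f) = f" if "f \<in> sfuns p q (?S ` V)" for f
    using T.sfunsD(2)[OF that] inv_sub by (force simp: shear_pull_def fun_eq_iff shear_inverse[OF ij(3)])
  have "bij_betw ?P (sfuns p q (?S ` V)) (sfuns p q V)"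
    by (rule bij_betw_byWitness[where f' = ?P']) (use 1 2 closed closed' in auto)
  moreover have "?P \<in> superalg_hom (sf_alg p q (?S ` V)) (sf_alg p q V)"
    unfolding superalg_hom_def ring_hom_def
  proof (intro CollectI conjI ballI allI impI)
    show "?P \<in> carrier (sf_alg p q (?S ` V)) \<rightarrow> carrier (sf_alg p q V)" using closed by simp
    fix f g :: sfun
    show "?P (f \<otimes>\<^bsub>sf_alg p q (?S ` V)\<^esub> g) = ?P f \<otimes>\<^bsub>sf_alg p q V\<^esub> ?P g"
      by (auto simp: shear_pull_def sf_mult_def fun_eq_iff)
    show "?P (f \<oplus>\<^bsub>sf_alg p q (?S ` V)\<^esub> g) = ?P f \<oplus>\<^bsub>sf_alg p q V\<^esub> ?P g"
      by (auto simp: shear_pull_def fun_eq_iff plus_fun_apply)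
    fix c
    show "?P (c \<odot>\<^bsub>sf_alg p q (?S ` V)\<^esub> f) = c \<odot>\<^bsub>sf_alg p q V\<^esub> ?P f"
      by (auto simp: shear_pull_def sf_scale_def fun_eq_iff)
  next
    show "?P \<one>\<^bsub>sf_alg p q (?S ` V)\<^esub> = \<one>\<^bsub>sf_alg p q V\<^esub>"
      by (auto simp: shear_pull_def sf_of_fun_def fun_eq_iff)
    fix \<sigma>
    show "?P ` hpart (sf_alg p q (?S ` V)) \<sigma> \<subseteq> hpart (sf_alg p q V) \<sigma>"
      using closed by (force simp: sf_alg_def shear_pull_def split: if_splits)
  qed
  ultimately show ?thesis by (simp add: superalg_iso_def)
qed

lemma superalg_iso_comp:
  "h \<in> superalg_iso A B \<Longrightarrow> g \<in> superalg_iso B K \<Longrightarrow> (\<lambda>x. g (h x)) \<in> superalg_iso A K"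
proof -
  assume h: "h \<in> superalg_iso A B" and g: "g \<in> superalg_iso B K"
  have "bij_betw (g \<circ> h) (carrier A) (carrier K)"
    using h g by (intro bij_betw_trans[of h _ "carrier B"]) (auto simp: superalg_iso_def)
  moreover have "(\<lambda>x. g (h x)) \<in> superalg_hom A K"
    using h g unfolding superalg_iso_def superalg_hom_def ring_hom_def by (auto simp: image_subset_iff Pi_iff)
  ultimately show ?thesis by (simp add: superalg_iso_def o_def)
qed

section \<open>Powers of an even coordinate and the sheared chart\<close>

lemma (in even_derivation) deriv_body_fun:
  assumes h: "\<And>i. i < p \<Longrightarrow> D (X i) = sf_scale (w i) (X i)" and j: "j < p" and u: "smooth_fun p V u"
    and u': "\<And>x. x \<in> V \<Longrightarrow> has_pderiv j u (u' x) x" and u0: "\<And>x l t. l \<noteq> j \<Longrightarrow> u (x(l := t)) = u x"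
  shows "D (sf_of_fun V u) = sf_of_fun V (\<lambda>x. w j * x j * u' x)"
proof -
  have "D (sf_of_fun V u) = (\<Sum>l<p + q. sf_mult (D (X l)) (pd l (sf_of_fun V u)))"
    by (rule deriv_chain[OF sfuns_of_fun[OF u]])
  also have "\<dots> = (\<Sum>l<p + q. if l = j then sf_mult (D (X j)) (sf_of_fun V u') else 0)"
  proof (rule sum.cong[OF refl])
    fix l assume l: "l \<in> {..<p + q}"
    show "sf_mult (D (X l)) (pd l (sf_of_fun V u)) = (if l = j then sf_mult (D (X j)) (sf_of_fun V u') else 0)"
    proof (cases "l = j")
      case True
      have "sf_of_fun V (pderiv_at j u) = sf_of_fun V u'"
      proof -
        have "pderiv_at j u x = u' x" if "x \<in> V" for x by (rule pderiv_at_eqI[OF u'[OF that]])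
        then show ?thesis by (auto simp: sf_of_fun_def fun_eq_iff)
      qed
      then show ?thesis using True j l by (simp add: sf_pderiv_of_fun)
    next
      case False
      have "pderiv_at l u = (\<lambda>_. 0)" unfolding pderiv_at_def using u0[OF False] by simp
      moreover have "sf_of_fun V (\<lambda>_. 0) = 0" by (auto simp: sf_of_fun_def fun_eq_iff zero_fun_apply)
      ultimately show ?thesis using False l by (simp add: sf_pderiv_of_fun)
    qed
  qed
  also have "\<dots> = sf_mult (D (X j)) (sf_of_fun V u')"
    using j by (subst sum.delta) auto
  also have "\<dots> = sf_of_fun V (\<lambda>x. w j * x j * u' x)"
    unfolding h[OF j] sf_mult_scale_left sf_mult_of_fun_right[OF sf_coord_in_sfuns[OF trans_less_add1[OF j]]]
    using j by (auto simp: sf_scale_def fun_eq_iff sf_of_fun_def sf_coord_def)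
  finally show ?thesis .
qed

lemma (in even_derivation) deriv_powr:
  assumes h: "\<And>i. i < p \<Longrightarrow> D (X i) = sf_scale (w i) (X i)" and j: "j < p" and V: "V \<subseteq> {x. 0 < x j / a}"
  shows "smooth_fun p V (\<lambda>x. (x j / a) powr e)"
    and "D (sf_of_fun V (\<lambda>x. (x j / a) powr e)) = sf_scale (w j * e) (sf_of_fun V (\<lambda>x. (x j / a) powr e))"
proof -
  have pos: "0 < x j / a" if "x \<in> V" for x using V that by auto
  have "smooth_fun p V (\<lambda>x. ((1 / a) * x j) powr e)"
    using pos by (intro smooth_fun_mult smooth_fun_powr smooth_fun_const smooth_fun_coord openV) auto
  then show us: "smooth_fun p V (\<lambda>x. (x j / a) powr e)" by simp
  have "D (sf_of_fun V (\<lambda>x. (x j / a) powr e)) = sf_of_fun V (\<lambda>x. w j * x j * (e * (x j / a) powr (e - 1) * (1 / a)))"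
  proof (rule deriv_body_fun[OF h j us])
    show "has_pderiv j (\<lambda>x. (x j / a) powr e) (e * (x j / a) powr (e - 1) * (1 / a)) x" if x: "x \<in> V" for x
      using pos[OF x] unfolding fun_upd_same
      by (intro DERIV_chain2[where g = "\<lambda>t. t / a"] has_real_derivative_powr) (auto intro!: derivative_eq_intros)
  qed auto
  moreover have "w j * x j * (e * (x j / a) powr (e - 1) * (1 / a)) = w j * e * (x j / a) powr e" if x: "x \<in> V" for x
  proof -
    have "(x j / a) powr e = x j * (x j / a) powr (e - 1) / a"
      using powr_mult_base[of "x j / a" "e - 1"] pos[OF x] by simp
    then show ?thesis by simp
  qed
  ultimately show "D (sf_of_fun V (\<lambda>x. (x j / a) powr e)) = sf_scale (w j * e) (sf_of_fun V (\<lambda>x. (x j / a) powr e))"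
    by (auto simp: fun_eq_iff sf_of_fun_def sf_scale_def)
qed

lemma (in smfd) half_space_open:
  assumes c: "c \<in> C"
  shows "opn {x \<in> cdom c. 0 < cmap c x j / a}"
proof -
  let ?H = "{x :: nat \<Rightarrow> real. 0 < x j / a} \<inter> {x. \<forall>i\<ge>p. x i = 0}"
  have "{x \<in> cdom c. 0 < cmap c x j / a} = {x \<in> cdom c. cmap c x \<in> ?H}"
    using Euclidean_space_open_subset[OF chartD(2)[OF c]] by (auto simp: cimg_def)
  moreover have "openin (Euclidean_space p) ?H"
    using open_half_space unfolding openin_Euclidean_space_iff by blast
  ultimately show ?thesis using chart_preimage_open[OF c, of ?H] by simp
qed

context vfd
begin

text \<open>The new chart has the same sections; its map is followed by the shear, and
  superfunctions are first pulled back along it. The domain shrinks to where \<open>x^j\<close> has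
  the sign it has at \<open>m\<close>, so that the base of the real power is positive.\<close>

lemma shear_chart:
  assumes h: "homogeneous_coords p q M nabla c w" and m: "m \<in> cdom c" and ij: "i < p" "j < p" "i \<noteq> j"
    and wa: "w j \<noteq> 0" "cmap c m j \<noteq> 0"
  obtains c' where "homogeneous_coords p q M nabla c' w" "m \<in> cdom c'" "cdom c' \<subseteq> cdom c"
    "\<And>k. k \<noteq> i \<Longrightarrow> cmap c' m k = cmap c m k" "cmap c' m i = 0"
proof -
  define a b e where "a = cmap c m j" and "b = cmap c m i" and "e = w i / w j"
  let ?H = "{x :: nat \<Rightarrow> real. 0 < x j / a}" and ?s = "shear i j a e b"
  have c: "c \<in> C" using h by (simp add: homogeneous_coords_def)
  define U where "U = {x \<in> cdom c. 0 < cmap c x j / a}"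
  have U: "opn U" "U \<subseteq> cdom c" unfolding U_def by (rule half_space_open[OF c]) blast
  have mU: "m \<in> U" using m wa by (simp add: U_def a_def)
  define c0 where "c0 = chart_restrict c U"
  have c0: "c0 \<in> C" unfolding c0_def by (rule chart_restrict_in[OF c U])
  have h0: "homogeneous_coords p q M nabla c0 w" unfolding c0_def by (rule homogeneous_coords_restrict[OF h U])
  have c0_simps: "cdom c0 = U" "cmap c0 = cmap c" "ciso c0 = ciso c" "cimg c0 = cmap c ` U" by (simp_all add: c0_def)
  have V: "openin (Euclidean_space p) (cmap c ` W)" "cmap c ` W \<subseteq> ?H" if "opn W" "W \<subseteq> U" for W
  proof -
    show "openin (Euclidean_space p) (cmap c ` W)" using chart_image_open[OF c0 that(1)] that(2) by (simp add: c0_simps)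
    show "cmap c ` W \<subseteq> ?H" using that(2) by (auto simp: U_def)
  qed
  note VU = V[OF U(1) order_refl]
  let ?P = "\<lambda>W. shear_pull ?s (cmap c ` W)"
  define c1 :: "('a, 's) chart" where "c1 = \<lparr>cdom = U, cmap = ?s \<circ> cmap c, ciso = \<lambda>W f. ciso c W (?P W f)\<rparr>"
  have c1_simps: "cdom c1 = U" "cmap c1 = ?s \<circ> cmap c" "cimg c1 = ?s ` cmap c ` U" "ciso c1 W f = ciso c W (?P W f)" for W f
    by (simp_all add: c1_def cimg_def image_comp)
  have c1: "c1 \<in> C"
    unfolding charts_def
  proof (intro CollectI conjI allI impI ballI)
    show "opn (cdom c1)" "openin (Euclidean_space p) (cimg c1)"
      using U(1) openin_shear_image[OF ij VU] by (simp_all add: c1_simps)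
    show "homeomorphic_map (subtopology (body M) (cdom c1)) (subtopology (Euclidean_space p) (cimg c1)) (cmap c1)"
      using homeomorphic_map_compose[OF chartD(3)[OF c0, unfolded c0_simps] homeomorphic_map_shear[OF ij VU]] by (simp add: c1_simps)
    fix W assume "opn W \<and> W \<subseteq> cdom c1"
    then have W: "opn W" "W \<subseteq> U" by (auto simp: c1_simps)
    have "(\<lambda>f. ciso c W (?P W f)) \<in> superalg_iso (sf_alg p q (?s ` cmap c ` W)) (sec W)"
      by (rule superalg_iso_comp[OF shear_pull_iso[OF ij V[OF W]]])
        (use chartD(4)[OF c0, of W] W in \<open>simp add: c0_simps\<close>)
    then show "ciso c1 W \<in> superalg_iso (sf_alg p q (cmap c1 ` W)) (sec W)"
      by (simp add: c1_def image_comp)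
  next
    fix W' W f assume a: "opn W' \<and> opn W \<and> W \<subseteq> W' \<and> W' \<subseteq> cdom c1" and f: "f \<in> sfuns p q (cmap c1 ` W')"
    then have W: "opn W'" "opn W" "W \<subseteq> W'" "W' \<subseteq> U" by (auto simp: c1_simps)
    have f': "?P W' f \<in> sfuns p q (cmap c ` W')"
      using shear_pull_in_sfuns[OF ij V[OF W(1,4)] openin_shear_image[OF ij V[OF W(1,4)]] order_refl] f
      by (simp add: c1_simps image_comp)
    have eq: "sf_restrict (cmap c ` W) (?P W' f) = ?P W (sf_restrict (cmap c1 ` W) f)"
      using W(3) by (auto simp: sf_restrict_apply shear_pull_def fun_eq_iff c1_simps)
    show "restr M W' W (ciso c1 W' f) = ciso c1 W (sf_restrict (cmap c1 ` W) f)"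
      using chartD(5)[OF c0 W(1-3), of "?P W' f"] W(4) f' by (simp add: c0_simps c1_simps(4) eq)
  qed
  interpret P0: superdomain p q "cimg c0" by (rule chart_superdomain[OF c0])
  interpret P1: superdomain p q "cimg c1" by (rule chart_superdomain[OF c1])
  interpret D0: even_derivation p q "cimg c0" "vl c0" by (rule vl_derivation[OF c0])
  have X0: "vl c0 (P0.X k) = sf_scale (w k) (P0.X k)" if "k < p + q" for k
    using h0 that by (simp add: homogeneous_coords_iff)
  let ?u = "\<lambda>x :: nat \<Rightarrow> real. (x j / a) powr e"
  have a0: "a \<noteq> 0" using wa by (simp add: a_def)
  have "cimg c0 \<subseteq> ?H" using VU(2) by (simp add: c0_simps)
  note us = D0.deriv_powr(1)[OF X0[OF trans_less_add1] ij(2) this, of e] and Du = D0.deriv_powr(2)[OF X0[OF trans_less_add1] ij(2) this, of e]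
  have we: "w j * e = w i" using wa(1) by (simp add: e_def)
  have Pk: "vl c0 (?P U (P1.X k)) = sf_scale (w k) (?P U (P1.X k))" "?P U (P1.X k) \<in> Sf c0" if k: "k < p + q" for k
  proof -
    have *: "?P U (P1.X k) = (if k = i then P0.X k - sf_scale b (sf_of_fun (cimg c0) ?u) else P0.X k)"
      using ij by (auto simp: fun_eq_iff shear_pull_def sf_coord_def sf_of_fun_def sf_scale_def c0_simps c1_simps shear_def minus_apply)
    note T = P0.sfuns_of_fun[OF us]
    show "?P U (P1.X k) \<in> Sf c0"
      unfolding * using k by (simp add: P0.sf_coord_in_sfuns P0.sfuns_diff P0.sfuns_scale T)
    have "vl c0 (P0.X i - sf_scale b (sf_of_fun (cimg c0) ?u)) = sf_scale (w i) (P0.X i - sf_scale b (sf_of_fun (cimg c0) ?u))"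
    proof -
      have 1: "P0.X i - sf_scale b (sf_of_fun (cimg c0) ?u) = P0.X i + sf_scale (- b) (sf_of_fun (cimg c0) ?u)"
        by (simp add: fun_eq_iff sf_scale_def minus_apply plus_fun_apply)
      show ?thesis
        unfolding 1 using ij(1) X0[of i] Du[unfolded we]
        by (simp add: D0.deriv_add[OF P0.sf_coord_in_sfuns P0.sfuns_scale[OF T]] D0.deriv_scale[OF T] sf_scale_add mult.commute)
    qed
    then show "vl c0 (?P U (P1.X k)) = sf_scale (w k) (?P U (P1.X k))"
      unfolding * using X0[OF k] by simp
  qed
  have "homogeneous_coords p q M nabla c1 w"
    unfolding homogeneous_coords_def
  proof (intro conjI c1 allI impI)
    fix k assume k: "k < p + q"
    show "nabla (cdom c1) (ciso c1 (cdom c1) (P1.X k)) = w k \<odot>\<^bsub>sec (cdom c1)\<^esub> ciso c1 (cdom c1) (P1.X k)"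
      using vl_spec(2)[OF c0 Pk(2)[OF k]] iso_properties(5)[OF c0 Pk(2)[OF k], of "w k"] Pk(1)[OF k]
      by (simp add: c1_simps(1,4) c0_simps)
  qed
  moreover have "cmap c1 m k = cmap c m k" if "k \<noteq> i" for k using that by (simp add: c1_simps shear_def)
  moreover have "cmap c1 m i = 0" using a0 by (simp add: c1_simps shear_def a_def b_def)
  ultimately show thesis using that[of c1] mU U(2) by (simp add: c1_simps)
qed

text \<open>One shear for each even coordinate other than \<open>j\<close>. Each changes a single
  coordinate of \<open>m\<close> and neither the weights nor the value of \<open>x^j\<close>, so the
  effects accumulate.\<close>

lemma adapted_coords:
  assumes h: "homogeneous_coords p q M nabla c w" and m: "m \<in> cdom c" and j: "j < p" and wa: "w j \<noteq> 0" "cmap c m j \<noteq> 0"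
  obtains c' where "homogeneous_coords p q M nabla c' w" "m \<in> cdom c'" "cdom c' \<subseteq> cdom c" "\<And>i. i < p \<Longrightarrow> i \<noteq> j \<Longrightarrow> cmap c' m i = 0"
proof -
  have "l \<le> p \<Longrightarrow> \<exists>c'. homogeneous_coords p q M nabla c' w \<and> m \<in> cdom c' \<and> cdom c' \<subseteq> cdom c \<and>
      cmap c' m j \<noteq> 0 \<and> (\<forall>i<l. i \<noteq> j \<longrightarrow> cmap c' m i = 0)" for l
  proof (induction l)
    case 0
    then show ?case using h m wa by auto
  next
    case (Suc l)
    then obtain c' where c': "homogeneous_coords p q M nabla c' w" "m \<in> cdom c'" "cdom c' \<subseteq> cdom c"
      "cmap c' m j \<noteq> 0" "\<forall>i<l. i \<noteq> j \<longrightarrow> cmap c' m i = 0" by auto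
    show ?case
    proof (cases "l = j")
      case True
      then show ?thesis using c' less_Suc_eq by auto
    next
      case False
      have "l < p" using Suc.prems by simp
      from shear_chart[OF c'(1,2) this j False wa(1) c'(4)]
      obtain c'' where c'': "homogeneous_coords p q M nabla c'' w" "m \<in> cdom c''" "cdom c'' \<subseteq> cdom c'"
        "\<And>k. k \<noteq> l \<Longrightarrow> cmap c'' m k = cmap c' m k" "cmap c'' m l = 0" by blast
      have "\<forall>i<Suc l. i \<noteq> j \<longrightarrow> cmap c'' m i = 0" using c''(4,5) c'(5) less_Suc_eq by metis
      moreover have "cmap c'' m j \<noteq> 0" using c''(4) c'(4) False by simp
      ultimately show ?thesis using c'' c'(3) by blast
    qed
  qed
  from this[OF order_refl] show thesis using that by blast
qed

end

section \<open>Homogeneous primitives\<close>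

text \<open>A restriction takes coordinate differentials to coordinate differentials, so the sum in
  the pullback is the expansion of the restricted form.\<close>

lemma (in smfd) spread_restrict:
  assumes c: "c \<in> C" and U: "opn U" "U \<subseteq> cdom c" and a: "\<alpha> \<in> dforms p q (cimg c) n"
  shows "spread c \<alpha> (chart_restrict c U) I = sf_restrict (cmap c ` U) (\<alpha> I)"
proof -
  let ?c = "chart_restrict c U"
  have s: "cdom ?c \<subseteq> cdom c" using U(2) by simp
  interpret T: sf_morphism p q "cimg c" "cimg ?c" "chg c ?c" by (rule trans_morphism[OF c chart_restrict_in[OF c U] s])
  note tr = trans_restrict[OF c U]
  define \<beta> where "\<beta> = (\<lambda>I. sf_restrict (cmap c ` U) (\<alpha> I))"
  have th: "chg c ?c (\<alpha> I) = \<beta> I" for I using tr[OF T.dom.dformsD(1)[OF a]] by (simp add: \<beta>_def)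
  have b: "\<beta> \<in> T.cod.\<Omega> n"
  proof (rule T.cod.dformsI)
    show "\<beta> I \<in> T.cod.S" for I unfolding th[symmetric] by (rule T.morph_closed[OF T.dom.dformsD(1)[OF a]])
    show "\<beta> I = 0" if "I \<notin> dmonoms p q n" for I unfolding th[symmetric] T.dom.dformsD(2)[OF a that] by simp
  qed
  have "T.cod.wlist T.dXi (sorted_list_of_multiset I) = T.cod.wlist (\<lambda>j. T.cod.dX j) (sorted_list_of_multiset I)"
    if "I \<in> dmonoms p q n" for I
  proof (rule T.cod.wlist_cong)
    fix i assume "i \<in> set (sorted_list_of_multiset I)"
    then have i: "i < p + q" using T.dom.set_sorted_list_dmonoms[OF that] by auto
    have "chg c ?c (T.dom.X i) = T.cod.X i"
      using tr[OF T.dom.sf_coord_in_sfuns[OF i]] U(2) by (simp add: sf_restrict_coord cimg_def image_mono)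
    then show "T.dXi i = T.cod.dX i" using T.cod.sf_d_coord[OF i] by simp
  qed
  then have "spread c \<alpha> ?c = (\<Sum>I\<in>dmonoms p q n. wedge p (T.cod.wlist (\<lambda>j. T.cod.dX j) (sorted_list_of_multiset I)) (fun_form (\<beta> I)))"
    unfolding spread_def T.pullback_eq[OF a] by (simp add: th)
  then have "spread c \<alpha> ?c = \<beta>" by (simp only: T.cod.dform_expand[OF b, symmetric])
  then show ?thesis by (simp add: \<beta>_def)
qed

context vfd
begin

text \<open>In the expansion by \<open>deriv_chain\<close> the terms with odd coordinates have value
  \<open>0\<close> at every point.\<close>

lemma euler_formula_body:
  assumes h: "homogeneous_coords p q M nabla c w" and m: "m \<in> cdom c" and f: "f \<in> Sf c"
  shows "vl c f {} (cmap c m) = (\<Sum>i<p. w i * cmap c m i * sf_pderiv p (cimg c) i f {} (cmap c m))"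
proof -
  have c: "c \<in> C" using h by (simp add: homogeneous_coords_def)
  interpret D: even_derivation p q "cimg c" "vl c" by (rule vl_derivation[OF c])
  have m': "cmap c m \<in> cimg c" using m by (simp add: cimg_def)
  have "vl c f {} (cmap c m) = (\<Sum>i<p + q. sf_mult (vl c (D.X i)) (D.pd i f)) {} (cmap c m)"
    by (subst D.deriv_chain[OF f]) (rule refl)
  also have "\<dots> = (\<Sum>i<p + q. if i < p then w i * cmap c m i * D.pd i f {} (cmap c m) else 0)"
    using h m' by (auto simp: sum_fun_apply sf_mult_empty homogeneous_coords_iff sf_scale_def sf_coord_def sf_of_fun_def intro!: sum.cong)
  also have "\<dots> = (\<Sum>i<p. w i * cmap c m i * D.pd i f {} (cmap c m))"
    by (rule sum.mono_neutral_cong_right) auto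
  finally show ?thesis .
qed

lemma vf_coefficient_body:
  assumes h: "homogeneous_coords p q M nabla c w" and m: "m \<in> cdom c" and i: "i < p"
  shows "vl c (sf_coord p (cimg c) i) {} (cmap c m) = w i * cmap c m i"
proof -
  have "vl c (sf_coord p (cimg c) i) = sf_scale (w i) (sf_coord p (cimg c) i)"
    using h i by (simp add: homogeneous_coords_iff)
  then show ?thesis using m i by (simp add: sf_scale_def sf_coord_def sf_of_fun_def cimg_def)
qed

text \<open>Vanishing is asked for in all charts around \<open>m\<close>. A coefficient in another
  chart is \<open>\<nabla>\<close> applied to a coordinate function; expressed in \<open>c\<close>
  on the common domain, its value at \<open>m\<close> is by Euler's formula a combination of the
  numbers \<open>w i * cmap c m i\<close>.\<close>

lemma vf_vanishes_iff:
  assumes h: "homogeneous_coords p q M nabla c w" and m: "m \<in> cdom c"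
  shows "vf_vanishes_at p q M nabla m \<longleftrightarrow> (\<forall>i<p. w i = 0 \<or> cmap c m i = 0)"
proof
  have c: "c \<in> C" using h by (simp add: homogeneous_coords_def)
  show "\<forall>i<p. w i = 0 \<or> cmap c m i = 0" if "vf_vanishes_at p q M nabla m"
  proof (intro allI impI)
    fix i assume i: "i < p"
    then have "vl c (sf_coord p (cimg c) i) {} (cmap c m) = 0"
      using that c m by (simp add: vf_vanishes_at_def)
    then show "w i = 0 \<or> cmap c m i = 0" using vf_coefficient_body[OF h m i] by simp
  qed
  assume z: "\<forall>i<p. w i = 0 \<or> cmap c m i = 0"
  show "vf_vanishes_at p q M nabla m"
    unfolding vf_vanishes_at_def
  proof (intro ballI impI allI)
    fix c' k assume c': "c' \<in> C" and m': "m \<in> cdom c'" and k: "k < p + q"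
    let ?W = "cdom c \<inter> cdom c'"
    have W: "opn ?W" "?W \<subseteq> cdom c" "?W \<subseteq> cdom c'" using chartD(1)[OF c] chartD(1)[OF c'] by auto
    define c1 c2 where "c1 = chart_restrict c ?W" and "c2 = chart_restrict c' ?W"
    have c1: "c1 \<in> C" unfolding c1_def by (rule chart_restrict_in[OF c W(1,2)])
    have c2: "c2 \<in> C" unfolding c2_def by (rule chart_restrict_in[OF c' W(1,3)])
    have s: "cdom c1 \<subseteq> cdom c2" by (simp add: c1_def c2_def)
    have m1: "m \<in> cdom c1" using m m' by (simp add: c1_def)
    interpret P: superdomain p q "cimg c'" by (rule chart_superdomain[OF c'])
    interpret P2: superdomain p q "cimg c2" by (rule chart_superdomain[OF c2])
    note X2 = P2.sf_coord_in_sfuns[OF k]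
    have "vl c2 (P2.X k) = sf_restrict (cmap c' ` ?W) (vl c' (P.X k))"
      using vl_restrict[OF c' W(1,3) P.sf_coord_in_sfuns[OF k]] sf_restrict_coord[of "cmap c' ` ?W" "cimg c'" p k]
      by (simp add: c2_def cimg_def image_mono)
    then have "vl c' (P.X k) {} (cmap c' m) = vl c2 (P2.X k) {} (cmap c2 m)"
      using m m' by (simp add: sf_restrict_apply c2_def)
    also have "\<dots> = chg c2 c1 (vl c2 (P2.X k)) {} (cmap c1 m)"
      by (rule body_value[OF c2 c1 s m1 vl_spec(1)[OF c2 X2], symmetric])
    also have "\<dots> = vl c1 (chg c2 c1 (P2.X k)) {} (cmap c1 m)"
      by (simp only: vl_trans[OF c2 c1 s X2])
    also have "\<dots> = 0"
      unfolding euler_formula_body[OF homogeneous_coords_restrict[OF h W(1,2), folded c1_def] m1 trans_spec(1)[OF c2 c1 s X2]]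
      using z by (intro sum.neutral) (auto simp: c1_def)
    finally show "vl c' (P.X k) {} (cmap c' m) = 0" .
  qed
qed

section \<open>Primitives from one chart\<close>

lemma euler_derivation_chart:
  assumes h: "homogeneous_coords p q M nabla c w" and b: "cimg c = ebox p a r"
  shows "euler_derivation p q (cimg c) (vl c) w a r"
proof -
  have c: "c \<in> C" using h by (simp add: homogeneous_coords_def)
  interpret D: even_derivation p q "cimg c" "vl c" by (rule vl_derivation[OF c])
  show ?thesis by unfold_locales (use h b in \<open>simp_all add: homogeneous_coords_iff\<close>)
qed

lemma weighted_chart:
  assumes h: "homogeneous_coords p q M nabla c w" and b: "cimg c = ebox p a r"
    and om: "\<omega> \<in> mforms p q M N n" "homogeneous_mform p q M nabla N (of_nat k, \<mu>) \<omega>" and s: "cdom c \<subseteq> N"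
  shows "euler_derivation.weighted p q (cimg c) (vl c) w n k \<mu> (\<omega> c)"
proof -
  have c: "c \<in> C" using h by (simp add: homogeneous_coords_def)
  interpret E: euler_derivation p q "cimg c" "vl c" w a r by (rule euler_derivation_chart[OF h b])
  show ?thesis
    unfolding E.weighted_def
    using mforms_dforms[OF om(1) c s] homogeneous_chart[OF h om(1) s om(2)] by blast
qed

text \<open>By \<open>mon\<close> every monomial of the given degree contains a removed coordinate,
  so nothing remains of \<open>\<omega>\<close> after \<open>contract_coordinates\<close>. The
  primitive found on one box is spread to all charts inside it, and homogeneity and the value
  \<open>0\<close> at \<open>m\<close> go along.\<close>

lemma local_primitive:
  assumes h: "homogeneous_coords p q M nabla c w" and m: "m \<in> cdom c" and s: "cdom c \<subseteq> N"
    and om: "\<omega> \<in> mforms p q M N (Suc n)" "closed_mform p q M N \<omega>" "homogeneous_mform p q M nabla N (\<sigma>, \<mu>) \<omega>"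
    and R: "R \<subseteq> {..<p + q}" "\<And>i. i \<in> R \<Longrightarrow> i < p \<Longrightarrow> w i = 0 \<or> cmap c m i = 0"
    and mon: "\<And>I. I \<in> dmonoms p q (Suc n) \<Longrightarrow> \<exists>i\<in>R. i \<in># I"
  shows "\<exists>U \<alpha>. is_nbhd M m U \<and> U \<subseteq> cdom c \<and> \<alpha> \<in> mforms p q M U n \<and>
    homogeneous_mform p q M nabla U (\<sigma>, \<mu>) \<alpha> \<and> mform_eq p q M U \<omega> (mform_d p q \<alpha>) \<and> mform_vanishes_at p q M U \<alpha> m"
proof -
  have c: "c \<in> C" using h by (simp add: homogeneous_coords_def)
  obtain k where k: "\<sigma> = of_nat k" using ex_of_nat_bit by blast
  obtain U r where U: "opn U" "m \<in> U" "U \<subseteq> cdom c" "U \<subseteq> cdom c" "0 < r" "r \<le> 1" "cmap c ` U = ebox p (cmap c m) r"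
    by (rule chart_box[OF c m chartD(1)[OF c] m zero_less_one])
  define c0 where "c0 = chart_restrict c U"
  have h0: "homogeneous_coords p q M nabla c0 w" unfolding c0_def by (rule homogeneous_coords_restrict[OF h U(1,3)])
  have c0: "c0 \<in> C" using h0 by (simp add: homogeneous_coords_def)
  have b: "cimg c0 = ebox p (cmap c m) r" and dom: "cdom c0 = U" and mp: "cmap c0 = cmap c" using U(7) by (simp_all add: c0_def)
  have s0: "cdom c0 \<subseteq> N" using U(3) s dom by blast
  interpret E: euler_derivation p q "cimg c0" "vl c0" w "cmap c m" r by (rule euler_derivation_chart[OF h0 b])
  have cl: "ext_d p q (cimg c0) (\<omega> c0) = 0" by (rule closed_chart[OF om(2) c0 s0])
  note W = weighted_chart[OF h0 b om(1) om(3)[unfolded k] s0]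
  obtain \<alpha> where \<alpha>: "E.weighted n k \<mu> \<alpha>" "\<And>I. \<alpha> I {} (cmap c m) = 0" "\<And>i. i \<in> R \<Longrightarrow> E.df_indep i (\<omega> c0 - ext_d p q (cimg c0) \<alpha>)"
    using E.contract_coordinates[OF W cl R] by blast
  note aS = E.weightedD(1)[OF \<alpha>(1)]
  note dS = E.dforms_diff[OF E.weightedD(1)[OF W] E.ext_d_dforms[OF aS]]
  have eq: "\<omega> c0 = ext_d p q (cimg c0) \<alpha>"
  proof -
    have "(\<omega> c0 - ext_d p q (cimg c0) \<alpha>) I = 0" for I
    proof (cases "I \<in> dmonoms p q (Suc n)")
      case True
      then obtain i where "i \<in> R" "i \<in># I" using mon by blast
      then show ?thesis using \<alpha>(3)[of i] unfolding E.df_indep_def by blast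
    next
      case False
      show ?thesis by (rule E.dformsD(2)[OF dS False])
    qed
    then have "\<omega> c0 - ext_d p q (cimg c0) \<alpha> = 0" by (simp add: fun_eq_iff zero_fun_apply)
    then show ?thesis by simp
  qed
  have "spread c0 \<alpha> \<in> mforms p q M U n" using spread_mforms[OF c0 aS] by (simp only: dom)
  moreover have "homogeneous_mform p q M nabla U (\<sigma>, \<mu>) (spread c0 \<alpha>)"
    using spread_homogeneous[OF h0 aS E.weightedD(2)[OF \<alpha>(1)] E.weightedD(3)[OF \<alpha>(1)]] by (simp only: dom k)
  moreover have "mform_eq p q M U \<omega> (mform_d p q (spread c0 \<alpha>))"
    unfolding mform_eq_def mform_d_def
  proof (intro ballI impI)
    fix c' assume c': "c' \<in> C" "cdom c' \<subseteq> U"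
    show "\<omega> c' = ext_d p q (cimg c') (spread c0 \<alpha> c')"
      using mforms_spread[OF om(1) c0 s0 c'(1)] spread_ext_d[OF c0 c'(1) _ aS] c'(2) by (simp only: dom eq)
  qed
  moreover have "mform_vanishes_at p q M U (spread c0 \<alpha>) m"
    using spread_vanishes[OF c0 _ aS, of m] \<alpha>(2) U(2) by (simp only: dom mp)
  ultimately show ?thesis using U(1-3) unfolding is_nbhd_def by blast
qed

theorem primitive_at_zero:
  assumes h: "homogeneous_coords p q M nabla c w" and m: "m \<in> cdom c"
    and om: "\<omega> \<in> mforms p q M (cdom c) (Suc n)" "closed_mform p q M (cdom c) \<omega>" "homogeneous_mform p q M nabla (cdom c) (\<sigma>, \<mu>) \<omega>"
    and z: "vf_vanishes_at p q M nabla m"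
  shows "\<exists>U \<alpha>. is_nbhd M m U \<and> U \<subseteq> cdom c \<and> \<alpha> \<in> mforms p q M U n \<and>
    homogeneous_mform p q M nabla U (\<sigma>, \<mu>) \<alpha> \<and> mform_eq p q M U \<omega> (mform_d p q \<alpha>) \<and> mform_vanishes_at p q M U \<alpha> m"
proof (rule local_primitive[OF h m order_refl om order_refl])
  show "w i = 0 \<or> cmap c m i = 0" if "i < p" for i using z that vf_vanishes_iff[OF h m] by blast
  show "\<exists>i\<in>{..<p + q}. i \<in># I" if I: "I \<in> dmonoms p q (Suc n)" for I
  proof -
    obtain i where "i \<in># I" using I by (cases I) (auto simp: dmonoms_def)
    then show ?thesis using I by (auto simp: dmonoms_def)
  qed
qed

theorem primitive_at_nonzero:
  assumes h: "homogeneous_coords p q M nabla c w" and m: "m \<in> cdom c" and n: "0 < n"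
    and om: "\<omega> \<in> mforms p q M (cdom c) (Suc n)" "closed_mform p q M (cdom c) \<omega>" "homogeneous_mform p q M nabla (cdom c) (\<sigma>, \<mu>) \<omega>"
    and z: "\<not> vf_vanishes_at p q M nabla m"
  shows "\<exists>U \<alpha>. is_nbhd M m U \<and> U \<subseteq> cdom c \<and> \<alpha> \<in> mforms p q M U n \<and>
    homogeneous_mform p q M nabla U (\<sigma>, \<mu>) \<alpha> \<and> mform_eq p q M U \<omega> (mform_d p q \<alpha>) \<and> mform_vanishes_at p q M U \<alpha> m"
proof -
  obtain j where j: "j < p" "w j \<noteq> 0" "cmap c m j \<noteq> 0" using z vf_vanishes_iff[OF h m] by blast
  obtain c' where c': "homogeneous_coords p q M nabla c' w" "m \<in> cdom c'" "cdom c' \<subseteq> cdom c" "\<And>i. i < p \<Longrightarrow> i \<noteq> j \<Longrightarrow> cmap c' m i = 0"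
    by (rule adapted_coords[OF h m j]) blast
  have "\<exists>U \<alpha>. is_nbhd M m U \<and> U \<subseteq> cdom c' \<and> \<alpha> \<in> mforms p q M U n \<and>
    homogeneous_mform p q M nabla U (\<sigma>, \<mu>) \<alpha> \<and> mform_eq p q M U \<omega> (mform_d p q \<alpha>) \<and> mform_vanishes_at p q M U \<alpha> m"
  proof (rule local_primitive[OF c'(1,2,3) om])
    show "{..<p + q} - {j} \<subseteq> {..<p + q}" by blast
    show "w i = 0 \<or> cmap c' m i = 0" if "i \<in> {..<p + q} - {j}" "i < p" for i using that c'(4) by blast
    show "\<exists>i\<in>{..<p + q} - {j}. i \<in># I" if I: "I \<in> dmonoms p q (Suc n)" for I
    proof (rule ccontr)
      assume "\<not> ?thesis"
      then have "set_mset I \<subseteq> {j}" using I by (auto simp: dmonoms_def)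
      then have "size I = count I j" using size_multiset_overloaded_eq[of I] by (cases "I = {#}") (auto simp: subset_singleton_iff)
      \<comment> \<open>\<open>j\<close> is even, so a monomial in \<open>dx^j\<close> alone has
        degree at most one.\<close>
      moreover have "count I j \<le> 1" "size I = Suc n" using I j(1) by (auto simp: dmonoms_def)
      ultimately show False using n by simp
    qed
  qed
  then show ?thesis using c'(3) by blast
qed

end

section \<open>Closed one-forms of nonzero weight\<close>

text \<open>Read off the coefficient of \<open>d\<omega>\<close> at the two differentials in
  increasing order. For \<open>i = j\<close> odd the square of \<open>dx^i\<close> is a genuine
  monomial and forces the \<open>i\<close>-th derivative to vanish; for \<open>i = j\<close> even
  both sides coincide.\<close>

lemma (in superdomain) closed_one_form:
  assumes om: "\<omega> \<in> \<Omega> 1" and cl: "ext_d p q V \<omega> = 0" and i: "i < p + q" and j: "j < p + q"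
  shows "pd j (\<omega> {#i#}) = sf_scale ((- 1) ^ (cpar p i * cpar p j)) (pd i (\<omega> {#j#}))"
proof -
  have I: "{#k#} \<in> dmonoms p q 1" if "k < p + q" for k using that by (auto simp: dmonoms_def)
  have "pd j (\<omega> {#i#}) = sf_scale ((- 1) ^ (cpar p i * cpar p j)) (pd i (\<omega> {#j#}))"
    if i: "i < p + q" and j: "j < p + q" and ij: "i < j" for i j
  proof -
    have "sf_scale (- 1) (pd j (\<omega> {#i#})) + sf_scale (if i < p then 1 else - 1) (pd i (\<omega> {#j#})) = 0"
      using closed_coefficient[OF om cl I[OF i] j] ij by (simp add: dmonom_sign_single split: if_splits)
    then show ?thesis
      using ij by (auto simp: fun_eq_iff sf_scale_def plus_fun_apply zero_fun_apply cpar_def split: if_splits)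
  qed
  note lt = this
  consider "i < j" | "j < i" | "i = j" by linarith
  then show ?thesis
  proof cases
    case 1
    then show ?thesis by (rule lt[OF i j])
  next
    case 2
    show ?thesis unfolding lt[OF j i 2] by (simp add: mult.commute)
  next
    case 3
    have "pd i (\<omega> {#i#}) = 0" if "p \<le> i"
    proof -
      have "sf_scale (- 1) (pd i (\<omega> {#i#})) = 0"
        using closed_coefficient[OF om cl I[OF i] i] that by (simp add: dmonom_sign_single)
      then show ?thesis by (simp add: sf_scale_eq_0_iff)
    qed
    then show ?thesis using 3 by (cases "i < p") (simp_all add: cpar_def)
  qed
qed

context even_derivation
begin

lemma deriv_sf_d: "f \<in> S \<Longrightarrow> D f = (\<Sum>i<p + q. sf_mult (D (X i)) (sf_d p q V f {#i#}))"
  by (subst deriv_chain) (simp_all add: sf_d_apply(1))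

text \<open>In the \<open>j\<close>-th derivative of the contraction, closedness exchanges the two
  indices, so the sum becomes \<open>D\<close> of the coefficient at \<open>j\<close>, plus
  \<open>w j\<close> times that coefficient where the derivative falls on \<open>x^j\<close>. The
  weights \<open>\<mu> - w j\<close> and \<open>w j\<close> add up to \<open>\<mu>\<close>.\<close>

lemma sf_d_euler_contraction:
  assumes euler: "\<And>i. i < p + q \<Longrightarrow> D (X i) = sf_scale (w i) (X i)" and om: "\<omega> \<in> \<Omega> 1" and cl: "ext_d p q V \<omega> = 0"
    and D: "\<And>i. i < p + q \<Longrightarrow> D (\<omega> {#i#}) = sf_scale (\<mu> - w i) (\<omega> {#i#})"
  shows "sf_d p q V (\<Sum>i<p + q. sf_mult (D (X i)) (\<omega> {#i#})) = df_scale \<mu> \<omega>"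
proof
  note omS = dformsD(1)[OF om]
  have T: "sf_mult (X i) (\<omega> {#i#}) \<in> S" if "i < p + q" for i by (rule sfuns_mult[OF sf_coord_in_sfuns[OF that] omS])
  have T': "sf_mult (D (X i)) (\<omega> {#i#}) \<in> S" if "i < p + q" for i
    by (rule sfuns_mult[OF deriv_closed[OF sf_coord_in_sfuns[OF that]] omS])
  have F: "(\<Sum>i<p + q. sf_mult (D (X i)) (\<omega> {#i#})) \<in> S" by (intro sfuns_sum T') simp
  fix I
  show "sf_d p q V (\<Sum>i<p + q. sf_mult (D (X i)) (\<omega> {#i#})) I = df_scale \<mu> \<omega> I"
  proof (cases "I \<in> dmonoms p q 1")
    case False
    then show ?thesis using dformsD(2)[OF sf_d_dforms[OF F] False] dformsD(2)[OF om False] by (simp add: df_scale_apply)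
  next
    case True
    then obtain j where j: "I = {#j#}" "j < p + q" by (auto simp: dmonoms_def size_1_singleton_mset dest!: size_1_singleton_mset)
    have "pd j (\<Sum>i<p + q. sf_mult (D (X i)) (\<omega> {#i#})) = (\<Sum>i<p + q. pd j (sf_mult (D (X i)) (\<omega> {#i#})))"
      by (rule sf_pderiv_sum[OF _ j(2)]) (use T' in auto)
    also have "\<dots> = (\<Sum>i<p + q. (if i = j then sf_scale (w j) (\<omega> {#j#}) else 0) + sf_mult (D (X i)) (pd i (\<omega> {#j#})))"
    proof (rule sum.cong[OF refl])
      fix i assume "i \<in> {..<p + q}"
      then have i: "i < p + q" by simp
      show "pd j (sf_mult (D (X i)) (\<omega> {#i#})) = (if i = j then sf_scale (w j) (\<omega> {#j#}) else 0) + sf_mult (D (X i)) (pd i (\<omega> {#j#}))"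
        unfolding euler[OF i] sf_mult_scale_left sf_pderiv_scale[OF T[OF i] j(2)] pd_coord_mult[OF i j(2) omS]
          closed_one_form[OF om cl i j(2)]
        by (simp add: sf_mult_scale_right sf_scale_add mult.commute[of "cpar p i"])
    qed
    also have "\<dots> = sf_scale (w j) (\<omega> {#j#}) + (\<Sum>i<p + q. sf_mult (D (X i)) (pd i (\<omega> {#j#})))"
      using j(2) by (simp add: sum.distrib)
    also have "\<dots> = sf_scale (w j) (\<omega> {#j#}) + D (\<omega> {#j#})"
      by (simp only: deriv_chain[OF omS, symmetric])
    also have "\<dots> = sf_scale \<mu> (\<omega> {#j#})"
      unfolding D[OF j(2)] by (auto simp: fun_eq_iff sf_scale_def plus_fun_apply algebra_simps)
    finally show ?thesis unfolding j(1) sf_d_apply(1)[OF F j(2)] df_scale_apply .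
  qed
qed

end

context vfd
begin

lemma hpart_subset: "opn U \<Longrightarrow> hpart (sec U) \<sigma> \<subseteq> carrier (sec U)"
  using superalgebra_sec submodule.axioms(1)[THEN subgroup.subset] unfolding superalgebra_def by fastforce

text \<open>On \<open>cdom c\<close> both forms are determined by their expressions in
  \<open>c\<close>, so equality in that chart suffices.\<close>

lemma fun_d_eqI:
  assumes c: "c \<in> C" and om: "\<omega> \<in> mforms p q M N 1" and s: "cdom c \<subseteq> N" and F: "F \<in> Sf c" and eq: "\<omega> c = sf_d p q (cimg c) F"
  shows "mform_eq p q M (cdom c) \<omega> (fun_d p q M (cdom c) (ciso c (cdom c) F))"
  unfolding mform_eq_def
proof (intro ballI impI)
  fix c' assume c': "c' \<in> C" "cdom c' \<subseteq> cdom c"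
  note f = iso_properties(2)[OF c F]
  have "local_expr p q M (cdom c) c (ciso c (cdom c) F) = F"
    by (rule local_expr_eqI[OF c F]) (simp add: restr_id[OF chartD(1)[OF c] f])
  then show "\<omega> c' = fun_d p q M (cdom c) (ciso c (cdom c) F) c'"
    unfolding fun_d_spread[OF c c' chartD(1)[OF c] order_refl f] mforms_spread[OF om c s c'] eq by simp
qed

lemma potentialI:
  assumes c: "c \<in> C" and om: "\<omega> \<in> mforms p q M N 1" and s: "cdom c \<subseteq> N" and F: "F \<in> Sf c" "sf_par k F" "vl c F = sf_scale \<mu> F"
    and eq: "\<omega> c = sf_d p q (cimg c) F"
  shows "homogeneous_potential p q M nabla (cdom c) (of_nat k, \<mu>) \<omega> (ciso c (cdom c) F)"
  unfolding homogeneous_potential_def homogeneous_fun_def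
  using iso_properties(5)[OF c F(1), of \<mu>] iso_properties(7)[OF c F(1,2)] vl_spec(2)[OF c F(1)] F(3) fun_d_eqI[OF c om s F(1) eq] by simp

lemma potentialE:
  assumes c: "c \<in> C" and pot: "homogeneous_potential p q M nabla (cdom c) (\<sigma>, \<mu>) \<omega> f"
  obtains F where "F \<in> Sf c" "f = ciso c (cdom c) F" "local_expr p q M (cdom c) c f = F" "vl c F = sf_scale \<mu> F"
    "\<omega> c = sf_d p q (cimg c) F" "f \<in> carrier (sec (cdom c))"
proof -
  note o = chartD(1)[OF c]
  interpret P: superdomain p q "cimg c" by (rule chart_superdomain[OF c])
  have f: "f \<in> carrier (sec (cdom c))" "nabla (cdom c) f = \<mu> \<odot>\<^bsub>sec (cdom c)\<^esub> f" and om: "\<omega> c = fun_d p q M (cdom c) f c"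
    using pot hpart_subset[OF o] c unfolding homogeneous_potential_def homogeneous_fun_def mform_eq_def by auto
  define F where "F = local_expr p q M (cdom c) c f"
  have F: "F \<in> Sf c" "f = ciso c (cdom c) F"
    using local_expr_spec[OF c o order_refl f(1)] restr_id[OF o f(1)] by (simp_all add: F_def)
  have "vl c F = sf_scale \<mu> F"
    by (rule vl_eqI[OF c F(1) P.sfuns_scale[OF F(1)]]) (use f(2) iso_properties(5)[OF c F(1), of \<mu>] F(2) in simp)
  then show thesis using that[OF F F_def[symmetric] _ _ f(1)] om by (simp add: fun_d_def F_def)
qed

theorem potential_exists:
  assumes h: "homogeneous_coords p q M nabla c w" and \<mu>: "\<mu> \<noteq> 0"
    and om: "\<omega> \<in> mforms p q M (cdom c) 1" "closed_mform p q M (cdom c) \<omega>" "homogeneous_mform p q M nabla (cdom c) (\<sigma>, \<mu>) \<omega>"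
  shows "\<exists>f. homogeneous_potential p q M nabla (cdom c) (\<sigma>, \<mu>) \<omega> f"
proof -
  have c: "c \<in> C" using h by (simp add: homogeneous_coords_def)
  obtain k where k: "\<sigma> = of_nat k" using ex_of_nat_bit by blast
  interpret D: even_derivation p q "cimg c" "vl c" by (rule vl_derivation[OF c])
  have omc: "\<omega> c \<in> D.\<Omega> 1" by (rule mforms_dforms[OF om(1) c order_refl])
  note cl = closed_chart[OF om(2) c order_refl]
  note hc = homogeneous_chart[OF h om(1) order_refl om(3)[unfolded k]]
  have X: "vl c (D.X i) = sf_scale (w i) (D.X i)" if "i < p + q" for i using h that by (simp add: homogeneous_coords_iff)
  have w1: "vl c (\<omega> c {#i#}) = sf_scale (\<mu> - w i) (\<omega> c {#i#})" for i using hc(2)[of "{#i#}"] by simp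
  define G where "G = (\<Sum>i<p + q. sf_mult (vl c (D.X i)) (\<omega> c {#i#}))"
  have G: "G \<in> Sf c"
    unfolding G_def by (intro D.sfuns_sum D.sfuns_mult D.deriv_closed D.sf_coord_in_sfuns D.dformsD(1)[OF omc]) simp
  have dG: "sf_d p q (cimg c) G = df_scale \<mu> (\<omega> c)"
    unfolding G_def by (rule D.sf_d_euler_contraction[OF X omc cl w1])
  define F where "F = sf_scale (1 / \<mu>) G"
  have F: "F \<in> Sf c" unfolding F_def by (rule D.sfuns_scale[OF G])
  have dF: "\<omega> c = sf_d p q (cimg c) F" unfolding F_def D.sf_d_scale[OF G] dG using \<mu> by simp
  \<comment> \<open>The derivative of \<open>F\<close> along \<open>\<nabla>\<close> is the
    contraction of \<open>dF = \<omega>\<close> with \<open>\<nabla>\<close>, and this is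
    \<open>G\<close>, that is \<open>\<mu>\<close> times \<open>F\<close>.\<close>
  have "vl c F = G" unfolding D.deriv_sf_d[OF F] dF[symmetric] G_def ..
  then have vF: "vl c F = sf_scale \<mu> F" using \<mu> by (simp add: F_def)
  have "sf_par k (sf_mult (vl c (D.X i)) (\<omega> c {#i#}))" if i: "i < p + q" for i
  proof -
    have "sf_par (cpar p i + (k + cpar p i)) (sf_mult (D.X i) (\<omega> c {#i#}))"
      using hc(1) sf_par_mult[OF sf_par_coord] unfolding df_par_def by (metis odd_size_single)
    moreover have "even (cpar p i + (k + cpar p i) + k)" by presburger
    ultimately have "sf_par k (sf_mult (D.X i) (\<omega> c {#i#}))" using sf_par_cong by blast
    then show ?thesis unfolding X[OF i] sf_mult_scale_left by (rule sf_par_scale)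
  qed
  then have "sf_par k G" unfolding G_def by (intro sf_par_sum) simp
  then have "sf_par k F" unfolding F_def by (rule sf_par_scale)
  from potentialI[OF c om(1) order_refl F this vF dF] show ?thesis unfolding k by blast
qed

text \<open>From \<open>\<nabla> f = \<mu> f\<close> and \<open>df = \<omega>\<close>,
  \<open>\<mu> f\<close> is the contraction of \<open>\<omega>\<close> with \<open>\<nabla>\<close>.
  Its value at \<open>m\<close>, computed by Euler's formula in the given coordinates, decides
  whether \<open>f\<close> vanishes at \<open>m\<close>; as an identity of functions it shows that
  \<open>f\<close> is zero if \<open>\<omega>\<close> is.\<close>

theorem potential_vanishes_iff:
  assumes h: "homogeneous_coords p q M nabla c w" and \<mu>: "\<mu> \<noteq> 0" and om: "\<omega> \<in> mforms p q M (cdom c) 1"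
    and U: "opn U" "U \<subseteq> cdom c" and m: "m \<in> U" and pot: "homogeneous_potential p q M nabla U (\<sigma>, \<mu>) \<omega> f"
  shows "fun_vanishes_at p q M U f m \<longleftrightarrow> pairing_at p q M nabla c \<omega> m = 0"
    and "f = \<zero>\<^bsub>sec U\<^esub> \<longleftrightarrow> mform_eq p q M U \<omega> mform_zero"
proof -
  have c: "c \<in> C" using h by (simp add: homogeneous_coords_def)
  define c0 where "c0 = chart_restrict c U"
  have h0: "homogeneous_coords p q M nabla c0 w" unfolding c0_def by (rule homogeneous_coords_restrict[OF h U])
  have c0: "c0 \<in> C" using h0 by (simp add: homogeneous_coords_def)
  have dom: "cdom c0 = U" and mp: "cmap c0 = cmap c" by (simp_all add: c0_def)
  have mc: "m \<in> cdom c" and m0: "m \<in> cdom c0" using m U(2) dom by auto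
  interpret D: even_derivation p q "cimg c0" "vl c0" by (rule vl_derivation[OF c0])
  obtain F where F: "F \<in> Sf c0" "f = ciso c0 U F" "local_expr p q M U c0 f = F" "vl c0 F = sf_scale \<mu> F"
    "\<omega> c0 = sf_d p q (cimg c0) F" "f \<in> carrier (sec U)"
    by (rule potentialE[OF c0 pot[folded dom], unfolded dom])
  have "\<mu> * F {} (cmap c m) = (\<Sum>i<p. w i * cmap c m i * sf_pderiv p (cimg c0) i F {} (cmap c m))"
    using euler_formula_body[OF h0 m0 F(1)] by (simp add: F(4) mp sf_scale_def)
  also have "\<dots> = pairing_at p q M nabla c \<omega> m"
    unfolding pairing_at_def
  proof (intro sum.cong refl)
    fix i assume "i \<in> {..<p}"
    then have i: "i < p" by simp
    have "sf_pderiv p (cimg c0) i F = \<omega> c0 {#i#}" using D.sf_d_apply(1)[OF F(1)] i by (simp add: F(5))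
    also have "\<dots> = sf_restrict (cmap c ` U) (\<omega> c {#i#})"
      using mforms_spread[OF om c order_refl c0] spread_restrict[OF c U mforms_dforms[OF om c order_refl]] U(2) by (simp add: c0_def)
    finally show "w i * cmap c m i * sf_pderiv p (cimg c0) i F {} (cmap c m) =
        vl c (sf_coord p (cimg c) i) {} (cmap c m) * \<omega> c {#i#} {} (cmap c m)"
      using vf_coefficient_body[OF h mc i] m by (simp add: sf_restrict_apply)
  qed
  finally show "fun_vanishes_at p q M U f m \<longleftrightarrow> pairing_at p q M nabla c \<omega> m = 0"
    using fun_vanishes_iff[OF U(1) F(6) c0 dom m] \<mu> by (simp add: F(3) mp) (metis mult_eq_0_iff)
  have zero: "f = \<zero>\<^bsub>sec U\<^esub> \<longleftrightarrow> F = 0"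
    using iso_zero[OF c0] iso_inj[OF c0 F(1) D.sfuns_0] F(2) by (auto simp: dom)
  show "f = \<zero>\<^bsub>sec U\<^esub> \<longleftrightarrow> mform_eq p q M U \<omega> mform_zero"
    unfolding zero
  proof
    assume F0: "F = 0"
    have om0: "\<omega> c0 = 0" unfolding F(5) F0 by (simp add: sf_d_def)
    show "mform_eq p q M U \<omega> mform_zero"
      unfolding mform_eq_def
    proof (intro ballI impI)
      fix c' assume c': "c' \<in> C" "cdom c' \<subseteq> U"
      interpret T: sf_morphism p q "cimg c0" "cimg c'" "chg c0 c'" by (rule trans_morphism[OF c0 c'(1)]) (simp add: dom c'(2))
      have "\<omega> c' = spread c0 (\<omega> c0) c'" by (rule mforms_spread[OF om c0 _ c'(1)]) (use dom U(2) c'(2) in auto)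
      then show "\<omega> c' = mform_zero c'" by (simp add: om0 spread_def mform_zero_def fun_eq_iff zero_fun_apply)
    qed
  next
    assume "mform_eq p q M U \<omega> mform_zero"
    then have "\<omega> c0 = 0" using c0 dom unfolding mform_eq_def mform_zero_def by (simp add: zero_fun_def)
    then have "vl c0 F = 0" unfolding D.deriv_sf_d[OF F(1)] F(5)[symmetric] by (simp add: zero_fun_apply)
    then show "F = 0" unfolding F(4) using \<mu> D.sf_scale_eq_0_iff by blast
  qed
qed

text \<open>Take \<open>\<eta> = dF\<close> for the power \<open>F\<close> of \<open>x^j\<close>
  that has weight \<open>\<mu>\<close> and value \<open>1\<close> at \<open>m\<close>. Every
  homogeneous potential of this weight equals \<open>F\<close> on its domain, because multiplied by
  \<open>\<mu>\<close> both are the contraction of \<open>\<eta>\<close> with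
  \<open>\<nabla>\<close>.\<close>

theorem nonvanishing_potential:
  assumes h: "homogeneous_coords p q M nabla c w" and m: "m \<in> cdom c" and \<mu>: "\<mu> \<noteq> 0" and z: "\<not> vf_vanishes_at p q M nabla m"
  shows "\<exists>W \<eta>. is_nbhd M m W \<and> W \<subseteq> cdom c \<and> \<eta> \<in> mforms p q M W 1 \<and>
    closed_mform p q M W \<eta> \<and> homogeneous_mform p q M nabla W (0, \<mu>) \<eta> \<and>
    (\<forall>U f. is_nbhd M m U \<and> U \<subseteq> W \<and> homogeneous_potential p q M nabla U (0, \<mu>) \<eta> f \<longrightarrow> \<not> fun_vanishes_at p q M U f m)"
proof -
  have c: "c \<in> C" using h by (simp add: homogeneous_coords_def)
  obtain j where j: "j < p" "w j \<noteq> 0" "cmap c m j \<noteq> 0" using z vf_vanishes_iff[OF h m] by blast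
  let ?a = "cmap c m j"
  let ?N = "{x \<in> cdom c. 0 < cmap c x j / ?a}"
  have mN: "m \<in> ?N" using m j(3) by simp
  obtain W r where W: "opn W" "m \<in> W" "W \<subseteq> ?N" "W \<subseteq> cdom c" "0 < r" "r \<le> 1" "cmap c ` W = ebox p (cmap c m) r"
    by (rule chart_box[OF c m half_space_open[OF c] mN zero_less_one])
  define c0 where "c0 = chart_restrict c W"
  have h0: "homogeneous_coords p q M nabla c0 w" unfolding c0_def by (rule homogeneous_coords_restrict[OF h W(1,4)])
  have c0: "c0 \<in> C" using h0 by (simp add: homogeneous_coords_def)
  have b: "cimg c0 = ebox p (cmap c m) r" and dom: "cdom c0 = W" and mp: "cmap c0 = cmap c" using W(7) by (simp_all add: c0_def)
  interpret E: euler_derivation p q "cimg c0" "vl c0" w "cmap c m" r by (rule euler_derivation_chart[OF h0 b])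
  have pos: "cimg c0 \<subseteq> {x. 0 < x j / ?a}" using W(3) by (auto simp: c0_def)
  have X: "vl c0 (E.X i) = sf_scale (w i) (E.X i)" if "i < p" for i using E.euler that by simp
  \<comment> \<open>\<open>x^j\<close> has weight \<open>w j\<close>, so the exponent
    \<open>\<mu> / w j\<close> yields weight \<open>\<mu>\<close>. Dividing by the value at
    \<open>m\<close> makes the base positive and \<open>F\<close> equal to \<open>1\<close>
    there.\<close>
  define F where "F = sf_of_fun (cimg c0) (\<lambda>x. (x j / ?a) powr (\<mu> / w j))"
  have F: "F \<in> Sf c0" unfolding F_def by (rule E.sfuns_of_fun[OF E.deriv_powr(1)[OF X j(1) pos]])
  have vF: "vl c0 F = sf_scale \<mu> F" using E.deriv_powr(2)[OF X j(1) pos, of "\<mu> / w j"] j(2) by (simp add: F_def)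
  have "E.weighted 0 0 \<mu> (fun_form F)"
    unfolding E.weighted_def using E.dforms_fun[OF F] df_par_fun[of 0 F p] vF by (auto simp: F_def dmonom_form_apply)
  from E.weighted_ext_d[OF this] have dW: "E.weighted 1 0 \<mu> (sf_d p q (cimg c0) F)" by (simp add: sf_d_def One_nat_def)
  note dS = E.weightedD(1)[OF dW]
  define \<eta> where "\<eta> = spread c0 (sf_d p q (cimg c0) F)"
  have "\<eta> \<in> mforms p q M W 1" using spread_mforms[OF c0 dS] by (simp only: dom \<eta>_def)
  moreover have "closed_mform p q M W \<eta>"
    unfolding closed_mform_def mform_eq_def mform_d_def
  proof (intro ballI impI)
    fix c' assume c': "c' \<in> C" "cdom c' \<subseteq> W"
    interpret T: sf_morphism p q "cimg c0" "cimg c'" "chg c0 c'" by (rule trans_morphism[OF c0 c'(1)]) (simp add: dom c'(2))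
    have "ext_d p q (cimg c0) (sf_d p q (cimg c0) F) = 0"
      unfolding sf_d_def by (rule E.ext_d_ext_d[OF E.dforms_fun[OF F]])
    then have "ext_d p q (cimg c') (\<eta> c') = spread c0 0 c'"
      unfolding \<eta>_def using spread_ext_d[OF c0 c'(1) _ dS] c'(2) dom by simp
    then show "ext_d p q (cimg c') (\<eta> c') = mform_zero c'" by (simp add: spread_def mform_zero_def fun_eq_iff zero_fun_apply)
  qed
  moreover have "homogeneous_mform p q M nabla W (0, \<mu>) \<eta>"
    using spread_homogeneous[OF h0 dS E.weightedD(2)[OF dW] E.weightedD(3)[OF dW]] by (simp add: dom \<eta>_def)
  moreover have "\<not> fun_vanishes_at p q M U f m" if U: "is_nbhd M m U" "U \<subseteq> W" and pot: "homogeneous_potential p q M nabla U (0, \<mu>) \<eta> f" for U f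
  proof -
    have U': "opn U" "m \<in> U" using U(1) by (simp_all add: is_nbhd_def)
    define c1 where "c1 = chart_restrict c0 U"
    have c1: "c1 \<in> C" unfolding c1_def by (rule chart_restrict_in[OF c0 U'(1)]) (simp add: dom U(2))
    have dom1: "cdom c1 = U" by (simp add: c1_def)
    have s1: "cdom c1 \<subseteq> cdom c0" using U(2) dom dom1 by simp
    obtain G where G: "G \<in> Sf c1" "f = ciso c1 U G" "local_expr p q M U c1 f = G" "vl c1 G = sf_scale \<mu> G"
      "\<eta> c1 = sf_d p q (cimg c1) G" "f \<in> carrier (sec U)"
      by (rule potentialE[OF c1 pot[folded dom1], unfolded dom1])
    interpret T: sf_morphism p q "cimg c0" "cimg c1" "chg c0 c1" by (rule trans_morphism[OF c0 c1 s1])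
    interpret D1: even_derivation p q "cimg c1" "vl c1" by (rule vl_derivation[OF c1])
    let ?H = "chg c0 c1 F"
    have H: "?H \<in> Sf c1" by (rule T.morph_closed[OF F])
    have "sf_d p q (cimg c1) G = sf_d p q (cimg c1) ?H"
      using T.pullback_sf_d[OF F] G(5) by (simp add: \<eta>_def spread_def)
    then have "vl c1 G = vl c1 ?H" unfolding D1.deriv_sf_d[OF G(1)] D1.deriv_sf_d[OF H] by simp
    also have "\<dots> = sf_scale \<mu> ?H" unfolding vl_trans[OF c0 c1 s1 F] vF T.morph_scale[OF F] ..
    finally have "sf_scale \<mu> G = sf_scale \<mu> ?H" unfolding G(4) .
    from arg_cong[OF this, of "sf_scale (1 / \<mu>)"] have "G = ?H" using \<mu> by simp
    then have "G {} (cmap c1 m) = F {} (cmap c0 m)" using body_value[OF c0 c1 s1 _ F] U'(2) dom1 by simp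
    also have "\<dots> = 1" using W(2) j(3) by (simp add: F_def sf_of_fun_def c0_def)
    finally show ?thesis using fun_vanishes_iff[OF U'(1) G(6) c1 dom1 U'(2)] by (simp add: G(3))
  qed
  ultimately show ?thesis using W(1,2,4) unfolding is_nbhd_def by blast
qed

end

section \<open>Closed one-forms of weight zero\<close>

lemma (in superdomain) independent_of_coord:
  assumes VB: "V = ebox p a r" and f: "f \<in> S" and i: "i < p" and z: "pd i f = 0"
    and x: "x \<in> V" and y: "y \<in> V" and xy: "\<And>k. k \<noteq> i \<Longrightarrow> x k = y k"
  shows "f J x = f J y"
proof -
  have "pderiv_at i (f J) v = 0" if "v \<in> V" for v
    using z i that by (metis sf_pderiv_even_eq zero_fun_apply)
  then have "f J v = f J (v(i := a i))" if "v \<in> V" for v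
    using avg_ftc(1)[of p a r "f J" i v] avg_zero[of a r "pderiv_at i (f J)" v i 0] sfunsD(1)[OF f, of J] i that
    by (simp add: VB)
  moreover have "x(i := a i) = y(i := a i)" using xy by auto
  ultimately show ?thesis using x y by metis
qed

text \<open>Move the point to the centre one coordinate at a time. A point of the box shows that
  \<open>r\<close> is positive only if there is an even coordinate, hence the separate case
  \<open>p = 0\<close>.\<close>

lemma (in superdomain) constant_if_pderiv_zero:
  assumes VB: "V = ebox p a r" and a: "\<forall>i\<ge>p. a i = 0" and f: "f \<in> S" and z: "\<And>i. i < p \<Longrightarrow> pd i f = 0" and x: "x \<in> V"
  shows "f J x = f J a"
proof (cases "p = 0")
  case True
  then have "x = a" using x a by (auto simp: VB ebox_def fun_eq_iff)
  then show ?thesis by simp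
next
  case False
  have xr: "\<bar>x i - a i\<bar> < r" if "i < p" for i using x that by (simp add: VB ebox_def)
  then have r: "0 < r" using False by (metis abs_ge_zero le_less_trans gr0I)
  let ?z = "\<lambda>l i. if i < l then a i else x i"
  have zV: "?z l \<in> V" if "l \<le> p" for l using that r xr x by (auto simp: VB ebox_def)
  have "l \<le> p \<Longrightarrow> f J (?z l) = f J x" for l
  proof (induction l)
    case (Suc l)
    then have "f J (?z (Suc l)) = f J (?z l)"
      by (intro independent_of_coord[OF VB f, of l] z zV) auto
    then show ?case using Suc by simp
  qed simp
  moreover have "?z p = a" using x a by (auto simp: VB ebox_def fun_eq_iff)
  ultimately show ?thesis by (metis order_refl)
qed

text \<open>Here \<open>\<nabla>\<close> is \<open>x^j\<close> times the \<open>j\<close>-th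
  derivative, and all other coordinates can be removed. The function \<open>g\<close> that this
  produces has weight \<open>0\<close>, so it does not depend on \<open>x^j\<close>. What remains is
  \<open>dx^j\<close> times a function \<open>u\<close> of weight \<open>- 1\<close> that depends on
  \<open>x^j\<close> only, and then the product of \<open>x^j\<close> and \<open>u\<close> is
  constant.\<close>

theorem (in vfd) logarithmic_potential:
  assumes h: "homogeneous_coords p q M nabla c (\<lambda>i. if i = j then 1 else 0)" and m: "m \<in> cdom c"
    and j: "j < p" "cmap c m j = 1" "\<And>i. i < p \<Longrightarrow> i \<noteq> j \<Longrightarrow> cmap c m i = 0"
    and N: "opn N" "m \<in> N"
    and om: "\<omega> \<in> mforms p q M N 1" "closed_mform p q M N \<omega>" "homogeneous_mform p q M nabla N (\<sigma>, 0) \<omega>"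
  shows "\<exists>U \<kappa> g. is_nbhd M m U \<and> U \<subseteq> N \<and> U \<subseteq> cdom c \<and>
      g \<in> sfuns p q (cmap c ` U) \<and>
      (\<forall>J. \<forall>x\<in>cmap c ` U. \<forall>y\<in>cmap c ` U. (\<forall>i. i \<noteq> j \<longrightarrow> x i = y i) \<longrightarrow> g J x = g J y) \<and>
      (\<forall>x\<in>cmap c ` U. 0 < x j) \<and>
      \<omega> (chart_restrict c U) =
        (\<lambda>I J x. \<kappa> * dmonom_form {#j#} (sf_of_fun (cmap c ` U) (\<lambda>x. 1 / x j)) I J x + sf_d p q (cmap c ` U) g I J x) \<and>
      (\<forall>c\<^sub>1. \<exists>f\<in>carrier (sections M U).
         f = ciso c U (\<lambda>J x. sf_of_fun (cmap c ` U) (\<lambda>x. \<kappa> * ln (x j) + c\<^sub>1) J x + g J x) \<and>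
         mform_eq p q M U \<omega> (fun_d p q M U f) \<and>
         (\<kappa> \<noteq> 0 \<longrightarrow> \<not> (\<exists>\<mu>. homogeneous_fun M nabla U \<mu> f)))"
proof -
  let ?w = "\<lambda>i. if i = j then 1 else 0 :: real"
  have c: "c \<in> C" using h by (simp add: homogeneous_coords_def)
  obtain k where k: "\<sigma> = of_nat k" using ex_of_nat_bit by blast
  define a where "a = cmap c m"
  \<comment> \<open>\<open>x^j\<close> has the value \<open>1\<close> at \<open>m\<close>, so a
    radius of at most \<open>1 / 2\<close> keeps it positive.\<close>
  obtain U r where U: "opn U" "m \<in> U" "U \<subseteq> N" "U \<subseteq> cdom c" "0 < r" "r \<le> 1 / 2" "cmap c ` U = ebox p (cmap c m) r"
    by (rule chart_box[OF c m N, of "1 / 2"]) simp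
  define V where "V = cmap c ` U"
  define c0 where "c0 = chart_restrict c U"
  have h0: "homogeneous_coords p q M nabla c0 ?w" unfolding c0_def by (rule homogeneous_coords_restrict[OF h U(1,4)])
  have c0: "c0 \<in> C" using h0 by (simp add: homogeneous_coords_def)
  have b: "cimg c0 = ebox p a r" using U(7) by (simp add: c0_def a_def)
  have dom: "cdom c0 = U" and iso: "ciso c0 = ciso c" and img: "cimg c0 = V" by (simp_all add: c0_def V_def)
  have VB: "V = ebox p a r" using b img by simp
  have s0: "cdom c0 \<subseteq> N" using U(3) dom by blast
  interpret E: euler_derivation p q V "vl c0" ?w a r using euler_derivation_chart[OF h0 b] img by simp
  note openV = E.openV
  have aV: "a \<in> V" using U(2) by (simp add: V_def a_def)
  have a0: "\<forall>i\<ge>p. a i = 0" using Euclidean_space_open_subset[OF openV] aV by auto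
  have aj: "a j = 1" using j(2) by (simp add: a_def)
  have pos: "0 < x j" if "x \<in> V" for x
    using that j(1) U(6) aj abs_less_iff[of "x j - 1" r] by (auto simp: VB ebox_def)
  have cl: "ext_d p q V (\<omega> c0) = 0" using closed_chart[OF om(2) c0 s0] img by simp
  have W: "E.weighted (Suc 0) k 0 (\<omega> c0)"
    using weighted_chart[OF h0 b om(1) om(3)[unfolded k] s0] by (simp only: img One_nat_def)
  have R: "{..<p + q} - {j} \<subseteq> {..<p + q}" "\<And>i. i \<in> {..<p + q} - {j} \<Longrightarrow> i < p \<Longrightarrow> ?w i = 0 \<or> a i = 0" by auto
  obtain \<alpha> where \<alpha>: "E.weighted 0 k 0 \<alpha>" "\<And>I. \<alpha> I {} a = 0" "\<And>i. i \<in> {..<p + q} - {j} \<Longrightarrow> E.df_indep i (\<omega> c0 - ext_d p q V \<alpha>)"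
    using E.contract_coordinates[OF W cl R] by blast
  obtain g where g: "g \<in> E.S" "\<alpha> = fun_form g" using E.weightedD(1)[OF \<alpha>(1)] E.dforms_0_iff by blast
  have da: "ext_d p q V \<alpha> = sf_d p q V g" by (simp add: sf_d_def g(2))
  have jq: "j < p + q" using j(1) by simp
  have Xj: "sf_mult (E.X j) f = (\<lambda>J x. x j * f J x)" if "f \<in> E.S" for f
    using E.sf_mult_of_fun_left[OF that] j(1) by (simp add: sf_coord_def)
  have D: "vl c0 f = sf_mult (E.X j) (E.pd j f)" if f: "f \<in> E.S" for f
  proof -
    have "vl c0 f = (\<Sum>i<p + q. if i = j then sf_mult (E.X j) (E.pd j f) else 0)"
      unfolding E.deriv_chain[OF f] by (intro sum.cong) (auto simp: E.euler sf_mult_scale_left)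
    then show ?thesis using jq by (simp add: sum.delta)
  qed
  \<comment> \<open>\<open>\<nabla>\<close> annihilates \<open>g\<close>, and the factor
    \<open>x^j\<close> in it can be cancelled because it is positive on \<open>V\<close>.\<close>
  have g0: "E.pd j g = 0"
  proof -
    have "vl c0 g = 0" using E.weightedD(3)[OF \<alpha>(1), of "{#}"] by (simp add: g(2) dmonom_form_apply)
    then have "x j * E.pd j g J x = 0" for J x
      using D[OF g(1)] Xj[OF E.sf_pderiv_in_sfuns[OF g(1) jq]] by (simp add: fun_eq_iff zero_fun_apply)
    then have *: "x j = 0 \<or> E.pd j g J x = 0" for J x by simp
    have "E.pd j g J x = 0" for J x using pos[of x] *[of x J] by (cases "x \<in> V") (auto simp: sf_pderiv_outside)
    then show ?thesis by (simp add: fun_eq_iff zero_fun_apply)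
  qed
  define \<omega>' where "\<omega>' = \<omega> c0 - sf_d p q V g"
  have W': "E.weighted (Suc 0) k 0 \<omega>'"
    unfolding \<omega>'_def da[symmetric] by (rule E.weighted_diff[OF W E.weighted_ext_d[OF \<alpha>(1)]])
  have ind: "E.df_indep i \<omega>'" if "i < p + q" "i \<noteq> j" for i using \<alpha>(3)[of i] that by (simp add: \<omega>'_def da)
  note w'S = E.dformsD(1)[OF E.weightedD(1)[OF W']]
  define u where "u = \<omega>' {#j#}"
  have u: "u \<in> E.S" unfolding u_def by (rule w'S)
  have w'0: "\<omega>' I = 0" if "I \<noteq> {#j#}" for I
  proof (cases "I \<in> dmonoms p q (Suc 0)")
    case True
    then obtain i where i: "I = {#i#}" "i < p + q" by (auto simp: dmonoms_def dest!: size_1_singleton_mset[unfolded One_nat_def])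
    then have "E.df_indep i \<omega>'" using ind that by blast
    moreover have "i \<in># I" by (simp add: i(1))
    ultimately show ?thesis unfolding E.df_indep_def by blast
  next
    case False
    show ?thesis by (rule E.dformsD(2)[OF E.weightedD(1)[OF W'] False])
  qed
  have pu: "E.pd i u = 0" if "i < p + q" "i \<noteq> j" for i using ind[OF that] unfolding E.df_indep_def u_def by blast
  have uJ: "u J x = 0" if J: "J \<noteq> {}" for J x
  proof (cases "J \<subseteq> {p..<p + q} \<and> x \<in> V")
    case True
    obtain l where l: "l \<in> J" using J by blast
    then have l': "p \<le> l" "l < p + q" "l \<noteq> j" using True j(1) by auto
    have "E.pd l u (J - {l}) x = 0" by (simp add: pu[OF l'(2,3)] zero_fun_apply)
    then show ?thesis using l l'(1) True by (simp add: sf_pderiv_def insert_absorb)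
  next
    case False
    then show ?thesis using E.sfunsD(2)[OF u] E.sfunsD(3)[OF u, of J] by auto
  qed
  let ?G = "sf_mult (E.X j) u"
  have G: "?G \<in> E.S" by (rule E.sfuns_mult[OF E.sf_coord_in_sfuns[OF jq] u])
  \<comment> \<open>In direction \<open>j\<close> the derivative is \<open>u\<close> plus
    \<open>x^j\<close> times the derivative of \<open>u\<close>, that is
    \<open>u + \<nabla> u\<close>, which is \<open>0\<close> by the weight
    \<open>- 1\<close>.\<close>
  have "E.pd i ?G = 0" if i: "i < p" for i
  proof (cases "i = j")
    case True
    have "vl c0 u = sf_scale (- 1) u" using E.weightedD(3)[OF W', of "{#j#}"] by (simp add: u_def)
    then have "sf_mult (E.X j) (E.pd j u) = - u" by (simp add: D[OF u] sf_scale_minus_1)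
    then show ?thesis using E.pd_coord_mult[OF jq jq u] j(1) True by (simp add: cpar_def)
  next
    case False
    then show ?thesis using E.pd_coord_mult[OF jq _ u, of i] pu[of i] i by simp
  qed
  note const = E.constant_if_pderiv_zero[OF VB a0 G this]
  \<comment> \<open>Since \<open>a j = 1\<close>, this is the constant value of \<open>x^j\<close>
    times \<open>u\<close>.\<close>
  define \<kappa> where "\<kappa> = u {} a"
  have u_eq: "u = sf_scale \<kappa> (sf_of_fun V (\<lambda>x. 1 / x j))"
  proof (intro ext)
    fix J x
    show "u J x = sf_scale \<kappa> (sf_of_fun V (\<lambda>x. 1 / x j)) J x"
    proof (cases "J = {} \<and> x \<in> V")
      case True
      have "x j * u {} x = \<kappa>" using const[of x "{}"] True by (simp add: Xj[OF u] aj \<kappa>_def)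
      then show ?thesis using True pos[of x] by (simp add: sf_scale_def sf_of_fun_def field_simps)
    next
      case False
      then show ?thesis using uJ E.sfunsD(2)[OF u] by (auto simp: sf_scale_def sf_of_fun_def)
    qed
  qed
  have w'_eq: "\<omega>' = df_scale \<kappa> (dmonom_form {#j#} (sf_of_fun V (\<lambda>x. 1 / x j)))"
    using w'0 u_eq by (auto simp: fun_eq_iff df_scale_def dmonom_form_def u_def sf_scale_def zero_fun_apply)
  have om_eq: "\<omega> c0 = df_scale \<kappa> (dmonom_form {#j#} (sf_of_fun V (\<lambda>x. 1 / x j))) + sf_d p q V g"
    unfolding w'_eq[symmetric] \<omega>'_def by simp
  have pot: "\<exists>f\<in>carrier (sections M U).
         f = ciso c U (\<lambda>J x. sf_of_fun V (\<lambda>x. \<kappa> * ln (x j) + c\<^sub>1) J x + g J x) \<and>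
         mform_eq p q M U \<omega> (fun_d p q M U f) \<and>
         (\<kappa> \<noteq> 0 \<longrightarrow> \<not> (\<exists>\<mu>. homogeneous_fun M nabla U \<mu> f))" for c\<^sub>1
  proof -
    let ?l = "\<lambda>x :: nat \<Rightarrow> real. \<kappa> * ln (x j) + c\<^sub>1"
    define L where "L = sf_of_fun V ?l"
    have ls: "smooth_fun p V ?l"
      by (intro smooth_fun_add smooth_fun_mult smooth_fun_const smooth_fun_ln_coord openV pos)
    have L: "L \<in> E.S" unfolding L_def by (rule E.sfuns_of_fun[OF ls])
    have dl: "has_pderiv j ?l (\<kappa> / x j) x" if "x \<in> V" for x
      using pos[OF that] by (auto intro!: derivative_eq_intros)
    have l0: "?l (x(i := t)) = ?l x" if "i \<noteq> j" for x i t using that by simp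
    have dL: "sf_d p q V L = df_scale \<kappa> (dmonom_form {#j#} (sf_of_fun V (\<lambda>x. 1 / x j)))"
    proof
      fix I
      show "sf_d p q V L I = df_scale \<kappa> (dmonom_form {#j#} (sf_of_fun V (\<lambda>x. 1 / x j))) I"
      proof (cases "I \<in> dmonoms p q 1")
        case True
        then obtain i where i: "I = {#i#}" "i < p + q" by (auto simp: dmonoms_def dest!: size_1_singleton_mset)
        show ?thesis
        proof (cases "i = j")
          case True
          have "pderiv_at j ?l x = \<kappa> / x j" if "x \<in> V" for x by (rule pderiv_at_eqI[OF dl[OF that]])
          then have "sf_of_fun V (pderiv_at j ?l) = sf_scale \<kappa> (sf_of_fun V (\<lambda>x. 1 / x j))"
            by (auto simp: fun_eq_iff sf_of_fun_def sf_scale_def)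
          then show ?thesis
            using True i E.sf_d_apply(1)[OF L jq] E.sf_pderiv_of_fun[OF jq, of ?l] j(1)
            by (simp add: L_def df_scale_apply dmonom_form_apply)
        next
          case False
          have "pderiv_at i ?l = (\<lambda>_. 0)" unfolding pderiv_at_def l0[OF False] by simp
          then have "E.pd i L = 0"
            using E.sf_pderiv_of_fun[OF i(2), of ?l] by (auto simp: L_def fun_eq_iff sf_of_fun_def zero_fun_apply)
          then show ?thesis using False i E.sf_d_apply(1)[OF L i(2)] by (simp add: df_scale_apply dmonom_form_apply)
        qed
      next
        case False
        then have "I \<noteq> {#j#}" using jq by (auto simp: dmonoms_def split: if_splits)
        then show ?thesis using E.dformsD(2)[OF E.sf_d_dforms[OF L] False] by (simp add: df_scale_apply dmonom_form_apply)
      qed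
    qed
    define F where "F = L + g"
    have F: "F \<in> Sf c0" unfolding F_def img by (rule E.sfuns_add[OF L g(1)])
    have F_eq: "F = (\<lambda>J x. sf_of_fun V ?l J x + g J x)" by (simp add: F_def L_def fun_eq_iff plus_fun_apply)
    have dF: "\<omega> c0 = sf_d p q (cimg c0) F" unfolding img F_def E.sf_d_add[OF L g(1)] dL om_eq ..
    have vF: "vl c0 F = sf_of_fun V (\<lambda>_. \<kappa>)"
    proof -
      have "vl c0 L = sf_of_fun V (\<lambda>x. ?w j * x j * (\<kappa> / x j))"
        unfolding L_def by (rule E.deriv_body_fun[OF E.euler[OF trans_less_add1] j(1) ls dl l0])
      also have "\<dots> = sf_of_fun V (\<lambda>_. \<kappa>)" using pos by (force simp: sf_of_fun_def fun_eq_iff)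
      finally show ?thesis unfolding F_def E.deriv_add[OF L g(1)] D[OF g(1)] g0 by simp
    qed
    \<comment> \<open>If \<open>\<nabla> F = \<kappa>\<close> were a multiple \<open>s F\<close>,
      applying \<open>\<nabla>\<close> once more would give \<open>0 = s \<kappa>\<close>, hence
      \<open>s = 0\<close> and then \<open>\<kappa> = 0\<close>.\<close>
    have "\<not> homogeneous_fun M nabla U \<mu> (ciso c U F)" if \<kappa>: "\<kappa> \<noteq> 0" for \<mu>
    proof
      assume "homogeneous_fun M nabla U \<mu> (ciso c U F)"
      then have "vl c0 F = sf_scale (snd \<mu>) F"
        using vl_eqI[OF c0 F, of "sf_scale (snd \<mu>) F"] E.sfuns_scale[of F "snd \<mu>"] F iso_properties(5)[OF c0 F, of "snd \<mu>"]
        by (simp add: homogeneous_fun_def dom iso img)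
      then have eq: "sf_of_fun V (\<lambda>_. \<kappa>) = sf_scale (snd \<mu>) F" by (simp add: vF)
      have "0 = vl c0 (sf_of_fun V (\<lambda>_. \<kappa>))" using vl_const[OF c0, of \<kappa>] by (simp add: img)
      also have "\<dots> = sf_scale (snd \<mu>) (vl c0 F)" unfolding eq using E.deriv_scale[of F] F by (simp add: img)
      also have "\<dots> = sf_scale (snd \<mu>) (sf_of_fun V (\<lambda>_. \<kappa>))" by (simp only: vF)
      finally have "snd \<mu> * \<kappa> = 0" using aV by (auto dest!: fun_cong[of _ _ "{}"] fun_cong[of _ _ a] simp: sf_scale_def sf_of_fun_def zero_fun_apply)
      then have "sf_of_fun V (\<lambda>_. \<kappa>) = 0" using eq \<kappa> by simp
      then show False using aV \<kappa> by (auto dest!: fun_cong[of _ _ "{}"] fun_cong[of _ _ a] simp: sf_of_fun_def zero_fun_apply)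
    qed
    moreover have "ciso c U F \<in> carrier (sec U)" using iso_properties(2)[OF c0 F] by (simp add: dom iso)
    moreover have "mform_eq p q M U \<omega> (fun_d p q M U (ciso c U F))"
      using fun_d_eqI[OF c0 om(1) s0 F dF] by (simp add: dom iso)
    ultimately show ?thesis unfolding F_eq by blast
  qed
  have eq: "\<omega> (chart_restrict c U) = (\<lambda>I J x. \<kappa> * dmonom_form {#j#} (sf_of_fun V (\<lambda>x. 1 / x j)) I J x + sf_d p q V g I J x)"
    using om_eq by (simp add: c0_def fun_eq_iff plus_fun_apply df_scale_def sf_scale_def)
  have indep: "\<forall>J. \<forall>x\<in>V. \<forall>y\<in>V. (\<forall>i. i \<noteq> j \<longrightarrow> x i = y i) \<longrightarrow> g J x = g J y"
    using E.independent_of_coord[OF VB g(1) j(1) g0] by blast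
  have nb: "is_nbhd M m U" using U(1,2) by (simp add: is_nbhd_def)
  have "\<forall>x\<in>V. 0 < x j" using pos by blast
  note conjI[OF nb conjI[OF U(3) conjI[OF U(4) conjI[OF g(1) conjI[OF indep conjI[OF this conjI[OF eq allI[OF pot]]]]]]]]
  then show ?thesis unfolding V_def by (intro exI)
qed

text \<open>For \<open>n = 1\<close> and nonzero weight, whether a potential vanishes at
  \<open>m\<close> depends on the form. This is expressed by an equivalence for all potentials,
  together with a form whose potentials never vanish at \<open>m\<close>; that form is even because
  an odd function has value \<open>0\<close> at every point.\<close>

theorem lemma10p3:
  fixes p q n :: nat
    and M :: "('a, 's) superspace"
    and nabla :: "'a set \<Rightarrow> 's \<Rightarrow> 's"
    and m :: 'a
    and c :: "('a, 's) chart"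
    and w :: "nat \<Rightarrow> real"
    and \<omega> :: "('a, 's) mform"
    and \<sigma> :: bit
    and wt :: real
  assumes "homogeneity_supermanifold p q M nabla"
    and "m \<in> topspace (body M)"
    and "homogeneous_coords p q M nabla c w" and "m \<in> cdom c"
    and "0 < n"
    and "\<omega> \<in> mforms p q M (cdom c) n"
    and "closed_mform p q M (cdom c) \<omega>"
    and "homogeneous_mform p q M nabla (cdom c) (\<sigma>, wt) \<omega>"
  shows
    "(vf_vanishes_at p q M nabla m \<longrightarrow>
        (\<exists>U \<alpha>. is_nbhd M m U \<and> U \<subseteq> cdom c \<and> \<alpha> \<in> mforms p q M U (n - 1) \<and>
           homogeneous_mform p q M nabla U (\<sigma>, wt) \<alpha> \<and>
           mform_eq p q M U \<omega> (mform_d p q \<alpha>) \<and>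
           mform_vanishes_at p q M U \<alpha> m)) \<and>
     (\<not> vf_vanishes_at p q M nabla m \<and> 1 < n \<longrightarrow>
        (\<exists>U \<alpha>. is_nbhd M m U \<and> U \<subseteq> cdom c \<and> \<alpha> \<in> mforms p q M U (n - 1) \<and>
           homogeneous_mform p q M nabla U (\<sigma>, wt) \<alpha> \<and>
           mform_eq p q M U \<omega> (mform_d p q \<alpha>) \<and>
           mform_vanishes_at p q M U \<alpha> m)) \<and>
     (\<not> vf_vanishes_at p q M nabla m \<and> n = 1 \<and> wt \<noteq> 0 \<longrightarrow>
        (\<exists>U f. is_nbhd M m U \<and> U \<subseteq> cdom c \<and>
           homogeneous_potential p q M nabla U (\<sigma>, wt) \<omega> f) \<and>
        (\<forall>U f. is_nbhd M m U \<and> U \<subseteq> cdom c \<and>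
           homogeneous_potential p q M nabla U (\<sigma>, wt) \<omega> f \<longrightarrow>
             (fun_vanishes_at p q M U f m \<longleftrightarrow> pairing_at p q M nabla c \<omega> m = 0) \<and>
             (f = \<zero>\<^bsub>sections M U\<^esub> \<longleftrightarrow> mform_eq p q M U \<omega> mform_zero)) \<and>
        (\<exists>W \<eta>. is_nbhd M m W \<and> W \<subseteq> cdom c \<and> \<eta> \<in> mforms p q M W 1 \<and>
           closed_mform p q M W \<eta> \<and> homogeneous_mform p q M nabla W (0, wt) \<eta> \<and>
           (\<forall>U f. is_nbhd M m U \<and> U \<subseteq> W \<and>
              homogeneous_potential p q M nabla U (0, wt) \<eta> f \<longrightarrow>
                \<not> fun_vanishes_at p q M U f m))) \<and>
     (\<not> vf_vanishes_at p q M nabla m \<and> n = 1 \<and> wt = 0 \<longrightarrow>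
        (\<forall>c' i\<^sub>0.
           homogeneous_coords p q M nabla c' (\<lambda>i. if i = i\<^sub>0 then 1 else 0) \<and>
           m \<in> cdom c' \<and> i\<^sub>0 < p \<and> cmap c' m i\<^sub>0 = 1 \<and> (\<forall>i<p. i \<noteq> i\<^sub>0 \<longrightarrow> cmap c' m i = 0) \<longrightarrow>
           (\<exists>U \<kappa> g. is_nbhd M m U \<and> U \<subseteq> cdom c \<and> U \<subseteq> cdom c' \<and>
              g \<in> sfuns p q (cmap c' ` U) \<and>
              (\<forall>J. \<forall>x\<in>cmap c' ` U. \<forall>y\<in>cmap c' ` U.
                 (\<forall>i. i \<noteq> i\<^sub>0 \<longrightarrow> x i = y i) \<longrightarrow> g J x = g J y) \<and>
              (\<forall>x\<in>cmap c' ` U. 0 < x i\<^sub>0) \<and>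
              \<omega> (chart_restrict c' U) =
                (\<lambda>I J x.
                   \<kappa> * dmonom_form {#i\<^sub>0#} (sf_of_fun (cmap c' ` U) (\<lambda>x. 1 / x i\<^sub>0)) I J x +
                   sf_d p q (cmap c' ` U) g I J x) \<and>
              (\<forall>c\<^sub>1. \<exists>f\<in>carrier (sections M U).
                 f = ciso c' U
                   (\<lambda>J x. sf_of_fun (cmap c' ` U) (\<lambda>x. \<kappa> * ln (x i\<^sub>0) + c\<^sub>1) J x + g J x) \<and>
                 mform_eq p q M U \<omega> (fun_d p q M U f) \<and>
                 (\<kappa> \<noteq> 0 \<longrightarrow> \<not> (\<exists>\<mu>. homogeneous_fun M nabla U \<mu> f))))))"
proof -
  note ho = assms(1)[unfolded homogeneity_supermanifold_def]
  interpret M: vfd p q M nabla using ho by unfold_locales blast+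
  obtain n' where n': "n = Suc n'" using assms(5) by (cases n) auto
  note h = assms(3) and m = assms(4)
  have N: "openin (body M) (cdom c)" using h by (auto simp: homogeneous_coords_def charts_def)
  note om = assms(6-8)
  show ?thesis
  proof (intro conjI impI)
    assume "vf_vanishes_at p q M nabla m"
    then show "\<exists>U \<alpha>. is_nbhd M m U \<and> U \<subseteq> cdom c \<and> \<alpha> \<in> mforms p q M U (n - 1) \<and>
           homogeneous_mform p q M nabla U (\<sigma>, wt) \<alpha> \<and>
           mform_eq p q M U \<omega> (mform_d p q \<alpha>) \<and>
           mform_vanishes_at p q M U \<alpha> m"
      using M.primitive_at_zero[OF h m om[unfolded n']] by (simp add: n')
  next
    assume a: "\<not> vf_vanishes_at p q M nabla m \<and> 1 < n"
    then have "0 < n'" by (simp add: n')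
    then show "\<exists>U \<alpha>. is_nbhd M m U \<and> U \<subseteq> cdom c \<and> \<alpha> \<in> mforms p q M U (n - 1) \<and>
           homogeneous_mform p q M nabla U (\<sigma>, wt) \<alpha> \<and>
           mform_eq p q M U \<omega> (mform_d p q \<alpha>) \<and>
           mform_vanishes_at p q M U \<alpha> m"
      using M.primitive_at_nonzero[OF h m _ om[unfolded n']] a by (simp add: n')
  next
    assume "\<not> vf_vanishes_at p q M nabla m \<and> n = 1 \<and> wt \<noteq> 0"
    then have z: "\<not> vf_vanishes_at p q M nabla m" and n1: "n = 1" and wt: "wt \<noteq> 0" by blast+
    show "\<exists>U f. is_nbhd M m U \<and> U \<subseteq> cdom c \<and> homogeneous_potential p q M nabla U (\<sigma>, wt) \<omega> f"
      using M.potential_exists[OF h wt om[unfolded n1]] N m unfolding is_nbhd_def by blast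
    show "\<forall>U f. is_nbhd M m U \<and> U \<subseteq> cdom c \<and> homogeneous_potential p q M nabla U (\<sigma>, wt) \<omega> f \<longrightarrow>
             (fun_vanishes_at p q M U f m \<longleftrightarrow> pairing_at p q M nabla c \<omega> m = 0) \<and>
             (f = \<zero>\<^bsub>sections M U\<^esub> \<longleftrightarrow> mform_eq p q M U \<omega> mform_zero)"
      using M.potential_vanishes_iff[OF h wt om(1)[unfolded n1]] unfolding is_nbhd_def by blast
    show "\<exists>W \<eta>. is_nbhd M m W \<and> W \<subseteq> cdom c \<and> \<eta> \<in> mforms p q M W 1 \<and>
           closed_mform p q M W \<eta> \<and> homogeneous_mform p q M nabla W (0, wt) \<eta> \<and>
           (\<forall>U f. is_nbhd M m U \<and> U \<subseteq> W \<and> homogeneous_potential p q M nabla U (0, wt) \<eta> f \<longrightarrow>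
                \<not> fun_vanishes_at p q M U f m)"
      by (rule M.nonvanishing_potential[OF h m wt z])
  next
    assume "\<not> vf_vanishes_at p q M nabla m \<and> n = 1 \<and> wt = 0"
    then have n1: "n = 1" and wt: "wt = 0" by blast+
    show "\<forall>c' i\<^sub>0. homogeneous_coords p q M nabla c' (\<lambda>i. if i = i\<^sub>0 then 1 else 0) \<and>
           m \<in> cdom c' \<and> i\<^sub>0 < p \<and> cmap c' m i\<^sub>0 = 1 \<and> (\<forall>i<p. i \<noteq> i\<^sub>0 \<longrightarrow> cmap c' m i = 0) \<longrightarrow> (\<exists>U \<kappa> g. is_nbhd M m U \<and> U \<subseteq> cdom c \<and> U \<subseteq> cdom c' \<and>
              g \<in> sfuns p q (cmap c' ` U) \<and>
              (\<forall>J. \<forall>x\<in>cmap c' ` U. \<forall>y\<in>cmap c' ` U.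
                 (\<forall>i. i \<noteq> i\<^sub>0 \<longrightarrow> x i = y i) \<longrightarrow> g J x = g J y) \<and>
              (\<forall>x\<in>cmap c' ` U. 0 < x i\<^sub>0) \<and>
              \<omega> (chart_restrict c' U) =
                (\<lambda>I J x.
                   \<kappa> * dmonom_form {#i\<^sub>0#} (sf_of_fun (cmap c' ` U) (\<lambda>x. 1 / x i\<^sub>0)) I J x +
                   sf_d p q (cmap c' ` U) g I J x) \<and>
              (\<forall>c\<^sub>1. \<exists>f\<in>carrier (sections M U).
                 f = ciso c' U
                   (\<lambda>J x. sf_of_fun (cmap c' ` U) (\<lambda>x. \<kappa> * ln (x i\<^sub>0) + c\<^sub>1) J x + g J x) \<and>
                 mform_eq p q M U \<omega> (fun_d p q M U f) \<and>
                 (\<kappa> \<noteq> 0 \<longrightarrow> \<not> (\<exists>\<mu>. homogeneous_fun M nabla U \<mu> f))))"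
    proof (intro allI impI; elim conjE, rule M.logarithmic_potential[OF _ _ _ _ _ N m om[unfolded n1 wt]])
    qed auto
  qed
qed

end
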